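(* Fix $n\in\mathbb{Z}_{>0}$. Let $\alpha$ be a weak composition with $n$ parts. Let $P_1$ be an increasing tableau with $\mathrm{wt}(K_-(P_1))=\alpha$. Let $N$ be an integer with $N>n$ and $N>\max(P_1)$. Suppose $w\in S_+$ fixes $1,2,\dots,N$. Then $$\mathfrak{L}_\alpha^{(\beta)}\times G_w^{(\beta)}(x_1,\dots,x_n)=\sum_P \beta^{|P|-\ell(w)-|\alpha|}\,\mathfrak{L}^{(\beta)}_{\mathrm{wt}(\mathrm{cap}_n(K_-(P)))},$$ where the sum is over all increasing tableaux $P$ with at most $n$ rows such that (i) the cells of $P$ whose entries are smaller than $N$ form exactly the tableau $P_1$ (i.e. ignoring entries of $P$ larger than $N$ gives $P_1$), and (ii) the subword of $\mathrm{word}(P)$ consisting of the letters larger than $N$ is a Hecke word of $w$.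
   Context: Tableaux are drawn in English convention on Young diagrams of partitions (row 1 on top, column 1 leftmost); $T(r,c)$ is the entry in row $r$, column $c$; $|P|$ is the number of cells. An increasing tableau is a filling with positive integers, strictly increasing along rows (left to right) and columns (top to bottom). For a tableau $T$, $T_j$ denotes the set of entries in column $j$. A key is a tableau whose columns are strictly increasing and satisfy $T_1\supseteq T_2\supseteq\cdots$. For finite $S,T\subseteq\mathbb{Z}_{>0}$, $T\triangleleft S$ is computed as follows: go through the elements of $S$ from largest to smallest; each $s$ picks the largest element of $T$ that is less than $s$ and not yet picked (if one exists); $T\triangleleft S$ is the set of picked elements. Iterated expressions are evaluated right to left. The left key $K_-(P)$ of an increasing tableau $P$ is the key of the same shape whose column $j$ consists (in increasing order) of $P_1\triangleleft(P_2\triangleleft(\cdots\triangleleft P_j))$. For a key $T$ with at most $n$ rows, $\mathrm{cap}_n(T)$ is obtained by replacing, in each column, the entries larger than $n$ by the largest integers in $[n]$ missing from that column, and then sorting each column increasingly. For a tableau $T$ with entries in $[n]$, $\mathrm{wt}(T)$ is the weak composition whose $i$th entry is the number of entries equal to $i$. For a weak composition $\alpha=(\alpha_1,\dots,\alpha_n)$ (sequence of $n$ nonnegative integers), $|\alpha|=\sum\alpha_i$ and $x^\alpha=\prod x_i^{\alpha_i}$. The reading word $\mathrm{word}(P)$ reads columns left to right, each column bottom to top. $S_+$ is the group of permutations of $\mathbb{Z}_{>0}$ moving finitely many elements; $s_i$ swaps $i,i+1$; a reduced word of $w$ is a word $a_1\cdots a_l$ of minimal length with $w=s_{a_1}\cdots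 s_{a_l}$, and $\ell(w)=l$. The 0-Hecke equivalence $\equiv_H$ on words in positive integers is generated by $ii\equiv_H i$, $i(i+1)i\equiv_H(i+1)i(i+1)$, $ij\equiv_H ji$ for $|i-j|\ge2$; a word $a$ is a Hecke word of $w$ (written $[a]_H=w$) if $a\equiv_H b$ for a reduced word $b$ of $w$. A compatible pair is a pair of words $(a,i)=(a_1\cdots a_m,i_1\cdots i_m)$ of equal length with $i$ weakly increasing and $i_j=i_{j+1}\Rightarrow a_j>a_{j+1}$. The stable Grothendieck function is $G_w^{(\beta)}=\sum \beta^{\ell(a)-\ell(w)}x^{\mathrm{wt}(i)}$ over compatible pairs $(a,i)$ with $[a]_H=w^{-1}$, where $\mathrm{wt}(i)_j$ is the number of $j$'s in $i$; $G_w^{(\beta)}(x_1,\dots,x_n)$ is obtained by setting $x_{n+1}=x_{n+2}=\cdots=0$. Lascoux polynomials: a reverse set-valued tableau (RSVT) is a filling of a Young diagram with nonempty subsets of $[n]$ such that $\min T(r,c)\ge\max T(r,c+1)$ and $\min T(r,c)>\max T(r+1,c)$; $L(T)$ keeps the largest element of each cell; $\mathrm{wt}(T)_i$ is the number of cells containing $i$. For an RSSYT $T$ (row weakly decreasing, column strictly decreasing), $K_-(T)$ is the key whose column $i$ is $T_1\trianglerighteq(T_2\trianglerighteq(\cdots(T_{i-1}\trianglerighteq T_i)))$, where $T\trianglerighteq S$ is computed by going through $S$ from smallest to largest, each $s$ picking the smallest not-yet-picked $t\in T$ with $t\ge s$, and taking the picked set. $\mathrm{key}(\alpha)$ is the key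 whose column $c$ is $\{i:\alpha_i\ge c\}$. Then $\mathfrak{L}_\alpha^{(\beta)}=\sum_T \beta^{|\mathrm{wt}(T)|-|\alpha|}x^{\mathrm{wt}(T)}$ over RSVTs $T$ of the same shape as $\mathrm{key}(\alpha)$ with $K_-(L(T))\le\mathrm{key}(\alpha)$ entrywise. *)

theory Defs
  imports Main
begin

text \<open>A tableau is a list of rows (top to bottom), each row a list of entries
(left to right). Canonical representation: rows nonempty, lengths weakly decreasing.
T(r,c) (1-indexed) is entry T r c.\<close>

definition young :: "'a list list \<Rightarrow> bool" where
  "young T \<longleftrightarrow> (\<forall>row\<in>set T. row \<noteq> []) \<and>
     (\<forall>r. Suc r < length T \<longrightarrow> length (T ! Suc r) \<le> length (T ! r))"

definition entry :: "'a list list \<Rightarrow> nat \<Rightarrow> nat \<Rightarrow> 'a" where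
  "entry T r c = T ! (r - 1) ! (c - 1)"

definition cells :: "'a list list \<Rightarrow> (nat \<times> nat) set" where
  "cells T = {(r, c). 1 \<le> r \<and> r \<le> length T \<and> 1 \<le> c \<and> c \<le> length (T ! (r - 1))}"

definition size_tab :: "'a list list \<Rightarrow> nat" where
  "size_tab T = sum_list (map length T)"

definition ncols :: "'a list list \<Rightarrow> nat" where
  "ncols T = (if T = [] then 0 else length (hd T))"

definition increasing :: "nat list list \<Rightarrow> bool" where
  "increasing T \<longleftrightarrow> young T \<and>
     (\<forall>(r, c)\<in>cells T. 0 < entry T r c) \<and>
     (\<forall>r c. (r, c) \<in> cells T \<and> (r, Suc c) \<in> cells T \<longrightarrow> entry T r c < entry T r (Suc c)) \<and>
     (\<forall>r c. (r, c) \<in> cells T \<and> (Suc r, c) \<in> cells T \<longrightarrow> entry T r c < entry T (Suc r) c)"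

definition col :: "'a list list \<Rightarrow> nat \<Rightarrow> 'a set" where
  "col T j = {entry T r j | r. (r, j) \<in> cells T}"

definition col_list :: "'a list list \<Rightarrow> nat \<Rightarrow> 'a list" where
  "col_list T j = map (\<lambda>r. entry T r j) (filter (\<lambda>r. (r, j) \<in> cells T) [1..<length T + 1])"

definition word :: "'a list list \<Rightarrow> 'a list" where
  "word T = concat (map (\<lambda>j. rev (col_list T j)) [1..<ncols T + 1])"

definition tab_of_cols :: "nat list \<Rightarrow> (nat \<Rightarrow> nat set) \<Rightarrow> (nat set \<Rightarrow> nat list) \<Rightarrow> nat list list" where
  "tab_of_cols sh C ord = map (\<lambda>r. map (\<lambda>c. ord (C (Suc c)) ! r) [0..<sh ! r]) [0..<length sh]"

definition wt :: "nat \<Rightarrow> nat list list \<Rightarrow> nat list" where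
  "wt n T = map (\<lambda>i. sum_list (map (\<lambda>row. length (filter (\<lambda>x. x = i) row)) T)) [1..<n + 1]"

fun tri_aux :: "nat set \<Rightarrow> nat list \<Rightarrow> nat set" where
  "tri_aux T [] = {}"
| "tri_aux T (s # ss) =
     (let C = {t \<in> T. t < s} in
      if C = {} then tri_aux T ss else insert (Max C) (tri_aux (T - {Max C}) ss))"

definition tri :: "nat set \<Rightarrow> nat set \<Rightarrow> nat set" where
  "tri T S = tri_aux T (rev (sorted_list_of_set S))"

definition leftkey_col :: "nat list list \<Rightarrow> nat \<Rightarrow> nat set" where
  "leftkey_col P j = foldr (\<lambda>i X. tri (col P i) X) [1..<j] (col P j)"

definition K_minus :: "nat list list \<Rightarrow> nat list list" where
  "K_minus P = tab_of_cols (map length P) (leftkey_col P) sorted_list_of_set"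

definition top_k :: "nat \<Rightarrow> nat set \<Rightarrow> nat set" where
  "top_k k A = {a \<in> A. card {b \<in> A. a < b} < k}"

definition cap_col :: "nat \<Rightarrow> nat set \<Rightarrow> nat set" where
  "cap_col n C = (C \<inter> {1..n}) \<union> top_k (card (C - {1..n})) ({1..n} - C)"

definition cap :: "nat \<Rightarrow> nat list list \<Rightarrow> nat list list" where
  "cap n T = tab_of_cols (map length T) (\<lambda>j. cap_col n (col T j)) sorted_list_of_set"

definition restrict_le :: "nat \<Rightarrow> nat list list \<Rightarrow> nat list list" where
  "restrict_le N P = filter (\<lambda>row. row \<noteq> []) (map (filter (\<lambda>x. x \<le> N)) P)"

definition in_S_plus :: "(nat \<Rightarrow> nat) \<Rightarrow> bool" where
  "in_S_plus w \<longleftrightarrow> bij w \<and> w 0 = 0 \<and> finite {i. w i \<noteq> i}"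

definition sref :: "nat \<Rightarrow> nat \<Rightarrow> nat" where
  "sref i = (\<lambda>x. if x = i then Suc i else if x = Suc i then i else x)"

definition perm_of_word :: "nat list \<Rightarrow> nat \<Rightarrow> nat" where
  "perm_of_word a = foldr (\<lambda>i f. sref i \<circ> f) a id"

definition is_word_of :: "nat list \<Rightarrow> (nat \<Rightarrow> nat) \<Rightarrow> bool" where
  "is_word_of a w \<longleftrightarrow> (\<forall>x\<in>set a. 0 < x) \<and> perm_of_word a = w"

definition perm_length :: "(nat \<Rightarrow> nat) \<Rightarrow> nat" where
  "perm_length w = (LEAST l. \<exists>a. length a = l \<and> is_word_of a w)"

definition reduced_word :: "nat list \<Rightarrow> (nat \<Rightarrow> nat) \<Rightarrow> bool" where
  "reduced_word a w \<longleftrightarrow> is_word_of a w \<and> length a = perm_length w"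

inductive hecke_step :: "nat list \<Rightarrow> nat list \<Rightarrow> bool" where
  idem: "hecke_step (u @ [i, i] @ v) (u @ [i] @ v)"
| braid: "hecke_step (u @ [i, Suc i, i] @ v) (u @ [Suc i, i, Suc i] @ v)"
| comm: "i + 2 \<le> j \<or> j + 2 \<le> i \<Longrightarrow> hecke_step (u @ [i, j] @ v) (u @ [j, i] @ v)"

definition hecke_equiv :: "nat list \<Rightarrow> nat list \<Rightarrow> bool" where
  "hecke_equiv = (symclp hecke_step)\<^sup>*\<^sup>*"

definition hecke_word :: "nat list \<Rightarrow> (nat \<Rightarrow> nat) \<Rightarrow> bool" where
  "hecke_word a w \<longleftrightarrow> (\<forall>x\<in>set a. 0 < x) \<and> (\<exists>b. hecke_equiv a b \<and> reduced_word b w)"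

text \<open>A (polynomial or power series) in x_1..x_n, \<beta> is represented by its coefficient
function: p \<gamma> k is the coefficient of x^\<gamma> \<beta>^k, \<gamma> a weak composition (list of length n).\<close>
type_synonym poly = "nat list \<Rightarrow> nat \<Rightarrow> int"

definition poly_mult :: "poly \<Rightarrow> poly \<Rightarrow> poly" where
  "poly_mult p q = (\<lambda>\<gamma> k.
     \<Sum>\<gamma>1\<in>{c. list_all2 (\<le>) c \<gamma>}. \<Sum>k1\<in>{0..k}. p \<gamma>1 k1 * q (map2 (-) \<gamma> \<gamma>1) (k - k1))"

definition compatible :: "nat list \<Rightarrow> nat list \<Rightarrow> bool" where
  "compatible a i \<longleftrightarrow> length a = length i \<and> sorted i \<and>
     (\<forall>j. Suc j < length i \<longrightarrow> i ! j = i ! Suc j \<longrightarrow> a ! j > a ! Suc j)"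

definition wtw :: "nat \<Rightarrow> nat list \<Rightarrow> nat list" where
  "wtw n i = map (\<lambda>j. length (filter (\<lambda>x. x = j) i)) [1..<n + 1]"

text \<open>G_w(x_1..x_n): compatible pairs whose i-letters exceed n are killed by x_{n+1}=...=0.\<close>
definition groth :: "nat \<Rightarrow> (nat \<Rightarrow> nat) \<Rightarrow> poly" where
  "groth n w = (\<lambda>\<gamma> k. int (card {(a, i). compatible a i \<and> set i \<subseteq> {1..n} \<and>
       hecke_word a (inv w) \<and> wtw n i = \<gamma> \<and> length a = perm_length w + k}))"

definition rsvt :: "nat \<Rightarrow> nat set list list \<Rightarrow> bool" where
  "rsvt n T \<longleftrightarrow> young T \<and>
     (\<forall>(r, c)\<in>cells T. entry T r c \<noteq> {} \<and> entry T r c \<subseteq> {1..n}) \<and>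
     (\<forall>r c. (r, c) \<in> cells T \<and> (r, Suc c) \<in> cells T \<longrightarrow> Min (entry T r c) \<ge> Max (entry T r (Suc c))) \<and>
     (\<forall>r c. (r, c) \<in> cells T \<and> (Suc r, c) \<in> cells T \<longrightarrow> Min (entry T r c) > Max (entry T (Suc r) c))"

definition Lmax :: "nat set list list \<Rightarrow> nat list list" where
  "Lmax T = map (map Max) T"

definition wt_rsvt :: "nat \<Rightarrow> nat set list list \<Rightarrow> nat list" where
  "wt_rsvt n T = map (\<lambda>i. card {(r, c) \<in> cells T. i \<in> entry T r c}) [1..<n + 1]"

fun tri_ge_aux :: "nat set \<Rightarrow> nat list \<Rightarrow> nat set" where
  "tri_ge_aux T [] = {}"
| "tri_ge_aux T (s # ss) =
     (let C = {t \<in> T. s \<le> t} in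
      if C = {} then tri_ge_aux T ss else insert (Min C) (tri_ge_aux (T - {Min C}) ss))"

definition tri_ge :: "nat set \<Rightarrow> nat set \<Rightarrow> nat set" where
  "tri_ge T S = tri_ge_aux T (sorted_list_of_set S)"

definition leftkey_rev_col :: "nat list list \<Rightarrow> nat \<Rightarrow> nat set" where
  "leftkey_rev_col T i = foldr (\<lambda>j X. tri_ge (col T j) X) [1..<i] (col T i)"

definition K_minus_rev :: "nat list list \<Rightarrow> nat list list" where
  "K_minus_rev T = tab_of_cols (map length T) (leftkey_rev_col T) (\<lambda>S. rev (sorted_list_of_set S))"

definition keyshape :: "nat list \<Rightarrow> nat list" where
  "keyshape \<alpha> = rev (sort (filter (\<lambda>x. 0 < x) \<alpha>))"

definition key_tab :: "nat list \<Rightarrow> nat list list" where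
  "key_tab \<alpha> = tab_of_cols (keyshape \<alpha>) (\<lambda>c. {i \<in> {1..length \<alpha>}. c \<le> \<alpha> ! (i - 1)})
                 (\<lambda>S. rev (sorted_list_of_set S))"

definition tab_le :: "nat list list \<Rightarrow> nat list list \<Rightarrow> bool" where
  "tab_le A B \<longleftrightarrow> map length A = map length B \<and> (\<forall>(r, c)\<in>cells A. entry A r c \<le> entry B r c)"

definition lascoux :: "nat \<Rightarrow> nat list \<Rightarrow> poly" where
  "lascoux n \<alpha> = (\<lambda>\<gamma> k. int (card {T. rsvt n T \<and> map length T = keyshape \<alpha> \<and>
       tab_le (K_minus_rev (Lmax T)) (key_tab \<alpha>) \<and>
       wt_rsvt n T = \<gamma> \<and> sum_list \<gamma> = sum_list \<alpha> + k}))"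

definition shift_beta :: "int \<Rightarrow> poly \<Rightarrow> poly" where
  "shift_beta e p = (\<lambda>\<gamma> k. if e \<le> int k then p \<gamma> (nat (int k - e)) else 0)"

definition thm_index_set :: "nat \<Rightarrow> nat list list \<Rightarrow> nat \<Rightarrow> (nat \<Rightarrow> nat) \<Rightarrow> nat list list set" where
  "thm_index_set n P1 N w = {P. increasing P \<and> length P \<le> n \<and> restrict_le N P = P1 \<and>
       hecke_word (filter (\<lambda>x. N < x) (word P)) w}"

end

theory Submission
  imports Defs
begin

text \<open>
  An increasing tableau is encoded by the family of sets \<open>F a\<close> of columns containing the letter \<open>a\<close>;
  its letters at most \<open>a\<close> form the shape with column heights \<open>ht F a\<close>.  Hecke insertion of a word, letter by
  letter, gives such a family together with a record of tokens: every inserted letter either adds a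
  cell to a column (\<open>New j\<close>) or leaves the shape unchanged and marks a corner (\<open>Mark j\<close>).  A Pieri property makes
  the tokens of a compatible pair form a set-valued tableau, and the condition that each letter is at
  least its label becomes a comparison of the left key of the recording tableau with the left key of
  the insertion tableau.  Applying this to the alphabet \<open>{1..N}\<close>, respectively \<open>{1..M}\<close> for large \<open>M\<close>, counts
  the same compatible pairs twice: the letters above \<open>N\<close> are kept verbatim on the left-hand side
  of the theorem and are inserted on the right-hand side.  The insertion handles weakly
  decreasing runs; a weak run is a strict one with repetitions, following the same pattern on both
  sides, so the counts agree for strictly decreasing runs as well.
\<close>

section \<open>Single insertion steps\<close>

text \<open>Strictness is the obstacle. Compatible pairs ask for strictly decreasing letters under
  equal labels, set-valued tableaux for tokens in strictly different columns, but insertion does not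
  match these conditions word by word: inserting 1 and then 2 into the single row 1 3 records
  \<open>New 0\<close>, \<open>Mark 0\<close>, and so does inserting 1 twice. Only the weak
  conditions correspond exactly, so strict objects are compared by numbers, through a triangular
  system indexed by label words. The bound between letter and label is imposed only up to the
  threshold. Labels are at most \<open>n\<close> and \<open>n < N\<close>, so it holds by itself
  above \<open>N\<close>, and raising the threshold to \<open>M\<close> does not change the set of
  words. With threshold \<open>N\<close> a code is a shuffle of a token word and a word of large
  letters, which gives the product; with threshold \<open>M\<close> the codes are sorted by
  insertion tableau, which gives the sum. The map \<open>cap\<close> has its origin in the labels
  too: recording keys have entries in \<open>[n]\<close> only, and such a key cannot tell a column
  from its capped version.\<close>

datatype tok = Idle | New nat | Mark nat

definition part :: "(nat \<Rightarrow> nat) \<Rightarrow> bool" where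
  "part h \<longleftrightarrow> antimono h \<and> (\<exists>c. h c = 0)"

text \<open>Columns are numbered from 0 and \<open>h\<close> gives their heights. The cell added to
  column \<open>c\<close> lies in row \<open>h c + 1\<close>, which all columns to the left already
  reach; so \<open>S\<close> is a set of addable corners and no two added cells share a row or a
  column. This is what the occurrences of one letter in an increasing tableau look like.\<close>

definition vstrip :: "(nat \<Rightarrow> nat) \<Rightarrow> nat set \<Rightarrow> bool" where
  "vstrip h S \<longleftrightarrow> (\<forall>c\<in>S. \<forall>i<c. h c < h i)"

definition adds :: "(nat \<Rightarrow> nat) \<Rightarrow> nat set \<Rightarrow> nat \<Rightarrow> nat" where
  "adds h S c = (if c \<in> S then Suc (h c) else h c)"

text \<open>With rows counted from 0 this is the length of row \<open>r\<close> of the diagram with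
  column heights \<open>h\<close>, and therefore also the column in which a letter appended to that
  row is placed.\<close>

definition first_col :: "(nat \<Rightarrow> nat) \<Rightarrow> nat \<Rightarrow> nat" where
  "first_col h r = (LEAST c. h c \<le> r)"

text \<open>The merging rule of Hecke insertion: a letter that already occupies its destination is
  absorbed, and only the corner is remembered.\<close>

definition land :: "(nat \<Rightarrow> nat) \<Rightarrow> nat set \<Rightarrow> nat \<Rightarrow> nat set \<times> tok" where
  "land h S r = (let q = first_col h r in if q \<in> S then (S, Mark q) else (insert q S, New q))"

text \<open>Local rule for one letter \<open>a\<close>: \<open>h\<close> is the shape of the smaller
  letters before the insertion, \<open>S\<close> the set of columns of \<open>a\<close>, and the
  token tells what happened to the smaller letters. \<open>New j\<close> with
  \<open>j \<in> S\<close> means that the cell of \<open>a\<close> has been taken, so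
  \<open>a\<close> is bumped from column \<open>j\<close> to the next row. \<open>Mark j\<close>
  with \<open>a\<close> directly to the right of the marked corner, and not below it, is the case in
  which the arriving letter cannot replace its victim: \<open>a\<close> stays and a copy of it
  enters the next row.\<close>

fun step :: "(nat \<Rightarrow> nat) \<Rightarrow> nat set \<Rightarrow> tok \<Rightarrow> nat set \<times> tok" where
  "step h S Idle = (S, Idle)"
| "step h S (New j) = (if j \<in> S then land h (S - {j}) (Suc (h j)) else (S, New j))"
| "step h S (Mark j) = (if Suc j \<in> S \<and> j \<notin> S \<and> h j = Suc (h (Suc j)) then land h S (h j) else (S, Mark j))"

definition ext :: "(nat \<Rightarrow> nat) \<Rightarrow> nat set \<Rightarrow> tok \<Rightarrow> bool \<Rightarrow> nat set \<times> tok" where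
  "ext h S t st = (if st then land h S 0 else step h S t)"

fun up :: "(nat \<Rightarrow> nat) \<Rightarrow> tok \<Rightarrow> nat \<Rightarrow> nat" where
  "up h (New j) = h(j := Suc (h j))"
| "up h t = h"

fun down :: "(nat \<Rightarrow> nat) \<Rightarrow> tok \<Rightarrow> nat \<Rightarrow> nat" where
  "down g (New j) = g(j := g j - 1)"
| "down g t = g"

fun okt :: "(nat \<Rightarrow> nat) \<Rightarrow> tok \<Rightarrow> bool" where
  "okt h Idle = True"
| "okt h (New j) = (\<forall>i<j. h j < h i)"
| "okt h (Mark j) = (h (Suc j) < h j)"

fun tcol :: "tok \<Rightarrow> nat" where
  "tcol (New j) = j" | "tcol (Mark j) = j" | "tcol Idle = 0"

definition corner :: "(nat \<Rightarrow> nat) \<Rightarrow> tok \<Rightarrow> bool" where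
  "corner g t \<longleftrightarrow> t \<noteq> Idle \<and> g (Suc (tcol t)) < g (tcol t)"

lemma first_col:
  assumes "part h"
  shows "h (first_col h r) \<le> r" "i < first_col h r \<Longrightarrow> r < h i"
proof -
  obtain c where "h c = 0" using assms part_def by auto
  then show "h (first_col h r) \<le> r" unfolding first_col_def using LeastI[of "\<lambda>c. h c \<le> r" c] by simp
  show "i < first_col h r \<Longrightarrow> r < h i" unfolding first_col_def using not_less_Least by fastforce
qed

lemma first_colE:
  assumes "part h"
  obtains q where "first_col h r = q" "h q \<le> r" "\<forall>i<q. r < h i"
  using first_col[OF assms] by blast

lemma partD: "part h \<Longrightarrow> i \<le> j \<Longrightarrow> h j \<le> h i"
  by (auto simp: part_def antimono_def)

lemma first_col_eq:
  assumes "part h" "h q \<le> r" "\<forall>i<q. r < h i"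
  shows "first_col h r = q"
  unfolding first_col_def by (rule Least_equality) (use assms(2,3) in \<open>auto simp: not_less[symmetric]\<close>)

lemma part_adds:
  assumes "part h" "vstrip h S" shows "part (adds h S)"
proof -
  obtain c where c: "h c = 0" using assms(1) by (auto simp: part_def)
  have "Suc c \<notin> S" using assms(2) c lessI[of c] unfolding vstrip_def by (metis not_less_zero)
  moreover have "h (Suc c) = 0" using partD[OF assms(1), of c "Suc c"] c by simp
  moreover have "antimono (adds h S)"
  proof (rule antimonoI)
    fix x y :: nat assume "x \<le> y"
    then consider "x = y" | "x < y" by linarith
    then show "adds h S y \<le> adds h S x"
      using partD[OF assms(1), of x y] assms(2) by cases (auto simp: adds_def vstrip_def Suc_le_eq le_SucI)
  qed
  ultimately show ?thesis unfolding part_def adds_def by auto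
qed

lemma up_as_adds: "up h t = (case t of New j \<Rightarrow> adds h {j} | _ \<Rightarrow> h)"
  by (cases t) (auto simp: adds_def fun_eq_iff)

lemma part_up: "part h \<Longrightarrow> okt h t \<Longrightarrow> part (up h t)"
  by (cases t) (auto simp: up_as_adds vstrip_def intro!: part_adds)


lemma vstripD: "vstrip h S \<Longrightarrow> c \<in> S \<Longrightarrow> i < c \<Longrightarrow> h c < h i"
  by (auto simp: vstrip_def)

text \<open>The four shapes, with or without \<open>a\<close> and before or after the insertion,
  have to form a consistent square; this is the equation between \<open>up\<close> and
  \<open>adds\<close>. It makes the local rules composable from one letter to the next.\<close>

lemma step_ok:
  assumes h: "part h" and v: "vstrip h S" and t: "okt h t" and e: "ext h S t st = (S', t')"
    and st: "st \<Longrightarrow> t = Idle"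
  shows "vstrip (up h t) S' \<and> okt (adds h S) t' \<and> up (adds h S) t' = adds (up h t) S'
     \<and> (t' = Idle \<longleftrightarrow> t = Idle \<and> \<not> st)"
proof -
  have m: "\<And>i j. i \<le> j \<Longrightarrow> h j \<le> h i" using partD[OF h] .
  have v': "\<And>c i. c \<in> S \<Longrightarrow> i < c \<Longrightarrow> h c < h i" using v by (auto simp: vstrip_def)
  show ?thesis
  proof (cases st)
    case True
    obtain q where q: "first_col h 0 = q" "h q = 0" "\<forall>i<q. 0 < h i" by (metis first_colE h le_zero_eq)
    have e': "(S',t') = (if q \<in> S then (S, Mark q) else (insert q S, New q))"
      using e True q by (auto simp: ext_def land_def)
    have "Suc q \<notin> S" using v'[of "Suc q" q] q by auto
    moreover have "h (Suc q) = 0" using m[of q "Suc q"] q by simp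
    ultimately show ?thesis using True st e' q v
      by (cases "q \<in> S") (auto simp: vstrip_def adds_def fun_eq_iff)
  next
    case False
    show ?thesis
    proof (cases t)
      case Idle then show ?thesis using False e v by (auto simp: ext_def)
    next
      case (New j)
      have t': "\<And>i. i < j \<Longrightarrow> h j < h i" using t New by simp
      show ?thesis
      proof (cases "j \<in> S")
        case jS: False
        then have e': "S' = S" "t' = New j" using e False New by (auto simp: ext_def)
        have "vstrip (up h t) S" using v' t' unfolding vstrip_def New by (auto simp: less_SucI) (metis jS)
        moreover have "okt (adds h S) t'" using t' e' jS by (auto simp: adds_def less_SucI)
        ultimately show ?thesis using e' New jS by (auto simp: adds_def fun_eq_iff)
      next
        case jS: True
        obtain q where q: "first_col h (Suc (h j)) = q" "h q \<le> Suc (h j)" "\<forall>i<q. Suc (h j) < h i"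
          by (metis first_colE h)
        have qj: "q \<le> j" using q(3) by (meson lessI less_not_sym linorder_not_less)
        have hq: "h q = Suc (h j)" if "q < j" using t'[OF that] q(2) by simp
        have e': "(S',t') = (if q \<in> S - {j} then (S - {j}, Mark q) else (insert q (S - {j}), New q))"
          using e False New jS q by (auto simp: ext_def land_def)
        show ?thesis
        proof (cases "q = j")
          case True
          then have e2: "S' = S" "t' = New j" using e' jS by auto
          have "vstrip (up h t) S" unfolding vstrip_def New
          proof (intro ballI allI impI)
            fix c i assume "c \<in> S" "i < c"
            then show "up h (New j) c < up h (New j) i"
              using v'[of c i] q(3) True by (auto simp: less_SucI)
          qed
          moreover have "okt (adds h S) t'" using q(3) True e2 jS by (auto simp: adds_def less_SucI)
          ultimately show ?thesis using e2 New jS by (auto simp: adds_def fun_eq_iff)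
        next
          case False
          then have lt: "q < j" using qj by simp
          \<comment> \<open>An \<open>a\<close> to the right of the landing column could spoil the
            corner at \<open>q\<close>. Columns \<open>q\<close> to \<open>j - 1\<close> all have
            height \<open>h j + 1\<close>, so none of them after \<open>q\<close> is addable, and
            only the bumped copy in column \<open>j\<close> itself can be the right
            neighbour.\<close>
          have nS: "Suc q \<notin> S \<or> Suc q = j"
          proof (rule ccontr)
            assume "\<not> ?thesis"
            then have "h (Suc q) < h q" "Suc q < j" using v'[of "Suc q" q] lt by auto
            then show False using t'[of "Suc q"] hq lt by simp
          qed
          have nh: "Suc q = j \<Longrightarrow> h (Suc q) = h j" "h (Suc q) \<le> Suc (h j)"
            using m[of q "Suc q"] q(2) by auto
          have a: "vstrip (up h t) (S - {j})" unfolding vstrip_def New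
          proof (intro ballI allI impI)
            fix c i assume "c \<in> S - {j}" "i < c"
            then show "up h (New j) c < up h (New j) i"
              using v'[of c i] by (auto simp: less_SucI)
          qed
          have b: "vstrip (up h t) (insert q (S - {j}))" using a q(2,3) lt False
            by (auto simp: vstrip_def New)
          show ?thesis
          proof (cases "q \<in> S")
            case True
            then have "S' = S - {j}" "t' = Mark q" using e' False by auto
            then show ?thesis using a New jS True nh hq lt nS
              by (auto simp: adds_def fun_eq_iff)
          next
            case qS: False
            then have e2: "S' = insert q (S - {j})" "t' = New q" using e' False by auto
            have "okt (adds h S) t'" using qS q(3) lt hq unfolding e2 by (auto simp: adds_def less_SucI)
            then show ?thesis using b New jS qS e2 lt
              by (auto simp: adds_def fun_eq_iff)
          qed
        qed
      qed
    next
      case (Mark j)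
      show ?thesis
      proof (cases "Suc j \<in> S \<and> j \<notin> S \<and> h j = Suc (h (Suc j))")
        case x: False
        then have e': "S' = S" "t' = Mark j" using e False Mark by (auto simp: ext_def)
        then show ?thesis using x Mark t v by (auto simp: adds_def fun_eq_iff)
      next
        case x: True
        obtain q where q: "first_col h (h j) = q" "h q \<le> h j" "\<forall>i<q. h j < h i"
          by (metis first_colE h)
        have qj: "q \<le> j" using q(3) by (meson less_irrefl linorder_not_less)
        have hq: "h q = h j" using m[OF qj] q(2) by simp
        have e': "(S',t') = (if q \<in> S then (S, Mark q) else (insert q S, New q))"
          using e False Mark x q by (auto simp: ext_def land_def)
        have nx: "h (Suc q) \<le> h q" using m[of q "Suc q"] by simp
        have nx2: "Suc q \<in> S \<Longrightarrow> h (Suc q) < h q" using v'[of "Suc q" q] by auto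
        show ?thesis
        proof (cases "q \<in> S")
          case True
          then show ?thesis using e' Mark v nx nx2 by (auto simp: adds_def fun_eq_iff)
        next
          case qS: False
          then have e2: "S' = insert q S" "t' = New q" using e' by auto
          have "vstrip h S'" using v q(3) hq by (auto simp: e2 vstrip_def)
          then show ?thesis using e2 Mark qS q(3) hq by (auto simp: adds_def fun_eq_iff less_SucI)
        qed
      qed
    qed
  qed
qed

section \<open>Reversing a step\<close>

definition lastc :: "(nat \<Rightarrow> nat) \<Rightarrow> nat \<Rightarrow> nat" where
  "lastc g r = (LEAST c. g (Suc c) < r)"

lemma lastcE:
  assumes "part g" "0 < g q"
  obtains j where "lastc g (g q) = j" "q \<le> j" "g j = g q" "g (Suc j) < g q"
proof -
  have m: "\<And>i j. i \<le> j \<Longrightarrow> g j \<le> g i" using partD[OF assms(1)] .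
  obtain c where c: "g c = 0" using assms(1) by (auto simp: part_def)
  then have "g (Suc c) < g q" using m[of c "Suc c"] assms(2) by simp
  then have a: "g (Suc (lastc g (g q))) < g q" unfolding lastc_def by (rule LeastI)
  have b: "\<not> g (Suc i) < g q" if "i < lastc g (g q)" for i
    using that not_less_Least unfolding lastc_def by blast
  let ?j = "lastc g (g q)"
  have q: "q \<le> ?j" using a m[of "Suc ?j" q] by (meson leD not_less_eq_eq)
  have "g q \<le> g ?j"
  proof (cases ?j)
    case 0 then show ?thesis using m[of ?j q] by simp
  next
    case (Suc i) then show ?thesis using b[of i] by simp
  qed
  then show ?thesis using that[OF refl q] m[OF q] a by simp
qed

lemma lastc_eq:
  assumes "part g" "q \<le> j" "g j = g q" "g (Suc j) < g q"
  shows "lastc g (g q) = j"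
proof -
  have "0 < g q" using assms(4) by simp
  then obtain j' where j': "lastc g (g q) = j'" "q \<le> j'" "g j' = g q" "g (Suc j') < g q"
    using lastcE[OF assms(1)] by metis
  have "\<not> j' < j" using partD[OF assms(1), of "Suc j'" j] j' assms by (auto simp: Suc_le_eq)
  moreover have "\<not> j < j'" using partD[OF assms(1), of "Suc j" j'] j' assms by (auto simp: Suc_le_eq)
  ultimately show ?thesis using j'(1) by simp
qed

text \<open>Undoes a landing once the corner \<open>j\<close> where the bump began has been found:
  it is the last column of the block of equal heights containing the landing column. The copying
  rule leaves an \<open>a\<close> directly right of the corner and none below it; after an ordinary
  bump the heights of columns \<open>j\<close> and \<open>Suc j\<close> exclude this picture, so the
  two cases are told apart.\<close>

definition bkr :: "(nat \<Rightarrow> nat) \<Rightarrow> nat set \<Rightarrow> nat \<Rightarrow> nat set \<times> tok \<times> bool" where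
  "bkr g S j = (if Suc j \<in> S \<and> j \<notin> S \<and> g j = Suc (g (Suc j)) then (S, Mark j, False)
     else (insert j S, New j, False))"

fun bk :: "(nat \<Rightarrow> nat) \<Rightarrow> nat set \<Rightarrow> tok \<Rightarrow> nat set \<times> tok \<times> bool" where
  "bk g S' Idle = (S', Idle, False)"
| "bk g S' (Mark q) = (if q \<notin> S' then (S', Mark q, False) else if g q = 0 then (S', Idle, True)
      else if lastc g (g q) = q then (S', Mark q, False) else bkr g S' (lastc g (g q)))"
| "bk g S' (New q) = (if q \<notin> S' then (S', New q, False) else if g q = 0 then (S' - {q}, Idle, True)
      else bkr g (S' - {q}) (lastc g (g q)))"

definition flat :: "(nat \<Rightarrow> nat) \<Rightarrow> nat \<Rightarrow> nat \<Rightarrow> bool" where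
  "flat g q j \<longleftrightarrow> (\<forall>c. q \<le> c \<longrightarrow> c \<le> j \<longrightarrow> g j = g c)"

definition landed :: "nat set \<Rightarrow> nat \<Rightarrow> nat set \<Rightarrow> tok \<Rightarrow> nat \<Rightarrow> bool" where
  "landed S j S' t' q \<longleftrightarrow> (t' = New q \<and> (q \<in> S \<longrightarrow> q = j) \<and> S' = insert q (S - {j})) \<or>
       (t' = Mark q \<and> q \<in> S \<and> q \<noteq> j \<and> S' = S - {j})"

text \<open>What the two active rules have in common. In terms of the new shape \<open>g\<close> of
  the smaller letters, the landing column is the left end of the block of columns of height
  \<open>g j\<close>; it is thus a function of \<open>g\<close> and \<open>j\<close>, whichever rule
  was applied.\<close>

lemma step_active:
  assumes h: "part h" and v: "vstrip h S" and t: "okt h t" and a: "t \<noteq> Idle"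
    and e: "step h S t = (S', t')" and j: "j = tcol t" and g: "g = up h t"
  shows "(S' = S \<and> t' = t \<and> (t = New j \<longrightarrow> j \<notin> S)
        \<and> (t = Mark j \<longrightarrow> \<not> (Suc j \<in> S \<and> j \<notin> S \<and> h j = Suc (h (Suc j))))) \<or>
   (\<exists>q\<le>j. flat g q j \<and> (\<forall>i<q. g j < g i) \<and> q \<in> S' \<and>
      landed S j S' t' q \<and> (t = New j \<longrightarrow> j \<in> S) \<and>
      (t = Mark j \<longrightarrow> Suc j \<in> S \<and> j \<notin> S \<and> h j = Suc (h (Suc j))))"
proof -
  have m: "\<And>i j. i \<le> j \<Longrightarrow> h j \<le> h i" using partD[OF h] .
  show ?thesis
  proof (cases t)
    case Idle then show ?thesis using a by simp
  next
    case (New i)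
    then have ij: "i = j" using j by simp
    show ?thesis
    proof (cases "j \<in> S")
      case False then show ?thesis using New ij e by auto
    next
      case True
      obtain q where q: "first_col h (Suc (h j)) = q" "h q \<le> Suc (h j)" "\<forall>i<q. Suc (h j) < h i"
        by (metis first_colE h)
      have qj: "q \<le> j" using q(3) by (meson lessI less_not_sym linorder_not_less)
      have eq: "g j = g c" if "q \<le> c" "c \<le> j" for c
      proof (cases "c = j")
        case False
        then have "c < j" using that by simp
        then have "h j < h c" using t New ij by simp
        moreover have "h c \<le> Suc (h j)" using m[OF that(1)] q(2) by simp
        ultimately show ?thesis using False New ij g by simp
      qed simp
      have lt: "\<forall>i<q. g j < g i" using q(3) qj New ij g by auto
      have "(S',t') = (if q \<in> S - {j} then (S - {j}, Mark q) else (insert q (S - {j}), New q))"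
        using e New True q ij by (auto simp: land_def)
      then have d: "q \<in> S' \<and> ((t' = New q \<and> (q \<in> S \<longrightarrow> q = j) \<and> S' = insert q (S - {j})) \<or>
          (t' = Mark q \<and> q \<in> S \<and> q \<noteq> j \<and> S' = S - {j}))" by (auto split: if_splits)
      have "t \<noteq> Mark j" using New by simp
      then show ?thesis using qj eq lt d True unfolding flat_def landed_def by blast
    qed
  next
    case (Mark i)
    then have ij: "i = j" using j by simp
    show ?thesis
    proof (cases "Suc j \<in> S \<and> j \<notin> S \<and> h j = Suc (h (Suc j))")
      case False then show ?thesis using Mark ij e by auto
    next
      case x: True
      obtain q where q: "first_col h (h j) = q" "h q \<le> h j" "\<forall>i<q. h j < h i"
        by (metis first_colE h)
      have qj: "q \<le> j" using q(3) by (meson less_irrefl linorder_not_less)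
      have eq: "g j = g c" if "q \<le> c" "c \<le> j" for c
        using m[OF that(1)] m[OF that(2)] q(2) g Mark by simp
      have "(S',t') = (if q \<in> S then (S, Mark q) else (insert q S, New q))"
        using e Mark x q ij by (auto simp: land_def)
      then have d: "q \<in> S' \<and> ((t' = New q \<and> (q \<in> S \<longrightarrow> q = j) \<and> S' = insert q (S - {j})) \<or>
          (t' = Mark q \<and> q \<in> S \<and> q \<noteq> j \<and> S' = S - {j}))" using x by (auto split: if_splits)
      have "t \<noteq> New j" "\<forall>i<q. g j < g i" using Mark g q(3) by simp_all
      then show ?thesis using qj eq d x unfolding flat_def landed_def by blast
    qed
  qed
qed

lemma bk_ext:
  assumes h: "part h" and v: "vstrip h S" and t: "okt h t" and e: "ext h S t st = (S', t')"
    and st: "st \<Longrightarrow> t = Idle"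
  shows "bk (up h t) S' t' = (S, t, st)"
proof (cases "t = Idle")
  case True
  show ?thesis
  proof (cases st)
    case False then show ?thesis using True e by (auto simp: ext_def)
  next
    case s: True
    have "h (first_col h 0) = 0" using first_col(1)[OF h, of 0] by simp
    then show ?thesis using True s e by (auto simp: ext_def land_def Let_def split: if_splits)
  qed
next
  case a: False
  then have st': "\<not> st" using st by auto
  define j where "j = tcol t"
  define g where "g = up h t"
  have g: "part g" using part_up[OF h t] g_def by simp
  have vg: "vstrip g S'" using step_ok[OF h v t e st] g_def by simp
  have e': "step h S t = (S',t')" using e st' by (simp add: ext_def)
  have tj: "t = New j \<or> t = Mark j" using a j_def by (cases t) auto
  have m: "\<And>i j. i \<le> j \<Longrightarrow> g j \<le> g i" using partD[OF g] .
  have v': "\<And>c i. c \<in> S \<Longrightarrow> i < c \<Longrightarrow> h c < h i" using v by (auto simp: vstrip_def)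
  have gc: "g (Suc j) < g j"
    using tj t partD[OF h, of j "Suc j"] g_def by auto
  from step_active[OF h v t a e' j_def g_def] show ?thesis
  proof (elim disjE, goal_cases)
    case 1
    then have "lastc g (g j) = j" using gc lastc_eq[OF g, of j j] by simp
    then show ?case using 1 tj gc g_def st' by auto
  next
    case 2
    then obtain q where q: "q\<le>j" "flat g q j" "q \<in> S'"
      and d: "(t' = New q \<and> (q \<in> S \<longrightarrow> q = j) \<and> S' = insert q (S - {j})) \<or>
       (t' = Mark q \<and> q \<in> S \<and> q \<noteq> j \<and> S' = S - {j})"
      and n: "t = New j \<longrightarrow> j \<in> S"
      and k: "t = Mark j \<longrightarrow> Suc j \<in> S \<and> j \<notin> S \<and> h j = Suc (h (Suc j))" unfolding landed_def by blast
    have gq: "g q = g j" using q(1,2) unfolding flat_def by (metis le_refl)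
    then have l: "lastc g (g q) = j" using gc lastc_eq[OF g, of q j] q(1) by simp
    have pos: "g q \<noteq> 0" using gc gq by simp
    have nn: "\<not> (Suc j \<in> S \<and> g j = Suc (g (Suc j)))" if "t = New j"
      using v'[of "Suc j" j] that g_def by auto
    have r: "bk g S' t' = bkr g (S - {j}) j"
      using d
    proof (elim disjE conjE)
      assume "t' = New q" "q \<in> S \<longrightarrow> q = j" "S' = insert q (S - {j})"
      moreover from this have "S' - {q} = S - {j}" by auto
      ultimately show ?thesis using l pos q(3) by simp
    next
      assume "t' = Mark q" "q \<in> S" "q \<noteq> j" "S' = S - {j}"
      then show ?thesis using l pos q(3) by simp
    qed
    have "bkr g (S - {j}) j = (S, t, False)"
      using tj
    proof
      assume tN: "t = New j"
      then show ?thesis using nn[OF tN] n by (auto simp: bkr_def)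
    next
      assume tM: "t = Mark j"
      then have "g = h" using g_def by simp
      then show ?thesis using k tM by (simp add: bkr_def)
    qed
    then show ?case using r g_def st' by simp
  qed
qed

text \<open>Surjectivity of a single step: every strip together with a corner of the outer shape
  arises. The recovered token is again idle or a corner of the inner shape, so that the descent
  through the letters can go on.\<close>

lemma ext_bk:
  assumes g: "part g" and v: "vstrip g S'" and t': "t' = Idle \<or> corner (adds g S') t'"
    and b: "bk g S' t' = (S, t, st)"
  shows "part (down g t) \<and> vstrip (down g t) S \<and> okt (down g t) t \<and> up (down g t) t = g
    \<and> (st \<longrightarrow> t = Idle) \<and> ext (down g t) S t st = (S', t') \<and> (t = Idle \<or> corner g t)"
proof -
  have m: "\<And>i j. i \<le> j \<Longrightarrow> g j \<le> g i" using partD[OF g] .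
  have v': "\<And>c i. c \<in> S' \<Longrightarrow> i < c \<Longrightarrow> g c < g i" using v by (auto simp: vstrip_def)
  have pd: "part (g(j := g j - 1))" if "g (Suc j) < g j" for j
  proof -
    obtain c where c: "g c = 0" using g by (auto simp: part_def)
    have "antimono (g(j := g j - 1))"
    proof (rule antimonoI)
      fix x y :: nat assume xy: "x \<le> y"
      show "(g(j := g j - 1)) y \<le> (g(j := g j - 1)) x"
        using m[OF xy] m[of "Suc j" y] that xy by (auto simp: Suc_le_eq) 
    qed
    then show ?thesis using c unfolding part_def by (auto intro!: exI[of _ c])
  qed
  have stay: ?thesis if "t' = Mark q" "S = S'" "t = Mark q" "\<not> st" "q \<notin> S' \<or> g (Suc q) < g q" for q
    using that t' g v by (auto simp: corner_def adds_def ext_def split: if_splits)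
  have start: "first_col g 0 = q" if "q \<in> S'" "g q = 0" for q
    using first_col_eq[OF g, of q 0] v' that by force
  have bkr: ?thesis if q: "q \<in> S'" "g q \<noteq> 0" "S = S0 \<longrightarrow> True" and j: "j = lastc g (g q)" and b: "bkr g S0 j = (S,t,st)"
     and S0: "(t' = New q \<and> S0 = S' - {q}) \<or> (t' = Mark q \<and> S0 = S' \<and> j \<noteq> q)" for q j S0
  proof -
    have jj: "q \<le> j" "g j = g q" "g (Suc j) < g q" using lastcE[OF g, of q] q j by auto
    have jS: "j \<notin> S0" using v'[of j q] jj S0 by force
    have gq: "g j = g c" if "q \<le> c" "c \<le> j" for c
      using m[OF that(1)] m[OF that(2)] jj by simp
    have lt: "\<forall>i<q. g j < g i" using v'[OF q(1)] jj by simp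
    show ?thesis
    proof (cases "Suc j \<in> S0 \<and> g j = Suc (g (Suc j))")
      case True
      then have b': "S = S0" "t = Mark j" "\<not> st" using b jS by (auto simp: bkr_def)
      have "first_col g (g j) = q" using first_col_eq[OF g, of q "g j"] jj lt by simp
      then have "ext g S t st = (S',t')" using b' True jS S0 q(1) jj
        by (auto simp: ext_def land_def insert_absorb)
      moreover have "vstrip g S" using v S0 b' by (auto simp: vstrip_def)
      ultimately show ?thesis using b' g jj by (auto simp: corner_def)
    next
      case False
      then have b': "S = insert j S0" "t = New j" "\<not> st" using b jS by (auto simp: bkr_def)
      let ?h = "g(j := g j - 1)"
      have p: "part ?h" by (rule pd) (use jj in simp)
      have hj: "Suc (?h j) = g j" using jj by simp
      have "?h q \<le> g j" using jj(2) by (metis diff_le_self fun_upd_apply order_refl)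
      moreover have "\<forall>i<q. g j < ?h i" using lt jj(1) by simp
      ultimately have "first_col ?h (g j) = q" by (rule first_col_eq[OF p])
      then have "first_col ?h (Suc (?h j)) = q" using hj by simp
      then have "ext ?h S t st = (S',t')" using b' jS S0 q(1) 
        by (auto simp: ext_def land_def insert_absorb)
      moreover have "vstrip ?h S" unfolding vstrip_def
      proof (intro ballI allI impI)
        fix c i assume c: "c \<in> S" "i < c"
        show "?h c < ?h i"
        proof (cases "c = j")
          case True
          then show ?thesis using m[of i j] c jj by auto
        next
          case cj: False
          then have "c \<in> S0" "c \<in> S'" using c b' S0 by auto
          then have "g c < g i" using v' c by simp
          \<comment> \<open>Column \<open>j\<close> loses a cell, so \<open>g c < g j\<close> is one
            short. The only dangerous column is \<open>Suc j\<close> with height one less than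
            \<open>g j\<close>, and this is the configuration that was diverted to
            \<open>Mark\<close>.\<close>
          moreover have "g c < g j - 1" if "i = j"
          proof -
            have "Suc j \<noteq> c \<or> g j \<noteq> Suc (g (Suc j))" using False \<open>c \<in> S0\<close> by auto
            moreover have "c \<noteq> Suc j \<Longrightarrow> g c < g (Suc j)" using v'[OF \<open>c \<in> S'\<close>, of "Suc j"] c that by simp
            ultimately show ?thesis using \<open>g c < g i\<close> that jj by (cases "c = Suc j") auto
          qed
          ultimately show ?thesis using cj by auto
        qed
      qed
      moreover have "okt ?h t"
      proof -
        have "g j - 1 < g i" if "i < j" for i using m[of i j] that jj by simp
        then show ?thesis using b' by auto
      qed
      ultimately show ?thesis using b' p jj by (auto simp: corner_def)
    qed
  qed
  show ?thesis
  proof (cases t')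
    case Idle then show ?thesis using b g v by (auto simp: ext_def)
  next
    case (Mark q)
    show ?thesis
    proof (cases "q \<in> S' \<and> g q \<noteq> 0 \<and> lastc g (g q) \<noteq> q")
      case True
      then show ?thesis using bkr[of q S' "lastc g (g q)"] b Mark by auto
    next
      case False
      then consider "q \<notin> S'" | "q \<in> S'" "g q = 0" | "q \<in> S'" "g q \<noteq> 0" "lastc g (g q) = q" by blast
      then show ?thesis
      proof cases
        case 1 then show ?thesis using stay[of q] b Mark by auto
      next
        case 2 then show ?thesis using b Mark start[of q] g v by (auto simp: ext_def land_def)
      next
        case 3
        then have "g (Suc q) < g q" using lastcE[OF g, of q] by auto
        then show ?thesis using 3 stay[of q] b Mark by auto
      qed
    qed
  next
    case (New q)
    show ?thesis
    proof (cases "q \<in> S'")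
      case True
      show ?thesis
      proof (cases "g q = 0")
        case z: True
        have "vstrip g (S' - {q})" using v by (auto simp: vstrip_def)
        then show ?thesis using b New start[of q] g True z by (auto simp: ext_def land_def)
      next
        case False
        then show ?thesis using bkr[of q "S' - {q}" "lastc g (g q)"] b New True by auto
      qed
    next
      case False
      have b': "S = S'" "t = New q" "\<not> st" using b New False by auto
      have c: "g (Suc q) < g q" "Suc q \<in> S' \<Longrightarrow> Suc (g (Suc q)) < g q"
        using t' New False by (auto simp: corner_def adds_def split: if_splits)
      let ?h = "g(q := g q - 1)"
      have p: "part ?h" using pd c by simp
      have "vstrip ?h S" unfolding vstrip_def
      proof (intro ballI allI impI)
        fix d i assume d: "d \<in> S" "i < d"
        then have gd: "g d < g i" "d \<noteq> q" using v' b' False by auto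
        have "g d < g q - 1" if "i = q"
        proof (cases "d = Suc q")
          case True then show ?thesis using c(2) d b' by auto
        next
          case False
          then show ?thesis using v'[of d "Suc q"] d b' c(1) that by simp
        qed
        then show "?h d < ?h i" using gd by auto
      qed
      moreover have "okt ?h t"
      proof -
        have "g q - 1 < g i" if "i < q" for i using m[of i q] that c(1) by simp
        then show ?thesis using b' by auto
      qed
      ultimately show ?thesis using b' p c(1) False New by (auto simp: ext_def corner_def)
    qed
  qed
qed

section \<open>The Pieri property\<close>

definition tle :: "tok \<Rightarrow> tok \<Rightarrow> bool" where
  "tle s t \<longleftrightarrow> tcol s < tcol t \<or> (tcol s = tcol t \<and> (\<exists>j. t = Mark j))"

lemma ext_active_col:
  assumes "part h" "vstrip h S" "okt h t" "t \<noteq> Idle" "step h S t = (S', t')"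
  shows "tcol t' \<le> tcol t"
  using step_active[OF assms refl refl] by (auto simp: landed_def)

lemma okt_up_corner:
  assumes "part h" "okt h t" "t \<noteq> Idle"
  shows "up h t (Suc (tcol t)) < up h t (tcol t)"
  using assms partD[OF assms(1), of "tcol t" "Suc (tcol t)"] by (cases t) auto

text \<open>A landing goes to the left end of a block of equal columns, so two tokens can change
  their relative position only when they meet in one block. In the increasing case the second token
  then finds its cell filled by the first and merges, giving \<open>Mark\<close> in the same column,
  which \<open>tle\<close> admits. In the other case the second token is a \<open>New\<close>
  exactly at the landing column; it is bumped and ends strictly further left or again as
  \<open>New\<close> in that column.\<close>

lemma pieri_local:
  assumes h: "part h" and v: "vstrip h S" and t1: "okt h t1" and e1: "step h S t1 = (S1, t1')"
    and t2: "okt (up h t1) t2" and e2: "step (up h t1) S1 t2 = (S2, t2')"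
    and a: "t1 \<noteq> Idle" "t2 \<noteq> Idle"
  shows "tle t1' t2' \<longleftrightarrow> tle t1 t2"
proof -
  define g where "g = up h t1"
  define g2 where "g2 = up g t2"
  define j where "j = tcol t1"
  define k where "k = tcol t2"
  have g: "part g" using part_up[OF h t1] g_def by simp
  have g2: "part g2" using part_up[OF g] t2 g_def g2_def by simp
  have e1': "ext h S t1 False = (S1,t1')" using e1 by (simp add: ext_def)
  have v1: "vstrip g S1" using step_ok[OF h v t1 e1'] g_def by simp
  have v': "\<And>c i. c \<in> S \<Longrightarrow> i < c \<Longrightarrow> h c < h i" using v by (auto simp: vstrip_def)
  have v1': "\<And>c i. c \<in> S1 \<Longrightarrow> i < c \<Longrightarrow> g c < g i" using v1 by (auto simp: vstrip_def)
  have gm: "\<And>i j. i \<le> j \<Longrightarrow> g j \<le> g i" using partD[OF g] .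
  have hm: "\<And>i j. i \<le> j \<Longrightarrow> h j \<le> h i" using partD[OF h] .
  have tj: "t1 = New j \<or> t1 = Mark j" using a j_def by (cases t1) auto
  have tk: "t2 = New k \<or> t2 = Mark k" using a k_def by (cases t2) auto
  have gk: "c \<noteq> k \<Longrightarrow> g2 c = g c" for c using tk g2_def by auto
  have g2k: "t2 = New k \<Longrightarrow> g2 k = Suc (g k)" "t2 = Mark k \<Longrightarrow> g2 k = g k" using g2_def by auto
  have gj: "c \<noteq> j \<Longrightarrow> g c = h c" for c using tj g_def by auto
  have gjj: "t1 = New j \<Longrightarrow> g j = Suc (h j)" "t1 = Mark j \<Longrightarrow> g = h" using g_def by auto
  note A1 = step_active[OF h v t1 a(1) e1 j_def g_def]
  note A2 = step_active[OF g v1 t2[folded g_def] a(2) e2[folded g_def] k_def g2_def]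
  have jc: "tcol t1' \<le> j" using ext_active_col[OF h v t1 a(1) e1] j_def by simp
  have kc: "tcol t2' \<le> k" using ext_active_col[OF g v1 t2[folded g_def] a(2) e2[folded g_def]] k_def by simp
  have corner1: "g (Suc j) < g j" using okt_up_corner[OF h t1 a(1)] g_def j_def by simp
  have S1S: "c \<in> S" if "c \<in> S1" "j < c" for c
    using A1 that by (auto simp: landed_def)
  show ?thesis
  proof (cases "tle t1 t2")
    case True
    then have jk: "j < k \<or> (j = k \<and> t2 = Mark k)" using j_def k_def tk by (auto simp: tle_def)
    have "tle t1' t2'"
      using A2
    proof (elim disjE exE conjE)
      assume "S2 = S1" "t2' = t2"
      then show ?thesis using jk jc k_def tk by (auto simp: tle_def)
    next
      fix q assume q: "q \<le> k" "flat g2 q k" "\<forall>i<q. g2 k < g2 i"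
        and tn: "t2 = New k \<longrightarrow> k \<in> S1"
        and tm: "t2 = Mark k \<longrightarrow> Suc k \<in> S1 \<and> k \<notin> S1 \<and> g k = Suc (g (Suc k))"
        and d: "landed S1 k S2 t2' q"
      have q2: "tcol t2' = q" using d by (auto simp: landed_def)
      show ?thesis
      proof (cases "j < q")
        case True then show ?thesis using q2 jc by (simp add: tle_def)
      next
        case False
        then have qj: "q \<le> j" by simp
        \<comment> \<open>If the second token gets as far left as the first, the first was a mark
          and column \<open>q\<close> already holds an \<open>a\<close>: after \<open>New j\<close>
          the column \<open>j\<close> would be too tall for the second landing to cross it.\<close>
        have key: "t1 = Mark j \<and> q \<in> S1 \<and> tcol t1' = q \<and> q \<noteq> k"
        proof (cases "j < k")
          case lt: True
          have gjk: "g j = g2 k" using q(2)[unfolded flat_def] qj lt gk[of j] by (metis less_imp_le nat_neq_iff)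
          have nk: "t2 = New k"
          proof (rule ccontr)
            assume "t2 \<noteq> New k"
            then have "t2 = Mark k" using tk by simp
            then have "g j = g k" using gjk g2k by simp
            then show False using corner1 gm[of "Suc j" k] lt by simp
          qed
          then have kS: "k \<in> S1" "k \<in> S" using tn S1S lt by auto
          have hk: "h k < h j" using v'[OF kS(2) lt] .
          have gjk': "g j = Suc (h k)" using gjk g2k nk gj lt by simp
          have m1: "t1 = Mark j" using tj gjj gjk' hk by auto
          then have gh: "g = h" using gjj by simp
          have kk: "k = Suc j"
          proof (rule ccontr)
            assume "k \<noteq> Suc j"
            then have "Suc j < k" using lt by simp
            then have "g2 (Suc j) = g2 k" using q(2)[unfolded flat_def] qj by (metis le_Suc_eq less_imp_le)
            then have "g (Suc j) = g j" using gk[of "Suc j"] gjk \<open>Suc j < k\<close> by simp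
            then show False using corner1 by simp
          qed
          have lq: "\<forall>i<q. g j < g i" using q(3) gjk gk qj lt by auto
          show ?thesis
            using A1
          proof (elim disjE exE conjE)
            assume x: "S1 = S" "t1' = t1" and "t1 = Mark j \<longrightarrow> \<not> (Suc j \<in> S \<and> j \<notin> S \<and> h j = Suc (h (Suc j)))"
            then have "j \<in> S" using kS kk m1 gjk' gh by auto
            then have "\<forall>i<j. g j < g i" using v1' x by auto
            moreover have "g q = g j" if "q < j"
              using q(2)[unfolded flat_def, rule_format, of q] gjk gk[of q] q(1) that lt by simp
            ultimately have "q = j" using qj by (metis le_neq_implies_less less_irrefl)
            then show ?thesis using x m1 \<open>j \<in> S\<close> lt by simp
          next
            fix p assume p: "p \<le> j" "flat g p j" "\<forall>i<p. g j < g i" "p \<in> S1"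
              and "landed S j S1 t1' p"
            then have "tcol t1' = p" by (auto simp: landed_def)
            moreover have "p = q"
            proof -
              have "\<not> p < q" using lq p(2)[unfolded flat_def] p(1) by (metis le_refl less_irrefl)
              moreover have "\<not> q < p"
              proof
                assume "q < p"
                then have "g j < g q" using p by simp
                moreover have "g q = g2 k" using q(1) q(2)[unfolded flat_def] gk[of q] qj lt by (metis le_refl le_less_trans less_irrefl)
                ultimately show False using gjk by simp
              qed
              ultimately show ?thesis by simp
            qed
            ultimately show ?thesis using m1 p(4) qj lt by auto
          qed
        next
          case False
          then have jk': "j = k" "t2 = Mark k" using jk by auto
          then have x: "Suc j \<in> S1" "j \<notin> S1" "g j = Suc (g (Suc j))" using tm by auto
          have sS: "Suc j \<in> S" using S1S x by simp
          have m1: "t1 = Mark j" using tj gjj v'[OF sS, of j] x gj[of "Suc j"] by auto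
          then have gh: "g = h" using gjj by simp
          have g2g: "g2 = g" using jk' g2_def by simp
          show ?thesis
            using A1
          proof (elim disjE exE conjE)
            assume "S1 = S" "t1' = t1" and "t1 = Mark j \<longrightarrow> \<not> (Suc j \<in> S \<and> j \<notin> S \<and> h j = Suc (h (Suc j)))"
            then show ?thesis using x m1 gh by simp
          next
            fix p assume p: "p \<le> j" "flat g p j" "\<forall>i<p. g j < g i" "p \<in> S1"
              and "landed S j S1 t1' p"
            then have "tcol t1' = p" by (auto simp: landed_def)
            moreover have "p = q" using p(1,3) p(2)[unfolded flat_def] q(1,3) q(2)[unfolded flat_def] g2g jk'(1) by (metis le_refl less_irrefl nat_neq_iff)
            ultimately show ?thesis using m1 p(4) x jk' by auto
          qed
        qed
        then show ?thesis using d by (auto simp: tle_def landed_def)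
      qed
    qed
    then show ?thesis using True by simp
  next
    case False
    then have jk: "k < j \<or> (j = k \<and> t2 = New k)" using j_def k_def tk by (auto simp: tle_def)
    have t2': "t2 = New k \<Longrightarrow> i < k \<Longrightarrow> g k < g i" "t2 = Mark k \<Longrightarrow> g (Suc k) < g k" for i
      using t2 g_def by auto
    \<comment> \<open>Inside a flat block a new cell can only be added at the left end, and a mark
      before the right end is not a corner. So this is the only token that can lie in the block of
      the first landing.\<close>
    have lands: "t2 = New k \<and> k = p" if p: "p \<le> j" "flat g p j" "p \<le> k" for p
    proof -
      have kj: "k \<le> j" using jk by auto
      then have gkj: "g k = g j" "g p = g j" using p unfolding flat_def by (metis le_refl)+
      have nk: "t2 = New k"
      proof (rule ccontr)
        assume "t2 \<noteq> New k"
        then have "t2 = Mark k" "k < j" using tk jk by auto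
        then have "g (Suc k) = g j" using p unfolding flat_def by (metis Suc_leI le_Suc_eq)
        then show False using t2'(2)[OF \<open>t2 = Mark k\<close>] gkj by simp
      qed
      moreover have "k = p" using t2'(1)[OF nk, of p] gkj p(3) by (metis le_neq_implies_less less_irrefl)
      ultimately show ?thesis by simp
    qed
    have "\<not> tle t1' t2'"
      using A1
    proof (elim disjE exE conjE)
      assume x: "S1 = S" "t1' = t1"
      show ?thesis
        using A2
      proof (elim disjE exE conjE)
        assume "S2 = S1" "t2' = t2" then show ?thesis using x False by simp
      next
        fix q assume "q \<le> k" "landed S1 k S2 t2' q"
        then show ?thesis using x jk j_def by (auto simp: tle_def landed_def)
      qed
    next
      fix p assume p: "p \<le> j" "flat g p j" "\<forall>i<p. g j < g i" "p \<in> S1"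
         and d: "landed S j S1 t1' p"
      have c: "tcol t1' = p" using d by (auto simp: landed_def)
      show ?thesis
      proof (cases "p \<le> k")
        case False then show ?thesis using c kc by (auto simp: tle_def)
      next
        case True
        then have nk: "t2 = New k" "k = p" using lands[OF p(1,2)] by auto
        show ?thesis
          using A2
        proof (elim disjE exE conjE)
          assume "t2 = New k \<longrightarrow> k \<notin> S1" then show ?thesis using nk p by simp
        next
          fix q assume "q \<le> k" "landed S1 k S2 t2' q"
          then show ?thesis using c nk by (auto simp: tle_def landed_def)
        qed
      qed
    qed
    then show ?thesis using False by simp
  qed
qed

text \<open>The starting letter exceeds all letters of the current shape, so it lands in the first
  column without smaller letters, to the right of every corner.\<close>

lemma pieri_start2:
  assumes h: "part h" and v: "vstrip h S" and t1: "okt h t1" and e1: "step h S t1 = (S1, t1')"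
    and e2: "land (up h t1) S1 0 = (S2, t2')" and a: "t1 \<noteq> Idle"
  shows "tle t1' t2'"
proof -
  have g: "part (up h t1)" using part_up[OF h t1] .
  let ?q = "first_col (up h t1) 0"
  have "up h t1 ?q = 0" using first_col(1)[OF g, of 0] by simp
  moreover have "0 < up h t1 (tcol t1)" using okt_up_corner[OF h t1 a] by simp
  ultimately have "tcol t1 < ?q" using partD[OF g, of ?q "tcol t1"] by (metis leI not_less_zero le_zero_eq neq0_conv)
  moreover have "tcol t2' = ?q" using e2 by (auto simp: land_def Let_def split: if_splits)
  ultimately show ?thesis using ext_active_col[OF h v t1 a e1] by (simp add: tle_def)
qed

lemma pieri_start1:
  assumes h: "part h" and v: "vstrip h S" and e1: "land h S 0 = (S1, t1')"
    and t2: "okt h t2" and e2: "step h S1 t2 = (S2, t2')" and a: "t2 \<noteq> Idle"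
  shows "\<not> tle t1' t2'"
proof -
  obtain q where q: "first_col h 0 = q" "h q = 0" "\<forall>i<q. 0 < h i" by (metis first_colE h le_zero_eq)
  have t1: "tcol t1' = q" "q \<in> S1" using e1 q by (auto simp: land_def split: if_splits)
  have "ext h S Idle True = (S1,t1')" using e1 by (simp add: ext_def)
  from step_ok[OF h v _ this] have v1: "vstrip h S1" by simp
  define k where "k = tcol t2"
  have tk: "t2 = New k \<or> t2 = Mark k" using a k_def by (cases t2) auto
  have kq: "k \<le> q" "t2 = Mark k \<Longrightarrow> k < q"
  proof -
    have "\<not> q < k" if "t2 = New k" using t2 that q(2) by auto
    moreover show "k < q" if "t2 = Mark k"
      using t2 that q(2) partD[OF h, of q k] by (cases "k < q") auto
    ultimately show "k \<le> q" using tk by fastforce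
  qed
  have c: "tcol t2' \<le> k" using ext_active_col[OF h v1 t2 a e2] k_def by simp
  show ?thesis
  proof (cases "k < q")
    case True then show ?thesis using c t1 by (auto simp: tle_def)
  next
    case False
    then have "k = q" "t2 = New q" using kq tk by auto
    then show ?thesis using step_active[OF h v1 t2 a e2 k_def refl] t1
      by (auto simp: tle_def landed_def)
  qed
qed

lemma pieri_start12:
  assumes h: "part h" and v: "vstrip h S" and e1: "land h S 0 = (S1, t1')" and e2: "land h S1 0 = (S2, t2')"
  shows "tle t1' t2'"
  using e1 e2 by (auto simp: land_def Let_def tle_def split: if_splits)

section \<open>Insertion into a whole tableau\<close>

primrec ht :: "(nat \<Rightarrow> nat set) \<Rightarrow> nat \<Rightarrow> nat \<Rightarrow> nat" where
  "ht F 0 = (\<lambda>_. 0)"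
| "ht F (Suc a) = adds (ht F a) (F (Suc a))"

text \<open>Row and column strictness of a tableau with entries in \<open>{1..M}\<close> are packed
  into one condition: the letter \<open>a + 1\<close> extends only addable corners of the shape of
  the letters up to \<open>a\<close>.\<close>

definition fam :: "nat \<Rightarrow> (nat \<Rightarrow> nat set) \<Rightarrow> bool" where
  "fam M F \<longleftrightarrow> (\<forall>a. a = 0 \<or> M < a \<longrightarrow> F a = {}) \<and> (\<forall>a. vstrip (ht F a) (F (Suc a)))"

primrec tk :: "(nat \<Rightarrow> nat set) \<Rightarrow> nat \<Rightarrow> nat \<Rightarrow> tok" where
  "tk F x 0 = Idle"
| "tk F x (Suc a) = snd (ext (ht F a) (F (Suc a)) (tk F x a) (Suc a = x))"

definition ins :: "(nat \<Rightarrow> nat set) \<Rightarrow> nat \<Rightarrow> nat \<Rightarrow> nat set" where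
  "ins F x a = (case a of 0 \<Rightarrow> {} | Suc b \<Rightarrow> fst (ext (ht F b) (F (Suc b)) (tk F x b) (Suc b = x)))"

lemma ins_simps [simp]: "ins F x 0 = {}"
  "ins F x (Suc b) = fst (ext (ht F b) (F (Suc b)) (tk F x b) (Suc b = x))"
  by (simp_all add: ins_def)

lemma part_ht: "\<forall>b<a. vstrip (ht F b) (F (Suc b)) \<Longrightarrow> part (ht F a)"
proof (induction a)
  case 0 then show ?case by (auto simp: part_def antimono_def)
next
  case (Suc a) then show ?case using part_adds[of "ht F a" "F (Suc a)"] by simp
qed

lemma ht_cong: "\<forall>b. 0 < b \<and> b \<le> a \<longrightarrow> F b = G b \<Longrightarrow> ht F a = ht G a"
  by (induction a) auto

lemma tk_cong: "\<forall>b. 0 < b \<and> b \<le> a \<longrightarrow> F b = G b \<Longrightarrow> tk F x a = tk G x a"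
proof (induction a)
  case (Suc a)
  then have "ht F a = ht G a" using ht_cong[of a F G] by simp
  then show ?case using Suc by simp
qed simp

lemma ins_cong: "\<forall>b. 0 < b \<and> b \<le> a \<longrightarrow> F b = G b \<Longrightarrow> ins F x a = ins G x a"
proof (cases a)
  case (Suc b)
  assume *: "\<forall>b. 0 < b \<and> b \<le> a \<longrightarrow> F b = G b"
  then have "ht F b = ht G b" "tk F x b = tk G x b" using ht_cong[of b F G] tk_cong[of b F G x] Suc by auto
  then show ?thesis using * Suc by simp
qed simp

lemma ins_inv:
  assumes "\<forall>b<a. vstrip (ht F b) (F (Suc b))" "0 < x"
  shows "okt (ht F a) (tk F x a) \<and> ht (ins F x) a = up (ht F a) (tk F x a) \<and> (tk F x a = Idle \<longleftrightarrow> a < x)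
     \<and> (\<forall>b<a. vstrip (ht (ins F x) b) (ins F x (Suc b)))"
  using assms(1)
proof (induction a)
  case 0 then show ?case using assms(2) by simp
next
  case (Suc a)
  then have IH: "okt (ht F a) (tk F x a)" "ht (ins F x) a = up (ht F a) (tk F x a)" "tk F x a = Idle \<longleftrightarrow> a < x"
     "\<forall>b<a. vstrip (ht (ins F x) b) (ins F x (Suc b))" by auto
  have p: "part (ht F a)" using part_ht[of a F] Suc.prems by simp
  have v: "vstrip (ht F a) (F (Suc a))" using Suc.prems by simp
  obtain S' t' where e: "ext (ht F a) (F (Suc a)) (tk F x a) (Suc a = x) = (S',t')" by fastforce
  have "Suc a = x \<Longrightarrow> tk F x a = Idle" using IH(3) by simp
  from step_ok[OF p v IH(1) e this] show ?case using IH e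
    by (auto simp: less_Suc_eq)
qed

lemma fam_part: "fam M F \<Longrightarrow> part (ht F a)"
  by (rule part_ht) (simp add: fam_def)

lemma fam_ins:
  assumes "fam M F" "0 < x" "x \<le> M"
  shows "fam M (ins F x)"
proof -
  have s: "ins F x a = {}" if "M < a" for a
  proof -
    have "0 < a" using that by simp
    then obtain b where b: "a = Suc b" using gr0_conv_Suc by blast
    then have "F (Suc b) = {}" "Suc b \<noteq> x" using that assms by (auto simp: fam_def)
    moreover have "step h {} t = ({}, t)" for h t by (cases t) auto
    ultimately show ?thesis using b by (simp add: ext_def)
  qed
  moreover have "vstrip (ht (ins F x) a) (ins F x (Suc a))" for a
  proof -
    have "\<forall>b<Suc a. vstrip (ht F b) (F (Suc b))" using assms(1) unfolding fam_def by blast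
    from ins_inv[OF this assms(2)] show ?thesis by blast
  qed
  moreover have "ins F x 0 = {}" by simp
  ultimately show ?thesis unfolding fam_def by metis
qed

text \<open>Peels off the largest letter. Its columns after the insertion and the final token
  determine, through \<open>bk\<close>, its old columns, the token below it, and whether the
  insertion started there.\<close>

lemma ins_inj_aux:
  assumes "\<forall>b<a. vstrip (ht F b) (F (Suc b))" "\<forall>b<a. vstrip (ht G b) (G (Suc b))" "0 < x" "0 < y"
    and "\<forall>b. 0 < b \<and> b \<le> a \<longrightarrow> ins F x b = ins G y b" "tk F x a = tk G y a"
  shows "(\<forall>b. 0 < b \<and> b \<le> a \<longrightarrow> F b = G b) \<and> (x \<le> a \<longrightarrow> x = y)"
  using assms
proof (induction a)
  case (Suc a)
  have i: "okt (ht F a) (tk F x a)" "ht (ins F x) a = up (ht F a) (tk F x a)" "tk F x a = Idle \<longleftrightarrow> a < x"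
    using ins_inv[of a F x] Suc.prems by auto
  have j: "okt (ht G a) (tk G y a)" "ht (ins G y) a = up (ht G a) (tk G y a)" "tk G y a = Idle \<longleftrightarrow> a < y"
    using ins_inv[of a G y] Suc.prems by auto
  have p: "part (ht F a)" "part (ht G a)" using part_ht[of a] Suc.prems by auto
  have v: "vstrip (ht F a) (F (Suc a))" "vstrip (ht G a) (G (Suc a))" using Suc.prems by auto
  have e: "ext (ht F a) (F (Suc a)) (tk F x a) (Suc a = x) = (ins F x (Suc a), tk F x (Suc a))"
     "ext (ht G a) (G (Suc a)) (tk G y a) (Suc a = y) = (ins G y (Suc a), tk G y (Suc a))" by simp_all
  have "bk (ht (ins F x) a) (ins F x (Suc a)) (tk F x (Suc a)) = (F (Suc a), tk F x a, Suc a = x)"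
    using bk_ext[OF p(1) v(1) i(1) e(1)] i by simp
  moreover have "bk (ht (ins G y) a) (ins G y (Suc a)) (tk G y (Suc a)) = (G (Suc a), tk G y a, Suc a = y)"
    using bk_ext[OF p(2) v(2) j(1) e(2)] j by simp
  moreover have "ht (ins F x) a = ht (ins G y) a" using ht_cong[of a "ins F x" "ins G y"] Suc.prems(5) by simp
  moreover have "ins F x (Suc a) = ins G y (Suc a)" using Suc.prems(5) by blast
  ultimately have eq: "F (Suc a) = G (Suc a)" "tk F x a = tk G y a" "(Suc a = x) = (Suc a = y)"
    using Suc.prems(6) by (metis prod.inject)+
  have "(\<forall>b. 0 < b \<and> b \<le> a \<longrightarrow> F b = G b) \<and> (x \<le> a \<longrightarrow> x = y)"
    using Suc.IH Suc.prems eq(2) by simp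
  then show ?case using eq by (auto simp: le_Suc_eq)
qed simp

lemma ins_inj:
  assumes "fam M F" "fam M G" "0 < x" "0 < y" "x \<le> M" "ins F x = ins G y" "tk F x M = tk G y M"
  shows "F = G \<and> x = y"
proof -
  have "(\<forall>b. 0 < b \<and> b \<le> M \<longrightarrow> F b = G b) \<and> (x \<le> M \<longrightarrow> x = y)"
    using assms by (intro ins_inj_aux) (auto simp: fam_def)
  moreover have "F b = G b" if "b = 0 \<or> M < b" for b using assms(1,2) that by (auto simp: fam_def)
  ultimately have "F b = G b" for b by (cases "0 < b \<and> b \<le> M") (auto simp: not_le)
  then show ?thesis using \<open>_ \<and> (x \<le> M \<longrightarrow> x = y)\<close> assms(5) by auto
qed

lemma down_up: "down (up h t) t = h"
  by (cases t) (auto simp: fun_eq_iff)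

text \<open>Descending induction with \<open>bk\<close>. While the recovered token is a corner, the
  letters below are treated in the same way; once it is idle, the start has been found. It must be
  found, because the empty shape has no corner.\<close>

lemma ins_surj_aux:
  assumes "\<forall>b<a. vstrip (ht G b) (G (Suc b))" "corner (ht G a) t"
  shows "\<exists>F x. 0 < x \<and> x \<le> a \<and> (\<forall>b. b = 0 \<or> a < b \<longrightarrow> F b = {}) \<and> (\<forall>b<a. vstrip (ht F b) (F (Suc b)))
     \<and> (\<forall>b. 0 < b \<and> b \<le> a \<longrightarrow> ins F x b = G b) \<and> tk F x a = t"
  using assms
proof (induction a arbitrary: t)
  case 0 then show ?case by (simp add: corner_def)
next
  case (Suc a)
  have p: "part (ht G a)" using part_ht[of a G] Suc.prems by simp
  have v: "vstrip (ht G a) (G (Suc a))" using Suc.prems by simp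
  obtain S s st where b: "bk (ht G a) (G (Suc a)) t = (S, s, st)" using prod_cases3 by blast
  note E = ext_bk[OF p v _ b] 
  have E': "part (down (ht G a) s)" "vstrip (down (ht G a) s) S" "okt (down (ht G a) s) s" "up (down (ht G a) s) s = ht G a"
    "st \<longrightarrow> s = Idle" "ext (down (ht G a) s) S s st = (G (Suc a), t)" "s = Idle \<or> corner (ht G a) s"
    using E Suc.prems(2) by auto
  have tI: "t \<noteq> Idle" using Suc.prems by (simp add: corner_def)
  have "\<exists>F x. 0 < x \<and> x \<le> Suc a \<and> (st \<longleftrightarrow> x = Suc a) \<and> (\<forall>b. b = 0 \<or> a < b \<longrightarrow> F b = {}) \<and> (\<forall>b<a. vstrip (ht F b) (F (Suc b)))
     \<and> (\<forall>b. 0 < b \<and> b \<le> a \<longrightarrow> ins F x b = G b) \<and> tk F x a = s"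
  proof (cases st)
    case True
    then have s: "s = Idle" using E' by simp
    \<comment> \<open>Here \<open>Suc a\<close> is the inserted letter, and all smaller letters are
      taken over from \<open>G\<close> unchanged.\<close>
    define F where "F b = (if 0 < b \<and> b \<le> a then G b else {})" for b
    have FG: "\<forall>b. 0 < b \<and> b \<le> a \<longrightarrow> F b = G b" by (simp add: F_def)
    have vF: "\<forall>b<a. vstrip (ht F b) (F (Suc b))"
    proof (intro allI impI)
      fix b assume "b < a"
      then have "ht F b = ht G b" using ht_cong[of b F G] FG by simp
      then show "vstrip (ht F b) (F (Suc b))" using \<open>b < a\<close> FG Suc.prems by simp
    qed
    have "tk F (Suc a) b = Idle" if "b \<le> a" for b
      using ins_inv[of b F "Suc a"] vF that by auto
    moreover have "ins F (Suc a) b = G b" if "0 < b" "b \<le> a" for b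
    proof -
      from \<open>0 < b\<close> obtain c where "b = Suc c" using gr0_conv_Suc by blast
      then show ?thesis using calculation[of c] that FG by (simp add: ext_def)
    qed
    ultimately show ?thesis using vF s True by (intro exI[of _ F] exI[of _ "Suc a"]) (auto simp: F_def)
  next
    case False
    then have "s \<noteq> Idle" using E'(6) tI by (auto simp: ext_def)
    then have "corner (ht G a) s" using E' by simp
    then show ?thesis using Suc.IH[of s] Suc.prems False by (metis le_SucI not_less_eq_eq less_Suc_eq order_refl)
  qed
  then obtain F x where F: "0 < x" "x \<le> Suc a" "st \<longleftrightarrow> x = Suc a" "\<forall>b. b = 0 \<or> a < b \<longrightarrow> F b = {}" "\<forall>b<a. vstrip (ht F b) (F (Suc b))"
     "\<forall>b. 0 < b \<and> b \<le> a \<longrightarrow> ins F x b = G b" "tk F x a = s" by blast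
  define F' where "F' = F(Suc a := S)"
  have FF: "\<forall>b. 0 < b \<and> b \<le> a \<longrightarrow> F' b = F b" by (simp add: F'_def)
  have h: "ht F' b = ht F b" "tk F' x b = tk F x b" "ins F' x b = ins F x b" if "b \<le> a" for b
    using ht_cong[of b F' F] tk_cong[of b F' F x] ins_cong[of b F' F x] FF that by auto
  have "ht (ins F x) a = ht G a" using ht_cong[of a "ins F x" G] F(6) by simp
  then have ha: "up (ht F a) s = ht G a" "okt (ht F a) s" using ins_inv[of a F x] F by auto
  then have hd: "ht F a = down (ht G a) s" using down_up by metis
  have vF: "\<forall>b<Suc a. vstrip (ht F' b) (F' (Suc b))"
    using F(5) h E'(2) hd FF by (auto simp: less_Suc_eq F'_def)
  have "ext (ht F' a) (F' (Suc a)) (tk F' x a) (Suc a = x) = (G (Suc a), t)"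
    using h[of a] hd F(3,7) E'(6) by (auto simp: F'_def)
  then have "ins F' x (Suc a) = G (Suc a)" "tk F' x (Suc a) = t" by auto
  note last = this
  have "\<forall>b. b = 0 \<or> Suc a < b \<longrightarrow> F' b = {}" using F(4) by (simp add: F'_def)
  moreover have "\<forall>b. 0 < b \<and> b \<le> Suc a \<longrightarrow> ins F' x b = G b"
    using h(3) F(6) last(1) le_Suc_eq by metis
  ultimately show ?case using F(1,2) vF last(2) by blast
qed

lemma ins_surj:
  assumes "fam M G" "corner (ht G M) t"
  shows "\<exists>F x. 0 < x \<and> x \<le> M \<and> fam M F \<and> ins F x = G \<and> tk F x M = t"
proof -
  obtain F x where F: "0 < x" "x \<le> M" "\<forall>b. b = 0 \<or> M < b \<longrightarrow> F b = {}" "\<forall>b<M. vstrip (ht F b) (F (Suc b))"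
     "\<forall>b. 0 < b \<and> b \<le> M \<longrightarrow> ins F x b = G b" "tk F x M = t"
    using ins_surj_aux[of M G t] assms by (auto simp: fam_def)
  have "vstrip (ht F b) (F (Suc b))" for b using F(3,4) by (cases "b < M") (auto simp: vstrip_def)
  then have fF: "fam M F" using F by (auto simp: fam_def)
  then have "fam M (ins F x)" using fam_ins F by blast
  then have "ins F x b = G b" for b
    using F(5) assms(1) by (cases "0 < b \<and> b \<le> M") (auto simp: fam_def not_le)
  then show ?thesis using F fF by blast
qed

lemma tk_corner:
  assumes "fam M F" "0 < x" "x \<le> M"
  shows "corner (ht (ins F x) M) (tk F x M)" "down (ht (ins F x) M) (tk F x M) = ht F M"
proof -
  have i: "okt (ht F M) (tk F x M)" "ht (ins F x) M = up (ht F M) (tk F x M)" "tk F x M \<noteq> Idle"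
    using ins_inv[of M F x] assms by (auto simp: fam_def)
  show "corner (ht (ins F x) M) (tk F x M)"
    using okt_up_corner[OF fam_part[OF assms(1)] i(1,3)] i by (simp add: corner_def)
  show "down (ht (ins F x) M) (tk F x M) = ht F M" using i by (cases "tk F x M") auto
qed

text \<open>The order of the two tokens is created when the larger of \<open>x\<close> and
  \<open>y\<close> starts, and \<open>pieri_local\<close> carries it unchanged through all greater
  letters.\<close>

lemma pieri:
  assumes "\<forall>b<a. vstrip (ht F b) (F (Suc b))" "0 < x" "0 < y"
  shows "x \<le> a \<and> y \<le> a \<longrightarrow> (tle (tk F x a) (tk (ins F x) y a) \<longleftrightarrow> x \<le> y)"
  using assms(1)
proof (induction a)
  case (Suc a)
  let ?h = "ht F a" and ?g = "ht (ins F x) a"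
  have i: "okt ?h (tk F x a)" "?g = up ?h (tk F x a)" "tk F x a = Idle \<longleftrightarrow> a < x"
     "\<forall>b<Suc a. vstrip (ht (ins F x) b) (ins F x (Suc b))"
    using ins_inv[of a F x] ins_inv[of "Suc a" F x] Suc.prems assms by auto
  have j: "okt ?g (tk (ins F x) y a)" "tk (ins F x) y a = Idle \<longleftrightarrow> a < y"
    using ins_inv[of a "ins F x" y] i assms by auto
  have p: "part ?h" "part ?g" using part_ht[of a F] part_ht[of a "ins F x"] Suc.prems i by auto
  have v: "vstrip ?h (F (Suc a))" using Suc.prems by simp
  have IH: "x \<le> a \<and> y \<le> a \<longrightarrow> (tle (tk F x a) (tk (ins F x) y a) \<longleftrightarrow> x \<le> y)" using Suc by simp
  obtain S1 t1 where e1: "ext ?h (F (Suc a)) (tk F x a) (Suc a = x) = (S1, t1)" by fastforce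
  obtain S2 t2 where e2: "ext ?g S1 (tk (ins F x) y a) (Suc a = y) = (S2, t2)" by fastforce
  have r: "tk F x (Suc a) = t1" "tk (ins F x) y (Suc a) = t2" using e1 e2 by auto
  show ?case
  proof (intro impI)
    assume xy: "x \<le> Suc a \<and> y \<le> Suc a"
    consider "x \<le> a" "y \<le> a" | "x \<le> a" "y = Suc a" | "x = Suc a" "y \<le> a" | "x = Suc a" "y = Suc a"
      using xy by linarith
    then have "tle t1 t2 \<longleftrightarrow> x \<le> y"
    proof cases
      case 1
      then show ?thesis using pieri_local[OF p(1) v i(1), of S1 t1 "tk (ins F x) y a" S2 t2] e1 e2 i j IH
        by (auto simp: ext_def)
    next
      case 2
      then show ?thesis using pieri_start2[OF p(1) v i(1), of S1 t1 S2 t2] e1 e2 i j by (auto simp: ext_def)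
    next
      case 3
      then have "tk F x a = Idle" using i by simp
      then show ?thesis using 3 pieri_start1[OF p(1) v, of S1 t1 "tk (ins F x) y a" S2 t2] e1 e2 i j by (auto simp: ext_def)
    next
      case 4
      then have "tk F x a = Idle" using i by simp
      then show ?thesis using 4 pieri_start12[OF p(1) v, of S1 t1 S2 t2] e1 e2 i j by (auto simp: ext_def)
    qed
    then show "tle (tk F x (Suc a)) (tk (ins F x) y (Suc a)) \<longleftrightarrow> x \<le> y" using r by simp
  qed
qed (use assms in simp)

section \<open>Left keys as weight vectors\<close>

definition topi :: "nat \<Rightarrow> (nat \<Rightarrow> nat) \<Rightarrow> nat \<Rightarrow> bool" where
  "topi a \<alpha> i \<longleftrightarrow> 0 < i \<and> i \<le> a \<and> (\<forall>i'. i < i' \<and> i' \<le> a \<longrightarrow> \<alpha> i' \<noteq> \<alpha> i)"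

text \<open>The left key is stored by its weight: the value of an index is the number of key columns
  containing it. Adding the letter \<open>a\<close> to column \<open>c\<close> of the tableau
  enlarges column \<open>c\<close> of the left key by one entry, namely the largest index of value
  \<open>c\<close>. For \<open>c = 0\<close> this is \<open>a\<close> itself, whose value is still
  0.\<close>

definition upd :: "nat \<Rightarrow> nat set \<Rightarrow> (nat \<Rightarrow> nat) \<Rightarrow> nat \<Rightarrow> nat" where
  "upd a S \<alpha> i = (if topi a \<alpha> i \<and> \<alpha> i \<in> S then Suc (\<alpha> i) else \<alpha> i)"

definition kv :: "nat \<Rightarrow> (nat \<Rightarrow> nat) \<Rightarrow> (nat \<Rightarrow> nat) \<Rightarrow> bool" where
  "kv a h \<alpha> \<longleftrightarrow> (\<forall>i. i = 0 \<or> a < i \<longrightarrow> \<alpha> i = 0) \<and> (\<forall>c. card {i. c < \<alpha> i} = h c)"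

primrec al :: "(nat \<Rightarrow> nat set) \<Rightarrow> nat \<Rightarrow> nat \<Rightarrow> nat" where
  "al F 0 = (\<lambda>_. 0)"
| "al F (Suc a) = upd (Suc a) (F (Suc a)) (al F a)"

text \<open>The promoted index becomes the smallest of its new level. This minimality belongs to the
  relation because both the induction over the letters and the backward comparison of keys rest on
  it.\<close>

fun krel :: "tok \<Rightarrow> (nat \<Rightarrow> nat) \<Rightarrow> (nat \<Rightarrow> nat) \<Rightarrow> bool" where
  "krel (New j) \<alpha> \<beta> = (\<exists>b. \<alpha> b = j \<and> \<beta> = \<alpha>(b := Suc j) \<and> (\<forall>i. \<beta> i = Suc j \<longrightarrow> b \<le> i))"
| "krel t \<alpha> \<beta> = (\<beta> = \<alpha>)"

lemma kv_fin: "kv a h \<alpha> \<Longrightarrow> finite {i. c < \<alpha> i}"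
  by (rule finite_subset[of _ "{..a}"]) (simp_all add: kv_def, metis (mono_tags) atMost_iff mem_Collect_eq not_le not_less_zero subsetI)

lemma kv_level:
  assumes "kv a h \<alpha>" "0 < c"
  shows "h (c - 1) = h c + card {i. \<alpha> i = c}"
proof -
  have e: "{i. c - 1 < \<alpha> i} = {i. c < \<alpha> i} \<union> {i. \<alpha> i = c}" using assms(2) by auto
  have "finite {i. \<alpha> i = c}" using kv_fin[OF assms(1), of "c - 1"] unfolding e by simp
  then have "card {i. c - 1 < \<alpha> i} = card {i. c < \<alpha> i} + card {i. \<alpha> i = c}"
    unfolding e by (rule card_Un_disjoint[OF kv_fin[OF assms(1)]]) auto
  then show ?thesis using assms(1) by (simp add: kv_def)
qed

lemma kv_level_ex:
  assumes "kv a h \<alpha>" "\<forall>i<c. h c < h i"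
  shows "\<exists>i. 0 < i \<and> i \<le> Suc a \<and> \<alpha> i = c"
proof (cases "c = 0")
  case True then show ?thesis using assms(1) by (intro exI[of _ "Suc a"]) (auto simp: kv_def)
next
  case False
  then have "card {i. \<alpha> i = c} \<noteq> 0" using kv_level[OF assms(1), of c] assms(2)[rule_format, of "c - 1"] by simp
  then obtain i where "\<alpha> i = c" by (metis (mono_tags) Collect_empty_eq card.empty)
  then show ?thesis using assms(1) False unfolding kv_def by (intro exI[of _ i]) (metis gr0I le_SucI not_le)
qed

lemma kv_level_empty:
  assumes "kv a h \<alpha>" "h (c - 1) = h c" "0 < c"
  shows "\<alpha> i \<noteq> c"
proof -
  have e: "{i. c - 1 < \<alpha> i} = {i. c < \<alpha> i} \<union> {i. \<alpha> i = c}" using assms(3) by auto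
  have "finite {i. \<alpha> i = c}" using kv_fin[OF assms(1), of "c - 1"] unfolding e by simp
  then show ?thesis using kv_level[OF assms(1,3)] assms(2) by (auto simp: card_eq_0_iff)
qed

lemma kv_level_single:
  assumes "kv a h \<alpha>" "h (c - 1) = Suc (h c)" "0 < c" "\<alpha> i = c" "\<alpha> k = c"
  shows "i = k"
proof -
  have "card {i. \<alpha> i = c} = 1" using kv_level[OF assms(1,3)] assms(2) by simp
  then obtain x where "{i. \<alpha> i = c} = {x}" by (auto simp: card_1_singleton_iff)
  then have "i \<in> {x}" "k \<in> {x}" using assms(4,5) by blast+
  then show ?thesis by simp
qed

lemma top_ex:
  assumes "0 < i" "i \<le> a" "\<alpha> i = c"
  shows "\<exists>k. topi a \<alpha> k \<and> \<alpha> k = c \<and> i \<le> k"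
proof -
  let ?A = "{k. i \<le> k \<and> k \<le> a \<and> \<alpha> k = c}"
  have f: "finite ?A" by (rule finite_subset[of _ "{..a}"]) auto
  have "i \<in> ?A" using assms by simp
  then have m: "Max ?A \<in> ?A" using Max_in[OF f] by blast
  define m where "m = Max ?A"
  have m': "i \<le> m" "m \<le> a" "\<alpha> m = c" using m m_def by auto
  have "\<alpha> k \<noteq> \<alpha> m" if "m < k" "k \<le> a" for k
  proof
    assume "\<alpha> k = \<alpha> m"
    then have "k \<in> ?A" using m' that by simp
    then have "k \<le> m" unfolding m_def by (rule Max_ge[OF f])
    then show False using that by simp
  qed
  then have "topi a \<alpha> m" unfolding topi_def using m' assms by auto
  then show ?thesis using m' by blast
qed

lemma top_unique: "topi a \<alpha> i \<Longrightarrow> topi a \<alpha> k \<Longrightarrow> \<alpha> i = \<alpha> k \<Longrightarrow> i = k"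
  unfolding topi_def by (metis linorder_neqE_nat)

lemma kv_upd:
  assumes k: "kv a h \<alpha>" and v: "vstrip h S"
  shows "kv (Suc a) (adds h S) (upd (Suc a) S \<alpha>)"
proof -
  have "card {i. c < upd (Suc a) S \<alpha> i} = adds h S c" for c
  proof (cases "c \<in> S")
    case False
    then have "{i. c < upd (Suc a) S \<alpha> i} = {i. c < \<alpha> i}" by (auto simp: upd_def less_Suc_eq split: if_splits)
    then show ?thesis using k False by (simp add: kv_def adds_def)
  next
    case True
    then obtain i where "0 < i" "i \<le> Suc a" "\<alpha> i = c" using kv_level_ex[OF k, of c] v by (auto simp: vstrip_def)
    then obtain m where m: "topi (Suc a) \<alpha> m" "\<alpha> m = c" using top_ex by blast
    have "(c < upd (Suc a) S \<alpha> i) = (i = m \<or> c < \<alpha> i)" for i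
    proof (cases "\<alpha> i = c")
      case ic: True
      then show ?thesis using top_unique[OF m(1), of i] m True by (auto simp: upd_def)
    next
      case False
      then show ?thesis using m by (auto simp: upd_def)
    qed
    then have "{i. c < upd (Suc a) S \<alpha> i} = insert m {i. c < \<alpha> i}" by auto
    then show ?thesis using k True kv_fin[OF k] m(2) by (simp add: kv_def adds_def)
  qed
  moreover have "upd (Suc a) S \<alpha> i = 0" if "i = 0 \<or> Suc a < i" for i
    using that k by (auto simp: upd_def topi_def kv_def)
  ultimately show ?thesis by (simp add: kv_def)
qed

lemma kv_al: "\<forall>b<a. vstrip (ht F b) (F (Suc b)) \<Longrightarrow> kv a (ht F a) (al F a)"
proof (induction a)
  case 0 then show ?case by (simp add: kv_def)
next
  case (Suc a) then show ?case using kv_upd[of a "ht F a" "al F a" "F (Suc a)"] by simp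
qed

lemma upd_level:
  assumes "topi a \<alpha> p" "\<alpha> p = c" "c \<in> S" "\<alpha> i = c"
  shows "upd a S \<alpha> i = (if i = p then Suc c else c)"
proof (cases "i = p")
  case False
  then have "\<not> topi a \<alpha> i" using top_unique[OF assms(1), of i] assms(2,4) by metis
  then show ?thesis using False assms(4) by (simp add: upd_def)
qed (use assms in \<open>simp add: upd_def\<close>)

text \<open>By the last assumption every index on level \<open>Suc q\<close> is promoted at the same
  time, so the newly arrived \<open>m\<close> is alone there and trivially minimal.\<close>

lemma krel_insert:
  assumes "topi a \<beta> m" "\<beta> m = q" "q \<notin> S" "\<And>i. \<beta> i = Suc q \<Longrightarrow> topi a \<beta> i \<and> Suc q \<in> S"
  shows "krel (New q) (upd a S \<beta>) (upd a (insert q S) \<beta>)"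
proof -
  have "upd a (insert q S) \<beta> i = ((upd a S \<beta>)(m := Suc q)) i" for i
  proof (cases "i = m")
    case True then show ?thesis using assms(1,2) by (simp add: upd_def)
  next
    case False
    then have "\<not> (topi a \<beta> i \<and> \<beta> i = q)" using assms(2) top_unique[OF assms(1), of i] by metis
    then show ?thesis using False by (auto simp: upd_def)
  qed
  then have "upd a (insert q S) \<beta> = (upd a S \<beta>)(m := Suc q)" by blast
  moreover have "upd a S \<beta> m = q" using assms by (simp add: upd_def)
  moreover have "m \<le> i" if "upd a (insert q S) \<beta> i = Suc q" for i
  proof (cases "\<beta> i = Suc q")
    case True then show ?thesis using assms(4)[OF True] that by (simp add: upd_def)
  next
    case False
    then have "topi a \<beta> i" "\<beta> i = q" using that by (auto simp: upd_def split: if_splits)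
    then show ?thesis using top_unique[OF assms(1), of i] assms(2) by simp
  qed
  ultimately show ?thesis by auto
qed

text \<open>Each of the two vectors promotes the top index of the levels in its strip. The strips
  differ only at \<open>j\<close> and at the landing column \<open>q\<close>, and the levels between
  them are empty because the columns there have equal height; so everything is decided on levels
  \<open>q\<close>, \<open>j\<close> and \<open>Suc j\<close>.\<close>

lemma key_step:
  assumes h: "part h" and v: "vstrip h S" and t: "okt h t" and e: "ext h S t st = (S', t')"
    and st: "st \<Longrightarrow> t = Idle" and k: "kv a h \<alpha>" and k': "kv a (up h t) \<beta>" and r: "krel t \<alpha> \<beta>"
  shows "krel t' (upd (Suc a) S \<alpha>) (upd (Suc a) S' \<beta>)"
proof (cases "t = Idle")
  case True
  then have ab: "\<beta> = \<alpha>" using r by simp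
  show ?thesis
  proof (cases st)
    case False then show ?thesis using True e ab by (auto simp: ext_def)
  next
    case s: True
    obtain q where q: "first_col h 0 = q" "h q = 0" "\<forall>i<q. 0 < h i" by (metis first_colE h le_zero_eq)
    show ?thesis
    proof (cases "q \<in> S")
      case True then show ?thesis using e s q ab by (auto simp: ext_def land_def)
    next
      case False
      then have e': "S' = insert q S" "t' = New q" using e s q by (auto simp: ext_def land_def)
      obtain i where "0 < i" "i \<le> Suc a" "\<alpha> i = q" using kv_level_ex[OF k, of q] q by auto
      then obtain m where m: "topi (Suc a) \<alpha> m" "\<alpha> m = q" using top_ex by blast
      have "{i. q < \<alpha> i} = {}" using k q kv_fin[OF k, of q] unfolding kv_def by (metis card_0_eq)
      then have "\<alpha> i \<noteq> Suc q" for i by (metis empty_iff lessI mem_Collect_eq)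
      then show ?thesis using krel_insert[OF m False] e' ab by blast
    qed
  qed
next
  case a: False
  then have st': "\<not> st" using st by auto
  define j where "j = tcol t"
  define g where "g = up h t"
  have g: "part g" using part_up[OF h t] g_def by simp
  have kg: "kv a g \<beta>" using k' g_def by simp
  have e': "step h S t = (S',t')" using e st' by (simp add: ext_def)
  have tj: "t = New j \<or> t = Mark j" using a j_def by (cases t) auto
  have suc: "\<exists>i. \<alpha> i = Suc j" if "Suc j \<in> S"
    using kv_level_ex[OF k, of "Suc j"] v that by (auto simp: vstrip_def)
  have bnew: "\<exists>b. \<alpha> b = j \<and> \<beta> = \<alpha>(b := Suc j) \<and> (\<forall>i. \<beta> i = Suc j \<longrightarrow> b \<le> i) \<and> 0 < b \<and> b \<le> a" if "t = New j"
  proof -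
    obtain b where b: "\<alpha> b = j" "\<beta> = \<alpha>(b := Suc j)" "\<forall>i. \<beta> i = Suc j \<longrightarrow> b \<le> i" using r \<open>t = New j\<close> by auto
    have "\<beta> b \<noteq> 0" using b by simp
    then have "0 < b \<and> b \<le> a" using kg unfolding kv_def by (metis gr0I not_le)
    then show ?thesis using b by blast
  qed
  \<comment> \<open>If column \<open>Suc j\<close> is extended, level \<open>Suc j\<close> of
    \<open>\<alpha>\<close> is inhabited, and its indices are larger than the minimal
    \<open>b\<close>; hence \<open>b\<close> is not the one promoted from there.\<close>
  have ntop: "\<not> (topi (Suc a) \<beta> b \<and> Suc j \<in> S)" if "\<beta> = \<alpha>(b := Suc j)" "\<forall>i. \<beta> i = Suc j \<longrightarrow> b \<le> i" "\<alpha> b = j" for b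
  proof
    assume x: "topi (Suc a) \<beta> b \<and> Suc j \<in> S"
    then obtain i where i: "\<alpha> i = Suc j" using suc by blast
    then have "i \<noteq> b" using that by auto
    then have "\<beta> i = Suc j" "b < i" using that i by (auto simp: le_neq_implies_less)
    moreover have "i \<le> a" using k i unfolding kv_def by (metis not_le Zero_not_Suc)
    ultimately show False using x that(1) by (auto simp: topi_def)
  qed
  from step_active[OF h v t a e' j_def g_def] show ?thesis
  proof (elim disjE exE conjE)
    assume s: "S' = S" "t' = t" and n: "t = New j \<longrightarrow> j \<notin> S"
    show ?thesis
      using tj
    proof
      assume "t = Mark j" then show ?thesis using r s by simp
    next
      assume tn: "t = New j"
      then obtain b where b: "\<alpha> b = j" "\<beta> = \<alpha>(b := Suc j)" "\<forall>i. \<beta> i = Suc j \<longrightarrow> b \<le> i" "0 < b" "b \<le> a"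
        using bnew by blast
      have nt: "\<not> (topi (Suc a) \<beta> b \<and> Suc j \<in> S)" using ntop b by blast
      have jS: "j \<notin> S" using n tn by simp
      have eq: "upd (Suc a) S \<beta> i = upd (Suc a) S \<alpha> i" if "i \<noteq> b" for i
      proof -
        have ai: "\<beta> i = \<alpha> i" using that b by simp
        have "topi (Suc a) \<beta> i \<longleftrightarrow> topi (Suc a) \<alpha> i" if "\<alpha> i \<noteq> j"
        proof -
          have "\<beta> i' = \<beta> i \<longleftrightarrow> \<alpha> i' = \<alpha> i" if "i < i'" for i'
            using that \<open>\<alpha> i \<noteq> j\<close> b ai by (auto simp: fun_upd_def split: if_splits)
          then show ?thesis by (auto simp: topi_def)
        qed
        then show ?thesis using ai jS by (auto simp: upd_def)
      qed
      have ub: "upd (Suc a) S \<alpha> b = j" "upd (Suc a) S \<beta> b = Suc j" using b nt jS by (auto simp: upd_def)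
      have "upd (Suc a) S \<beta> = (upd (Suc a) S \<alpha>)(b := Suc j)" using eq ub by (auto simp: fun_eq_iff)
      moreover have "b \<le> i" if "upd (Suc a) S \<beta> i = Suc j" for i
        using that b(3) jS by (auto simp: upd_def split: if_splits)
      ultimately show ?thesis using s tn ub by auto
    qed
  next
    fix q assume q: "q \<le> j" "flat g q j" "\<forall>i<q. g j < g i" "q \<in> S'" and d: "landed S j S' t' q"
      and n: "t = New j \<longrightarrow> j \<in> S"
      and mm: "t = Mark j \<longrightarrow> Suc j \<in> S \<and> j \<notin> S \<and> h j = Suc (h (Suc j))"
    have fl: "g c = g j" if "q \<le> c" "c \<le> j" for c using q(2) that unfolding flat_def by simp
    have gq: "g q = g j" using fl q(1) by blast
    have "\<exists>i. 0 < i \<and> i \<le> Suc a \<and> \<beta> i = q" using kv_level_ex[OF kg, of q] q(3) gq by simp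
    then obtain m where m: "topi (Suc a) \<beta> m" "\<beta> m = q" using top_ex by blast
    \<comment> \<open>Adjacent columns of equal height leave no index with the value in
      between.\<close>
    have emp: "\<beta> i \<noteq> c" if "q < c" "c \<le> j" for c i
      using kv_level_empty[OF kg, of c i] fl[of c] fl[of "c - 1"] that by simp
    show ?thesis
      using tj
    proof
      assume tM: "t = Mark j"
      then have ab: "\<beta> = \<alpha>" and gh: "g = h" using r g_def by auto
      have x: "Suc j \<in> S" "j \<notin> S" "h j = Suc (h (Suc j))" using mm tM by auto
      show ?thesis
      proof (cases "q \<in> S")
        case True
        then have "S' = S" "t' = Mark q" using d x by (auto simp: landed_def)
        then show ?thesis using ab by simp
      next
        case False
        then have e2: "S' = insert q S" "t' = New q" using d x by (auto simp: landed_def)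
        have "topi (Suc a) \<beta> i \<and> Suc q \<in> S" if "\<beta> i = Suc q" for i
        proof (cases "q = j")
          case False then show ?thesis using emp[of "Suc q" i] that q(1) by simp
        next
          case True
          have i: "0 < i" "i \<le> a" using that kg unfolding kv_def by (metis gr0I Zero_not_Suc, metis not_le Zero_not_Suc)
          have "\<beta> i' \<noteq> \<beta> i" if "i < i'" for i'
            using kv_level_single[OF kg, of "Suc j" i i'] x gh True \<open>\<beta> i = Suc q\<close> that by auto
          then show ?thesis using i x True by (auto simp: topi_def)
        qed
        then show ?thesis using krel_insert[OF m False] e2 ab by simp
      qed
    next
      assume tn: "t = New j"
      then obtain b where b: "\<alpha> b = j" "\<beta> = \<alpha>(b := Suc j)" "\<forall>i. \<beta> i = Suc j \<longrightarrow> b \<le> i" "0 < b" "b \<le> a"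
        using bnew by blast
      have nt: "\<not> (topi (Suc a) \<beta> b \<and> Suc j \<in> S)" using ntop b by blast
      have jS: "j \<in> S" using n tn by simp
      have gj: "g j = Suc (h j)" "\<And>c. c \<noteq> j \<Longrightarrow> g c = h c" using tn g_def by auto
      have topeq: "topi (Suc a) \<beta> i \<longleftrightarrow> topi (Suc a) \<alpha> i" if "i \<noteq> b" "\<alpha> i \<noteq> j" for i
      proof -
        have "\<beta> i' = \<beta> i \<longleftrightarrow> \<alpha> i' = \<alpha> i" if "i < i'" for i'
          using that \<open>\<alpha> i \<noteq> j\<close> \<open>i \<noteq> b\<close> b by (auto simp: fun_upd_def split: if_splits)
        then show ?thesis by (auto simp: topi_def)
      qed
      show ?thesis
      proof (cases "q = j")
        case True
        then have e2: "S' = S" "t' = New j" using d jS by (auto simp: landed_def)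
        \<comment> \<open>\<open>p\<close> is promoted from level \<open>j\<close> in
          \<open>\<alpha>\<close>, and \<open>m\<close> in \<open>\<beta>\<close>, where
          \<open>b\<close> has already left this level. If \<open>p = b\<close>, the difference
          between the keys moves from \<open>b\<close> to \<open>m\<close>; otherwise
          \<open>p = m\<close> and it stays at \<open>b\<close>.\<close>
        obtain p where p: "topi (Suc a) \<alpha> p" "\<alpha> p = j" "b \<le> p" using top_ex[of b "Suc a" \<alpha> j] b by auto
        have mb: "m \<noteq> b" "\<alpha> m = j" using m True b by (auto split: if_splits)
        have others: "upd (Suc a) S \<beta> i = upd (Suc a) S \<alpha> i" if "i \<noteq> b" "\<alpha> i \<noteq> j" for i
          using topeq[OF that] that b by (simp add: upd_def)
        have lev: "upd (Suc a) S \<beta> i = (if i = m then Suc j else j)" if "i \<noteq> b" "\<alpha> i = j" for i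
          by (rule upd_level[OF m(1)]) (use that b m(2) jS True in auto)
        have leva: "upd (Suc a) S \<alpha> i = (if i = p then Suc j else j)" if "\<alpha> i = j" for i
          by (rule upd_level[OF p(1,2) jS that])
        have bb: "upd (Suc a) S \<beta> b = Suc j" using b nt by (auto simp: upd_def)
        have mp: "m \<le> p" using p mb m unfolding topi_def by (metis not_le)
        show ?thesis
        proof (cases "p = b")
          case True
          have mltb: "m < b" using mp True mb by simp
          have "upd (Suc a) S \<beta> = (upd (Suc a) S \<alpha>)(m := Suc j)"
          proof
            fix i show "upd (Suc a) S \<beta> i = ((upd (Suc a) S \<alpha>)(m := Suc j)) i"
              using others[of i] lev[of i] leva[of i] bb leva[OF b(1)] True mb by (cases "i = b"; cases "\<alpha> i = j") auto
          qed
          moreover have "upd (Suc a) S \<alpha> m = j" using leva[OF mb(2)] True mb by simp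
          moreover have "m \<le> i" if "upd (Suc a) S \<beta> i = Suc j" for i
          proof (cases "\<beta> i = Suc j")
            case True then show ?thesis using b(3) mltb by fastforce
          next
            case False
            then have "topi (Suc a) \<beta> i" "\<beta> i = j" using that by (auto simp: upd_def split: if_splits)
            then show ?thesis using top_unique[OF m(1), of i] m(2) \<open>q = j\<close> by simp
          qed
          ultimately show ?thesis unfolding e2 krel.simps by blast
        next
          case False
          then have bp: "b < p" using p by simp
          then have "p = m" using top_unique[OF m(1), of p] p m True b mp
            unfolding topi_def by (metis fun_upd_other le_antisym not_le)
          have "upd (Suc a) S \<beta> = (upd (Suc a) S \<alpha>)(b := Suc j)"
          proof
            fix i show "upd (Suc a) S \<beta> i = ((upd (Suc a) S \<alpha>)(b := Suc j)) i"
              using others[of i] lev[of i] leva[of i] bb \<open>p = m\<close> by (cases "i = b"; cases "\<alpha> i = j") auto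
          qed
          moreover have "upd (Suc a) S \<alpha> b = j" using leva[OF b(1)] False by simp
          moreover have "b \<le> i" if "upd (Suc a) S \<beta> i = Suc j" for i
          proof (cases "\<beta> i = Suc j")
            case True then show ?thesis using b(3) by simp
          next
            case False
            then have "topi (Suc a) \<beta> i" "\<beta> i = j" using that by (auto simp: upd_def split: if_splits)
            then have "m = i" using top_unique[OF m(1), of i] m(2) \<open>q = j\<close> by simp
            then show ?thesis using \<open>p = m\<close> bp by simp
          qed
          ultimately show ?thesis unfolding e2 krel.simps by blast
        qed
      next
        case False
        then have qj: "q < j" using q(1) by simp
        \<comment> \<open>The drop by exactly one from column \<open>j - 1\<close> to column
          \<open>j\<close> makes \<open>b\<close> the only index on level \<open>j\<close> of
          \<open>\<alpha>\<close>. So \<open>\<alpha>\<close> now promotes \<open>b\<close>, as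
          \<open>\<beta>\<close> has done before, and removing \<open>j\<close> from the strip of
          \<open>\<beta>\<close> makes both results equal.\<close>
        have "h (j - 1) = g (j - 1)" using gj(2)[of "j - 1"] qj by simp
        also have "\<dots> = Suc (h j)" using fl[of "j - 1"] gj(1) qj by simp
        finally have sing: "\<alpha> i = j \<Longrightarrow> i = b" for i
          using kv_level_single[OF k, of j i b] b(1) qj by simp
        have tb: "topi (Suc a) \<alpha> b" using b(4,5) sing b(1) unfolding topi_def by (metis le_SucI less_irrefl)
        have eq: "upd (Suc a) (S - {j}) \<beta> = upd (Suc a) S \<alpha>"
        proof
          fix i show "upd (Suc a) (S - {j}) \<beta> i = upd (Suc a) S \<alpha> i"
          proof (cases "i = b")
            case True then show ?thesis using tb jS b nt by (auto simp: upd_def)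
          next
            case False
            then have "\<alpha> i \<noteq> j" using sing by blast
            then show ?thesis using topeq[OF False] False b by (auto simp: upd_def)
          qed
        qed
        show ?thesis
        proof (cases "q \<in> S")
          case True
          then have "S' = S - {j}" "t' = Mark q" using d False by (auto simp: landed_def)
          then show ?thesis using eq by simp
        next
          case qS: False
          then have e2: "S' = insert q (S - {j})" "t' = New q" using d by (auto simp: landed_def)
          have "\<beta> i \<noteq> Suc q" for i using emp[of "Suc q" i] qj by simp
          then show ?thesis using krel_insert[OF m, of "S - {j}"] qS e2 eq by simp
        qed
      qed
    qed
  qed
qed

lemma krel_ins:
  assumes "\<forall>b<a. vstrip (ht F b) (F (Suc b))" "0 < x"
  shows "krel (tk F x a) (al F a) (al (ins F x) a)"
  using assms(1)
proof (induction a)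
  case (Suc a)
  have i: "okt (ht F a) (tk F x a)" "ht (ins F x) a = up (ht F a) (tk F x a)" "tk F x a = Idle \<longleftrightarrow> a < x"
     "\<forall>b<a. vstrip (ht (ins F x) b) (ins F x (Suc b))"
    using ins_inv[of a F x] Suc.prems assms by auto
  have e: "ext (ht F a) (F (Suc a)) (tk F x a) (Suc a = x) = (ins F x (Suc a), tk F x (Suc a))" by simp
  have "krel (tk F x (Suc a)) (upd (Suc a) (F (Suc a)) (al F a)) (upd (Suc a) (ins F x (Suc a)) (al (ins F x) a))"
  proof (rule key_step[OF _ _ i(1) e])
    show "part (ht F a)" using part_ht[of a F] Suc.prems by simp
    show "vstrip (ht F a) (F (Suc a))" using Suc.prems by simp
    show "Suc a = x \<Longrightarrow> tk F x a = Idle" using i by simp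
    show "kv a (ht F a) (al F a)" using kv_al[of a F] Suc.prems by simp
    show "kv a (up (ht F a) (tk F x a)) (al (ins F x) a)" using kv_al[of a "ins F x"] i by simp
    show "krel (tk F x a) (al F a) (al (ins F x) a)" using Suc by simp
  qed
  then show ?case by simp
qed simp

section \<open>Comparison of keys\<close>

definition lo :: "nat \<Rightarrow> nat \<Rightarrow> (nat \<Rightarrow> nat) \<Rightarrow> nat" where
  "lo t c \<alpha> = card {i. i < t \<and> c < \<alpha> i}"

text \<open>Entrywise comparison of keys in counting form: a column is at most another one of the
  same size exactly when, for each \<open>t\<close>, it has at least as many entries below
  \<open>t\<close>. In this form the relation can be followed while both keys grow.\<close>

definition kle :: "(nat \<Rightarrow> nat) \<Rightarrow> (nat \<Rightarrow> nat) \<Rightarrow> bool" where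
  "kle \<alpha> \<beta> \<longleftrightarrow> (\<forall>t c. lo t c \<beta> \<le> lo t c \<alpha>)"

lemma lo_upd:
  assumes "\<alpha> m = j"
  shows "lo t c (\<alpha>(m := Suc j)) = (if c = j \<and> m < t then Suc (lo t c \<alpha>) else lo t c \<alpha>)"
proof (cases "c = j \<and> m < t")
  case True
  then have "{i. i < t \<and> c < (\<alpha>(m := Suc j)) i} = insert m {i. i < t \<and> c < \<alpha> i}" by auto
  moreover have "m \<notin> {i. i < t \<and> c < \<alpha> i}" using assms True by simp
  moreover have "finite {i. i < t \<and> c < \<alpha> i}" by simp
  ultimately show ?thesis using True by (simp add: lo_def)
next
  case False
  then have "{i. i < t \<and> c < (\<alpha>(m := Suc j)) i} = {i. i < t \<and> c < \<alpha> i}"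
    using assms by (auto simp: less_Suc_eq)
  then show ?thesis using False by (auto simp: lo_def)
qed

lemma lo_mono: "{i. i < t \<and> c < \<alpha> i} \<subseteq> {i. i < t \<and> d < \<beta> i} \<Longrightarrow> lo t c \<alpha> \<le> lo t d \<beta>"
  unfolding lo_def by (rule card_mono) auto

lemma kle_supp:
  assumes "kle \<alpha> \<beta>" "\<And>i. 0 < \<alpha> i \<Longrightarrow> v \<le> i" "0 < \<beta> i"
  shows "v \<le> i"
proof (rule ccontr)
  assume "\<not> v \<le> i"
  have "{i. i < v \<and> 0 < \<alpha> i} = {}" using assms(2) leD by blast
  then have "lo v 0 \<alpha> = 0" by (simp add: lo_def)
  then have "lo v 0 \<beta> = 0" using assms(1) unfolding kle_def by (metis le_zero_eq)
  then have "{i. i < v \<and> 0 < \<beta> i} = {}" unfolding lo_def by simp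
  then show False using \<open>\<not> v \<le> i\<close> assms(3) by auto
qed

text \<open>Only \<open>c = j\<close> and \<open>b < t \<le> m\<close> is critical, where just the
  count for \<open>\<beta>\<close> grows. There \<open>\<alpha>\<close> has no index of value
  \<open>j\<close> in \<open>{v..<t}\<close>; so its count on level \<open>j\<close> equals the one
  on level \<open>j - 1\<close>, which dominates the count for \<open>\<beta>\<close> including
  \<open>b\<close>. For \<open>j = 0\<close> the interval itself takes the place of level
  \<open>j - 1\<close>.\<close>

lemma kle_up:
  assumes k: "kle \<alpha> \<beta>" and m: "\<alpha> m = j" "v \<le> m" "\<And>i. v \<le> i \<Longrightarrow> \<alpha> i = j \<Longrightarrow> m \<le> i"
    and s: "\<And>i. 0 < \<alpha> i \<Longrightarrow> v \<le> i" and b: "\<beta> b = j" "v \<le> b"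
  shows "kle (\<alpha>(m := Suc j)) (\<beta>(b := Suc j))"
  unfolding kle_def
proof (intro allI)
  fix t c
  have le: "lo t c \<beta> \<le> lo t c \<alpha>" for c using k by (auto simp: kle_def)
  have "Suc (lo t j \<beta>) \<le> lo t j \<alpha>" if bt: "b < t" and tm: "t \<le> m"
  proof (cases j)
    case 0
    have "{i. i < t \<and> 0 < \<beta> i} \<subseteq> {v..<t} - {b}"
      using kle_supp[OF k s] b 0 by fastforce
    then have "lo t j \<beta> \<le> card ({v..<t} - {b})" unfolding lo_def 0 by (rule card_mono[rotated]) simp
    also have "\<dots> < card {v..<t}" using bt b(2) by (intro card_Diff1_less) simp_all
    also have "\<dots> \<le> lo t j \<alpha>" unfolding lo_def 0
    proof (rule card_mono)
      show "{v..<t} \<subseteq> {i. i < t \<and> 0 < \<alpha> i}" using m(3) tm 0 by fastforce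
    qed simp
    finally show ?thesis by simp
  next
    case (Suc d)
    have "{i. i < t \<and> d < \<alpha> i} \<subseteq> {i. i < t \<and> j < \<alpha> i}"
    proof safe
      fix i assume i: "i < t" "d < \<alpha> i"
      then have "v \<le> i" using s[of i] by simp
      then have "\<alpha> i \<noteq> j" using m(3)[of i] tm i by auto
      then show "j < \<alpha> i" using i Suc by simp
    qed
    then have "lo t d \<alpha> \<le> lo t j \<alpha>" by (rule lo_mono)
    moreover have "{i. i < t \<and> j < \<beta> i} \<subset> {i. i < t \<and> d < \<beta> i}" 
    proof (rule psubsetI)
      show "{i. i < t \<and> j < \<beta> i} \<subseteq> {i. i < t \<and> d < \<beta> i}" using Suc by auto
      have "b \<in> {i. i < t \<and> d < \<beta> i}" "b \<notin> {i. i < t \<and> j < \<beta> i}" using bt b(1) Suc by auto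
      then show "{i. i < t \<and> j < \<beta> i} \<noteq> {i. i < t \<and> d < \<beta> i}" by blast
    qed
    then have "lo t j \<beta> < lo t d \<beta>" unfolding lo_def by (rule psubset_card_mono[rotated]) simp
    ultimately show ?thesis using le[of d] by simp
  qed
  then show "lo t c (\<beta>(b := Suc j)) \<le> lo t c (\<alpha>(m := Suc j))"
    using le[of c] by (auto simp: lo_upd[where j=j and m=m and \<alpha>=\<alpha>, OF m(1)] lo_upd[where j=j and m=b and \<alpha>=\<beta>, OF b(1)] simp del: fun_upd_apply)
qed

text \<open>The critical range is now \<open>m < t \<le> b\<close>. Minimality of \<open>b\<close>
  says that below \<open>t\<close> the larger vector has no value equal to \<open>Suc j\<close>, so
  the inequality one level higher suffices.\<close>

lemma kle_down:
  assumes k: "kle (\<alpha>(m := Suc j)) (\<beta>(b := Suc j))" and m: "\<alpha> m = j"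
    and b: "\<beta> b = j" "\<And>i. (\<beta>(b := Suc j)) i = Suc j \<Longrightarrow> b \<le> i"
  shows "kle \<alpha> \<beta>"
  unfolding kle_def
proof (intro allI)
  fix t c
  have le: "lo t c (\<beta>(b := Suc j)) \<le> lo t c (\<alpha>(m := Suc j))" for c using k by (auto simp: kle_def)
  note l = lo_upd[where j=j and m=m and \<alpha>=\<alpha>, OF m] lo_upd[where j=j and m=b and \<alpha>=\<beta>, OF b(1)]
  show "lo t c \<beta> \<le> lo t c \<alpha>"
  proof (cases "c = j \<and> m < t \<and> t \<le> b")
    case True
    have "{i. i < t \<and> j < (\<beta>(b := Suc j)) i} \<subseteq> {i. i < t \<and> Suc j < (\<beta>(b := Suc j)) i}"
    proof safe
      fix i assume i: "i < t" "j < (\<beta>(b := Suc j)) i"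
      then have "(\<beta>(b := Suc j)) i \<noteq> Suc j" using b(2)[of i] True by auto
      then show "Suc j < (\<beta>(b := Suc j)) i" using i by simp
    qed
    then have "lo t j (\<beta>(b := Suc j)) \<le> lo t (Suc j) (\<beta>(b := Suc j))" by (rule lo_mono)
    then have "lo t j \<beta> \<le> lo t (Suc j) \<alpha>" using le[of "Suc j"] True by (simp add: l)
    also have "\<dots> \<le> lo t j \<alpha>" by (rule lo_mono) auto
    finally show ?thesis using True by simp
  next
    case False then show ?thesis using le[of c] by (auto simp: l split: if_splits)
  qed
qed

lemma al_zero: "a < i \<or> i = 0 \<Longrightarrow> al F a i = 0"
  by (induction a) (auto simp: upd_def topi_def)

lemma al_supp:
  assumes "0 < al F a i" shows "i \<le> a \<and> 0 < i \<and> F i \<noteq> {}"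
  using assms
proof (induction a)
  case (Suc a)
  show ?case
  proof (cases "0 < al F a i")
    case True then show ?thesis using Suc.IH by auto
  next
    case False
    then have z: "al F a i = 0" by simp
    then have t: "topi (Suc a) (al F a) i" "0 \<in> F (Suc a)" using Suc.prems by (auto simp: upd_def split: if_splits)
    have "al F a (Suc a) = 0" by (simp add: al_zero)
    then have "i = Suc a" using t(1) z unfolding topi_def by (metis le_neq_implies_less order_refl)
    then show ?thesis using t by auto
  qed
qed simp

lemma al_mono: "a \<le> b \<Longrightarrow> al F a i \<le> al F b i"
proof (induction b)
  case (Suc b) then show ?case by (auto simp: le_Suc_eq upd_def)
qed simp

lemma ht_zero: "\<forall>b. 0 < b \<and> b \<le> a \<longrightarrow> F b = {} \<Longrightarrow> ht F a = (\<lambda>_. 0)"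
  by (induction a) (auto simp: adds_def fun_eq_iff)

text \<open>The smallest letter of a tableau sits in its top left corner and therefore belongs to
  the left key. So a lower bound for the support of the key bounds all letters.\<close>

lemma al_least_letter:
  assumes f: "fam M F" and y: "F y \<noteq> {}"
  shows "\<exists>z\<le>y. 0 < al F M z"
proof -
  define z where "z = (LEAST z. F z \<noteq> {})"
  have z: "F z \<noteq> {}" "z \<le> y" unfolding z_def using LeastI[of "\<lambda>z. F z \<noteq> {}", OF y] Least_le[of "\<lambda>z. F z \<noteq> {}", OF y] by auto
  have nz: "F b = {}" if "b < z" for b using not_less_Least that unfolding z_def by blast
  have "z \<noteq> 0" "z \<le> M" using z f unfolding fam_def by (metis, metis not_le)
  then obtain w where w: "z = Suc w" using not0_implies_Suc by blast
  have h0: "ht F w = (\<lambda>_. 0)" using ht_zero[of w F] nz w by auto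
  have a0: "al F w i = 0" for i using al_supp[of F w i] nz w by (metis gr0I le_imp_less_Suc)
  obtain c where c: "c \<in> F z" using z by blast
  have "vstrip (ht F w) (F z)" using f w by (simp add: fam_def)
  then have "c = 0" using c h0 by (auto simp: vstrip_def)
  moreover have "topi z (al F w) z" using w by (simp add: topi_def)
  ultimately have "0 < al F z z" using w c a0 by (simp add: upd_def)
  then have "0 < al F M z" using al_mono[OF \<open>z \<le> M\<close>, of F z] by simp
  then show ?thesis using z by blast
qed

lemma step_empty: "step h {} t = ({}, t)" by (cases t) auto

lemma ins_letter: "ins F x b \<noteq> {} \<Longrightarrow> F b \<noteq> {} \<or> b = x"
  by (cases b) (auto simp: ext_def step_empty split: if_splits)

lemma ins_self: "0 < x \<Longrightarrow> ins F x x \<noteq> {}"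
  by (cases x) (auto simp: ext_def land_def Let_def)

text \<open>Counterpart of \<open>upd\<close> for labels. They arrive in weakly decreasing order, so
  the current label \<open>v\<close> is a lower bound for all indices in use, and the least index of
  value \<open>j\<close> is promoted. For \<open>j = 0\<close> it is a fresh index, namely
  \<open>v\<close> if that is free.\<close>

definition qup :: "nat \<Rightarrow> nat \<Rightarrow> (nat \<Rightarrow> nat) \<Rightarrow> nat \<Rightarrow> nat" where
  "qup v j \<alpha> = \<alpha>((LEAST i. v \<le> i \<and> \<alpha> i = j) := Suc j)"

definition kq :: "(nat \<Rightarrow> nat) \<Rightarrow> (nat \<Rightarrow> nat) \<Rightarrow> bool" where
  "kq h \<alpha> \<longleftrightarrow> finite {i. 0 < \<alpha> i} \<and> (\<forall>c. card {i. c < \<alpha> i} = h c)"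

lemma kq_fin: "kq h \<alpha> \<Longrightarrow> finite {i. c < \<alpha> i}"
  unfolding kq_def by (elim conjE, rule finite_subset[of _ "{i. 0 < \<alpha> i}"]) auto

lemma kq_level_ex:
  assumes k: "kq h \<alpha>" and s: "\<And>i. 0 < \<alpha> i \<Longrightarrow> v \<le> i" and j: "\<forall>i<j. h j < h i"
  shows "\<exists>i. v \<le> i \<and> \<alpha> i = j"
proof (cases j)
  case 0
  have "infinite ({v..} - {i. 0 < \<alpha> i})" using kq_fin[OF k, of 0] infinite_Ici by simp
  then have "{v..} - {i. 0 < \<alpha> i} \<noteq> {}" using finite.emptyI by metis
  then show ?thesis using 0 by auto
next
  case (Suc d)
  have "card {i. j < \<alpha> i} < card {i. d < \<alpha> i}" using k j Suc by (simp add: kq_def)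
  moreover have "{i. d < \<alpha> i} \<subseteq> {i. j < \<alpha> i}" if "\<forall>i. \<alpha> i \<noteq> j"
    using that Suc by (auto simp: less_Suc_eq) (metis Suc_lessI)
  ultimately obtain i where i: "\<alpha> i = j" using card_mono[OF kq_fin[OF k, of j]] by (metis not_le)
  then show ?thesis using s[of i] Suc by auto
qed

lemma qup_props:
  assumes "kq h \<alpha>" "\<And>i. 0 < \<alpha> i \<Longrightarrow> v \<le> i" "\<forall>i<j. h j < h i"
  obtains m where "qup v j \<alpha> = \<alpha>(m := Suc j)" "\<alpha> m = j" "v \<le> m" "\<And>i. v \<le> i \<Longrightarrow> \<alpha> i = j \<Longrightarrow> m \<le> i"
proof -
  let ?m = "LEAST i. v \<le> i \<and> \<alpha> i = j"
  have "v \<le> ?m \<and> \<alpha> ?m = j" using kq_level_ex[OF assms] by (rule LeastI_ex)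
  moreover have "?m \<le> i" if "v \<le> i" "\<alpha> i = j" for i using that by (intro Least_le) auto
  ultimately show ?thesis using that[of ?m] by (simp add: qup_def)
qed

lemma kq_qup:
  assumes "kq h \<alpha>" "\<And>i. 0 < \<alpha> i \<Longrightarrow> v \<le> i" "\<forall>i<j. h j < h i"
  shows "kq (h(j := Suc (h j))) (qup v j \<alpha>)" "0 < qup v j \<alpha> i \<Longrightarrow> v \<le> i"
proof -
  obtain m where m: "qup v j \<alpha> = \<alpha>(m := Suc j)" "\<alpha> m = j" "v \<le> m" using qup_props[OF assms] by metis
  have e: "{i. c < qup v j \<alpha> i} = (if c = j then insert m {i. c < \<alpha> i} else {i. c < \<alpha> i})" for c
    using m by (auto simp: less_Suc_eq)
  have mn: "m \<notin> {i. j < \<alpha> i}" using m by simp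
  have "card {i. c < qup v j \<alpha> i} = (h(j := Suc (h j))) c" for c
    unfolding e using assms(1) kq_fin[OF assms(1), of j] mn by (auto simp: kq_def)
  moreover have "finite {i. 0 < qup v j \<alpha> i}" unfolding e using kq_fin[OF assms(1)] by auto
  ultimately show "kq (h(j := Suc (h j))) (qup v j \<alpha>)" by (simp add: kq_def)
  show "0 < qup v j \<alpha> i \<Longrightarrow> v \<le> i" using m assms(2) by (auto split: if_splits)
qed

lemma part_down:
  assumes "part g" "corner g t" shows "part (down g t)" "okt (down g t) t" "up (down g t) t = g"
proof -
  obtain j where j: "t = New j \<or> t = Mark j" "g (Suc j) < g j" using assms(2) by (cases t) (auto simp: corner_def)
  have m: "\<And>i j. i \<le> j \<Longrightarrow> g j \<le> g i" using partD[OF assms(1)] .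
  have "part (g(j := g j - 1))"
  proof -
    obtain c where c: "g c = 0" using assms(1) by (auto simp: part_def)
    have "antimono (g(j := g j - 1))"
    proof (rule antimonoI)
      fix x y :: nat assume xy: "x \<le> y"
      show "(g(j := g j - 1)) y \<le> (g(j := g j - 1)) x"
        using m[OF xy] m[of "Suc j" y] j xy by (auto simp: Suc_le_eq)
    qed
    then show ?thesis using c unfolding part_def by (auto intro!: exI[of _ c])
  qed
  then show "part (down g t)" using j assms(1) by auto
  have "g j - 1 < g i" if "i < j" for i using m[of i j] that j(2) by simp
  then show "okt (down g t) t" using j by auto
  show "up (down g t) t = g" using j by auto
qed

text \<open>One insertion step, with recorded label \<open>v\<close>: boundedness of the inserted letter is
  exactly what is needed to carry the comparison of the two keys through the step.\<close>

lemma key_compare_step: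
  assumes f: "fam M F" and x: "0 < x" "x \<le> M" and k: "kq (ht F M) \<alpha>"
    and s: "\<And>i. 0 < \<alpha> i \<Longrightarrow> v \<le> i"
    and a': "\<alpha>' = (case tk F x M of New j \<Rightarrow> qup v j \<alpha> | _ \<Rightarrow> \<alpha>)"
  shows "v \<le> x \<and> kle \<alpha> (al F M) \<longleftrightarrow> kle \<alpha>' (al (ins F x) M)"
proof -
  let ?b = "al F M" and ?b' = "al (ins F x) M"
  have vs: "\<forall>b<M. vstrip (ht F b) (F (Suc b))" using f by (simp add: fam_def)
  have r: "krel (tk F x M) ?b ?b'" using krel_ins[OF vs x(1)] .
  have i: "okt (ht F M) (tk F x M)" "tk F x M \<noteq> Idle" using ins_inv[OF vs x(1)] x by auto
  have fi: "fam M (ins F x)" using fam_ins[OF f x] .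
  \<comment> \<open>The inserted letter occurs in the new tableau, so it is bounded below by any
    lower bound of the new key.\<close>
  have xb: "v \<le> x" if "\<And>i. 0 < ?b' i \<Longrightarrow> v \<le> i"
    using al_least_letter[OF fi ins_self[OF x(1)]] that by (meson le_trans)
  have s': "v \<le> i" if "0 < \<alpha>' i" for i
    using that a' s kq_qup(2)[OF k s] i by (auto split: tok.splits)
  show ?thesis
  proof (cases "tk F x M")
    case Idle then show ?thesis using i by simp
  next
    case (Mark j)
    then have "\<alpha>' = \<alpha>" "?b' = ?b" using a' r by auto
    then show ?thesis using xb kle_supp[of \<alpha> ?b v] s by auto
  next
    case (New j)
    have "\<forall>i<j. ht F M j < ht F M i" using i New by simp
    from qup_props[OF k s this] obtain m where m: "qup v j \<alpha> = \<alpha>(m := Suc j)" "\<alpha> m = j" "v \<le> m" "\<And>i. v \<le> i \<Longrightarrow> \<alpha> i = j \<Longrightarrow> m \<le> i"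
      by blast
    have a: "\<alpha>' = \<alpha>(m := Suc j)" using m a' New by simp
    obtain b where b: "?b b = j" "?b' = ?b(b := Suc j)" "\<forall>i. ?b' i = Suc j \<longrightarrow> b \<le> i" using r New by auto
    show ?thesis
    proof
      assume h: "v \<le> x \<and> kle \<alpha> ?b"
      \<comment> \<open>\<open>b\<close> belongs to the new key and hence is a letter of the old
        tableau or \<open>x\<close> itself; both are bounded by \<open>v\<close>.\<close>
      have "v \<le> b"
      proof -
        have "0 < ?b' b" using b by simp
        then have "F b \<noteq> {} \<or> b = x" using al_supp ins_letter by blast
        then show ?thesis
        proof
          assume "F b \<noteq> {}"
          then obtain z where "z \<le> b" "0 < ?b z" using al_least_letter[OF f] by blast
          then show ?thesis using kle_supp[of \<alpha> ?b v z] h s by auto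
        qed (use h in simp)
      qed
      then show "kle \<alpha>' ?b'" using kle_up[of \<alpha> ?b m j v b] h m s b a by simp
    next
      assume h: "kle \<alpha>' ?b'"
      have "v \<le> x" using xb kle_supp[OF h s'] by blast
      moreover have "kle \<alpha> ?b" using kle_down[of \<alpha> m j ?b b] h a m b by auto
      ultimately show "v \<le> x \<and> kle \<alpha> ?b" by simp
    qed
  qed
qed

section \<open>Token codes of words\<close>

definition emptyF :: "nat \<Rightarrow> nat set" where "emptyF = (\<lambda>_. {})"

text \<open>The last letter of a word is inserted first. Labels increase along the word, so they
  arrive in decreasing order, which suits reverse tableaux.\<close>

primrec tab :: "nat list \<Rightarrow> nat \<Rightarrow> nat set" where
  "tab [] = emptyF"
| "tab (x # a) = ins (tab a) x"

definition res :: "nat \<Rightarrow> (nat \<Rightarrow> nat set) \<Rightarrow> nat \<Rightarrow> nat set" where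
  "res N F a = (if a \<le> N then F a else {})"

lemma fam_empty: "fam M emptyF"
  by (simp add: fam_def emptyF_def vstrip_def)

lemma fam_tab: "set a \<subseteq> {1..M} \<Longrightarrow> fam M (tab a)"
  by (induction a) (auto simp: fam_empty fam_ins)

lemma ht_res: "a \<le> N \<Longrightarrow> ht (res N F) a = ht F a"
  by (rule ht_cong) (simp add: res_def)

lemma fam_res: "fam M F \<Longrightarrow> fam N (res N F)"
proof -
  assume f: "fam M F"
  have "vstrip (ht (res N F) a) (res N F (Suc a))" for a
    using f ht_res[of a N F] by (cases "Suc a \<le> N") (auto simp: res_def fam_def vstrip_def)
  then show ?thesis using f by (auto simp: fam_def res_def)
qed

text \<open>A letter influences only larger ones, so forgetting the letters above \<open>N\<close>
  commutes with insertion, and inserted letters above \<open>N\<close> leave no trace.\<close>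

lemma res_ins:
  assumes "fam M F" "0 < x"
  shows "res N (ins F x) = (if x \<le> N then ins (res N F) x else res N F)"
proof (cases "x \<le> N")
  case True
  have "ins F x b = ins (res N F) x b" if "b \<le> N" for b
    using that by (intro ins_cong) (auto simp: res_def)
  moreover have "ins (res N F) x b = {}" if "N < b" for b
  proof -
    have "fam N (ins (res N F) x)" by (rule fam_ins[OF fam_res[OF assms(1)] assms(2) True])
    then show ?thesis using that by (simp add: fam_def)
  qed
  ultimately show ?thesis using True by (auto simp: res_def fun_eq_iff not_le)
next
  case False
  have "ins F x b = F b" if "b \<le> N" for b
  proof (cases b)
    case 0 then show ?thesis using assms(1) by (simp add: fam_def)
  next
    case (Suc c)
    have "\<forall>d<c. vstrip (ht F d) (F (Suc d))" using assms(1) by (simp add: fam_def)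
    then have "tk F x c = Idle" using ins_inv[of c F x] assms(2) that Suc False by auto
    then show ?thesis using Suc that False by (simp add: ext_def)
  qed
  then show ?thesis using False by (auto simp: res_def fun_eq_iff)
qed

lemma res_tab: "set a \<subseteq> {1..M} \<Longrightarrow> res N (tab a) = tab (filter (\<lambda>y. y \<le> N) a)"
proof (induction a)
  case Nil then show ?case by (simp add: res_def emptyF_def fun_eq_iff)
next
  case (Cons x a)
  then show ?case using res_ins[OF fam_tab[of a M], of x N] by auto
qed

datatype code = Tok tok | Let nat

primrec code_of :: "nat \<Rightarrow> nat list \<Rightarrow> code list" where
  "code_of N [] = []"
| "code_of N (x # a) = (if x \<le> N then Tok (tk (tab (filter (\<lambda>y. y \<le> N) a)) x N) else Let x) # code_of N a"

text \<open>Read from the left, a code undoes insertions: \<open>g\<close> is the current shape,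
  which must shrink through corners to the empty one.\<close>

fun vcode :: "nat \<Rightarrow> nat \<Rightarrow> (nat \<Rightarrow> nat) \<Rightarrow> code list \<Rightarrow> bool" where
  "vcode N M g [] = (\<forall>c. g c = 0)"
| "vcode N M g (Tok t # cs) = (corner g t \<and> vcode N M (down g t) cs)"
| "vcode N M g (Let x # cs) = (N < x \<and> x \<le> M \<and> vcode N M g cs)"

fun lets :: "code list \<Rightarrow> nat list" where
  "lets [] = []"
| "lets (Tok t # cs) = lets cs"
| "lets (Let x # cs) = x # lets cs"

fun aq :: "nat list \<Rightarrow> code list \<Rightarrow> nat \<Rightarrow> nat" where
  "aq (i # is) (Tok (New j) # cs) = qup i j (aq is cs)"
| "aq (i # is) (c # cs) = aq is cs"
| "aq is cs = (\<lambda>_. 0)"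

text \<open>\<open>R\<close> receives the later entry first, because the later entry is inserted
  first. With \<open>(\<le>)\<close> the runs of equal labels are weakly decreasing from left to
  right.\<close>

fun adj :: "('c \<Rightarrow> 'c \<Rightarrow> bool) \<Rightarrow> nat list \<Rightarrow> 'c list \<Rightarrow> bool" where
  "adj R (i # i' # is) (c # c' # cs) = ((i = i' \<longrightarrow> R c' c) \<and> adj R (i' # is) (c' # cs))"
| "adj R is cs = True"

fun cle :: "code \<Rightarrow> code \<Rightarrow> bool" where
  "cle (Tok s) (Tok t) = tle s t"
| "cle (Tok s) (Let x) = True"
| "cle (Let x) (Tok s) = False"
| "cle (Let x) (Let y) = (x \<le> y)"

abbreviation small :: "nat \<Rightarrow> nat list \<Rightarrow> nat list" where
  "small N \<equiv> filter (\<lambda>y. y \<le> N)"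

abbreviation large :: "nat \<Rightarrow> nat list \<Rightarrow> nat list" where
  "large N \<equiv> filter (\<lambda>y. N < y)"

lemma length_code_of [simp]: "length (code_of N a) = length a"
  by (induction a) auto

lemma lets_code_of: "lets (code_of N a) = large N a"
  by (induction a) auto

lemma fam_small: "set a \<subseteq> {1..M} \<Longrightarrow> fam N (tab (small N a))"
  by (rule fam_tab) auto

lemma vcode_code_of:
  "set a \<subseteq> {1..M} \<Longrightarrow> vcode N M (ht (tab (small N a)) N) (code_of N a)"
proof (induction a)
  case Nil
  show ?case using ht_zero[of N emptyF] by (simp add: emptyF_def)
next
  case (Cons x a)
  have f: "fam N (tab (small N a))" using fam_small[of a M] Cons.prems by simp
  show ?case using Cons tk_corner[OF f, of x] by auto
qed

text \<open>Decoding from the left: the tableau and the foremost token determine the last inserted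
  letter and the previous tableau.\<close>

lemma code_of_inj:
  assumes "set a \<subseteq> {1..M}" "set b \<subseteq> {1..M}" "code_of N a = code_of N b" "tab (small N a) = tab (small N b)"
  shows "a = b"
  using assms
proof (induction a arbitrary: b)
  case Nil then show ?case by (cases b) auto
next
  case (Cons x a)
  then obtain y b' where b: "b = y # b'" by (cases b) auto
  have fa: "fam N (tab (small N a))" using fam_small[of a M] Cons.prems by simp
  have fb: "fam N (tab (small N b'))" using fam_small[of b' M] Cons.prems b by simp
  have "(x \<le> N) = (y \<le> N)" using Cons.prems(3) b by (auto split: if_splits)
  then have "x = y \<and> tab (small N a) = tab (small N b')"
    using Cons.prems b ins_inj[OF fa fb, of x y] by (auto split: if_splits)
  then show ?case using Cons b by auto
qed

lemma code_of_surj: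
  assumes "vcode N M (ht F N) cs" "fam N F" "N \<le> M"
  shows "\<exists>a. set a \<subseteq> {1..M} \<and> tab (small N a) = F \<and> code_of N a = cs"
  using assms(1,2)
proof (induction cs arbitrary: F)
  case Nil
  have "F b = {}" for b
  proof (cases "b = 0 \<or> N < b")
    case False
    then obtain c where c: "b = Suc c" "Suc c \<le> N" by (cases b) auto
    have mono: "ht F d i \<le> ht F e i" if "d \<le> e" for d e i
      using that by (induction e) (auto simp: le_Suc_eq adds_def)
    show ?thesis
    proof (rule ccontr)
      assume "F b \<noteq> {}"
      then obtain i where "i \<in> F b" by blast
      then have "0 < ht F (Suc c) i" using c by (simp add: adds_def)
      then show False using mono[OF c(2), of i] Nil by simp
    qed
  qed (use Nil in \<open>auto simp: fam_def\<close>)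
  then show ?case by (intro exI[of _ "[]"]) (auto simp: emptyF_def)
next
  case (Cons c cs)
  show ?case
  proof (cases c)
    case (Tok t)
    then have t: "corner (ht F N) t" "vcode N M (down (ht F N) t) cs" using Cons.prems by auto
    obtain G x where G: "0 < x" "x \<le> N" "fam N G" "ins G x = F" "tk G x N = t"
      using ins_surj[OF Cons.prems(2) t(1)] by blast
    have "down (ht F N) t = ht G N" using tk_corner(2)[OF G(3,1,2)] G by simp
    then obtain a where "set a \<subseteq> {1..M}" "tab (small N a) = G" "code_of N a = cs"
      using Cons.IH[of G] t G by auto
    then show ?thesis using G Tok assms(3) by (intro exI[of _ "x # a"]) auto
  next
    case (Let x)
    then obtain a where "set a \<subseteq> {1..M}" "tab (small N a) = F" "code_of N a = cs"
      using Cons.IH[of F] Cons.prems by auto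
    then show ?thesis using Let Cons.prems by (intro exI[of _ "x # a"]) auto
  qed
qed

text \<open>For two tokens this is the Pieri property. A token stands for a letter up to
  \<open>N\<close>, hence for one smaller than every verbatim letter, which explains the mixed cases
  of \<open>cle\<close>.\<close>

lemma adj_code_of:
  assumes "set a \<subseteq> {1..M}" "length is = length a"
  shows "adj cle is (code_of N a) \<longleftrightarrow> adj (\<le>) is a"
  using assms
proof (induction "(\<le>) :: nat \<Rightarrow> nat \<Rightarrow> bool" "is" a rule: adj.induct)
  case (1 i i' "is" x y a)
  have f: "fam N (tab (small N a))" using fam_small[of a M] "1.prems" by simp
  have v: "\<forall>b<N. vstrip (ht (tab (small N a)) b) (tab (small N a) (Suc b))" using f by (simp add: fam_def)
  have "cle (code_of N (x # y # a) ! 1) (code_of N (x # y # a) ! 0) \<longleftrightarrow> y \<le> x"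
    using pieri[OF v, of y x] "1.prems" by auto
  then show ?case using 1 by (auto split: if_splits)
qed auto

lemma aq_Tok: "aq (i # is) (Tok t # cs) = (case t of New j \<Rightarrow> qup i j (aq is cs) | _ \<Rightarrow> aq is cs)"
  by (cases t) auto

lemma kq_aq_aux:
  assumes "part g" "vcode N M g cs" "length is = length cs" "sorted is"
  shows "kq g (aq is cs) \<and> (\<forall>v. (\<forall>i\<in>set is. v \<le> i) \<longrightarrow> (\<forall>i. 0 < aq is cs i \<longrightarrow> v \<le> i))"
  using assms
proof (induction cs arbitrary: g "is")
  case Nil then show ?case by (simp add: kq_def)
next
  case (Cons c cs)
  then obtain i js where iseq: "is = i # js" by (cases "is") auto
  have js: "sorted js" "length js = length cs" "\<forall>k\<in>set js. i \<le> k" using Cons.prems iseq by auto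
  show ?case
  proof (cases c)
    case (Let x)
    then have "vcode N M g cs" using Cons.prems by simp
    from Cons.IH[OF Cons.prems(1) this js(2,1)] show ?thesis using Let iseq by auto
  next
    case (Tok t)
    then have t: "corner g t" "vcode N M (down g t) cs" using Cons.prems by auto
    note d = part_down[OF Cons.prems(1) t(1)]
    note IH = Cons.IH[OF d(1) t(2) js(2,1)]
    have k: "kq (down g t) (aq js cs)" "\<And>k. 0 < aq js cs k \<Longrightarrow> i \<le> k" using IH js(3) by auto
    show ?thesis
    proof (cases "\<exists>j. t = New j")
      case True
      then obtain j where j: "t = New j" by blast
      have o: "\<forall>i<j. down g t j < down g t i" using d(2) j by simp
      have a: "aq is (c # cs) = qup i j (aq js cs)" using Tok j iseq by simp
      have "(down g t)(j := Suc (down g t j)) = g" using d(3) unfolding j up.simps .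
      then have "kq g (aq is (c # cs))" using kq_qup(1)[OF k o] unfolding a by metis
      moreover have "v \<le> k" if "\<forall>l\<in>set is. v \<le> l" "0 < aq is (c # cs) k" for v k
      proof -
        have "i \<le> k" using kq_qup(2)[OF k o] that(2) unfolding a by blast
        then show ?thesis using that(1) iseq by simp
      qed
      ultimately show ?thesis by blast
    next
      case False
      then have "down g t = g" "aq is (c # cs) = aq js cs" using Tok iseq t(1)
        by (cases t; auto simp: corner_def)+
      then show ?thesis using IH iseq by auto
    qed
  qed
qed

lemma kq_aq:
  assumes "part g" "vcode N M g cs" "length is = length cs" "sorted is"
  shows "kq g (aq is cs)" "\<And>i v. (\<forall>i\<in>set is. v \<le> i) \<Longrightarrow> 0 < aq is cs i \<Longrightarrow> v \<le> i"
  using kq_aq_aux[OF assms] by blast+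

definition bnd :: "nat \<Rightarrow> nat list \<Rightarrow> nat list \<Rightarrow> bool" where
  "bnd N is a \<longleftrightarrow> list_all2 (\<lambda>i x. x \<le> N \<longrightarrow> i \<le> x) is a"

text \<open>For the empty word both keys vanish and the comparison holds; by
  \<open>key_compare_step\<close> each insertion preserves it exactly when the inserted letter
  respects its label. Thus a condition on single letters becomes one comparison of two keys.\<close>

lemma bnd_code_of:
  assumes "set a \<subseteq> {1..M}" "length is = length a" "sorted is"
  shows "bnd N is a \<longleftrightarrow> kle (aq is (code_of N a)) (al (tab (small N a)) N)"
  using assms
proof (induction a arbitrary: "is")
  case Nil
  have "al emptyF N = (\<lambda>_. 0)" using al_supp[of emptyF N] by (auto simp: fun_eq_iff emptyF_def)
  then show ?case using Nil by (simp add: bnd_def kle_def)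
next
  case (Cons x a)
  then obtain i js where iseq: "is = i # js" by (cases "is") auto
  let ?F = "tab (small N a)"
  have f: "fam N ?F" using fam_small[of a M] Cons.prems by simp
  have IH: "bnd N js a \<longleftrightarrow> kle (aq js (code_of N a)) (al ?F N)" using Cons iseq by simp
  have v: "vcode N M (ht ?F N) (code_of N a)" using vcode_code_of Cons.prems by simp
  have js: "length js = length (code_of N a)" "sorted js" "\<forall>l\<in>set js. i \<le> l" using Cons.prems iseq by auto
  have kq: "kq (ht ?F N) (aq js (code_of N a))" "\<And>k. 0 < aq js (code_of N a) k \<Longrightarrow> i \<le> k"
    using kq_aq[OF fam_part[OF f] v js(1,2)] js(3) by blast+
  show ?case
  proof (cases "x \<le> N")
    case False then show ?thesis using IH iseq by (simp add: bnd_def)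
  next
    case True
    have x: "0 < x" using Cons.prems by simp
    have "aq is (code_of N (x # a)) = (case tk ?F x N of New j \<Rightarrow> qup i j (aq js (code_of N a)) | _ \<Rightarrow> aq js (code_of N a))"
      using True iseq by (auto split: tok.splits)
    from key_compare_step[OF f x True kq this]
    show ?thesis using IH iseq True by (simp add: bnd_def)
  qed
qed

section \<open>Strict runs and repetitions\<close>

fun cls :: "code \<Rightarrow> code \<Rightarrow> bool" where
  "cls (Tok s) (Tok t) = (tcol s < tcol t)"
| "cls (Tok s) (Let x) = True"
| "cls (Let x) (Tok s) = False"
| "cls (Let x) (Let y) = (x < y)"

fun same :: "code \<Rightarrow> code \<Rightarrow> bool" where
  "same (Tok s) (Tok t) = (tcol s = tcol t)"
| "same (Let x) (Let y) = (x = y)"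
| "same c c' = False"

text \<open>The only form a repetition can take: under \<open>cle\<close>, an entry in the same
  class as its right neighbour is a mark in the same column or the same verbatim letter.\<close>

fun mk :: "code \<Rightarrow> code" where
  "mk (Tok t) = Tok (Mark (tcol t))"
| "mk (Let x) = Let x"

fun filt :: "bool list \<Rightarrow> 'c list \<Rightarrow> 'c list" where
  "filt (b # bs) (x # xs) = (if b then filt bs xs else x # filt bs xs)"
| "filt bs xs = []"

fun ex :: "bool list \<Rightarrow> code list \<Rightarrow> code list" where
  "ex [] ds = []"
| "ex (True # bs) ds = mk (hd (ex bs ds)) # ex bs ds"
| "ex (False # bs) ds = hd ds # ex bs (tl ds)"

text \<open>\<open>True\<close> means that the entry at this position repeats its right neighbour,
  which is possible only under equal labels and never at the last position.\<close>

fun okb :: "nat list \<Rightarrow> bool list \<Rightarrow> bool" where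
  "okb (i # i' # is) (b # b' # bs) = ((b \<longrightarrow> i = i') \<and> okb (i' # is) (b' # bs))"
| "okb [i] [b] = (\<not> b)"
| "okb [] [] = True"
| "okb is bs = False"

fun grp :: "nat list \<Rightarrow> code list \<Rightarrow> bool list" where
  "grp (i # i' # is) (c # c' # cs) = (i = i' \<and> same c c') # grp (i' # is) (c' # cs)"
| "grp [i] [c] = [False]"
| "grp is cs = []"

lemma cls_iff: "cls c' c \<longleftrightarrow> cle c' c \<and> \<not> same c c'"
  by (cases c; cases c') (auto simp: tle_def)

lemma cle_same: "cle c' c \<Longrightarrow> same c c' \<Longrightarrow> c = mk c'"
  by (cases c; cases c') (auto simp: tle_def)

lemma cle_mk [simp]: "cle c (mk c)" "same (mk c) c" "cle (mk c) d = cle c d" "same d (mk c) = same d c" "cls (mk c) d = cls c d"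
  by (cases c; cases d; auto simp: tle_def)+

lemma okb_length: "okb is bs \<Longrightarrow> length bs = length is"
  by (induction "is" bs rule: okb.induct) auto

lemma okb_grp: "length cs = length is \<Longrightarrow> okb is (grp is cs)"
proof (induction "is" cs rule: grp.induct)
  case (1 i i' "is" c c' cs)
  then show ?case by (cases "grp (i' # is) (c' # cs)") auto
qed auto

lemma hd_filt: "okb is bs \<Longrightarrow> is \<noteq> [] \<Longrightarrow> filt bs is \<noteq> [] \<and> hd (filt bs is) = hd is"
  by (induction "is" bs rule: okb.induct) auto

lemma filt_mono_len: "length (filt bs xs) \<le> length xs"
  by (induction bs xs rule: filt.induct) auto

lemma length_filt_eq: "length bs = length xs \<Longrightarrow> length bs = length ys \<Longrightarrow> length (filt bs xs) = length (filt bs ys)"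
proof (induction bs arbitrary: xs ys)
  case (Cons b bs) then show ?case by (cases xs; cases ys) auto
qed simp

lemma set_filt: "set (filt bs xs) \<subseteq> set xs"
  by (induction bs xs rule: filt.induct) auto

lemma sorted_filt: "sorted is \<Longrightarrow> sorted (filt bs is)"
proof (induction bs "is" rule: filt.induct)
  case (1 b bs x xs)
  then show ?case using set_filt[of bs xs] by (auto simp: subset_iff)
qed auto

lemma filt_len_less: "length bs = length xs \<Longrightarrow> True \<in> set bs \<Longrightarrow> length (filt bs xs) < length xs"
proof (induction bs xs rule: filt.induct)
  case (1 b bs x xs)
  then show ?case using filt_mono_len[of bs xs] by (cases b) auto
qed auto

lemma filt_all: "length bs = length xs \<Longrightarrow> True \<notin> set bs \<Longrightarrow> filt bs xs = xs"
  by (induction bs xs rule: filt.induct) auto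

lemma length_ex [simp]: "length (ex bs ds) = length bs"
  by (induction bs ds rule: ex.induct) auto

lemma ex_filt:
  assumes "length cs = length is" "adj cle is cs" "grp is cs = bs"
  shows "ex bs (filt bs cs) = cs"
  using assms
proof (induction "is" cs arbitrary: bs rule: grp.induct)
  case (1 i i' "is" c c' cs)
  then show ?case using cle_same[of c' c] by auto
qed auto

lemma ex_props:
  assumes "okb is bs" "length ds = length (filt bs is)"
  shows "filt bs (ex bs ds) = ds" "bs \<noteq> [] \<Longrightarrow> hd (ex bs ds) = hd ds \<or> hd (ex bs ds) = mk (hd ds)"
proof -
  have mkmk: "mk (mk c) = mk c" for c by (cases c) auto
  have "filt bs (ex bs ds) = ds \<and> (bs \<noteq> [] \<longrightarrow> hd (ex bs ds) = hd ds \<or> hd (ex bs ds) = mk (hd ds))"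
    using assms
  proof (induction "is" bs arbitrary: ds rule: okb.induct)
    case (1 i i' "is" b b' bs)
    show ?case
    proof (cases b)
      case True
      then have "filt (b' # bs) (ex (b' # bs) ds) = ds \<and> (hd (ex (b' # bs) ds) = hd ds \<or> hd (ex (b' # bs) ds) = mk (hd ds))"
        using 1 by auto
      then show ?thesis using True mkmk by auto
    next
      case False
      then obtain d ds' where "ds = d # ds'" using 1 by (cases ds) auto
      then show ?thesis using 1 False by auto
    qed
  next
    case (2 i b)
    then show ?case by (cases ds) auto
  qed auto
  then show "filt bs (ex bs ds) = ds" "bs \<noteq> [] \<Longrightarrow> hd (ex bs ds) = hd ds \<or> hd (ex bs ds) = mk (hd ds)" by auto
qed

text \<open>The weak order without coincidences is the strict order. Replacing an entry by its
  \<open>mk\<close> does not change how it compares with the entry before it, so deleted repetitions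
  can be restored without disturbing the rest.\<close>

lemma ex_adj:
  assumes "okb is bs" "length ds = length (filt bs is)"
  shows "adj cle is (ex bs ds) \<and> grp is (ex bs ds) = bs \<longleftrightarrow> adj cls (filt bs is) ds"
  using assms
proof (induction "is" bs arbitrary: ds rule: okb.induct)
  case (1 i i' "is" b b' bs)
  show ?case
  proof (cases b)
    case True
    obtain e es where e: "ex (b' # bs) ds = e # es" by (cases "ex (b' # bs) ds") (auto dest: arg_cong[of _ _ length])
    have ii: "i = i'" using 1 True by simp
    have IH: "adj cle (i' # is) (e # es) \<and> grp (i' # is) (e # es) = b' # bs \<longleftrightarrow> adj cls (filt (b' # bs) (i' # is)) ds"
    proof -
      have ok: "okb (i' # is) (b' # bs)" using 1 by simp
      have l: "length ds = length (filt (b' # bs) (i' # is))" using 1 True by simp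
      show ?thesis using "1.IH"[OF ok l] unfolding e .
    qed
    have exb: "ex (b # b' # bs) ds = mk e # e # es" using True e by simp
    have "filt (b # b' # bs) (i # i' # is) = filt (b' # bs) (i' # is)" using True by simp
    then show ?thesis unfolding exb using IH True ii by auto
  next
    case False
    then obtain d ds' where d: "ds = d # ds'" using 1 by (cases ds) auto
    obtain e es where e: "ex (b' # bs) ds' = e # es" by (cases "ex (b' # bs) ds'") (auto dest: arg_cong[of _ _ length])
    have ok: "okb (i' # is) (b' # bs)" using 1 by simp
    have l: "length ds' = length (filt (b' # bs) (i' # is))" using 1 False d by simp
    have IH: "adj cle (i' # is) (e # es) \<and> grp (i' # is) (e # es) = b' # bs \<longleftrightarrow> adj cls (filt (b' # bs) (i' # is)) ds'"
      using "1.IH"[OF ok l] e by simp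
    obtain k ks where k: "filt (b' # bs) (i' # is) = k # ks" "k = i'"
      using hd_filt[OF ok] by (cases "filt (b' # bs) (i' # is)") auto
    obtain d' ds'' where d': "ds' = d' # ds''" using l k by (cases ds') auto
    have "e = d' \<or> e = mk d'" using ex_props(2)[OF ok l] e d' by simp
    then have "cls e d = cls d' d" by auto
    then have c: "cle e d \<and> \<not> same d e \<longleftrightarrow> cls d' d" using cls_iff[of e d] by simp
    have exb: "ex (b # b' # bs) ds = d # e # es" using False e d by simp
    have fb: "filt (b # b' # bs) (i # i' # is) = i # k # ks" using False k by simp
    have "adj cle (i # i' # is) (d # e # es) \<and> grp (i # i' # is) (d # e # es) = False # b' # bs
       \<longleftrightarrow> adj cls (i # k # ks) (d # d' # ds'')"
      using IH[unfolded k(1) d'] c k(2) by auto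
    then have "adj cle (i # i' # is) (d # e # es) \<and> grp (i # i' # is) (d # e # es) = b # b' # bs
       \<longleftrightarrow> adj cls (i # k # ks) ds" unfolding d d' using False by simp
    then show ?thesis unfolding exb fb .
  qed
next
  case (2 i b)
  then show ?case by (cases ds) auto
qed auto

lemma vcode_ex:
  assumes "okb is bs" "length ds = length (filt bs is)"
  shows "vcode N M g (ex bs ds) = vcode N M g ds"
  using assms
proof (induction "is" bs arbitrary: ds g rule: okb.induct)
  case (1 i i' "is" b b' bs)
  show ?case
  proof (cases b)
    case True
    obtain e es where e: "ex (b' # bs) ds = e # es" by (cases "ex (b' # bs) ds") (auto dest: arg_cong[of _ _ length])
    have "vcode N M g (mk e # e # es) = vcode N M g (e # es)" by (cases e) (auto simp: corner_def)
    moreover have "vcode N M g (ex (b' # bs) ds) = vcode N M g ds" using 1 True by simp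
    ultimately show ?thesis using True e by simp
  next
    case False
    then obtain d ds' where d: "ds = d # ds'" using 1 by (cases ds) auto
    then show ?thesis using 1 False by (cases d) auto
  qed
next
  case (2 i b)
  then show ?case by (cases ds) auto
qed auto

lemma aq_ex:
  assumes "okb is bs" "length ds = length (filt bs is)"
  shows "aq is (ex bs ds) = aq (filt bs is) ds"
  using assms
proof (induction "is" bs arbitrary: ds rule: okb.induct)
  case (1 i i' "is" b b' bs)
  show ?case
  proof (cases b)
    case True
    obtain e es where e: "ex (b' # bs) ds = e # es" by (cases "ex (b' # bs) ds") (auto dest: arg_cong[of _ _ length])
    have "aq (i # i' # is) (mk e # e # es) = aq (i' # is) (e # es)" by (cases e) auto
    moreover have "aq (i' # is) (ex (b' # bs) ds) = aq (filt (b' # bs) (i' # is)) ds" using 1 True by simp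
    ultimately show ?thesis using True e by simp
  next
    case False
    then obtain d ds' where d: "ds = d # ds'" using 1 by (cases ds) auto
    have IH: "aq (i' # is) (ex (b' # bs) ds') = aq (filt (b' # bs) (i' # is)) ds'" using 1 False d by simp
    define X Y where "X = ex (b' # bs) ds'" and "Y = filt (b' # bs) (i' # is)"
    have "ex (b # b' # bs) ds = d # X" "filt (b # b' # bs) (i # i' # is) = i # Y"
      using False d X_def Y_def by simp_all
    moreover have "aq (i # i' # is) (d # X) = aq (i # Y) (d # ds')"
      using IH[folded X_def Y_def] by (cases d) (simp_all add: aq_Tok split: tok.splits)
    ultimately show ?thesis using d by simp
  qed
next
  case (2 i b)
  then show ?case by (cases ds) auto
qed auto

text \<open>\<open>R\<close> will be the Hecke condition, which does not notice doubled letters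
  thanks to the idempotent relation. So it is compatible with deleting repetitions.\<close>

lemma lets_ex:
  assumes R: "\<And>u x v. R (u @ x # x # v) = R (u @ x # v)"
  assumes "okb is bs" "length ds = length (filt bs is)"
  shows "R (u @ lets (ex bs ds)) = R (u @ lets ds)"
  using assms(2,3)
proof (induction "is" bs arbitrary: ds u rule: okb.induct)
  case (1 i i' "is" b b' bs)
  show ?case
  proof (cases b)
    case True
    obtain e es where e: "ex (b' # bs) ds = e # es" by (cases "ex (b' # bs) ds") (auto dest: arg_cong[of _ _ length])
    have "R (u @ lets (mk e # e # es)) = R (u @ lets (e # es))" using R by (cases e) auto
    moreover have "R (u @ lets (ex (b' # bs) ds)) = R (u @ lets ds)" using 1 True by simp
    ultimately show ?thesis using True e by simp
  next
    case False
    then obtain d ds' where d: "ds = d # ds'" using 1 by (cases ds) auto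
    show ?thesis
    proof (cases d)
      case (Tok t) then show ?thesis using 1 False d by simp
    next
      case (Let x)
      have ok: "okb (i' # is) (b' # bs)" using 1 by simp
      have l: "length ds' = length (filt (b' # bs) (i' # is))" using 1 False d by simp
      have "R ((u @ [x]) @ lets (ex (b' # bs) ds')) = R ((u @ [x]) @ lets ds')" by (rule "1.IH"[OF ok l])
      then show ?thesis using False d Let by simp
    qed
  qed
next
  case (2 i b)
  then show ?case by (cases ds) auto
qed auto

text \<open>\<open>R\<close> restricts the verbatim letters. When both thresholds are
  \<open>M\<close> there are none, and \<open>R\<close> is taken to be constantly true.\<close>

definition Wk :: "nat \<Rightarrow> nat \<Rightarrow> (nat \<Rightarrow> nat set) \<Rightarrow> (nat list \<Rightarrow> bool) \<Rightarrow> nat list \<Rightarrow> code list set" where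
  "Wk N M F R is = {cs. length cs = length is \<and> vcode N M (ht F N) cs \<and> adj cle is cs
     \<and> kle (aq is cs) (al F N) \<and> R (lets cs)}"

definition St :: "nat \<Rightarrow> nat \<Rightarrow> (nat \<Rightarrow> nat set) \<Rightarrow> (nat list \<Rightarrow> bool) \<Rightarrow> nat list \<Rightarrow> code list set" where
  "St N M F R is = {cs. length cs = length is \<and> vcode N M (ht F N) cs \<and> adj cls is cs
     \<and> kle (aq is cs) (al F N) \<and> R (lets cs)}"

definition words :: "nat \<Rightarrow> nat \<Rightarrow> (nat \<Rightarrow> nat set) \<Rightarrow> (nat list \<Rightarrow> bool) \<Rightarrow> nat list \<Rightarrow> nat list set" where
  "words N M F R is = {a. set a \<subseteq> {1..M} \<and> length a = length is \<and> adj (\<le>) is a \<and> bnd N is a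
     \<and> tab (small N a) = F \<and> R (large N a)}"

lemma finite_words: "finite (words N M F R is)"
  by (rule finite_subset[OF _ finite_lists_length_eq[of "{1..M}" "length is"]]) (auto simp: words_def)

lemma words_Wk:
  assumes "fam N F" "N \<le> M" "sorted is"
  shows "bij_betw (code_of N) (words N M F R is) (Wk N M F R is)"
  unfolding bij_betw_def
proof
  show "inj_on (code_of N) (words N M F R is)"
    by (rule inj_onI, rule code_of_inj[where M = M and N = N]) (auto simp: words_def)
  show "code_of N ` words N M F R is = Wk N M F R is"
  proof (intro equalityI subsetI)
    fix cs assume "cs \<in> code_of N ` words N M F R is"
    then obtain a where a: "a \<in> words N M F R is" "cs = code_of N a" by blast
    then have s: "set a \<subseteq> {1..M}" "length is = length a" "tab (small N a) = F" by (auto simp: words_def)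
    show "cs \<in> Wk N M F R is"
      using a s vcode_code_of[OF s(1), of N] adj_code_of[OF s(1,2), of N] bnd_code_of[OF s(1,2) assms(3), of N]
      by (simp add: words_def Wk_def lets_code_of)
  next
    fix cs assume c: "cs \<in> Wk N M F R is"
    then obtain a where a: "set a \<subseteq> {1..M}" "tab (small N a) = F" "code_of N a = cs"
      using code_of_surj[OF _ assms(1,2)] by (auto simp: Wk_def)
    have l: "length is = length a" using c a by (auto simp: Wk_def)
    have "a \<in> words N M F R is"
      using a c l adj_code_of[OF a(1) l, of N] bnd_code_of[OF a(1) l assms(3), of N] lets_code_of[of N a]
      by (simp add: words_def Wk_def)
    then show "cs \<in> code_of N ` words N M F R is" using a by blast
  qed
qed

lemma adj_cls_cle: "adj cls is cs \<Longrightarrow> adj cle is cs"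
  by (induction cls "is" cs rule: adj.induct) (auto simp: cls_iff)

lemma finite_Wk:
  assumes "fam N F" "N \<le> M" "sorted is" shows "finite (Wk N M F R is)" "finite (St N M F R is)"
proof -
  show f: "finite (Wk N M F R is)" using bij_betw_finite[OF words_Wk[OF assms]] finite_words by blast
  show "finite (St N M F R is)"
    by (rule finite_subset[OF _ f]) (auto simp: St_def Wk_def adj_cls_cle)
qed

text \<open>Weak codes are sorted by their pattern of repetitions. The patterns depend on the labels
  only, neither on the threshold nor on the tableau, which is what makes the comparison of two
  thresholds possible.\<close>

lemma card_Wk:
  assumes "fam N F" "N \<le> M" "sorted is" and R: "\<And>u x v. R (u @ x # x # v) = R (u @ x # v)"
  shows "card (Wk N M F R is) = (\<Sum>bs\<in>{bs. okb is bs}. card (St N M F R (filt bs is)))"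
proof -
  have fB: "finite {bs. okb is bs}"
    by (rule finite_subset[OF _ finite_lists_length_eq[of UNIV "length is"]]) (auto dest: okb_length)
  note fW = finite_Wk(1)[OF assms(1-3)]
  have "card (Wk N M F R is) = (\<Sum>cs\<in>Wk N M F R is. 1)" by simp
  also have "\<dots> = (\<Sum>bs\<in>{bs. okb is bs}. sum (\<lambda>_. 1) {cs \<in> Wk N M F R is. grp is cs = bs})"
    by (rule sum.group[symmetric, OF fW fB]) (auto simp: Wk_def okb_grp)
  also have "\<dots> = (\<Sum>bs\<in>{bs. okb is bs}. card (St N M F R (filt bs is)))"
  proof (rule sum.cong[OF refl])
    fix bs assume "bs \<in> {bs. okb is bs}"
    then have ok: "okb is bs" by simp
    have "bij_betw (ex bs) (St N M F R (filt bs is)) {cs \<in> Wk N M F R is. grp is cs = bs}"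
    proof (rule bij_betw_byWitness[where f' = "filt bs"])
      show "ex bs ` St N M F R (filt bs is) \<subseteq> {cs \<in> Wk N M F R is. grp is cs = bs}"
      proof (rule image_subsetI)
        fix ds assume d: "ds \<in> St N M F R (filt bs is)"
        then have l: "length ds = length (filt bs is)" by (simp add: St_def)
        show "ex bs ds \<in> {cs \<in> Wk N M F R is. grp is cs = bs}"
          using d ex_adj[OF ok l] vcode_ex[OF ok l] aq_ex[OF ok l] lets_ex[OF R ok l, of "[]"] okb_length[OF ok]
          by (auto simp: St_def Wk_def)
      qed
      show "filt bs ` {cs \<in> Wk N M F R is. grp is cs = bs} \<subseteq> St N M F R (filt bs is)"
      proof (rule image_subsetI)
        fix cs assume c: "cs \<in> {cs \<in> Wk N M F R is. grp is cs = bs}"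
        then have e: "ex bs (filt bs cs) = cs" by (intro ex_filt[of _ "is"]) (auto simp: Wk_def)
        have l: "length (filt bs cs) = length (filt bs is)"
          using length_filt_eq[of bs cs "is"] okb_length[OF ok] c by (simp add: Wk_def)
        show "filt bs cs \<in> St N M F R (filt bs is)"
          using c l ex_adj[OF ok l] vcode_ex[OF ok l] aq_ex[OF ok l] lets_ex[OF R ok l, of "[]"] unfolding e
          by (auto simp: St_def Wk_def)
      qed
      show "\<forall>ds\<in>St N M F R (filt bs is). filt bs (ex bs ds) = ds"
        using ex_props(1)[OF ok] by (simp add: St_def)
      show "\<forall>cs\<in>{cs \<in> Wk N M F R is. grp is cs = bs}. ex bs (filt bs cs) = cs"
        by (intro ballI ex_filt[of _ "is"]) (auto simp: Wk_def)
    qed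
    then show "sum (\<lambda>_. 1) {cs \<in> Wk N M F R is. grp is cs = bs} = card (St N M F R (filt bs is))"
      by (simp add: bij_betw_same_card)
  qed
  finally show ?thesis .
qed

text \<open>The system is unitriangular: the pattern without repetitions contributes the value at
  \<open>is\<close>, every other pattern a value at a shorter label word.\<close>

lemma collapse_cancel:
  fixes f g :: "nat list \<Rightarrow> nat"
  assumes "\<And>is. sorted is \<Longrightarrow> set is \<subseteq> A \<Longrightarrow> (\<Sum>bs\<in>{bs. okb is bs}. f (filt bs is)) = (\<Sum>bs\<in>{bs. okb is bs}. g (filt bs is))"
    and "sorted is" "set is \<subseteq> A"
  shows "f is = g is"
  using assms(2,3)
proof (induction "length is" arbitrary: "is" rule: less_induct)
  case less
  let ?n = "replicate (length is) False"
  have fB: "finite {bs. okb is bs}"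
    by (rule finite_subset[OF _ finite_lists_length_eq[of UNIV "length is"]]) (auto dest: okb_length)
  have okr: "okb is (replicate (length is) False)" for "is"
    by (induction "is" rule: induct_list012) auto
  have n: "?n \<in> {bs. okb is bs}" using okr by simp
  have fn: "filt ?n is = is" by (rule filt_all) auto
  have r: "f (filt bs is) = g (filt bs is)" if "bs \<in> {bs. okb is bs} - {?n}" for bs
  proof -
    have l: "length bs = length is" using that okb_length by auto
    have "True \<in> set bs"
    proof (rule ccontr)
      assume "True \<notin> set bs"
      then have "bs = ?n" using l by (metis (full_types) replicate_eqI)
      then show False using that by simp
    qed
    then have "length (filt bs is) < length is" using filt_len_less[OF l] by simp
    then show ?thesis using less.hyps sorted_filt[OF less.prems(1)] set_filt[of bs "is"] less.prems(2) by blast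
  qed
  have "(\<Sum>bs\<in>{bs. okb is bs}. f (filt bs is)) = f is + (\<Sum>bs\<in>{bs. okb is bs} - {?n}. f (filt bs is))"
    using sum.remove[OF fB n, of "\<lambda>bs. f (filt bs is)"] fn by simp
  moreover have "(\<Sum>bs\<in>{bs. okb is bs}. g (filt bs is)) = g is + (\<Sum>bs\<in>{bs. okb is bs} - {?n}. g (filt bs is))"
    using sum.remove[OF fB n, of "\<lambda>bs. g (filt bs is)"] fn by simp
  moreover have "(\<Sum>bs\<in>{bs. okb is bs} - {?n}. f (filt bs is)) = (\<Sum>bs\<in>{bs. okb is bs} - {?n}. g (filt bs is))"
    using r by (rule sum.cong[OF refl])
  ultimately show ?case using assms(1)[OF less.prems] by simp
qed

section \<open>Comparison of two thresholds\<close>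

lemma fam_finite: "finite {F. fam M F}"
proof -
  have c: "c < M" if f: "fam M F" and "c \<in> F a" for F a c
  proof -
    \<comment> \<open>The entry in row \<open>r\<close> (from 1) and column \<open>c\<close> (from
      0) of an increasing tableau is at least \<open>r + c\<close>; this bounds the columns.\<close>
    have b: "ht F a c + c \<le> a \<or> ht F a c = 0" for a c
    proof (induction a arbitrary: c)
      case (Suc a)
      show ?case
      proof (cases "c \<in> F (Suc a)")
        case True
        show ?thesis
        proof (cases c)
          case 0
          have "ht F a 0 \<le> a" for a by (induction a) (auto simp: adds_def)
          then show ?thesis using 0 by (metis add.right_neutral)
        next
          case (Suc d)
          have "vstrip (ht F a) (F (Suc a))" using f by (simp add: fam_def)
          then have "ht F a c < ht F a d" using True Suc by (auto simp: vstrip_def)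
          then show ?thesis using Suc.IH[of d] True Suc by (auto simp: adds_def)
        qed
      next
        case False
        then show ?thesis using Suc.IH[of c] by (auto simp: adds_def)
      qed
    qed simp
    have am: "a \<noteq> 0" "a \<le> M" using that unfolding fam_def by (metis empty_iff, metis empty_iff not_le)
    then obtain a' where "a = Suc a'" using not0_implies_Suc by blast
    then have "0 < ht F a c" using that by (simp add: adds_def)
    then show ?thesis using b[of a c] am by simp
  qed
  have "{F. fam M F} \<subseteq> {F. \<forall>a. (a \<in> {1..M} \<longrightarrow> F a \<in> Pow {..<M}) \<and> (a \<notin> {1..M} \<longrightarrow> F a = {})}"
  proof safe
    fix F a c assume "fam M F" "c \<in> F a" then show "c < M" using c by blast
  next
    fix F a c assume "fam M F" "a \<notin> {1..M}" "c \<in> F a" then show "c \<in> {}" by (auto simp: fam_def not_le)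
  qed
  moreover have "finite \<dots>" by (rule finite_set_of_finite_funs) auto
  ultimately show ?thesis by (rule finite_subset)
qed

text \<open>Recording the letters above \<open>N\<close> verbatim or by tokens describes the same set of weak words.\<close>

lemma card_St_threshold:
  assumes f: "fam N F1" and NM: "N \<le> M" and s: "sorted is" "set is \<subseteq> {..N}"
    and R: "\<And>u x v. R (u @ x # x # v) = R (u @ x # v)"
    and RR: "\<And>a. set a \<subseteq> {1..M} \<Longrightarrow> RR (tab a) \<longleftrightarrow> R (large N a)"
  shows "card (St N M F1 R is) = (\<Sum>F\<in>{F. fam M F \<and> res N F = F1 \<and> RR F}. card (St M M F (\<lambda>_. True) is))"
proof -
  let ?I = "{F. fam M F \<and> res N F = F1 \<and> RR F}"
  have fI: "finite ?I" using fam_finite[of M] by simp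
  have w: "card (Wk N M F1 R is) = (\<Sum>F\<in>?I. card (Wk M M F (\<lambda>_. True) is))" if "sorted is" "set is \<subseteq> {..N}" for "is"
  proof -
    \<comment> \<open>Labels are at most \<open>N\<close>, so a letter above \<open>N\<close>
      exceeds its label in any case.\<close>
    have b: "bnd N is a \<longleftrightarrow> bnd M is a" if "set a \<subseteq> {1..M}" for a
      unfolding bnd_def using \<open>set is \<subseteq> {..N}\<close> that
      by (intro list.rel_cong refl) (auto simp: subset_iff)
    have sM: "small M a = a" "large M a = []" if "set a \<subseteq> {1..M}" for a using that
      by (auto simp: filter_id_conv filter_empty_conv)
    have eq: "words N M F1 R is = (\<Union>F\<in>?I. words M M F (\<lambda>_. True) is)"
    proof (intro equalityI subsetI)
      fix a assume a: "a \<in> words N M F1 R is"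
      then have sa: "set a \<subseteq> {1..M}" by (simp add: words_def)
      have "tab a \<in> ?I" using a fam_tab[OF sa] res_tab[OF sa, of N] RR[OF sa] by (simp add: words_def)
      moreover have "a \<in> words M M (tab a) (\<lambda>_. True) is" using a b[OF sa] sM[OF sa] by (simp add: words_def)
      ultimately show "a \<in> (\<Union>F\<in>?I. words M M F (\<lambda>_. True) is)" by blast
    next
      fix a assume "a \<in> (\<Union>F\<in>?I. words M M F (\<lambda>_. True) is)"
      then obtain F where F: "F \<in> ?I" "a \<in> words M M F (\<lambda>_. True) is" by blast
      then have sa: "set a \<subseteq> {1..M}" by (simp add: words_def)
      have "tab a = F" using F sM[OF sa] by (simp add: words_def)
      then show "a \<in> words N M F1 R is" using F b[OF sa] RR[OF sa] res_tab[OF sa, of N] by (auto simp: words_def)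
    qed
    have "card (Wk N M F1 R is) = card (words N M F1 R is)"
      using bij_betw_same_card[OF words_Wk[OF f NM that(1), of R]] by simp
    also have "\<dots> = (\<Sum>F\<in>?I. card (words M M F (\<lambda>_. True) is))"
      unfolding eq
    proof (rule card_UN_disjoint[OF fI])
      show "\<forall>F\<in>?I. finite (words M M F (\<lambda>_. True) is)" using finite_words by blast
      show "\<forall>F\<in>?I. \<forall>G\<in>?I. F \<noteq> G \<longrightarrow> words M M F (\<lambda>_. True) is \<inter> words M M G (\<lambda>_. True) is = {}"
        by (auto simp: words_def)
    qed
    also have "\<dots> = (\<Sum>F\<in>?I. card (Wk M M F (\<lambda>_. True) is))"
      by (rule sum.cong[OF refl]) (use bij_betw_same_card[OF words_Wk[OF _ order_refl that(1)]] in auto)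
    finally show ?thesis .
  qed
  show ?thesis
  proof (rule collapse_cancel[where A = "{..N}", OF _ s])
    fix "is" :: "nat list" assume s: "sorted is" "set is \<subseteq> {..N}"
    have "(\<Sum>bs\<in>{bs. okb is bs}. card (St N M F1 R (filt bs is))) = card (Wk N M F1 R is)"
      using card_Wk[OF f NM s(1) R] by simp
    also have "\<dots> = (\<Sum>F\<in>?I. \<Sum>bs\<in>{bs. okb is bs}. card (St M M F (\<lambda>_. True) (filt bs is)))"
      unfolding w[OF s] by (rule sum.cong[OF refl], rule card_Wk) (use s in auto)
    also have "\<dots> = (\<Sum>bs\<in>{bs. okb is bs}. \<Sum>F\<in>?I. card (St M M F (\<lambda>_. True) (filt bs is)))"
      by (rule sum.swap)
    finally show "(\<Sum>bs\<in>{bs. okb is bs}. card (St N M F1 R (filt bs is))) =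
       (\<Sum>bs\<in>{bs. okb is bs}. \<Sum>F\<in>?I. card (St M M F (\<lambda>_. True) (filt bs is)))" .
  qed
qed

section \<open>Insertion and Hecke equivalence\<close>

abbreviation heq (infix "\<approx>" 50) where "a \<approx> b \<equiv> hecke_equiv a b"

lemma heq_refl [simp]: "a \<approx> a" by (simp add: hecke_equiv_def)
lemma heq_trans [trans]: "a \<approx> b \<Longrightarrow> b \<approx> c \<Longrightarrow> a \<approx> c" by (simp add: hecke_equiv_def)
lemma heq_sym: "a \<approx> b \<Longrightarrow> b \<approx> a"
  unfolding hecke_equiv_def
proof (induction rule: rtranclp_induct)
  case (step b c)
  then have "symclp hecke_step c b" by (auto simp: symclp_def)
  then show ?case using step.IH by (rule converse_rtranclp_into_rtranclp)
qed simp
lemma heq_step: "hecke_step a b \<Longrightarrow> a \<approx> b"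
  unfolding hecke_equiv_def by (simp add: r_into_rtranclp symclpI1)

lemma hecke_step_ctx: "hecke_step a b \<Longrightarrow> hecke_step (u @ a @ v) (u @ b @ v)"
proof (induction rule: hecke_step.induct)
  case (idem u' i v') then show ?case using hecke_step.idem[of "u @ u'" i "v' @ v"] by simp
next
  case (braid u' i v') then show ?case using hecke_step.braid[of "u @ u'" i "v' @ v"] by simp
next
  case (comm i j u' v') then show ?case using hecke_step.comm[of i j "u @ u'" "v' @ v"] by simp
qed

lemma heq_ctx: "a \<approx> b \<Longrightarrow> u @ a @ v \<approx> u @ b @ v"
  unfolding hecke_equiv_def
proof (induction rule: rtranclp_induct)
  case (step b c)
  then have "symclp hecke_step (u @ b @ v) (u @ c @ v)"
    unfolding symclp_def using hecke_step_ctx by blast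
  then show ?case using step by (meson rtranclp.rtrancl_into_rtrancl)
qed simp

lemma heq_app: "a \<approx> b \<Longrightarrow> c \<approx> d \<Longrightarrow> a @ c \<approx> b @ d"
  using heq_ctx[of a b "[]" c] heq_ctx[of c d b "[]"] heq_trans by simp

lemma heq_L: "c \<approx> d \<Longrightarrow> a @ c \<approx> a @ d" by (rule heq_app[OF heq_refl])
lemma heq_R: "a \<approx> b \<Longrightarrow> a @ c \<approx> b @ c" by (rule heq_app[OF _ heq_refl])

lemma heq_idem: "[i, i] \<approx> [i]"
  using heq_step[OF hecke_step.idem[of "[]" i "[]"]] by simp

lemma heq_comm: "i + 2 \<le> j \<or> j + 2 \<le> i \<Longrightarrow> [i, j] \<approx> [j, i]"
  using heq_step[OF hecke_step.comm[of i j "[]" "[]"]] by simp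

text \<open>For letters that are not adjacent both sides reduce to \<open>[a, b]\<close> by
  commutation and idempotence. So later arguments need not ask whether
  \<open>a = Suc b\<close>.\<close>

lemma heq_bab:
  assumes "b < a" shows "[b, a, b] \<approx> [a, b, a]"
proof (cases "a = Suc b")
  case True
  then show ?thesis using heq_step[OF hecke_step.braid[of "[]" b "[]"]] by simp
next
  case False
  then have c: "[b, a] \<approx> [a, b]" using assms by (intro heq_comm) auto
  have "[b, a, b] \<approx> [a, b, b]" using heq_R[OF c, of "[b]"] by simp
  also have "[a, b, b] \<approx> [a, b]" using heq_L[OF heq_idem, of "[a]" b] by simp
  also have "[a, b] \<approx> [a, a, b]" using heq_R[OF heq_sym[OF heq_idem], of a "[b]"] by simp
  also have "[a, a, b] \<approx> [a, b, a]" using heq_L[OF heq_sym[OF c], of "[a]"] by simp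
  finally show ?thesis .
qed

lemma heq_comm_list:
  assumes "\<forall>z\<in>set l. z + 2 \<le> y \<or> y + 2 \<le> z"
  shows "[y] @ l \<approx> l @ [y]"
  using assms
proof (induction l)
  case (Cons z l)
  have "[y] @ z # l \<approx> [z] @ ([y] @ l)" using heq_R[OF heq_comm[of y z], of l] Cons.prems by auto
  also have "\<dots> \<approx> [z] @ (l @ [y])" using Cons by (intro heq_L) auto
  finally show ?case by simp
qed simp

lemma heq_comm_lists:
  assumes "\<forall>y\<in>set k. \<forall>z\<in>set l. z + 2 \<le> y \<or> y + 2 \<le> z"
  shows "k @ l \<approx> l @ k"
  using assms
proof (induction k)
  case (Cons y k)
  have "(y # k) @ l \<approx> [y] @ (l @ k)" using heq_L[of "k @ l" "l @ k" "[y]"] Cons by simp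
  also have "\<dots> \<approx> (l @ [y]) @ k" using heq_R[OF heq_comm_list[of l y], of k] Cons.prems by simp
  finally show ?case by simp
qed simp

text \<open>\<open>run bs as z\<close>: when the smallest letter of \<open>bs\<close> arrives from the right at two adjacent
  columns with upper parts \<open>bs\<close> and \<open>as\<close>, it finally pushes \<open>z\<close> (if any) into the left column.\<close>

inductive run :: "nat list \<Rightarrow> nat list \<Rightarrow> nat option \<Rightarrow> bool" where
  run_None: "run (b # bs) [] None"
| run_exit: "b < a \<Longrightarrow> \<forall>e\<in>set bs. a < e \<Longrightarrow> \<forall>e\<in>set as. a + 2 \<le> e \<Longrightarrow> run (b # bs) (a # as) (Some a)"
| run_cont: "b < a \<Longrightarrow> b < b' \<Longrightarrow> b' \<le> a \<Longrightarrow> \<forall>e\<in>set as. a < e \<Longrightarrow> run (b' # bs) as z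
     \<Longrightarrow> run (b # b' # bs) (a # as) z"

fun insz :: "nat option \<Rightarrow> nat list \<Rightarrow> nat list" where
  "insz None l = l"
| "insz (Some z) l = insort z l"

lemma run_z: "run bs as z \<Longrightarrow> z = Some c \<Longrightarrow> c \<in> set as \<and> (\<forall>b\<in>{hd bs}. b < c)"
  by (induction rule: run.induct) auto

lemma run_notin: "run bs as z \<Longrightarrow> z = Some c \<Longrightarrow> c \<notin> set bs"
proof (induction rule: run.induct)
  case (run_cont b a b' as bs z)
  then show ?case using run_z[OF run_cont(5)] by fastforce
qed auto

text \<open>The second half, with an arbitrary letter \<open>p\<close> at the end, strengthens the
  induction: when a run continues, the next letter \<open>a\<close> of the right column takes the
  part of \<open>p\<close>.\<close>

lemma run_word:
  assumes "run bs as z"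
  shows "(rev bs @ rev as @ [hd bs] \<approx> rev (insz z bs) @ rev as) \<and>
    (\<forall>p. hd bs \<le> p \<and> (\<forall>a\<in>set as. p < a) \<longrightarrow> rev bs @ rev as @ [p] \<approx> rev (insz z bs) @ rev as @ [p])"
  using assms
proof (induction rule: run.induct)
  case (run_None b bs)
  show ?case using heq_L[OF heq_idem, of "rev bs" b] by simp
next
  case (run_exit b a bs as)
  have b2: "[b] @ rev as \<approx> rev as @ [b]" "[a] @ rev as \<approx> rev as @ [a]"
    using run_exit by (intro heq_comm_list; auto)+
  have i: "insz (Some a) (b # bs) = b # a # bs" using run_exit by (cases bs) auto
  have "rev bs @ [b] @ rev as @ [a, b] \<approx> rev bs @ rev as @ [b, a, b]"
    using heq_ctx[OF b2(1), of "rev bs" "[a, b]"] by simp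
  also have "\<dots> \<approx> rev bs @ rev as @ [a, b, a]" using heq_L[OF heq_bab[OF run_exit(1)], of "rev bs @ rev as"] by simp
  also have "\<dots> \<approx> rev bs @ [a] @ rev as @ [b, a]" using heq_ctx[OF heq_sym[OF b2(2)], of "rev bs" "[b, a]"] by simp
  also have "\<dots> \<approx> rev bs @ [a] @ [b] @ rev as @ [a]" using heq_ctx[OF heq_sym[OF b2(1)], of "rev bs @ [a]" "[a]"] by simp
  finally have f: "rev (b # bs) @ rev (a # as) @ [b] \<approx> rev (insz (Some a) (b # bs)) @ rev (a # as)" unfolding i by simp
  moreover have "rev (b # bs) @ rev (a # as) @ [p] \<approx> rev (insz (Some a) (b # bs)) @ rev (a # as) @ [p]"
    if p: "b \<le> p" "p < a" for p
  proof (cases "p = b")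
    case True
    have "rev (b # bs) @ rev (a # as) @ [b] \<approx> rev (b # bs) @ rev (a # as) @ [b, b]"
      using heq_L[OF heq_sym[OF heq_idem], of "rev (b # bs) @ rev (a # as)" b] by simp
    also have "\<dots> \<approx> rev (insz (Some a) (b # bs)) @ rev (a # as) @ [b]" using heq_R[OF f, of "[b]"] by simp
    finally show ?thesis using True by simp
  next
    case False
    then have ab: "[b, a] \<approx> [a, b]" using p by (intro heq_comm) auto
    have "rev bs @ [b] @ rev as @ [a, p] \<approx> rev bs @ [b] @ rev as @ [a, a, p]"
      using heq_ctx[OF heq_sym[OF heq_idem], of "rev bs @ [b] @ rev as" a "[p]"] by simp
    also have "\<dots> \<approx> rev bs @ [b] @ [a] @ rev as @ [a, p]" using heq_ctx[OF heq_sym[OF b2(2)], of "rev bs @ [b]" "[a, p]"] by simp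
    also have "\<dots> \<approx> rev bs @ [a, b] @ rev as @ [a, p]" using heq_ctx[OF ab, of "rev bs" "rev as @ [a, p]"] by simp
    finally show ?thesis unfolding i by simp
  qed
  ultimately show ?case by auto
next
  case (run_cont b a b' as bs z)
  let ?B = "rev (b' # bs)" and ?Z = "rev (insz z (b' # bs))"
  have i: "rev (insz z (b # b' # bs)) = ?Z @ [b]"
  proof (cases z)
    case (Some c)
    then have "b < c" using run_z[OF run_cont(5) Some] run_cont(4,1) by auto
    then show ?thesis using Some by simp
  qed simp
  have b2: "[b] @ rev as \<approx> rev as @ [b]" using run_cont by (intro heq_comm_list) auto
  have IH1: "?B @ rev as @ [b'] \<approx> ?Z @ rev as" using run_cont.IH by simp
  have IH2: "?B @ rev as @ [a] \<approx> ?Z @ rev as @ [a]" using run_cont by auto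
  have f: "?B @ [b] @ rev as @ [a, b] \<approx> (?Z @ [b]) @ rev as @ [a]"
  proof -
    have "?B @ [b] @ rev as @ [a, b] \<approx> ?B @ rev as @ [b, a, b]"
      using heq_ctx[OF b2, of ?B "[a, b]"] by simp
    also have "\<dots> \<approx> ?Z @ rev as @ [b, a]"
    proof (cases "b' = a")
      case True
      have "?B @ rev as @ [b, a, b] \<approx> (?B @ rev as @ [b']) @ [b, a]"
        using heq_L[OF heq_bab[OF run_cont(1)], of "?B @ rev as"] True by simp
      also have "\<dots> \<approx> (?Z @ rev as) @ [b, a]" by (rule heq_R[OF IH1])
      finally show ?thesis by simp
    next
      case False
      then have ab: "[b, a] \<approx> [a, b]" using run_cont by (intro heq_comm) auto
      have "?B @ rev as @ [b, a, b] \<approx> ?B @ rev as @ [a, b, b]"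
        using heq_ctx[OF ab, of "?B @ rev as" "[b]"] by simp
      also have "\<dots> \<approx> (?B @ rev as @ [a]) @ [b]" using heq_L[OF heq_idem, of "?B @ rev as @ [a]" b] by simp
      also have "\<dots> \<approx> (?Z @ rev as @ [a]) @ [b]" by (rule heq_R[OF IH2])
      also have "\<dots> \<approx> ?Z @ rev as @ [b, a]" using heq_L[OF heq_sym[OF ab], of "?Z @ rev as"] by simp
      finally show ?thesis .
    qed
    also have "\<dots> \<approx> (?Z @ [b]) @ rev as @ [a]" using heq_ctx[OF heq_sym[OF b2], of ?Z "[a]"] by simp
    finally show ?thesis .
  qed
  moreover have "?B @ [b] @ rev as @ [a, p] \<approx> (?Z @ [b]) @ rev as @ [a, p]" if p: "b \<le> p" "p < a" for p
  proof (cases "p = b")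
    case True
    have "?B @ [b] @ rev as @ [a, b] \<approx> (?B @ [b] @ rev as @ [a, b]) @ [b]"
      using heq_L[OF heq_sym[OF heq_idem], of "?B @ [b] @ rev as @ [a]" b] by simp
    also have "\<dots> \<approx> ((?Z @ [b]) @ rev as @ [a]) @ [b]" by (rule heq_R[OF f])
    finally show ?thesis using True by simp
  next
    case False
    then have ba: "[b] @ (rev as @ [a]) \<approx> (rev as @ [a]) @ [b]"
      using run_cont p by (intro heq_comm_list) auto
    have "?B @ [b] @ rev as @ [a, p] \<approx> (?B @ rev as @ [a]) @ [b, p]" using heq_ctx[OF ba, of ?B "[p]"] by simp
    also have "\<dots> \<approx> (?Z @ rev as @ [a]) @ [b, p]" by (rule heq_R[OF IH2])
    also have "\<dots> \<approx> (?Z @ [b]) @ rev as @ [a, p]" using heq_ctx[OF heq_sym[OF ba], of ?Z "[p]"] by simp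
    finally show ?thesis .
  qed
  ultimately show ?case unfolding i by auto
qed

section \<open>Column words\<close>

definition cw :: "nat set \<Rightarrow> nat list" where "cw S = rev (sorted_list_of_set S)"

lemma sls_split:
  assumes "finite (A :: nat set)"
  shows "sorted_list_of_set A = sorted_list_of_set {z\<in>A. z < y} @ (if y \<in> A then [y] else []) @ sorted_list_of_set {z\<in>A. y < z}"
proof (rule sorted_distinct_set_unique)
  have f: "finite {z\<in>A. z < y}" "finite {z\<in>A. y < z}" using assms by auto
  show "sorted (sorted_list_of_set {z\<in>A. z < y} @ (if y \<in> A then [y] else []) @ sorted_list_of_set {z\<in>A. y < z})"
    using f by (auto simp: sorted_append)
  show "distinct (sorted_list_of_set {z\<in>A. z < y} @ (if y \<in> A then [y] else []) @ sorted_list_of_set {z\<in>A. y < z})"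
    using f by auto
  show "set (sorted_list_of_set A) = set (sorted_list_of_set {z\<in>A. z < y} @ (if y \<in> A then [y] else []) @ sorted_list_of_set {z\<in>A. y < z})"
    using f assms by auto
qed (use assms in auto)

lemma cw_split:
  assumes "finite A"
  shows "cw A = rev (sorted_list_of_set {z\<in>A. y < z}) @ (if y \<in> A then [y] else []) @ cw {z\<in>A. z < y}"
  unfolding cw_def by (subst sls_split[OF assms, of y]) simp

lemma set_cw [simp]: "finite A \<Longrightarrow> set (cw A) = A" by (simp add: cw_def)

lemma sls_ge:
  assumes "finite (A :: nat set)" "y \<in> A"
  shows "sorted_list_of_set {z\<in>A. y \<le> z} = y # sorted_list_of_set {z\<in>A. y < z}"
proof -
  have "{x\<in>{z\<in>A. y \<le> z}. x < y} = {}" "{x\<in>{z\<in>A. y \<le> z}. y < x} = {z\<in>A. y < z}" by auto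
  then show ?thesis using sls_split[of "{z\<in>A. y \<le> z}" y] assms by simp
qed

lemma cw_insert:
  assumes "finite A"
  shows "cw (insert y A) = rev (sorted_list_of_set {z\<in>A. y < z}) @ [y] @ cw {z\<in>A. z < y}"
proof -
  have "{z \<in> insert y A. y < z} = {z\<in>A. y < z}" "{z \<in> insert y A. z < y} = {z\<in>A. z < y}" by auto
  then show ?thesis using cw_split[of "insert y A" y] assms by simp
qed

text \<open>Between its two possible places \<open>y\<close> meets only the larger letters of the
  right column and the smaller ones of the left column, and by assumption it commutes with all of
  them.\<close>

lemma move_pair:
  assumes f: "finite A" "finite B" and y: "y \<notin> A" "y \<notin> B"
    and lo: "\<forall>b\<in>B. b < y \<longrightarrow> b + 2 \<le> y" and hi: "\<forall>z\<in>A. y < z \<longrightarrow> y + 2 \<le> z"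
  shows "cw B @ cw (insert y A) \<approx> cw (insert y B) @ cw A"
proof -
  let ?Ah = "rev (sorted_list_of_set {z\<in>A. y < z})" and ?Al = "cw {z\<in>A. z < y}"
  let ?Bh = "rev (sorted_list_of_set {z\<in>B. y < z})" and ?Bl = "cw {z\<in>B. z < y}"
  have A: "cw A = ?Ah @ ?Al" "cw (insert y A) = ?Ah @ [y] @ ?Al"
    using cw_split[OF f(1), of y] cw_insert[OF f(1), of y] y by simp_all
  have B: "cw B = ?Bh @ ?Bl" "cw (insert y B) = ?Bh @ [y] @ ?Bl"
    using cw_split[OF f(2), of y] cw_insert[OF f(2), of y] y by simp_all
  have "[y] @ (?Bl @ ?Ah) \<approx> (?Bl @ ?Ah) @ [y]" using lo hi f by (intro heq_comm_list) auto
  from heq_ctx[OF heq_sym[OF this], of ?Bh ?Al] show ?thesis unfolding A B by simp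
qed

lemma run_pair:
  assumes f: "finite A" "finite B" and y: "y \<in> B" "y \<notin> A" and lo: "\<forall>b\<in>B. b < y \<longrightarrow> b + 2 \<le> y"
    and r: "run (sorted_list_of_set {b\<in>B. y \<le> b}) (sorted_list_of_set {a\<in>A. y < a}) zo"
  shows "cw B @ cw (insert y A) \<approx> cw (case zo of None \<Rightarrow> B | Some z \<Rightarrow> insert z B) @ cw A"
proof -
  let ?B' = "case zo of None \<Rightarrow> B | Some z \<Rightarrow> insert z B"
  let ?Ah = "rev (sorted_list_of_set {z\<in>A. y < z})" and ?Al = "cw {z\<in>A. z < y}"
  let ?b = "sorted_list_of_set {b\<in>B. y \<le> b}" and ?Bl = "cw {z\<in>B. z < y}"
  have A: "cw A = ?Ah @ ?Al" "cw (insert y A) = ?Ah @ [y] @ ?Al"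
    using cw_split[OF f(1), of y] cw_insert[OF f(1), of y] y by simp_all
  have b: "?b = y # sorted_list_of_set {z\<in>B. y < z}" using sls_ge[OF f(2) y(1)] .
  have B: "cw B = rev ?b @ ?Bl" using cw_split[OF f(2), of y] y unfolding b by simp
  have B': "cw ?B' = rev (insz zo ?b) @ ?Bl"
  proof (cases zo)
    case None then show ?thesis using B by simp
  next
    case (Some z)
    then have z: "y < z" using run_z[OF r Some] b by simp
    have zB: "z \<notin> B" using run_notin[OF r Some] z f by auto
    have "{c \<in> insert z B. y \<le> c} = insert z {b\<in>B. y \<le> b}" "{c \<in> insert z B. c < y} = {c\<in>B. c < y}" using z by auto
    moreover have "cw (insert z B) = rev (sorted_list_of_set {c \<in> insert z B. y \<le> c}) @ cw {c \<in> insert z B. c < y}"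
      using cw_split[of "insert z B" y] sls_ge[of "insert z B" y] f y by simp
    moreover have "sorted_list_of_set (insert z {b\<in>B. y \<le> b}) = insort z ?b" if "z \<notin> B"
      using that f by (simp add: sorted_list_of_set_insert)
    ultimately show ?thesis using Some zB by simp
  qed
  have c: "?Bl @ (?Ah @ [y]) \<approx> (?Ah @ [y]) @ ?Bl" "?Bl @ ?Ah \<approx> ?Ah @ ?Bl"
    using lo f by (intro heq_comm_lists; fastforce)+
  have hdb: "hd ?b = y" unfolding b by simp
  have w: "rev ?b @ ?Ah @ [y] \<approx> rev (insz zo ?b) @ ?Ah" using run_word[OF r] unfolding hdb by blast
  have s0: "cw B @ cw (insert y A) = rev ?b @ (?Bl @ (?Ah @ [y])) @ ?Al" unfolding A B by simp
  have s1: "rev ?b @ (?Bl @ (?Ah @ [y])) @ ?Al \<approx> (rev ?b @ ?Ah @ [y]) @ (?Bl @ ?Al)"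
    using heq_ctx[OF c(1), of "rev ?b" ?Al] by simp
  have s2: "(rev ?b @ ?Ah @ [y]) @ (?Bl @ ?Al) \<approx> (rev (insz zo ?b) @ ?Ah) @ (?Bl @ ?Al)" by (rule heq_R[OF w])
  have s3: "(rev (insz zo ?b) @ ?Ah) @ (?Bl @ ?Al) \<approx> rev (insz zo ?b) @ (?Bl @ ?Ah) @ ?Al"
    using heq_ctx[OF heq_sym[OF c(2)], of "rev (insz zo ?b)" ?Al] by simp
  have "cw ?B' @ cw A = rev (insz zo ?b) @ (?Bl @ ?Ah) @ ?Al" unfolding A B' by simp
  then show ?thesis using heq_trans[OF s1 heq_trans[OF s2 s3]] unfolding s0 by simp
qed

definition cl :: "(nat \<Rightarrow> nat set) \<Rightarrow> nat \<Rightarrow> nat set" where "cl H c = {b. c \<in> H b}"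

definition fw :: "nat \<Rightarrow> (nat \<Rightarrow> nat set) \<Rightarrow> nat list" where
  "fw K C = concat (map (\<lambda>c. cw (C c)) [0..<K])"

lemma fw_Suc: "fw (Suc K) C = fw K C @ cw (C K)"
  by (simp add: fw_def)

lemma fw_cong: "(\<And>c. c < K \<Longrightarrow> C c = D c) \<Longrightarrow> fw K C = fw K D"
  unfolding fw_def by (intro arg_cong[of _ _ concat] map_cong) auto

lemma fw_pair:
  assumes "Suc c < K" "\<And>d. d \<noteq> c \<Longrightarrow> d \<noteq> Suc c \<Longrightarrow> C d = D d"
    and "cw (C c) @ cw (C (Suc c)) \<approx> cw (D c) @ cw (D (Suc c))"
  shows "fw K C \<approx> fw K D"
proof -
  have s: "[0..<K] = [0..<c] @ [c, Suc c] @ [Suc (Suc c)..<K]"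
  proof -
    have "[0..<K] = [0..<c] @ [c..<K]" using upt_add_eq_append[of 0 c "K - c"] assms(1) by simp
    moreover have "[c..<K] = c # Suc c # [Suc (Suc c)..<K]" using assms(1) by (simp add: upt_conv_Cons)
    ultimately show ?thesis by simp
  qed
  have e: "map (\<lambda>c. cw (C c)) [0..<c] = map (\<lambda>c. cw (D c)) [0..<c]"
    "map (\<lambda>c. cw (C c)) [Suc (Suc c)..<K] = map (\<lambda>c. cw (D c)) [Suc (Suc c)..<K]"
    using assms(2) by auto
  let ?p = "concat (map (\<lambda>c. cw (D c)) [0..<c])" and ?s = "concat (map (\<lambda>c. cw (D c)) [Suc (Suc c)..<K])"
  have "fw K C = ?p @ (cw (C c) @ cw (C (Suc c))) @ ?s" "fw K D = ?p @ (cw (D c) @ cw (D (Suc c))) @ ?s"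
    unfolding fw_def s map_append concat_append e by simp_all
  then show ?thesis using heq_ctx[OF assms(3), of ?p ?s] by simp
qed

definition movable :: "(nat \<Rightarrow> nat set) \<Rightarrow> nat \<Rightarrow> nat \<Rightarrow> bool" where
  "movable C y c \<longleftrightarrow> finite (C c) \<and> finite (C (Suc c)) \<and> y \<notin> C c \<and> y \<notin> C (Suc c)
     \<and> (\<forall>b\<in>C c. b < y \<longrightarrow> b + 2 \<le> y) \<and> (\<forall>z\<in>C (Suc c). y < z \<longrightarrow> y + 2 \<le> z)"

lemma fw_moves:
  assumes "d \<le> e" "e < K" "\<And>c. d \<le> c \<Longrightarrow> c < e \<Longrightarrow> movable C y c"
  shows "fw K (C(e := insert y (C e))) \<approx> fw K (C(d := insert y (C d)))"
  using assms
proof (induction e)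
  case (Suc e)
  show ?case
  proof (cases "d = Suc e")
    case False
    then have m: "movable C y e" "d \<le> e" using Suc.prems by auto
    have "fw K (C(Suc e := insert y (C (Suc e)))) \<approx> fw K (C(e := insert y (C e)))"
      by (rule fw_pair[of e]) (use Suc.prems m move_pair[of "C (Suc e)" "C e" y] in \<open>auto simp: movable_def\<close>)
    also have "fw K (C(e := insert y (C e))) \<approx> fw K (C(d := insert y (C d)))"
      by (rule Suc.IH) (use Suc.prems m in auto)
    finally show ?thesis .
  qed simp
qed simp

lemma ht_card: "ht H a c = card {b \<in> cl H c. 0 < b \<and> b \<le> a}"
proof (induction a)
  case 0
  have "{b \<in> cl H c. 0 < b \<and> b \<le> 0} = {}" by auto
  then show ?case by (simp only: ht.simps card.empty)
next
  case (Suc a)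
  have "{b \<in> cl H c. 0 < b \<and> b \<le> Suc a} = (if c \<in> H (Suc a) then insert (Suc a) {b \<in> cl H c. 0 < b \<and> b \<le> a} else {b \<in> cl H c. 0 < b \<and> b \<le> a})"
    by (auto simp: cl_def le_Suc_eq)
  moreover have "finite {b \<in> cl H c. 0 < b \<and> b \<le> a}" by (rule finite_subset[of _ "{..a}"]) auto
  ultimately show ?case using Suc by (simp add: adds_def)
qed

lemma ht_strict:
  assumes "vstrip (ht G b) (G (Suc b))" "part (ht G b)" "c \<in> G (Suc b)"
  shows "ht G (Suc b) (Suc c) < ht G (Suc b) c"
  using assms partD[OF assms(2), of c "Suc c"] vstripD[OF assms(1), of "Suc c" c]
  by (auto simp: adds_def)

lemma ins_below: "fam M F \<Longrightarrow> b < x \<Longrightarrow> ins F x b = F b"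
proof (cases b)
  case (Suc c)
  assume f: "fam M F" and b: "b < x"
  have "\<forall>d<c. vstrip (ht F d) (F (Suc d))" using f by (simp add: fam_def)
  then have "tk F x c = Idle" using ins_inv[of c F x] b Suc by auto
  then show ?thesis using Suc b by (simp add: ext_def)
qed (simp add: fam_def)

lemma fam_cols: assumes f: "fam M F" and "c \<in> F a" shows "c < M"
proof -
  have b: "ht F a c + c \<le> a \<or> ht F a c = 0" for a c
  proof (induction a arbitrary: c)
    case (Suc a)
    show ?case
    proof (cases "c \<in> F (Suc a)")
      case True
      show ?thesis
      proof (cases c)
        case 0
        have "ht F a 0 \<le> a" for a by (induction a) (auto simp: adds_def)
        then show ?thesis using 0 by (metis add.right_neutral)
      next
        case (Suc d)
        have "vstrip (ht F a) (F (Suc a))" using f by (simp add: fam_def)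
        then have "ht F a c < ht F a d" using True Suc by (auto simp: vstrip_def)
        then show ?thesis using Suc.IH[of d] True Suc by (auto simp: adds_def)
      qed
    next
      case False
      then show ?thesis using Suc.IH[of c] by (auto simp: adds_def)
    qed
  qed simp
  have am: "a \<noteq> 0" "a \<le> M" using assms unfolding fam_def by (metis empty_iff, metis empty_iff not_le)
  then obtain a' where "a = Suc a'" using not0_implies_Suc by blast
  then have "0 < ht F a c" using assms by (simp add: adds_def)
  then show ?thesis using b[of a c] am by simp
qed

abbreviation lst :: "nat set \<Rightarrow> nat list" where "lst \<equiv> sorted_list_of_set"

text \<open>Invariant while the token is \<open>Mark j\<close>: a second copy of some letter
  \<open>y\<close> of column \<open>j\<close> is waiting in column \<open>Suc j\<close>. The letter
  \<open>s\<close> records how far its run has advanced: it is the entry of column \<open>j\<close>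
  in the row just below the letters up to \<open>a\<close> of column \<open>Suc j\<close>, and every
  completion of the run from there completes the run that starts with \<open>y\<close>.\<close>

definition minv :: "nat list \<Rightarrow> nat \<Rightarrow> (nat \<Rightarrow> nat set) \<Rightarrow> nat \<Rightarrow> nat \<Rightarrow> bool" where
  "minv W K C a j \<longleftrightarrow> (\<exists>y s. y \<in> C j \<and> y \<notin> C (Suc j) \<and> (\<forall>b\<in>C j. b < y \<longrightarrow> b + 2 \<le> y)
     \<and> W \<approx> fw K (C(Suc j := insert y (C (Suc j)))) \<and> s \<in> C j \<and> s \<le> a
     \<and> card {b\<in>C j. b < s} = card {b\<in>C (Suc j). b \<le> a}
     \<and> (\<forall>z. run (lst {b\<in>C j. s \<le> b}) (lst {b\<in>C (Suc j). a < b}) z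
            \<longrightarrow> run (lst {b\<in>C j. y \<le> b}) (lst {b\<in>C (Suc j). y < b}) z))"

lemma minv_start:
  assumes "y \<in> C j" "y \<notin> C (Suc j)" "\<forall>b\<in>C j. b < y \<longrightarrow> b + 2 \<le> y"
    "W \<approx> fw K (C(Suc j := insert y (C (Suc j))))" "card {b\<in>C j. b < y} = card {b\<in>C (Suc j). b \<le> y}"
  shows "minv W K C y j"
  unfolding minv_def by (intro exI[of _ y]) (use assms in auto)

lemma minv_apply:
  assumes "minv W K C a j" "Suc j < K" "finite (C j)" "finite (C (Suc j))"
    and "\<And>s. s \<in> C j \<Longrightarrow> s \<le> a \<Longrightarrow> card {b\<in>C j. b < s} = card {b\<in>C (Suc j). b \<le> a}
       \<Longrightarrow> run (lst {b\<in>C j. s \<le> b}) (lst {b\<in>C (Suc j). a < b}) zo"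
  shows "W \<approx> fw K (case zo of None \<Rightarrow> C | Some z \<Rightarrow> C(j := insert z (C j)))"
proof -
  obtain y s where y: "y \<in> C j" "y \<notin> C (Suc j)" "\<forall>b\<in>C j. b < y \<longrightarrow> b + 2 \<le> y"
     "W \<approx> fw K (C(Suc j := insert y (C (Suc j))))" "s \<in> C j" "s \<le> a"
     "card {b\<in>C j. b < s} = card {b\<in>C (Suc j). b \<le> a}"
     "\<forall>z. run (lst {b\<in>C j. s \<le> b}) (lst {b\<in>C (Suc j). a < b}) z
            \<longrightarrow> run (lst {b\<in>C j. y \<le> b}) (lst {b\<in>C (Suc j). y < b}) z"
    using assms(1) unfolding minv_def by blast
  have r: "run (lst {b\<in>C j. y \<le> b}) (lst {b\<in>C (Suc j). y < b}) zo" using y assms(5) by blast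
  note p = run_pair[OF assms(4,3) y(1,2,3) r]
  have "fw K (C(Suc j := insert y (C (Suc j)))) \<approx> fw K (case zo of None \<Rightarrow> C | Some z \<Rightarrow> C(j := insert z (C j)))"
    by (rule fw_pair[OF assms(2)]) (use p in \<open>auto split: option.splits\<close>)
  then show ?thesis using heq_trans[OF y(4)] by blast
qed

text \<open>If \<open>Suc a\<close> occurs in the right column, one \<open>run_cont\<close> step is
  put in front and \<open>s\<close> moves to the next entry of column \<open>j\<close>. That entry
  is at most \<open>Suc a\<close> because column \<open>j\<close> remains strictly taller.\<close>

lemma minv_stay:
  assumes m: "minv W K C a j" and f: "finite (C j)" "finite (C (Suc j))"
    and k: "card {b\<in>C (Suc j). b \<le> Suc a} < card {b\<in>C j. b \<le> Suc a}"
  shows "minv W K C (Suc a) j"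
proof -
  obtain y s where y: "y \<in> C j" "y \<notin> C (Suc j)" "\<forall>b\<in>C j. b < y \<longrightarrow> b + 2 \<le> y"
     "W \<approx> fw K (C(Suc j := insert y (C (Suc j))))" "s \<in> C j" "s \<le> a"
     "card {b\<in>C j. b < s} = card {b\<in>C (Suc j). b \<le> a}"
     "\<forall>z. run (lst {b\<in>C j. s \<le> b}) (lst {b\<in>C (Suc j). a < b}) z
            \<longrightarrow> run (lst {b\<in>C j. y \<le> b}) (lst {b\<in>C (Suc j). y < b}) z"
    using m unfolding minv_def by blast
  show ?thesis
proof (cases "Suc a \<in> C (Suc j)")
  case False
  then have "b \<le> Suc a \<longleftrightarrow> b \<le> a" if "b \<in> C (Suc j)" for b using that by (auto simp: le_Suc_eq)
  then have eqs: "{b\<in>C (Suc j). b \<le> Suc a} = {b\<in>C (Suc j). b \<le> a}" "{b\<in>C (Suc j). Suc a < b} = {b\<in>C (Suc j). a < b}"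
    by (auto simp: not_le[symmetric])
  show ?thesis unfolding minv_def eqs using y le_SucI[OF y(6)] by blast
next
  case True
  have A: "{b\<in>C (Suc j). b \<le> Suc a} = insert (Suc a) {b\<in>C (Suc j). b \<le> a}" using True by (auto simp: le_Suc_eq)
  have cA: "card {b\<in>C (Suc j). b \<le> Suc a} = Suc (card {b\<in>C (Suc j). b \<le> a})" unfolding A using f by simp
  let ?X = "{b\<in>C j. s < b}"
  have "\<exists>b\<in>?X. b \<le> Suc a"
  proof (rule ccontr)
    assume "\<not> ?thesis"
    then have "{b\<in>C j. b \<le> Suc a} \<subseteq> insert s {b\<in>C j. b < s}" by (auto simp: not_less)
    then have "card {b\<in>C j. b \<le> Suc a} \<le> Suc (card {b\<in>C j. b < s})"
      using f card_mono[of "insert s {b\<in>C j. b < s}"] by (simp add: card_insert_if)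
    then show False using k cA y(7) by simp
  qed
  define s' where "s' = Min ?X"
  have s': "s' \<in> C j" "s < s'" "s' \<le> Suc a" "\<And>b. b \<in> C j \<Longrightarrow> s < b \<Longrightarrow> s' \<le> b"
  proof -
    have X: "finite ?X" "?X \<noteq> {}" using f \<open>\<exists>b\<in>?X. b \<le> Suc a\<close> by auto
    from Min_in[OF this] show "s' \<in> C j" "s < s'" unfolding s'_def by auto
    show mn: "\<And>b. b \<in> C j \<Longrightarrow> s < b \<Longrightarrow> s' \<le> b" unfolding s'_def using X by (intro Min_le) auto
    show "s' \<le> Suc a" using \<open>\<exists>b\<in>?X. b \<le> Suc a\<close> mn by fastforce
  qed
  have "{b\<in>C j. b < s'} = insert s {b\<in>C j. b < s}"
    using s' y(5) by (auto simp: not_le[symmetric])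
  then have c': "card {b\<in>C j. b < s'} = card {b\<in>C (Suc j). b \<le> Suc a}" using cA y(7) f by simp
  have l1: "lst {b\<in>C j. s \<le> b} = s # s' # lst {b\<in>C j. s' < b}"
  proof -
    have "{b\<in>C j. s < b} = {b\<in>C j. s' \<le> b}" using s' by (auto simp: less_le_trans)
    then show ?thesis using sls_ge[OF f(1) y(5)] sls_ge[OF f(1) s'(1)] by simp
  qed
  have l2: "lst {b\<in>C (Suc j). a < b} = Suc a # lst {b\<in>C (Suc j). Suc a < b}"
    using sls_ge[OF f(2) True] by (simp add: Suc_le_eq)
  have "run (lst {b\<in>C j. s \<le> b}) (lst {b\<in>C (Suc j). a < b}) z"
    if "run (lst {b\<in>C j. s' \<le> b}) (lst {b\<in>C (Suc j). Suc a < b}) z" for z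
    unfolding l1 l2 using that sls_ge[OF f(1) s'(1)] s' y(6) f
    by (intro run_cont) auto
  then show ?thesis unfolding minv_def using y s' c' by blast
qed
qed

text \<open>The insertion is followed through the hybrid tableau \<open>hy a\<close>, which is
  \<open>G\<close> up to the letter \<open>a\<close> and \<open>F\<close> above. Treating one more
  letter means carrying a copy of it leftwards across columns of equal height, where it commutes
  with its surroundings. A merge leaves a copy waiting, as described by \<open>minv\<close>.\<close>

lemma hecke_ins:
  assumes f: "fam M F" and x: "0 < x" "x \<le> M" and K: "M < K"
  shows "fw K (cl F) @ [x] \<approx> fw K (cl (ins F x))"
proof -
  define G where "G = ins F x"
  have fG: "fam M G" using fam_ins[OF f x] G_def by simp
  define hy where "hy a b = (if b \<le> a then G b else F b)" for a b
  define W where "W = fw K (cl F) @ [x]"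
  let ?K = "Suc K"
  have vF: "vstrip (ht F a) (F (Suc a))" and vG: "vstrip (ht G a) (G (Suc a))" for a using f fG by (auto simp: fam_def)
  have pF: "part (ht F a)" and pG: "part (ht G a)" for a using fam_part f fG by auto
  have finC: "finite (cl H c)" if "\<And>b. M < b \<Longrightarrow> H b = {}" for H c
    using that by (intro finite_subset[of "cl H c" "{..M}"]) (auto simp: cl_def not_less[symmetric])
  have F0: "F 0 = {}" "G 0 = {}" "\<And>b. M < b \<Longrightarrow> F b = {}" "\<And>b. M < b \<Longrightarrow> G b = {}" using f fG by (auto simp: fam_def)
  have fhy: "finite (cl (hy a) c)" for a c by (rule finC) (auto simp: hy_def F0)
  have cnt: "card {b \<in> cl (hy a) c. b \<le> a} = ht G a c" for a c
  proof -
    have "{b \<in> cl (hy a) c. b \<le> a} = {b \<in> cl G c. 0 < b \<and> b \<le> a}"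
      using F0 by (auto simp: cl_def hy_def) (metis empty_iff gr0I)
    then show ?thesis by (simp add: ht_card)
  qed
  \<comment> \<open>The letter to be inserted is placed in a column of its own, to the right of all
    columns of \<open>F\<close>; this is the reason for \<open>Suc K\<close> columns.\<close>
  have WK: "W = fw ?K ((cl F)(K := insert x (cl F K)))"
  proof -
    have "cl F K = {}" using fam_cols[OF f, of K] K by (auto simp: cl_def)
    moreover have "fw K ((cl F)(K := insert x (cl F K))) = fw K (cl F)" by (rule fw_cong) simp
    ultimately show ?thesis unfolding W_def fw_Suc by (simp add: cw_def)
  qed
  have main: "(\<forall>j. tk F x a = New j \<longrightarrow> W \<approx> fw ?K (cl (hy a))) \<and>
      (\<forall>j. tk F x a = Mark j \<longrightarrow> j < M \<and> minv W ?K (cl (hy a)) a j)" for a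
  proof (induction a)
    case (Suc a)
    define t h g S S' t' a' where "t = tk F x a" and "h = ht F a" and "g = ht G a" and "S = F (Suc a)"
      and "S' = G (Suc a)" and "t' = tk F x (Suc a)" and "a' = Suc a"
    note IHt = Suc.IH[folded t_def]
    have e: "ext h S t (a' = x) = (S', t')"
      unfolding t_def h_def S_def S'_def t'_def a'_def G_def by simp
    have i: "okt h t" "g = up h t" "t = Idle \<longleftrightarrow> a < x"
      using ins_inv[of a F x] f x unfolding t_def h_def g_def G_def by (auto simp: fam_def)
    have hp: "part h" "vstrip h S" "part g" using pF vF pG h_def S_def g_def by auto
    have hFa: "ht F a' = adds h S" using a'_def h_def S_def by simp
    have hya: "cl (hy a') = (\<lambda>c. if c \<in> S' then insert a' (cl (hy a) c - {a'}) else cl (hy a) c - {a'})"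
      unfolding fun_eq_iff cl_def hy_def a'_def S'_def by (auto simp: le_Suc_eq)
    have memS: "a' \<in> cl (hy a) c \<longleftrightarrow> c \<in> S" for c unfolding cl_def hy_def a'_def S_def by simp
    have colM: "c < M" if "c \<in> S'" for c using fam_cols[OF fG] that S'_def by blast
    \<comment> \<open>The predecessor \<open>a\<close> of \<open>a'\<close> is missing from column
      \<open>c\<close>: had it been added there last, the column would be strictly taller than the
      next one. \<open>high\<close> uses the strip condition of \<open>F\<close> in the same way for
      the successor of \<open>a'\<close>.\<close>
    have low: "b + 2 \<le> a'" if b: "b \<in> cl (hy a) c" "b < a'" and fl: "g c \<le> g (Suc c)" for b c
    proof -
      have "c \<in> G b" "b \<le> a" using b by (auto simp: cl_def hy_def a'_def split: if_splits)
      moreover have "b \<noteq> a"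
      proof
        assume ba: "b = a"
        obtain d where d: "a = Suc d" using \<open>c \<in> G b\<close> ba F0 by (cases a) auto
        show False using ht_strict[OF vG pG, of c d] d ba \<open>c \<in> G b\<close> fl g_def by auto
      qed
      ultimately show ?thesis using a'_def by simp
    qed
    have high: "a' + 2 \<le> z" if z: "z \<in> cl (hy a) (Suc c)" "a' < z" and fl: "ht F a' c \<le> ht F a' (Suc c)" for z c
    proof -
      have "Suc c \<in> F z" using z by (auto simp: cl_def hy_def a'_def split: if_splits)
      moreover have "z \<noteq> Suc a'" using vstripD[OF vF[of a'], of "Suc c" c] calculation fl by auto
      ultimately show ?thesis using z by simp
    qed
    \<comment> \<open>The hybrid tableau without the copy of \<open>a'\<close> that a
      \<open>New\<close> token may bump. This copy is then viewed as travelling through the columns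
      of \<open>C\<close>.\<close>
    define C where "C = (\<lambda>c. cl (hy a) c - (if t = New (tcol t) \<and> c = tcol t then {a'} else {}))"
    have Csub: "C c \<subseteq> cl (hy a) c" for c unfolding C_def by auto
    have fC: "finite (C c)" for c using fhy Csub finite_subset by metis
    have mv: "movable C a' c"
      if "a' \<notin> C c" "a' \<notin> C (Suc c)" "g c \<le> g (Suc c)" "ht F a' c \<le> ht F a' (Suc c)" for c
      unfolding movable_def using fC that low[OF _ _ that(3)] high[OF _ _ that(4)] Csub by blast
    show ?case
    proof (cases "t = Idle")
      case True
      show ?thesis
      proof (cases "a' = x")
        case False
        then have "t' = Idle" using e True by (auto simp: ext_def)
        then show ?thesis using t'_def by simp
      next
        case s: True
        have hF: "cl (hy a) = cl F"
          unfolding cl_def hy_def fun_eq_iff using ins_below[OF f] s a'_def G_def by auto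
        have CF: "C = cl F" unfolding C_def hF using True by auto
        obtain q where q: "first_col h 0 = q" "h q = 0" "\<forall>i<q. 0 < h i" by (metis first_colE hp(1) le_zero_eq)
        have e': "(S',t') = (if q \<in> S then (S, Mark q) else (insert q S, New q))"
          using e s q by (auto simp: ext_def land_def)
        have qM: "q < M" using colM[of q] e' by (auto split: if_splits)
        have gh: "g = h" using i True by simp
        have z: "h c = 0" if "q \<le> c" for c using partD[OF hp(1) that] q by simp
        have nS: "c \<notin> S" if "q < c" for c using vstripD[OF hp(2), of c q] that q by auto
        have mv': "movable C a' c" if "q \<le> c" "c \<notin> S" for c
          by (rule mv) (use that z[of c] z[of "Suc c"] nS[of "Suc c"] CF hF memS gh hFa in \<open>auto simp: adds_def\<close>)
        show ?thesis
        proof (cases "q \<in> S")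
          case False
          have "W \<approx> fw ?K (C(q := insert a' (C q)))"
            unfolding WK s[symmetric] CF[symmetric] by (rule fw_moves) (use qM K mv' nS False in \<open>auto simp: le_less\<close>)
          moreover have "C(q := insert a' (C q)) = cl (hy a')"
            unfolding hya using e' False CF hF memS by (auto simp: fun_eq_iff)
          ultimately show ?thesis using e' False t'_def a'_def by simp
        next
          case qS: True
          have "W \<approx> fw ?K (C(Suc q := insert a' (C (Suc q))))"
            unfolding WK s[symmetric] CF[symmetric] by (rule fw_moves) (use qM K mv' nS in \<open>auto simp: Suc_le_eq\<close>)
          moreover have Ca: "C = cl (hy a')"
            unfolding hya using e' qS CF hF memS by (auto simp: fun_eq_iff)
          moreover have lq: "{b\<in>C q. b < a'} = {}"
          proof -
            have "card {b \<in> C q. b \<le> a} = 0" using cnt[of a q] z[of q] gh g_def CF hF by simp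
            then show ?thesis using fC a'_def by (auto simp: less_Suc_eq_le)
          qed
          moreover have "a' \<notin> C (Suc q)" using nS[of "Suc q"] CF hF memS by simp
          moreover have lq': "card {b\<in>C (Suc q). b \<le> a'} = 0"
          proof -
            have "card {b \<in> C (Suc q). b \<le> a} = 0" using cnt[of a "Suc q"] z[of "Suc q"] gh g_def CF hF by simp
            then show ?thesis using fC a'_def \<open>a' \<notin> C (Suc q)\<close> by (auto simp: le_Suc_eq)
          qed
          moreover have "a' \<in> C q" using qS CF hF memS by simp
          moreover have "card {b\<in>C q. b < a'} = card {b\<in>C (Suc q). b \<le> a'}" unfolding lq lq' by simp
          moreover have "\<forall>b\<in>C q. b < a' \<longrightarrow> b + 2 \<le> a'" using lq by blast
          ultimately have "minv W ?K C a' q" by (intro minv_start)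
          then show ?thesis using e' qS t'_def a'_def Ca qM by simp
        qed
      qed
    next
      case act: False
      define j where "j = tcol t"
      have tj: "t = New j \<or> t = Mark j" using act j_def by (cases t) auto
      have st: "step h S t = (S', t')" using e act i by (auto simp: ext_def a'_def)
      have same: "cl (hy a') = cl (hy a)" if "S' = S" unfolding hya using that memS by (auto simp: fun_eq_iff)
      from step_active[OF hp(1,2) i(1) act st j_def i(2)] show ?thesis
      proof (elim disjE exE conjE)
        assume s: "S' = S" "t' = t" and nx: "t = Mark j \<longrightarrow> \<not> (Suc j \<in> S \<and> j \<notin> S \<and> h j = Suc (h (Suc j)))"
        show ?thesis
          using tj
        proof
          assume "t = New j" then show ?thesis using IHt s same t'_def a'_def by simp
        next
          assume tm: "t = Mark j"
          then have m: "j < M" "minv W ?K (cl (hy a)) a j" using IHt by auto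
          have "ht G a' (Suc j) < ht G a' j"
          proof -
            have "ht G a' = adds h S" using i tm s g_def a'_def S'_def by simp
            moreover have "h (Suc j) < h j" using i tm by simp
            ultimately show ?thesis using nx tm by (auto simp: adds_def)
          qed
          then have "card {b\<in>cl (hy a) (Suc j). b \<le> Suc a} < card {b\<in>cl (hy a) j. b \<le> Suc a}"
            using cnt[of a' j] cnt[of a' "Suc j"] same[OF s(1)] a'_def by simp
          from minv_stay[OF m(2) fhy fhy this] have "minv W ?K (cl (hy (Suc a))) (Suc a) j"
            using same[OF s(1)] a'_def by simp
          moreover have "tk F x (Suc a) = Mark j" using s(2) tm unfolding t'_def by simp
          ultimately show ?thesis using m(1) by (simp del: tk.simps)
        qed
      next
        fix q assume q: "q \<le> j" "flat g q j" "\<forall>i<q. g j < g i" "q \<in> S'" and d: "landed S j S' t' q"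
          and n: "t = New j \<longrightarrow> j \<in> S"
          and mm: "t = Mark j \<longrightarrow> Suc j \<in> S \<and> j \<notin> S \<and> h j = Suc (h (Suc j))"
        have fl: "g c = g j" if "q \<le> c" "c \<le> j" for c using q(2) that unfolding flat_def by simp
        have gh: "c \<noteq> j \<Longrightarrow> g c = h c" for c using i(2) tj by auto
        have qM: "q < M" using colM q(4) by simp
        have nS: "c \<notin> S" if "q < c" "c < j" for c
          using vstripD[OF hp(2), of c q] that fl[of c] fl[of q] gh[of c] gh[of q] by auto
        have hc: "ht F a' c = g j" if "q < c \<or> q \<notin> S \<or> q = j" "q \<le> c" "c \<le> j" for c
        proof (cases "c = j")
          case True
          then show ?thesis using tj n mm i(2) hFa by (auto simp: adds_def)
        next
          case False
          then have "c \<notin> S" using nS[of c] that by (cases "c = q") auto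
          then show ?thesis using False gh[of c] fl[of c] that hFa by (simp add: adds_def)
        qed
        have Cmem: "a' \<in> C c \<longleftrightarrow> c \<in> S \<and> c \<noteq> j" for c
          using tj mm memS unfolding C_def j_def by auto
        have mv': "movable C a' c" if "q \<le> c" "c < j" "q < c \<or> q \<notin> S" for c
        proof (rule mv)
          show "a' \<notin> C c" using that nS[of c] Cmem[of c] by (cases "c = q") auto
          show "a' \<notin> C (Suc c)" using that nS[of "Suc c"] Cmem[of "Suc c"] by (cases "Suc c = j") auto
          have "g c = g j" "g (Suc c) = g j" by (rule fl; use that in simp)+
          then show "g c \<le> g (Suc c)" by linarith
          have "ht F a' c = g j" "ht F a' (Suc c) = g j" by (rule hc; use that in auto)+
          then show "ht F a' c \<le> ht F a' (Suc c)" by linarith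
        qed
        have jM: "j < M"
          using tj
        proof
          assume "t = New j" then show ?thesis using n fam_cols[OF f] S_def by blast
        next
          assume "t = Mark j" then show ?thesis using IHt by simp
        qed
        have Wj: "W \<approx> fw ?K (C(j := insert a' (C j)))"
          using tj
        proof
          assume tn: "t = New j"
          have "C(j := insert a' (C j)) = cl (hy a)"
            using n tn memS unfolding C_def fun_eq_iff by auto
          then show ?thesis using IHt tn by simp
        next
          assume tm: "t = Mark j"
          then have m: "minv W ?K (cl (hy a)) a j" using IHt by simp
          have Ch: "C = cl (hy a)" unfolding C_def using tm by auto
          have x: "Suc j \<in> S" "j \<notin> S" "h j = Suc (h (Suc j))" using mm tm by auto
          have gg: "g = h" using i tm by simp
          \<comment> \<open>The run ends here. Since the two columns differ by exactly one,
            \<open>s\<close> is the last letter up to \<open>a\<close> in column \<open>j\<close>;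
            all later entries exceed \<open>a'\<close>, and so \<open>a'\<close> is pushed into
            column \<open>j\<close>.\<close>
          have rn: "run (lst {b\<in>cl (hy a) j. s \<le> b}) (lst {b\<in>cl (hy a) (Suc j). a < b}) (Some a')"
            if s: "s \<in> cl (hy a) j" "s \<le> a" "card {b\<in>cl (hy a) j. b < s} = card {b\<in>cl (hy a) (Suc j). b \<le> a}" for s
          proof -
            have aA: "a' \<in> cl (hy a) (Suc j)" "a' \<notin> cl (hy a) j" using memS x by auto
            have l2: "lst {b\<in>cl (hy a) (Suc j). a < b} = a' # lst {b\<in>cl (hy a) (Suc j). a' < b}"
              using sls_ge[OF fhy aA(1)] by (simp add: Suc_le_eq a'_def)
            have "card (insert s {b\<in>cl (hy a) j. b < s}) = card {b \<in> cl (hy a) j. b \<le> a}"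
              using s cnt[of a j] cnt[of a "Suc j"] x gg g_def fhy by simp
            moreover have "insert s {b\<in>cl (hy a) j. b < s} \<subseteq> {b \<in> cl (hy a) j. b \<le> a}" using s by auto
            ultimately have eq: "insert s {b\<in>cl (hy a) j. b < s} = {b \<in> cl (hy a) j. b \<le> a}"
              using fhy by (intro card_subset_eq) auto
            have "\<forall>e\<in>set (lst {b\<in>cl (hy a) j. s < b}). a' < e"
            proof
              fix e assume "e \<in> set (lst {b\<in>cl (hy a) j. s < b})"
              then have e: "e \<in> cl (hy a) j" "s < e" using fhy by auto
              then have "\<not> e \<le> a" using eq by auto
              then show "a' < e" using e aA(2) a'_def by (metis Suc_leI le_neq_implies_less not_le)
            qed
            moreover have "\<forall>e\<in>set (lst {b\<in>cl (hy a) (Suc j). a' < b}). a' + 2 \<le> e"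
              using high[of _ j] hFa x fhy by (auto simp: adds_def)
            ultimately show ?thesis unfolding l2 sls_ge[OF fhy s(1)] using s(2) a'_def by (intro run_exit) auto
          qed
          have "W \<approx> fw ?K (case Some a' of None \<Rightarrow> cl (hy a) | Some z \<Rightarrow> (cl (hy a))(j := insert z (cl (hy a) j)))"
          proof (rule minv_apply[OF m])
            show "Suc j < ?K" using jM K by simp
          qed (rule fhy rn; assumption)+
          then show ?thesis unfolding Ch by simp
        qed
        show ?thesis
        proof (cases "t' = New q")
          case True
          then have e2: "S' = insert q (S - {j})" "q \<in> S \<longrightarrow> q = j" using d by (auto simp: landed_def)
          note Wj
          also have "fw ?K (C(j := insert a' (C j))) \<approx> fw ?K (C(q := insert a' (C q)))"
            by (rule fw_moves) (use q jM K mv' e2 in auto)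
          also have "C(q := insert a' (C q)) = cl (hy a')"
          proof
            fix c
            have "C c - {a'} = cl (hy a) c - {a'}" unfolding C_def by auto
            then show "(C(q := insert a' (C q))) c = cl (hy a') c"
              unfolding hya e2 using Cmem[of c] by auto
          qed
          finally show ?thesis using True t'_def a'_def by simp
        next
          case False
          then have e2: "S' = S - {j}" "q \<in> S" "q \<noteq> j" "t' = Mark q" using d by (auto simp: landed_def)
          then have qj: "q < j" using q by simp
          note Wj
          also have "fw ?K (C(j := insert a' (C j))) \<approx> fw ?K (C(Suc q := insert a' (C (Suc q))))"
            by (rule fw_moves) (use qj jM K mv' in \<open>auto simp: Suc_le_eq\<close>)
          finally have Wq: "W \<approx> fw ?K (C(Suc q := insert a' (C (Suc q))))" .
          have Ca: "C = cl (hy a')"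
          proof
            fix c
            have "C c - {a'} = cl (hy a) c - {a'}" unfolding C_def by auto
            then show "C c = cl (hy a') c" unfolding hya e2 using Cmem[of c] by auto
          qed
          have aq: "a' \<in> C q" using Cmem[of q] e2 by simp
          have aq': "a' \<notin> C (Suc q)" using Cmem[of "Suc q"] nS[of "Suc q"] qj by (cases "Suc q = j") auto
          have gqq: "g q = g (Suc q)" using fl[of q] fl[of "Suc q"] qj by simp
          have cC: "card {b\<in>C c. b \<le> a} = g c" for c
          proof -
            have "{b\<in>C c. b \<le> a} = {b\<in>cl (hy a) c. b \<le> a}" unfolding C_def a'_def by auto
            then show ?thesis using cnt g_def by simp
          qed
          have "{b\<in>C q. b < a'} = {b\<in>C q. b \<le> a}" using a'_def by auto
          moreover have "{b\<in>C (Suc q). b \<le> a'} = {b\<in>C (Suc q). b \<le> a}" using aq' a'_def by (auto simp: le_Suc_eq)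
          ultimately have cc: "card {b\<in>C q. b < a'} = card {b\<in>C (Suc q). b \<le> a'}"
            using cC[of q] cC[of "Suc q"] gqq by simp
          have "\<forall>b\<in>C q. b < a' \<longrightarrow> b + 2 \<le> a'" using low[of _ q] Csub gqq by auto
          from minv_start[OF aq aq' this Wq cc] show ?thesis using e2 t'_def a'_def Ca qM by simp
        qed
      qed
    qed
  qed simp
  have "hy M = G" using F0(3,4) by (auto simp: hy_def fun_eq_iff not_le)
  then have hM: "cl (hy M) = cl G" by simp
  have fwK: "fw ?K (cl G) = fw K (cl G)"
  proof -
    have "cl G K = {}" using fam_cols[OF fG, of K] K by (auto simp: cl_def)
    then show ?thesis by (simp add: fw_def cw_def)
  qed
  have act: "tk F x M \<noteq> Idle" using ins_inv[of M F x] f x by (auto simp: fam_def)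
  have "W \<approx> fw ?K (cl G)"
  proof (cases "tk F x M")
    case (New j) then show ?thesis using main[of M] hM by simp
  next
    case (Mark j)
    then have m: "j < M" "minv W ?K (cl G) M j" using main[of M] hM by auto
    have fc: "finite (cl G c)" for c using fhy[of M c] hM by simp
    \<comment> \<open>The right column has no letters above \<open>M\<close>, so the waiting copy is
      absorbed by its twin.\<close>
    have rn: "run (lst {b\<in>cl G j. s \<le> b}) (lst {b\<in>cl G (Suc j). M < b}) None" if "s \<in> cl G j" for s
    proof -
      have em: "{b\<in>cl G (Suc j). M < b} = {}" using F0 by (auto simp: cl_def)
      show ?thesis unfolding em sls_ge[OF fc that] by (simp add: run_None)
    qed
    have "W \<approx> fw ?K (case None of None \<Rightarrow> cl G | Some z \<Rightarrow> (cl G)(j := insert z (cl G j)))"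
    proof (rule minv_apply[OF m(2)])
      show "Suc j < ?K" using m(1) K by simp
    qed (rule fc rn; assumption)+
    then show ?thesis by simp
  qed (use act in simp)
  then show ?thesis using fwK W_def G_def by simp
qed

section \<open>Left keys as greedy matchings\<close>

text \<open>Covers both matchings that define left keys: the largest element below \<open>s\<close>,
  and the smallest element not below \<open>s\<close>. \<open>best\<close> is maximal for the
  preference order \<open>le\<close>, and the candidate sets form a chain of initial segments of
  this order.\<close>

locale greedy =
  fixes le :: "nat \<Rightarrow> nat \<Rightarrow> bool" and cand :: "nat \<Rightarrow> nat set" and best :: "nat set \<Rightarrow> nat"
  assumes le_antisym: "le x y \<Longrightarrow> le y x \<Longrightarrow> x = y"
    and le_total: "le x y \<or> le y x"
    and best_in: "finite A \<Longrightarrow> A \<noteq> {} \<Longrightarrow> best A \<in> A"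
    and best_le: "finite A \<Longrightarrow> x \<in> A \<Longrightarrow> le x (best A)"
    and cand_down: "t \<in> cand s \<Longrightarrow> le t' t \<Longrightarrow> t' \<in> cand s"
    and cand_mono: "le s s' \<Longrightarrow> cand s \<subseteq> cand s'"
begin

fun gaux :: "nat set \<Rightarrow> nat list \<Rightarrow> nat set" where
  "gaux T [] = {}"
| "gaux T (s # ss) = (let C = {t\<in>T. t \<in> cand s} in
     if C = {} then gaux T ss else insert (best C) (gaux (T - {best C}) ss))"

definition pick :: "nat set \<Rightarrow> nat \<Rightarrow> nat set" where
  "pick T s = (let C = {t\<in>T. t \<in> cand s} in if C = {} then {} else {best C})"

lemma gaux_Cons: "gaux T (s # ss) = pick T s \<union> gaux (T - pick T s) ss"
proof (cases "{t\<in>T. t \<in> cand s} = {}")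
  case True show ?thesis unfolding gaux.simps pick_def Let_def True by simp
next
  case False show ?thesis unfolding gaux.simps pick_def Let_def if_not_P[OF False] by simp
qed

declare gaux.simps(2) [simp del]

lemma best_eq: "finite A \<Longrightarrow> x \<in> A \<Longrightarrow> (\<And>y. y \<in> A \<Longrightarrow> le y x) \<Longrightarrow> best A = x"
  using best_in best_le le_antisym by (metis empty_iff)

text \<open>If the choice of \<open>s'\<close> is also open to \<open>s\<close>, both see the same
  candidates; otherwise the two choices do not interfere. Hence the picked set is independent of the
  order of traversal, and one theory serves the decreasing and the increasing direction.\<close>

lemma pick_swap1:
  assumes f: "finite T" and l: "le s s'"
  shows "pick T s \<union> pick (T - pick T s) s' = pick T s' \<union> pick (T - pick T s') s"
proof -
  let ?C = "{t\<in>T. t \<in> cand s}" and ?D = "{t\<in>T. t \<in> cand s'}"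
  have CD: "?C \<subseteq> ?D" using cand_mono[OF l] by auto
  have fC: "finite ?C" "finite ?D" using f by auto
  show ?thesis
  proof (cases "?C = {}")
    case True
    then have "{t \<in> T - X. t \<in> cand s} = {}" for X by auto
    then have "pick (T - X) s = {}" for X by (simp add: pick_def)
    then show ?thesis by (metis Diff_empty sup_bot.left_neutral sup_bot.right_neutral)
  next
    case False
    then have D: "?D \<noteq> {}" using CD by auto
    define b d where "b = best ?C" and "d = best ?D"
    have b: "b \<in> T" "b \<in> cand s" and d: "d \<in> T" "d \<in> cand s'" using best_in fC False D b_def d_def by auto
    have ps: "pick T s = {b}" "pick T s' = {d}" using False D b_def d_def by (auto simp: pick_def)
    show ?thesis
    proof (cases "d \<in> cand s")
      case True
      have "t \<in> cand s" if "t \<in> ?D" for t using cand_down[OF True] best_le[OF fC(2) that] d_def by simp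
      then have eq: "?C = ?D" using CD by auto
      then have "b = d" using b_def d_def by simp
      moreover have "{t \<in> T - {d}. t \<in> cand s} = {t \<in> T - {d}. t \<in> cand s'}" using eq by auto
      ultimately show ?thesis using ps by (simp add: pick_def)
    next
      case False
      then have bd: "b \<noteq> d" using b by auto
      have "best {t \<in> T - {b}. t \<in> cand s'} = d"
        using best_eq[of "{t \<in> T - {b}. t \<in> cand s'}" d] best_le[OF fC(2)] d bd f d_def by auto
      moreover have "best {t \<in> T - {d}. t \<in> cand s} = b"
        using best_eq[of "{t \<in> T - {d}. t \<in> cand s}" b] best_le[OF fC(1)] b bd f b_def by auto
      moreover have "{t \<in> T - {b}. t \<in> cand s'} \<noteq> {}" "{t \<in> T - {d}. t \<in> cand s} \<noteq> {}" using b d bd by auto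
      ultimately show ?thesis unfolding ps by (auto simp: pick_def)
    qed
  qed
qed

lemma pick_swap: "finite T \<Longrightarrow> pick T s \<union> pick (T - pick T s) s' = pick T s' \<union> pick (T - pick T s') s"
  using pick_swap1 le_total by metis

lemma gaux_swap:
  assumes "finite T" shows "gaux T (s # s' # ss) = gaux T (s' # s # ss)"
proof -
  have d: "T - A - B = T - (A \<union> B)" for A B by blast
  show ?thesis unfolding gaux_Cons Un_assoc[symmetric] d pick_swap[OF assms, of s s'] ..
qed

lemma pick_sub: "finite T \<Longrightarrow> pick T s \<subseteq> T \<inter> cand s"
  using best_in[of "{t\<in>T. t \<in> cand s}"] by (auto simp: pick_def Let_def)

lemma gaux_sub: "finite T \<Longrightarrow> gaux T ss \<subseteq> T"
proof (induction ss arbitrary: T)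
  case (Cons s ss)
  then show ?case using Cons.IH[of "T - pick T s"] pick_sub[of T s] by (auto simp: gaux_Cons)
qed simp

lemma gaux_mid: "finite T \<Longrightarrow> gaux T (us @ x # vs) = gaux T (x # us @ vs)"
proof (induction us arbitrary: T)
  case (Cons u us)
  have "gaux T ((u # us) @ x # vs) = pick T u \<union> gaux (T - pick T u) (x # us @ vs)"
    using Cons.IH[of "T - pick T u"] Cons.prems by (simp add: gaux_Cons[of T])
  also have "\<dots> = gaux T (u # x # us @ vs)" by (simp add: gaux_Cons[of T])
  finally show ?case using gaux_swap[OF Cons.prems] by simp
qed simp

lemma gaux_perm:
  "finite T \<Longrightarrow> distinct xs \<Longrightarrow> distinct ys \<Longrightarrow> set xs = set ys \<Longrightarrow> gaux T xs = gaux T ys"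
proof (induction xs arbitrary: T ys)
  case (Cons x xs)
  then obtain us vs where ys: "ys = us @ x # vs" by (metis list.set_intros(1) split_list)
  have "insert x (set xs) = insert x (set us \<union> set vs)" "x \<notin> set xs" "x \<notin> set us \<union> set vs"
    using Cons.prems ys by auto
  then have "set xs = set (us @ vs)" using insert_ident[of x "set xs" "set us \<union> set vs"] by simp
  then have "gaux (T - pick T x) xs = gaux (T - pick T x) (us @ vs)"
    using Cons.prems ys by (intro Cons.IH) auto
  then show ?case using gaux_mid[OF Cons.prems(1), of us x vs] ys by (simp add: gaux_Cons)
qed simp

lemma gaux_append: "gaux T (xs @ ys) = gaux T xs \<union> gaux (T - gaux T xs) ys"
proof (induction xs arbitrary: T)
  case (Cons x xs)
  have "T - pick T x - gaux (T - pick T x) xs = T - (pick T x \<union> gaux (T - pick T x) xs)" by blast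
  then show ?case using Cons by (simp add: gaux_Cons Un_assoc)
qed simp

definition G :: "nat set \<Rightarrow> nat set \<Rightarrow> nat set" where "G T S = gaux T (sorted_list_of_set S)"

lemma G_list: "finite T \<Longrightarrow> distinct xs \<Longrightarrow> gaux T xs = G T (set xs)"
  unfolding G_def by (rule gaux_perm) auto

lemma G_insert:
  assumes "finite T" "finite X" "s \<notin> X"
  shows "G T (insert s X) = G T X \<union> pick (T - G T X) s"
proof -
  let ?l = "sorted_list_of_set X"
  have "gaux T (?l @ [s]) = G T (insert s X)" using G_list[of T "?l @ [s]"] assms by simp
  then show ?thesis using gaux_append[of T ?l "[s]"] by (simp add: gaux_Cons G_def)
qed

lemma G_empty [simp]: "G T {} = {}" by (simp add: G_def)

lemma G_sub: "finite T \<Longrightarrow> G T X \<subseteq> T" unfolding G_def by (rule gaux_sub)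

lemma pick_card: "card (pick T s) \<le> 1" "finite (pick T s)" by (auto simp: pick_def Let_def)

lemma G_card:
  assumes "finite T" "finite X" shows "card (G T X) \<le> card X"
  using assms(2)
proof (induction X rule: finite_induct)
  case (insert s X)
  have "card (G T (insert s X)) \<le> card (G T X) + card (pick (T - G T X) s)"
    unfolding G_insert[OF assms(1) insert(1,2)] by (rule card_Un_le)
  then show ?case using insert pick_card(1)[of "T - G T X" s] by simp
qed simp

text \<open>Every element of \<open>X\<close> finds a partner. For adjacent columns of a tableau
  this holds, and it gives the key columns the sizes of the tableau columns.\<close>

definition full :: "nat set \<Rightarrow> nat set \<Rightarrow> bool" where "full T X \<longleftrightarrow> card (G T X) = card X"

lemma full_insertD:
  assumes "finite T" "finite X" "s \<notin> X" "full T (insert s X)"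
  shows "full T X" "pick (T - G T X) s \<noteq> {}"
proof -
  have "card (G T (insert s X)) \<le> card (G T X) + card (pick (T - G T X) s)"
    unfolding G_insert[OF assms(1-3)] by (rule card_Un_le)
  moreover have "card (G T X) \<le> card X" using G_card assms by blast
  moreover have "card (pick (T - G T X) s) \<le> 1" by (rule pick_card)
  moreover have "card (G T (insert s X)) = Suc (card X)" using assms by (simp add: full_def)
  ultimately have "card (G T X) = card X" "card (pick (T - G T X) s) = 1" by linarith+
  then show "full T X" "pick (T - G T X) s \<noteq> {}" by (auto simp: full_def)
qed

lemma G_union:
  assumes "finite T" "finite X" "finite Z"
  shows "G T X \<subseteq> G T (X \<union> Z) \<and> (\<forall>t\<in>G T (X \<union> Z) - G T X. \<exists>s\<in>Z. t \<in> cand s) \<and> (full T (X \<union> Z) \<longrightarrow> full T X)"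
  using assms(3)
proof (induction Z rule: finite_induct)
  case (insert s Z)
  show ?case
  proof (cases "s \<in> X \<union> Z")
    case True then show ?thesis using insert by (auto simp: insert_absorb)
  next
    case False
    have f: "finite (X \<union> Z)" using assms insert by simp
    have e: "X \<union> insert s Z = insert s (X \<union> Z)" by simp
    note g = G_insert[OF assms(1) f False]
    have p: "pick (T - G T (X \<union> Z)) s \<subseteq> cand s" using pick_sub[of "T - G T (X \<union> Z)" s] assms by auto
    show ?thesis unfolding e g using insert.IH p full_insertD(1)[OF assms(1) f False] by auto
  qed
qed simp

lemma G_mono: "finite T \<Longrightarrow> finite Y \<Longrightarrow> X \<subseteq> Y \<Longrightarrow> G T X \<subseteq> G T Y"
  using G_union[of T X "Y - X"] finite_subset[of X Y] by (simp add: Un_absorb1)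

lemma full_mono: "finite T \<Longrightarrow> finite Y \<Longrightarrow> X \<subseteq> Y \<Longrightarrow> full T Y \<Longrightarrow> full T X"
  using G_union[of T X "Y - X"] finite_subset[of X Y] by (simp add: Un_absorb1)

text \<open>The best element of \<open>Y - X\<close> has the largest candidate set there, and this
  set contains everything that \<open>Y\<close> picks beyond \<open>X\<close>. So best goes to best,
  which is what survives iteration over several columns.\<close>

lemma G_chain:
  assumes T: "finite T" and Y: "finite Y" "X \<subseteq> Y" "X \<noteq> Y" and fl: "full T Y"
  shows "G T (insert (best (Y - X)) X) = insert (best (G T Y - G T X)) (G T X)"
proof -
  define m where "m = best (Y - X)"
  have X: "finite X" using Y finite_subset by blast
  have m: "m \<in> Y" "m \<notin> X" using best_in[of "Y - X"] Y m_def by auto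
  have sub: "insert m X \<subseteq> Y" using m Y by auto
  have "full T (insert m X)" using full_mono[OF T Y(1) sub fl] .
  then have p: "pick (T - G T X) m \<noteq> {}" using full_insertD(2)[OF T X m(2)] by simp
  let ?C = "{t\<in>T - G T X. t \<in> cand m}"
  define b where "b = best ?C"
  have pb: "pick (T - G T X) m = {b}" "?C \<noteq> {}" using p b_def by (auto simp: pick_def Let_def split: if_splits)
  have bC: "b \<in> ?C" using best_in[of ?C] pb(2) T b_def by auto
  have g: "G T (insert m X) = insert b (G T X)" using G_insert[OF T X m(2)] pb by simp
  have "best (G T Y - G T X) = b"
  proof (rule best_eq)
    show "finite (G T Y - G T X)" using G_sub[OF T, of Y] T finite_subset by blast
    show "b \<in> G T Y - G T X" using G_mono[OF T Y(1) sub] g bC by auto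
    fix t assume t: "t \<in> G T Y - G T X"
    have u: "X \<union> (Y - X) = Y" using Y by auto
    have "finite (Y - X)" using Y by simp
    from G_union[OF T X this, unfolded u] t obtain s where s: "s \<in> Y - X" "t \<in> cand s" by blast
    have "le s m" unfolding m_def using best_le[of "Y - X" s] s Y by simp
    then have "t \<in> ?C" using cand_mono s t G_sub[OF T, of Y] by blast
    then show "le t b" unfolding b_def using best_le[of ?C t] T by simp
  qed
  then show ?thesis using g m_def by simp
qed

definition Ph :: "(nat \<Rightarrow> nat set) \<Rightarrow> nat \<Rightarrow> nat set \<Rightarrow> nat set" where
  "Ph D c X = foldr (\<lambda>i X. G (D i) X) [0..<c] X"

definition lk :: "(nat \<Rightarrow> nat set) \<Rightarrow> nat \<Rightarrow> nat set" where "lk D c = Ph D c (D c)"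

lemma Ph_simps [simp]: "Ph D 0 X = X" "Ph D (Suc c) X = Ph D c (G (D c) X)"
  by (simp_all add: Ph_def)

lemma Ph_chain:
  assumes "\<And>i. finite (D i)" "\<And>i. i < c \<Longrightarrow> full (D i) (D (Suc i))" "Y \<subseteq> D c" "X \<subseteq> Y" "X \<noteq> Y"
  shows "Ph D c (insert (best (Y - X)) X) = insert (best (Ph D c Y - Ph D c X)) (Ph D c X) \<and> Ph D c X \<subset> Ph D c Y"
  using assms(2-5)
proof (induction c arbitrary: X Y)
  case (Suc c)
  have fY: "finite Y" using Suc.prems assms(1) finite_subset by blast
  have fl: "full (D c) Y" using full_mono[of "D c" "D (Suc c)" Y] Suc.prems assms(1) by auto
  have ne: "G (D c) X \<noteq> G (D c) Y"
  proof
    assume "G (D c) X = G (D c) Y"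
    then have "card Y = card X" using fl full_mono[OF assms(1) fY Suc.prems(3) fl] by (simp add: full_def)
    then show False using card_subset_eq[OF fY Suc.prems(3)] Suc.prems(4) by simp
  qed
  have "Ph D (Suc c) (insert (best (Y - X)) X) = Ph D c (insert (best (G (D c) Y - G (D c) X)) (G (D c) X))"
    using G_chain[OF assms(1) fY Suc.prems(3,4) fl] by simp
  then show ?case using Suc.IH[of "G (D c) Y" "G (D c) X"] Suc.prems(1) G_sub[OF assms(1)] G_mono[OF assms(1) fY Suc.prems(3)] ne
    by simp
qed auto

lemma lk_insert:
  assumes f: "\<And>i. finite (D i)" and fl: "\<And>i. i \<le> k \<Longrightarrow> full (D i) (D (Suc i))"
    and a: "a \<notin> D (Suc k)" "D k \<subseteq> cand a" and c: "card (D (Suc k)) < card (D k)"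
  shows "Ph D (Suc k) (insert a (D (Suc k))) = insert (best (lk D k - lk D (Suc k))) (lk D (Suc k))"
    "lk D (Suc k) \<subset> lk D k" "full (D k) (insert a (D (Suc k)))"
proof -
  let ?X = "G (D k) (D (Suc k))"
  have cX: "card ?X = card (D (Suc k))" using fl[of k] by (simp add: full_def)
  have XD: "?X \<subseteq> D k" "?X \<noteq> D k" using G_sub[OF f] cX c by auto
  have C: "{t\<in>D k - ?X. t \<in> cand a} = D k - ?X" using a by auto
  then have pk: "pick (D k - ?X) a = {best (D k - ?X)}" using XD by (auto simp: pick_def)
  have g: "G (D k) (insert a (D (Suc k))) = insert (best (D k - ?X)) ?X"
    using G_insert[OF f f a(1)] pk by simp
  have ch: "Ph D k (insert (best (D k - ?X)) ?X) = insert (best (Ph D k (D k) - Ph D k ?X)) (Ph D k ?X) \<and> Ph D k ?X \<subset> Ph D k (D k)"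
    by (rule Ph_chain) (use f fl XD in auto)
  show "Ph D (Suc k) (insert a (D (Suc k))) = insert (best (lk D k - lk D (Suc k))) (lk D (Suc k))"
    "lk D (Suc k) \<subset> lk D k"
    using ch g by (auto simp: lk_def)
  have "best (D k - ?X) \<notin> ?X" using best_in[of "D k - ?X"] XD f by auto
  then show "full (D k) (insert a (D (Suc k)))"
    unfolding full_def g using cX a(1) f finite_subset[OF XD(1) f] by simp
qed

lemma G_irrelevant:
  assumes "finite T" "finite X" "\<forall>s\<in>X. a \<notin> cand s"
  shows "G (insert a T) X = G T X"
proof (cases "a \<in> T")
  case False
  have "gaux (insert a T) ss = gaux T ss" if "\<forall>s\<in>set ss. a \<notin> cand s" "a \<notin> T" "finite T" for ss T
    using that
  proof (induction ss arbitrary: T)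
    case (Cons s ss)
    have p: "pick (insert a T) s = pick T s"
    proof -
      have "{t \<in> insert a T. t \<in> cand s} = {t\<in>T. t \<in> cand s}" using Cons.prems by auto
      then show ?thesis by (simp add: pick_def)
    qed
    have "insert a T - pick T s = insert a (T - pick T s)" using pick_sub[of T s] Cons.prems by auto
    then show ?case using Cons p by (simp add: gaux_Cons)
  qed simp
  then show ?thesis using assms False by (simp add: G_def)
qed (simp add: insert_absorb)

lemma full_irrelevant:
  "finite T \<Longrightarrow> finite X \<Longrightarrow> \<forall>s\<in>X. a \<notin> cand s \<Longrightarrow> full (insert a T) X = full T X"
  by (simp add: full_def G_irrelevant)

lemma Ph_cong:
  assumes "\<And>i. finite (D i)" "finite X" "\<And>i Z. i < c \<Longrightarrow> finite Z \<Longrightarrow> (\<forall>s\<in>Z. P (Suc i) s) \<Longrightarrow> G (D' i) Z = G (D i) Z"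
    "\<And>i. i < c \<Longrightarrow> \<forall>s\<in>D i. P i s" "\<forall>s\<in>X. P c s"
  shows "Ph D' c X = Ph D c X"
  using assms(2-5)
proof (induction c arbitrary: X)
  case (Suc c)
  have e: "G (D' c) X = G (D c) X" using Suc.prems by simp
  have "G (D c) X \<subseteq> D c" using G_sub[OF assms(1)] by simp
  then have "\<forall>s\<in>G (D c) X. P c s" "finite (G (D c) X)" using Suc.prems(3)[of c] finite_subset[OF _ assms(1)] by auto
  then have "Ph D' c (G (D c) X) = Ph D c (G (D c) X)" by (intro Suc.IH) (use Suc.prems in auto)
  then show ?case using e by simp
qed simp

end

interpretation gl: greedy "(\<le>)" "\<lambda>s. {..<s}" Max
  by unfold_locales auto

interpretation gh: greedy "(\<ge>)" "\<lambda>s. {s..}" Min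
  by unfold_locales auto

lemma tri_aux_gaux: "tri_aux T ss = gl.gaux T ss"
  by (induction ss arbitrary: T) (auto simp: gl.gaux.simps(2) Let_def)

lemma tri_G: "finite T \<Longrightarrow> finite S \<Longrightarrow> tri T S = gl.G T S"
  unfolding tri_def tri_aux_gaux using gl.G_list[of T "rev (sorted_list_of_set S)"] by simp

lemma tri_ge_aux_gaux: "tri_ge_aux T ss = gh.gaux T ss"
  by (induction ss arbitrary: T) (auto simp: gh.gaux.simps(2) Let_def)

lemma tri_ge_G: "tri_ge T S = gh.G T S"
  unfolding tri_ge_def tri_ge_aux_gaux gh.G_def ..

section \<open>The two greedy left keys and their weight vectors\<close>

definition Da :: "(nat \<Rightarrow> nat set) \<Rightarrow> nat \<Rightarrow> nat \<Rightarrow> nat set" where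
  "Da F a c = {b \<in> cl F c. 0 < b \<and> b \<le> a}"

lemma Da_finite [simp]: "finite (Da F a c)"
  unfolding Da_def by (rule finite_subset[of _ "{..a}"]) auto

lemma Da_Suc: "Da F (Suc a) c = (if c \<in> F (Suc a) then insert (Suc a) (Da F a c) else Da F a c)"
  unfolding Da_def cl_def by (auto simp: le_Suc_eq)

text \<open>Letters are added in increasing order. The newest letter is not smaller than any other,
  hence never a candidate for one; so only the key columns in the strip change, in the way given by
  \<open>lk_insert\<close>.\<close>

lemma lk_al:
  assumes "\<forall>b<a. vstrip (ht F b) (F (Suc b))"
  shows "(\<forall>c. gl.lk (Da F a) c = {i. c < al F a i}) \<and> (\<forall>c. gl.full (Da F a c) (Da F a (Suc c)))"
  using assms
proof (induction a)
  case 0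
  have "Da F 0 c = {}" for c by (auto simp: Da_def)
  moreover have "gl.Ph D c {} = {}" for D c by (induction c) auto
  ultimately show ?case by (simp add: gl.lk_def gl.full_def)
next
  case (Suc a)
  let ?a = "Suc a" and ?S = "F (Suc a)" and ?D = "Da F a" and ?D' = "Da F (Suc a)" and ?al = "al F a"
  have IH: "\<And>c. gl.lk ?D c = {i. c < ?al i}" "\<And>c. gl.full (?D c) (?D (Suc c))" using Suc by auto
  have v: "vstrip (ht F a) ?S" using Suc.prems by simp
  have kv: "kv a (ht F a) ?al" using kv_al[of a F] Suc.prems by simp
  have Dle: "\<forall>s\<in>?D c. s \<le> a" for c by (auto simp: Da_def)
  have irr: "gl.G (?D' i) Z = gl.G (?D i) Z" if "finite Z" "\<forall>s\<in>Z. s \<le> ?a" for i Z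
  proof -
    have "\<forall>s\<in>Z. ?a \<notin> {..<s}" using that by (auto simp: not_less)
    then show ?thesis using gl.G_irrelevant[of "?D i" Z ?a] that(1) by (simp add: Da_Suc)
  qed
  have Ph: "gl.Ph ?D' c X = gl.Ph ?D c X" if "finite X" "\<forall>s\<in>X. s \<le> ?a" for c X
    by (rule gl.Ph_cong[where P = "\<lambda>_ s. s \<le> ?a"]) (use that irr Dle in \<open>auto intro: le_SucI\<close>)
  have lk: "gl.lk ?D' c = gl.Ph ?D c (?D' c)" for c
    unfolding gl.lk_def by (rule Ph[OF Da_finite]) (simp add: Da_def)
  have na: "?a \<notin> ?D c" "?D c \<subseteq> {..<?a}" for c by (auto simp: Da_def)
  have crd: "card (?D (Suc k)) < card (?D k)" if "Suc k \<in> ?S" for k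
    using vstripD[OF v that, of k] by (simp add: ht_card Da_def)
  have main: "gl.lk ?D' c = {i. c < al F ?a i}" for c
  proof (cases "c \<in> ?S")
    case False
    then have "{i. c < al F ?a i} = {i. c < ?al i}" by (auto simp: upd_def less_Suc_eq split: if_splits)
    then show ?thesis using lk[of c] IH(1)[of c] False by (simp add: Da_Suc gl.lk_def)
  next
    case True
    obtain i0 where "0 < i0" "i0 \<le> ?a" "?al i0 = c" using kv_level_ex[OF kv, of c] v True by (auto simp: vstrip_def)
    then obtain m where m: "topi ?a ?al m" "?al m = c" using top_ex by blast
    have "(c < upd ?a ?S ?al i) = (i = m \<or> c < ?al i)" for i
    proof (cases "?al i = c")
      case ic: True
      then show ?thesis using upd_level[OF m True ic] by auto
    next
      case False
      then show ?thesis using m by (auto simp: upd_def)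
    qed
    then have up: "{i. c < al F ?a i} = insert m {i. c < ?al i}" by auto
    show ?thesis
    proof (cases c)
      case 0
      have "?al ?a = 0" by (simp add: al_zero)
      then have "m = ?a" using m 0 unfolding topi_def by (metis le_neq_implies_less order_refl)
      moreover have "gl.lk ?D' 0 = insert ?a (?D 0)" using True 0 by (simp add: gl.lk_def Da_Suc)
      moreover have "?D 0 = {i. 0 < ?al i}" using IH(1)[of 0] by (simp add: gl.lk_def)
      ultimately show ?thesis using up 0 by simp
    next
      case (Suc k)
      have "gl.lk ?D' c = insert (Max (gl.lk ?D k - gl.lk ?D c)) (gl.lk ?D c)"
        unfolding lk using gl.lk_insert(1)[of ?D k ?a] IH(2) na crd True Suc by (simp add: Da_Suc)
      moreover have "Max (gl.lk ?D k - gl.lk ?D c) = m"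
      proof (rule Max_eqI)
        have e: "gl.lk ?D k - gl.lk ?D c = {i. ?al i = c}" using IH(1) Suc by auto
        show "finite (gl.lk ?D k - gl.lk ?D c)" using IH(1)[of k] kv_fin[OF kv] by simp
        show "m \<in> gl.lk ?D k - gl.lk ?D c" using e m by simp
        fix i assume "i \<in> gl.lk ?D k - gl.lk ?D c"
        then have i: "?al i = c" using e by simp
        then have "i \<le> ?a" using al_supp[of F a i] Suc by auto
        then show "i \<le> m" using m i unfolding topi_def by (metis not_le)
      qed
      ultimately show ?thesis using up IH(1)[of c] by simp
    qed
  qed
  have "gl.full (?D' c) (?D' (Suc c))" for c
  proof -
    have f1: "gl.full (?D c) (?D' (Suc c))"
      using gl.lk_insert(3)[of ?D c ?a] IH(2) na crd by (auto simp: Da_Suc)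
    have "\<forall>s\<in>?D' (Suc c). ?a \<notin> {..<s}" by (auto simp: Da_def)
    then have "gl.full (insert ?a (?D c)) (?D' (Suc c))" using gl.full_irrelevant[of "?D c" "?D' (Suc c)" ?a] f1 by simp
    then show ?thesis using f1 by (simp add: Da_Suc[of F a c])
  qed
  then show ?case using main by blast
qed

text \<open>Only \<open>New\<close> tokens count: labels arrive in decreasing order, so the label
  that creates a cell is the largest it will ever contain. These are the columns of the tableau of
  maxima.\<close>

fun qC :: "nat list \<Rightarrow> code list \<Rightarrow> nat \<Rightarrow> nat set" where
  "qC (i # is) (Tok (New j) # cs) = (qC is cs)(j := insert i (qC is cs j))"
| "qC (i # is) (c # cs) = qC is cs"
| "qC is cs = (\<lambda>_. {})"

lemma qC_finite [simp]: "finite (qC is cs c)"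
  by (induction "is" cs arbitrary: c rule: qC.induct) auto

lemma qC_zip: "i \<in> qC is cs c \<Longrightarrow> (i, Tok (New c)) \<in> set (zip is cs)"
  by (induction "is" cs rule: qC.induct) (auto split: if_splits)

lemma cls_trans: "cls a b \<Longrightarrow> cls b c \<Longrightarrow> cls a c"
  by (cases a; cases b; cases c) auto

lemma adj_cls_all:
  assumes "adj cls (i # is) (c # cs)" "sorted (i # is)" "(i, c') \<in> set (zip is cs)"
  shows "cls c' c"
  using assms
proof (induction "is" arbitrary: c cs)
  case (Cons i' "is")
  then obtain d ds where cs: "cs = d # ds" by (cases cs) auto
  have "i = i' \<or> i \<in> set is" using Cons.prems(3) cs by (auto dest: set_zip_leftD)
  then have "i' = i" using Cons.prems(2) by auto
  then have "cls d c" using Cons.prems cs by simp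
  show ?case
  proof (cases "c' = d")
    case False
    then have "(i, c') \<in> set (zip is ds)" using Cons.prems cs by auto
    then have "cls c' d" using Cons cs \<open>i' = i\<close> by auto
    then show ?thesis using \<open>cls d c\<close> cls_trans by blast
  qed (use \<open>cls d c\<close> in simp)
qed simp

lemma adj_tl: "adj R (i # is) (c # cs) \<Longrightarrow> adj R is cs"
  by (cases "is"; cases cs) auto

text \<open>Mirror image of \<open>lk_al\<close>, with labels arriving in decreasing order.
  Strictness under equal labels makes the new label smaller than all labels in columns from
  \<open>j\<close> on, and so it is never a candidate for them.\<close>

lemma lk_aq:
  assumes "part g" "vcode N M g cs" "length is = length cs" "sorted is" "adj cls is cs"
  shows "(\<forall>c. gh.lk (qC is cs) c = {i. c < aq is cs i}) \<and> (\<forall>c. gh.full (qC is cs c) (qC is cs (Suc c)))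
    \<and> (\<forall>c. card (qC is cs c) = g c)"
  using assms
proof (induction cs arbitrary: g "is")
  case Nil
  have "gh.Ph D c {} = {}" for D c by (induction c) auto
  then show ?case using Nil by (simp add: gh.lk_def gh.full_def)
next
  case (Cons x cs)
  then obtain i js where iseq: "is = i # js" by (cases "is") auto
  have js: "sorted js" "length js = length cs" "\<forall>k\<in>set js. i \<le> k" "adj cls js cs"
    using Cons.prems iseq adj_tl[of cls i js x cs] by auto
  show ?case
  proof (cases x)
    case (Let y)
    then have "vcode N M g cs" using Cons.prems by simp
    from Cons.IH[OF Cons.prems(1) this js(2,1,4)] show ?thesis using Let iseq by simp
  next
    case (Tok t)
    then have t: "corner g t" "vcode N M (down g t) cs" using Cons.prems by auto
    note d = part_down[OF Cons.prems(1) t(1)]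
    note IH0 = Cons.IH[OF d(1) t(2) js(2,1,4)]
    show ?thesis
    proof (cases "\<exists>j. t = New j")
      case False
      then have "down g t = g" "aq is (x # cs) = aq js cs" "qC is (x # cs) = qC js cs" using Tok iseq t(1)
        by (cases t; auto simp: corner_def)+
      then show ?thesis using IH0 by simp
    next
      case True
      then obtain j where j: "t = New j" by blast
      let ?h = "down g t" and ?D = "qC js cs" and ?al = "aq js cs"
      define D' where "D' = ?D(j := insert i (?D j))"
      have q: "qC is (x # cs) = D'" "aq is (x # cs) = qup i j ?al" using Tok j iseq D'_def by simp_all
      have IH: "\<And>c. gh.lk ?D c = {i. c < ?al i}" "\<And>c. gh.full (?D c) (?D (Suc c))" "\<And>c. card (?D c) = ?h c"
        using IH0 by auto
      have k: "kq ?h ?al" "\<And>k. 0 < ?al k \<Longrightarrow> i \<le> k" using kq_aq[OF d(1) t(2) js(2,1)] js(3) by blast+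
      have o: "\<forall>l<j. ?h j < ?h l" using d(2) j by simp
      obtain m where m: "qup i j ?al = ?al(m := Suc j)" "?al m = j" "i \<le> m" "\<And>k. i \<le> k \<Longrightarrow> ?al k = j \<Longrightarrow> m \<le> k"
        using qup_props[OF k o] by blast
      have ge: "i \<le> s" if "s \<in> ?D c" for s c using qC_zip[OF that] js(3) by (auto dest: set_zip_leftD)
      have gt: "i < s" if "s \<in> ?D c" "j \<le> c" for s c
      proof (rule ccontr)
        assume "\<not> i < s"
        then have "s = i" using ge[OF that(1)] by simp
        then have "cls (Tok (New c)) x" using adj_cls_all[of i js x cs "Tok (New c)"] qC_zip[OF that(1)] Cons.prems iseq by auto
        then show False using Tok j that by simp
      qed
      have ni: "i \<notin> ?D j" using gt by blast
      have fD': "finite (D' c)" for c by (simp add: D'_def)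
      have irr: "gh.G (D' l) Z = gh.G (?D l) Z" if "finite Z" "j < Suc l \<longrightarrow> (\<forall>s\<in>Z. i < s)" for l Z
      proof (cases "l = j")
        case True
        then have "\<forall>s\<in>Z. i \<notin> {s..}" using that by (auto simp: not_le)
        then show ?thesis using gh.G_irrelevant[of "?D l" Z i] that(1) True by (simp add: D'_def)
      qed (simp add: D'_def)
      have Ph: "gh.Ph D' c X = gh.Ph ?D c X" if "finite X" "j < c \<longrightarrow> (\<forall>s\<in>X. i < s)" for c X
        by (rule gh.Ph_cong[where P = "\<lambda>k s. j < k \<longrightarrow> i < s"]) (use that irr gt in auto)
      have lkD: "gh.lk D' c = gh.Ph ?D c (D' c)" for c
        unfolding gh.lk_def by (rule Ph[OF fD']) (use gt in \<open>auto simp: D'_def\<close>)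
      have up: "{k. c < (?al(m := Suc j)) k} = (if c = j then insert m {k. c < ?al k} else {k. c < ?al k})" for c
        using m(2) by (auto simp: less_Suc_eq)
      have main: "gh.lk D' c = {k. c < (?al(m := Suc j)) k}" for c
      proof (cases "c = j")
        case False
        then show ?thesis using lkD[of c] IH(1)[of c] up[of c] by (simp add: D'_def gh.lk_def)
      next
        case cj: True
        show ?thesis
        proof (cases j)
          case 0
          have "?D 0 = {k. 0 < ?al k}" using IH(1)[of 0] by (simp add: gh.lk_def)
          then have "?al i = 0" using ni 0 by auto
          then have "m = i" using m(3) m(4)[of i] 0 by simp
          then show ?thesis using lkD[of c] up[of c] cj 0 \<open>?D 0 = _\<close> by (simp add: D'_def)
        next
          case (Suc l)
          have "card (?D (Suc l)) < card (?D l)" using IH(3) o Suc by simp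
          then have "gh.lk D' j = insert (Min (gh.lk ?D l - gh.lk ?D j)) (gh.lk ?D j)"
            unfolding lkD using gh.lk_insert(1)[of ?D l i] IH(2) ni ge Suc by (auto simp: D'_def)
          moreover have "Min (gh.lk ?D l - gh.lk ?D j) = m"
          proof (rule Min_eqI)
            have e: "gh.lk ?D l - gh.lk ?D j = {k. ?al k = j}" using IH(1) Suc by auto
            show "finite (gh.lk ?D l - gh.lk ?D j)" using IH(1)[of l] kq_fin[OF k(1)] by simp
            show "m \<in> gh.lk ?D l - gh.lk ?D j" using e m by simp
            fix k' assume "k' \<in> gh.lk ?D l - gh.lk ?D j"
            then have "?al k' = j" using e by simp
            then show "m \<le> k'" using m(4)[of k'] k(2)[of k'] Suc by simp
          qed
          ultimately show ?thesis using up[of c] cj IH(1)[of j] by simp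
        qed
      qed
      moreover have "gh.full (D' c) (D' (Suc c))" for c
      proof -
        have f1: "gh.full (?D c) (D' (Suc c))"
        proof (cases "Suc c = j")
          case True
          have "card (?D (Suc c)) < card (?D c)" using IH(3) o True by auto
          then show ?thesis using gh.lk_insert(3)[of ?D c i] IH(2) ni ge True by (auto simp: D'_def)
        next
          case False then show ?thesis using IH(2) by (simp add: D'_def)
        qed
        show ?thesis
        proof (cases "c = j")
          case True
          have "\<forall>s\<in>D' (Suc c). i \<notin> {s..}" using gt[of _ "Suc j"] True by (simp add: D'_def not_le)
          then show ?thesis using f1 gh.full_irrelevant[of "?D c" "D' (Suc c)" i] True fD' by (simp add: D'_def)
        next
          case False then show ?thesis using f1 by (simp add: D'_def)
        qed
      qed
      moreover have "card (D' c) = g c" for c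
      proof -
        have "up ?h t = g" using d by simp
        then have "g c = (if c = j then Suc (?h j) else ?h c)" using j by (metis fun_upd_apply up.simps(1))
        then show ?thesis using IH(3) ni by (auto simp: D'_def)
      qed
      ultimately show ?thesis unfolding q m(1) by blast
    qed
  qed
qed

section \<open>Increasing tableaux as column families\<close>

text \<open>Cells of tableaux are numbered from 1, columns of height functions and families from 0;
  \<open>mkT\<close>, \<open>hts\<close> and \<open>dg\<close> translate between the two
  conventions.\<close>

definition mkT :: "(nat \<Rightarrow> nat) \<Rightarrow> (nat \<Rightarrow> nat \<Rightarrow> 'a) \<Rightarrow> 'a list list" where
  "mkT h e = map (\<lambda>r. map (\<lambda>c. e (Suc r) (Suc c)) [0..<first_col h r]) [0..<h 0]"

definition hts :: "'a list list \<Rightarrow> nat \<Rightarrow> nat" where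
  "hts T c = card {r. (r, Suc c) \<in> cells T}"

definition dg :: "(nat \<Rightarrow> nat) \<Rightarrow> (nat \<times> nat) set" where
  "dg h = {(r, c). 1 \<le> r \<and> 1 \<le> c \<and> r \<le> h (c - 1)}"

lemma first_col_less: "part h \<Longrightarrow> c < first_col h r \<longleftrightarrow> r < h c"
  using first_col(1)[of h r] first_col(2)[of h c r] partD[of h "first_col h r" c] by linarith

lemma cells_mkT: "part h \<Longrightarrow> cells (mkT h e) = dg h"
proof -
  assume h: "part h"
  have "(1 \<le> r \<and> r \<le> h 0 \<and> 1 \<le> c \<and> c \<le> length (mkT h e ! (r - 1))) \<longleftrightarrow> (1 \<le> r \<and> 1 \<le> c \<and> r \<le> h (c - 1))" for r c
  proof (cases "1 \<le> r \<and> 1 \<le> c")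
    case True
    then have "r - 1 < h 0 \<Longrightarrow> length (mkT h e ! (r - 1)) = first_col h (r - 1)" by (simp add: mkT_def)
    moreover have "c \<le> first_col h (r - 1) \<longleftrightarrow> r \<le> h (c - 1)"
      using first_col_less[OF h, of "c - 1" "r - 1"] True by auto
    moreover have "h (c - 1) \<le> h 0" using partD[OF h, of 0 "c - 1"] by simp
    ultimately show ?thesis using True by (metis One_nat_def Suc_le_eq Suc_pred le_trans zero_less_one less_le_trans)
  qed auto
  then show ?thesis unfolding cells_def dg_def by (auto simp: mkT_def)
qed

lemma entry_mkT: "part h \<Longrightarrow> (r, c) \<in> dg h \<Longrightarrow> entry (mkT h e) r c = e r c"
proof -
  assume h: "part h" and "(r, c) \<in> dg h"
  then have r: "1 \<le> r" "1 \<le> c" "r \<le> h (c - 1)" by (auto simp: dg_def)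
  have "c - 1 < first_col h (r - 1)" using first_col_less[OF h] r by simp
  moreover have "r - 1 < h 0" using partD[OF h, of 0 "c - 1"] r by simp
  ultimately show ?thesis using r by (simp add: entry_def mkT_def)
qed

lemma young_mkT: "part h \<Longrightarrow> young (mkT h e)"
proof -
  assume h: "part h"
  have "first_col h r \<noteq> 0" if "r < h 0" for r using first_col_less[OF h, of 0 r] that by simp
  moreover have "first_col h (Suc r) \<le> first_col h r" for r
    using first_col_less[OF h, of "first_col h r" "Suc r"] first_col(1)[OF h, of r] by (simp add: not_less[symmetric])
  ultimately show ?thesis unfolding young_def mkT_def by auto
qed

lemma young_len: "young T \<Longrightarrow> i \<le> j \<Longrightarrow> j < length T \<Longrightarrow> length (T ! j) \<le> length (T ! i)"
proof (induction j)
  case (Suc j)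
  show ?case
  proof (cases "i = Suc j")
    case False
    then have "length (T ! j) \<le> length (T ! i)" using Suc by simp
    moreover have "length (T ! Suc j) \<le> length (T ! j)" using Suc.prems by (simp add: young_def)
    ultimately show ?thesis by simp
  qed simp
qed simp

lemma young_cells:
  assumes "young T"
  shows "cells T = dg (hts T)" "part (hts T)" "r < length T \<Longrightarrow> first_col (hts T) r = length (T ! r)" "hts T 0 = length T"
proof -
  have hts: "(r, Suc c) \<in> cells T \<longleftrightarrow> 1 \<le> r \<and> r \<le> hts T c" for r c
  proof -
    let ?A = "{r. (r, Suc c) \<in> cells T}"
    have f: "finite ?A" by (rule finite_subset[of _ "{..length T}"]) (auto simp: cells_def)
    have dn: "r' \<in> ?A" if "r \<in> ?A" "1 \<le> r'" "r' \<le> r" for r r'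
    proof -
      have "1 \<le> r" "r \<le> length T" "Suc c \<le> length (T ! (r - 1))" using that(1) by (auto simp: cells_def)
      moreover from this have "length (T ! (r - 1)) \<le> length (T ! (r' - 1))" by (intro young_len[OF assms]) (use that in linarith)+
      ultimately show ?thesis using that(2,3) by (simp add: cells_def)
    qed
    show ?thesis
    proof (cases "?A = {}")
      case True then show ?thesis by (auto simp: hts_def)
    next
      case False
      have m: "Max ?A \<in> ?A" using Max_in[OF f False] .
      have "?A = {1..Max ?A}"
      proof
        show "?A \<subseteq> {1..Max ?A}" using f by (auto simp: cells_def)
        show "{1..Max ?A} \<subseteq> ?A" using dn[OF m] by auto
      qed
      moreover from this have "hts T c = Max ?A" unfolding hts_def by (metis card_atLeastAtMost diff_Suc_1 One_nat_def)
      ultimately show ?thesis by (metis atLeastAtMost_iff mem_Collect_eq)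
    qed
  qed
  show c: "cells T = dg (hts T)"
  proof -
    have "(r, c) \<in> cells T \<longleftrightarrow> (r, c) \<in> dg (hts T)" for r c
      using hts[of r "c - 1"] by (cases c) (auto simp: dg_def cells_def)
    then show ?thesis by auto
  qed
  have z: "hts T c = 0" if "\<forall>row\<in>set T. length row \<le> c" for c
  proof -
    have "{r. (r, Suc c) \<in> cells T} = {}" using that by (auto simp: cells_def) (metis One_nat_def Suc_le_eq Suc_pred nth_mem not_less_eq_eq)
    then show ?thesis by (simp add: hts_def)
  qed
  have "\<exists>c. hts T c = 0"
  proof (cases T)
    case Nil then show ?thesis using z[of 0] by auto
  next
    case (Cons row T')
    have "length row' \<le> length row" if "row' \<in> set T" for row'
      using that young_len[OF assms, of 0] Cons by (auto simp: in_set_conv_nth) (metis length_Cons nth_Cons_0 nth_Cons_Suc Suc_less_eq zero_le)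
    then show ?thesis using z by blast
  qed
  moreover have "antimono (hts T)"
  proof (rule antimonoI)
    fix x y :: nat assume "x \<le> y"
    then have "{r. (r, Suc y) \<in> cells T} \<subseteq> {r. (r, Suc x) \<in> cells T}" by (auto simp: cells_def)
    moreover have "finite {r. (r, Suc x) \<in> cells T}" by (rule finite_subset[of _ "{..length T}"]) (auto simp: cells_def)
    ultimately show "hts T y \<le> hts T x" unfolding hts_def by (rule card_mono[rotated])
  qed
  ultimately show p: "part (hts T)" by (simp add: part_def)
  show "r < length T \<Longrightarrow> first_col (hts T) r = length (T ! r)"
  proof (rule first_col_eq[OF p])
    assume r: "r < length T"
    have "(Suc r, Suc (length (T ! r))) \<notin> cells T" by (simp add: cells_def)
    then show "hts T (length (T ! r)) \<le> r" using hts[of "Suc r" "length (T ! r)"] by simp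
    show "\<forall>i<length (T ! r). r < hts T i"
    proof (intro allI impI)
      fix i assume "i < length (T ! r)"
      then have "(Suc r, Suc i) \<in> cells T" using r by (simp add: cells_def)
      then show "r < hts T i" using hts[of "Suc r" i] by simp
    qed
  qed
  have "(r, Suc 0) \<in> cells T \<longleftrightarrow> 1 \<le> r \<and> r \<le> length T" for r
    using assms unfolding young_def cells_def by (auto simp: Suc_le_eq)
  then show "hts T 0 = length T" unfolding hts_def by (simp add: atLeastAtMost_def[symmetric] Collect_conj_eq atLeast_def[symmetric] atMost_def[symmetric])
qed

lemma young_mkT_eq: assumes "young T" shows "T = mkT (hts T) (entry T)"
proof (rule nth_equalityI)
  show "length T = length (mkT (hts T) (entry T))" using young_cells(4)[OF assms] by (simp add: mkT_def)
  fix r assume r: "r < length T"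
  show "T ! r = mkT (hts T) (entry T) ! r"
    using r young_cells(3)[OF assms r] young_cells(4)[OF assms]
    by (intro nth_equalityI) (auto simp: mkT_def entry_def)
qed

lemma mkT_cong:
  assumes "part h" "\<And>r c. (r, c) \<in> dg h \<Longrightarrow> e r c = e' r c" shows "mkT h e = mkT h e'"
  unfolding mkT_def
proof (intro map_cong refl)
  fix r c assume "c \<in> set [0..<first_col h r]"
  then have "(Suc r, Suc c) \<in> dg h" using first_col_less[OF assms(1), of c r] by (simp add: dg_def)
  then show "e (Suc r) (Suc c) = e' (Suc r) (Suc c)" by (rule assms(2))
qed

lemma hts_mkT: "part h \<Longrightarrow> hts (mkT h e) = h"
proof
  fix c assume "part h"
  then have "{r. (r, Suc c) \<in> cells (mkT h e)} = {1..h c}" by (auto simp: cells_mkT dg_def)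
  then show "hts (mkT h e) c = h c" by (simp add: hts_def)
qed

lemma young_eqI:
  assumes "young T" "young T'" "hts T = hts T'" "\<And>r c. (r, c) \<in> cells T \<Longrightarrow> entry T r c = entry T' r c"
  shows "T = T'"
proof -
  have "T = mkT (hts T) (entry T)" "T' = mkT (hts T') (entry T')" using young_mkT_eq assms by blast+
  moreover have "mkT (hts T) (entry T) = mkT (hts T') (entry T')"
    using mkT_cong[OF young_cells(2)[OF assms(1)], of "entry T" "entry T'"] assms(3,4) young_cells(1)[OF assms(1)] by simp
  ultimately show ?thesis by simp
qed

lemma map_length_mkT: "map length (mkT h e) = map (first_col h) [0..<h 0]"
  by (simp add: mkT_def)

lemma tab_of_cols_mkT:
  assumes "young P"
  shows "tab_of_cols (map length P) C od = mkT (hts P) (\<lambda>r c. od (C c) ! (r - 1))"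
  unfolding tab_of_cols_def mkT_def using young_cells(3,4)[OF assms] by simp

lemma hts_cong: "map length T = map length T' \<Longrightarrow> hts T = hts T'"
proof -
  assume e: "map length T = map length T'"
  then have l: "length T = length T'" by (metis length_map)
  have "length (T ! r) = length (T' ! r)" if "r < length T" for r
    using e l that by (metis nth_map)
  then have "(r, c) \<in> cells T \<longleftrightarrow> (r, c) \<in> cells T'" for r c
    using l by (auto simp: cells_def)
  then show ?thesis by (simp add: hts_def fun_eq_iff)
qed

definition fam_of :: "nat list list \<Rightarrow> nat \<Rightarrow> nat set" where
  "fam_of P a = {c. a \<in> col P (Suc c)}"

lemma cl_fam_of: "cl (fam_of P) c = col P (Suc c)" by (simp add: cl_def fam_of_def)

lemma inc_col_less:
  assumes "increasing P" "r < r'" "1 \<le> r" "(r', c) \<in> cells P"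
  shows "entry P r c < entry P r' c"
  using assms(2,4)
proof (induction r')
  case (Suc r')
  have y: "young P" using assms(1) by (simp add: increasing_def)
  have c: "(r', c) \<in> cells P" using Suc.prems assms(3) unfolding young_cells(1)[OF y] dg_def by auto
  have "entry P r' c < entry P (Suc r') c" using assms(1) c Suc.prems by (auto simp: increasing_def)
  then show ?case using Suc c by (cases "r = r'") auto
qed simp

lemma inc_row_less:
  assumes "increasing P" "c < c'" "1 \<le> c" "(r, c') \<in> cells P"
  shows "entry P r c < entry P r c'"
  using assms(2,4)
proof (induction c')
  case (Suc c')
  have c: "(r, c') \<in> cells P" using Suc.prems assms(3) by (auto simp: cells_def)
  have "entry P r c' < entry P r (Suc c')" using assms(1) c Suc.prems by (auto simp: increasing_def)
  then show ?case using Suc c by (cases "c = c'") auto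
qed simp

lemma inc_col_list:
  assumes "increasing P"
  shows "sorted_list_of_set (col P (Suc c)) = map (\<lambda>r. entry P r (Suc c)) [1..<Suc (hts P c)]"
    "col P (Suc c) = (\<lambda>r. entry P r (Suc c)) ` {1..hts P c}" "inj_on (\<lambda>r. entry P r (Suc c)) {1..hts P c}"
    "card (col P (Suc c)) = hts P c" "finite (col P (Suc c))"
proof -
  have y: "young P" using assms by (simp add: increasing_def)
  have ce: "(r, Suc c) \<in> cells P \<longleftrightarrow> r \<in> {1..hts P c}" for r unfolding young_cells(1)[OF y] dg_def by auto
  show e: "col P (Suc c) = (\<lambda>r. entry P r (Suc c)) ` {1..hts P c}" unfolding col_def ce by auto
  show i: "inj_on (\<lambda>r. entry P r (Suc c)) {1..hts P c}"
  proof (rule inj_onI)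
    fix x y assume "x \<in> {1..hts P c}" "y \<in> {1..hts P c}" "entry P x (Suc c) = entry P y (Suc c)"
    then show "x = y" using inc_col_less[OF assms, of x y "Suc c"] inc_col_less[OF assms, of y x "Suc c"] ce
      by (metis atLeastAtMost_iff less_irrefl linorder_neqE_nat)
  qed
  show "card (col P (Suc c)) = hts P c" unfolding e card_image[OF i] by simp
  show f: "finite (col P (Suc c))" unfolding e by simp
  show "sorted_list_of_set (col P (Suc c)) = map (\<lambda>r. entry P r (Suc c)) [1..<Suc (hts P c)]"
  proof (rule sorted_distinct_set_unique)
    show "sorted (map (\<lambda>r. entry P r (Suc c)) [1..<Suc (hts P c)])"
    proof (rule sorted_wrt_mono_rel[of _ "(<)"])
      show "sorted_wrt (<) (map (\<lambda>r. entry P r (Suc c)) [1..<Suc (hts P c)])"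
        unfolding sorted_wrt_map
        by (rule sorted_wrt_mono_rel[OF _ sorted_wrt_upt]) (auto intro!: inc_col_less[OF assms] simp: ce)
    qed simp
    have "set [1..<Suc (hts P c)] = {1..hts P c}" by auto
    then show "distinct (map (\<lambda>r. entry P r (Suc c)) [1..<Suc (hts P c)])" using i by (simp add: distinct_map del: upt_Suc)
    show "set (sorted_list_of_set (col P (Suc c))) = set (map (\<lambda>r. entry P r (Suc c)) [1..<Suc (hts P c)])"
      using f e \<open>set [1..<Suc (hts P c)] = {1..hts P c}\<close> by (simp del: upt_Suc)
  qed (use f in auto)
qed

lemma inc_count:
  assumes "increasing P" "(r, Suc c) \<in> cells P"
  shows "card {b \<in> col P (Suc c). b < entry P r (Suc c)} = r - 1"
proof -
  have y: "young P" using assms by (simp add: increasing_def)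
  have ce: "(r, Suc c) \<in> cells P \<longleftrightarrow> r \<in> {1..hts P c}" for r unfolding young_cells(1)[OF y] dg_def by auto
  have "{b \<in> col P (Suc c). b < entry P r (Suc c)} = (\<lambda>r. entry P r (Suc c)) ` {1..<r}"
  proof
    show "(\<lambda>r. entry P r (Suc c)) ` {1..<r} \<subseteq> {b \<in> col P (Suc c). b < entry P r (Suc c)}"
      using inc_col_less[OF assms(1) _ _ assms(2)] assms(2) ce inc_col_list(2)[OF assms(1), of c] by auto
    show "{b \<in> col P (Suc c). b < entry P r (Suc c)} \<subseteq> (\<lambda>r. entry P r (Suc c)) ` {1..<r}"
    proof
      fix b assume "b \<in> {b \<in> col P (Suc c). b < entry P r (Suc c)}"
      then obtain r' where r': "r' \<in> {1..hts P c}" "b = entry P r' (Suc c)" "b < entry P r (Suc c)"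
        using inc_col_list(2)[OF assms(1), of c] by auto
      then have "r' < r" using inc_col_less[OF assms(1), of r r' "Suc c"] ce assms(2)
        by (metis atLeastAtMost_iff less_asym less_irrefl linorder_neqE_nat)
      then show "b \<in> (\<lambda>r. entry P r (Suc c)) ` {1..<r}" using r' by auto
    qed
  qed
  moreover have "inj_on (\<lambda>r. entry P r (Suc c)) {1..<r}"
    by (rule inj_on_subset[OF inc_col_list(3)[OF assms(1), of c]]) (use assms(2) ce in auto)
  ultimately show ?thesis by (simp add: card_image)
qed

lemma inc_pos: "increasing P \<Longrightarrow> b \<in> col P c \<Longrightarrow> 0 < b"
  unfolding increasing_def col_def by fastforce

lemma inc_le_iff:
  assumes "increasing P" "(r, Suc c) \<in> cells P"
  shows "entry P r (Suc c) \<le> N \<longleftrightarrow> r \<le> card {b \<in> col P (Suc c). b \<le> N}"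
proof -
  have y: "young P" using assms by (simp add: increasing_def)
  have f: "finite (col P (Suc c))" using inc_col_list(5)[OF assms(1)] .
  have em: "entry P r (Suc c) \<in> col P (Suc c)" using assms(2) by (auto simp: col_def)
  have r1: "1 \<le> r" using assms(2) by (auto simp: cells_def)
  let ?L = "{b \<in> col P (Suc c). b < entry P r (Suc c)}"
  show ?thesis
  proof
    assume "entry P r (Suc c) \<le> N"
    then have "insert (entry P r (Suc c)) ?L \<subseteq> {b \<in> col P (Suc c). b \<le> N}" using em by auto
    then have "card (insert (entry P r (Suc c)) ?L) \<le> card {b \<in> col P (Suc c). b \<le> N}" using f by (intro card_mono) auto
    then show "r \<le> card {b \<in> col P (Suc c). b \<le> N}" using inc_count[OF assms] f r1 by simp
  next
    assume r: "r \<le> card {b \<in> col P (Suc c). b \<le> N}"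
    show "entry P r (Suc c) \<le> N"
    proof (rule ccontr)
      assume "\<not> ?thesis"
      then have "{b \<in> col P (Suc c). b \<le> N} \<subseteq> ?L" by auto
      then have "card {b \<in> col P (Suc c). b \<le> N} \<le> r - 1" using card_mono[of ?L] f inc_count[OF assms] by simp
      then show False using r r1 by simp
    qed
  qed
qed

text \<open>If \<open>Suc a\<close> stands in row \<open>r\<close>, row strictness puts smaller
  letters into row \<open>r\<close> of all columns to the left; these columns therefore reach row
  \<open>r\<close> before \<open>Suc a\<close> is added.\<close>

lemma fam_fam_of:
  assumes "increasing P" "\<forall>(r, c)\<in>cells P. entry P r c \<le> M"
  shows "fam M (fam_of P)"
proof -
  have y: "young P" using assms by (simp add: increasing_def)
  have ce: "(r, Suc c) \<in> cells P \<longleftrightarrow> r \<in> {1..hts P c}" for r c unfolding young_cells(1)[OF y] dg_def by auto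
  have "fam_of P a = {}" if "a = 0 \<or> M < a" for a
    using that assms(2) inc_pos[OF assms(1)] unfolding fam_of_def col_def by fastforce
  moreover have "vstrip (ht (fam_of P) a) (fam_of P (Suc a))" for a
    unfolding vstrip_def
  proof (intro ballI allI impI)
    fix c i assume c: "c \<in> fam_of P (Suc a)" and ic: "i < c"
    then obtain r where r: "(r, Suc c) \<in> cells P" "entry P r (Suc c) = Suc a" by (auto simp: fam_of_def col_def)
    have h: "ht (fam_of P) a d = card {b \<in> col P (Suc d). b \<le> a}" for d
      unfolding ht_card cl_fam_of by (rule arg_cong[of _ _ card]) (use inc_pos[OF assms(1)] in auto)
    have "{b \<in> col P (Suc c). b \<le> a} = {b \<in> col P (Suc c). b < entry P r (Suc c)}" using r by auto
    then have "ht (fam_of P) a c = r - 1" using h inc_count[OF assms(1) r(1)] by simp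
    moreover have ri: "(r, Suc i) \<in> cells P" using r(1) ic by (auto simp: cells_def)
    moreover have "entry P r (Suc i) \<le> a" using inc_row_less[OF assms(1), of "Suc i" "Suc c" r] r ic by simp
    then have "r \<le> ht (fam_of P) a i" using inc_le_iff[OF assms(1) ri] h by simp
    moreover have "1 \<le> r" using r(1) by (auto simp: cells_def)
    ultimately show "ht (fam_of P) a c < ht (fam_of P) a i" by simp
  qed
  ultimately show ?thesis by (simp add: fam_def)
qed

lemma hts_fam_of:
  assumes "increasing P" "fam M (fam_of P)" shows "ht (fam_of P) M = hts P"
proof
  fix c
  have "{b \<in> col P (Suc c). 0 < b \<and> b \<le> M} = col P (Suc c)"
    using assms(2) inc_pos[OF assms(1)] unfolding fam_def fam_of_def by (auto simp: not_less[symmetric])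
  then show "ht (fam_of P) M c = hts P c" unfolding ht_card cl_fam_of using inc_col_list(4)[OF assms(1)] by simp
qed

lemma fam_of_inj:
  assumes "increasing P" "increasing Q" "fam_of P = fam_of Q" shows "P = Q"
proof -
  have c: "col P (Suc c) = col Q (Suc c)" for c using assms(3) cl_fam_of by metis
  have h: "hts P = hts Q" using inc_col_list(4)[OF assms(1)] inc_col_list(4)[OF assms(2)] c by (metis ext)
  have y: "young P" "young Q" using assms by (auto simp: increasing_def)
  show ?thesis
  proof (rule young_eqI[OF y h])
    fix r c assume "(r, c) \<in> cells P"
    then have r: "1 \<le> r" "1 \<le> c" "r \<le> hts P (c - 1)" unfolding young_cells(1)[OF y(1)] dg_def by auto
    then obtain d where d: "c = Suc d" by (cases c) auto
    have "sorted_list_of_set (col P c) ! (r - 1) = entry P r c" "sorted_list_of_set (col Q c) ! (r - 1) = entry Q r c"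
      unfolding d inc_col_list(1)[OF assms(1)] inc_col_list(1)[OF assms(2)] using r d h by (auto simp del: upt_Suc)
    then show "entry P r c = entry Q r c" using c d by simp
  qed
qed

lemma sls_nth_count:
  assumes "finite (A :: nat set)" "r < card A"
  shows "card {b\<in>A. b < sorted_list_of_set A ! r} = r" "sorted_list_of_set A ! r \<in> A"
proof -
  let ?l = "sorted_list_of_set A"
  have l: "length ?l = card A" "sorted_wrt (<) ?l" "set ?l = A" "distinct ?l" using assms by auto
  show m: "?l ! r \<in> A" using l assms nth_mem by metis
  have "{b\<in>A. b < ?l ! r} = (\<lambda>k. ?l ! k) ` {..<r}"
  proof
    show "(\<lambda>k. ?l ! k) ` {..<r} \<subseteq> {b\<in>A. b < ?l ! r}"
    proof
      fix x assume "x \<in> (\<lambda>k. ?l ! k) ` {..<r}"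
      then obtain k where k: "k < r" "x = ?l ! k" by auto
      have "x < ?l ! r" unfolding k(2) by (rule sorted_wrt_nth_less[OF l(2) k(1)]) (use l(1) assms(2) in simp)
      moreover have "x \<in> set ?l" unfolding k(2) by (rule nth_mem) (use k l(1) assms(2) in simp)
      ultimately show "x \<in> {b\<in>A. b < ?l ! r}" using l(3) by simp
    qed
    show "{b\<in>A. b < ?l ! r} \<subseteq> (\<lambda>k. ?l ! k) ` {..<r}"
    proof
      fix b assume b: "b \<in> {b\<in>A. b < ?l ! r}"
      then obtain k where k: "k < card A" "b = ?l ! k" using l by (metis (no_types, lifting) in_set_conv_nth mem_Collect_eq)
      then have "k < r" using b sorted_wrt_nth_less[OF l(2), of r k] l(1) by (metis (no_types, lifting) less_asym less_irrefl linorder_neqE_nat mem_Collect_eq)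
      then show "b \<in> (\<lambda>k. ?l ! k) ` {..<r}" using k by simp
    qed
  qed
  moreover have "inj_on (\<lambda>k. ?l ! k) {..<r}" using l assms by (auto simp: inj_on_def nth_eq_iff_index_eq)
  ultimately show "card {b\<in>A. b < ?l ! r} = r" by (simp add: card_image)
qed

text \<open>Sorting each column gives strict columns. For the rows, the strip condition says that
  before the letter in row \<open>r\<close> of a column is added, the column to its left already has
  at least \<open>r\<close> smaller letters.\<close>

lemma fam_of_surj:
  assumes "fam M F" shows "\<exists>P. increasing P \<and> fam_of P = F"
proof -
  define h where "h = ht F M"
  define e where "e r c = sorted_list_of_set (cl F (c - 1)) ! (r - 1)" for r c :: nat
  define P where "P = mkT h e"
  have p: "part h" using fam_part[OF assms] h_def by simp
  have F0: "b \<in> cl F c \<Longrightarrow> 0 < b \<and> b \<le> M" for b c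
    using assms unfolding fam_def cl_def by (metis empty_iff gr0I mem_Collect_eq not_le)
  have fc: "finite (cl F c)" for c by (rule finite_subset[of _ "{..M}"]) (use F0 in auto)
  have hc: "h c = card (cl F c)" for c
    unfolding h_def ht_card by (rule arg_cong[of _ _ card]) (use F0 in auto)
  have y: "young P" and ce: "cells P = dg h" and en: "\<And>r c. (r, c) \<in> dg h \<Longrightarrow> entry P r c = e r c"
    using young_mkT[OF p] cells_mkT[OF p] entry_mkT[OF p] P_def by auto
  have mem: "e r c \<in> cl F (c - 1)" "card {b \<in> cl F (c - 1). b < e r c} = r - 1" if "(r, c) \<in> dg h" for r c
    using that sls_nth_count[OF fc, of "r - 1" "c - 1"] hc[of "c - 1"] unfolding dg_def e_def by auto
  have "increasing P"
    unfolding increasing_def ce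
  proof (intro conjI y allI impI ballI)
    show "case x of (r, c) \<Rightarrow> 0 < entry P r c" if "x \<in> dg h" for x
    proof -
      obtain r c where x: "x = (r, c)" by (cases x)
      have "0 < entry P r c" using en[of r c] F0[OF mem(1)[of r c]] that x by simp
      then show ?thesis using x by simp
    qed
    fix r c
    show "entry P r c < entry P r (Suc c)" if rc: "(r, c) \<in> dg h \<and> (r, Suc c) \<in> dg h"
    proof -
      let ?a = "e r (Suc c)"
      have a: "?a \<in> cl F c" "card {b \<in> cl F c. b < ?a} = r - 1" using mem[of r "Suc c"] rc by auto
      have r1: "1 \<le> r" "1 \<le> c" using rc by (auto simp: dg_def)
      obtain a' where a': "?a = Suc a'" using F0[OF a(1)] by (cases ?a) auto
      have "ht F a' c < ht F a' (c - 1)"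
        using assms a(1) a' r1 unfolding fam_def vstrip_def cl_def by (metis One_nat_def Suc_le_eq diff_less mem_Collect_eq zero_less_one)
      moreover have "ht F a' d = card {b \<in> cl F d. b < ?a}" for d
        unfolding ht_card by (rule arg_cong[of _ _ card]) (use F0 a' in auto)
      ultimately have lt: "r - 1 < card {b \<in> cl F (c - 1). b < ?a}" using a by simp
      have "e r c < ?a"
      proof (rule ccontr)
        assume "\<not> ?thesis"
        then have "{b \<in> cl F (c - 1). b < ?a} \<subseteq> {b \<in> cl F (c - 1). b < e r c}" by auto
        then have "card {b \<in> cl F (c - 1). b < ?a} \<le> r - 1" using card_mono[of "{b \<in> cl F (c - 1). b < e r c}"] fc mem(2)[of r c] rc by simp
        then show False using lt by simp
      qed
      then show ?thesis using en rc by simp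
    qed
    show "entry P r c < entry P (Suc r) c" if rc: "(r, c) \<in> dg h \<and> (Suc r, c) \<in> dg h"
    proof -
      have s: "sorted_wrt (<) (sorted_list_of_set (cl F (c - 1)))" by simp
      have r: "1 \<le> r" "Suc r \<le> card (cl F (c - 1))" using rc hc[of "c - 1"] by (auto simp: dg_def)
      have "e r c < e (Suc r) c" unfolding e_def
        by (rule sorted_wrt_nth_less[OF s]) (use r in auto)
      then show ?thesis using en rc by simp
    qed
  qed
  moreover have "fam_of P = F"
  proof -
    have "col P (Suc c) = cl F c" for c
    proof -
      have "col P (Suc c) = (\<lambda>r. sorted_list_of_set (cl F c) ! (r - 1)) ` {1..h c}"
      proof -
        have "(r, Suc c) \<in> dg h \<longleftrightarrow> r \<in> {1..h c}" for r by (auto simp: dg_def)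
        moreover have "entry P r (Suc c) = sorted_list_of_set (cl F c) ! (r - 1)" if "(r, Suc c) \<in> dg h" for r
          using en[OF that] by (simp add: e_def)
        ultimately show ?thesis unfolding col_def ce by (auto simp: image_iff) metis
      qed
      also have "\<dots> = (\<lambda>k. sorted_list_of_set (cl F c) ! k) ` {..<h c}"
      proof -
        have "(\<lambda>r. r - 1) ` {1..h c} = {..<h c}"
        proof
          show "{..<h c} \<subseteq> (\<lambda>r. r - 1) ` {1..h c}"
          proof
            fix k assume "k \<in> {..<h c}"
            then show "k \<in> (\<lambda>r. r - 1) ` {1..h c}" by (intro image_eqI[of _ _ "Suc k"]) auto
          qed
        qed auto
        then show ?thesis unfolding image_image[symmetric, of "\<lambda>k. sorted_list_of_set (cl F c) ! k" "\<lambda>r. r - 1"] by simp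
      qed
      also have "\<dots> = cl F c" using hc[of c] fc[of c] by (metis length_sorted_list_of_set nth_image lessThan_atLeast0 set_sorted_list_of_set take_all order_refl)
      finally show ?thesis .
    qed
    then show ?thesis unfolding fam_of_def cl_def by auto
  qed
  ultimately show ?thesis by blast
qed

section \<open>Hecke words and permutations\<close>

lemma heq_induct:
  assumes "a \<approx> b" "\<And>a. Q a a" "\<And>a b c. Q a b \<Longrightarrow> Q b c \<Longrightarrow> Q a c" "\<And>a b. Q a b \<Longrightarrow> Q b a"
    and "\<And>a b. hecke_step a b \<Longrightarrow> Q a b"
  shows "Q a b"
  using assms(1) unfolding hecke_equiv_def
proof (induction rule: rtranclp_induct)
  case (step y z)
  then have "Q y z" using assms(4,5) by (auto simp: symclp_pointfree)
  then show ?case using step.IH assms(3) by blast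
qed (rule assms(2))

lemma heq_set: assumes "a \<approx> b" shows "set a = set b"
  by (rule heq_induct[OF assms]) (auto elim: hecke_step.cases)

lemma heq_rev: assumes "a \<approx> b" shows "rev a \<approx> rev b"
proof (rule heq_induct[OF assms])
  fix a b assume "hecke_step a b"
  then show "rev a \<approx> rev b"
  proof cases
    case (idem u i v)
    show ?thesis unfolding idem using heq_step[OF hecke_step.idem[of "rev v" i "rev u"]] by simp
  next
    case (braid u i v)
    show ?thesis unfolding braid using heq_step[OF hecke_step.braid[of "rev v" i "rev u"]] by simp
  next
    case (comm i j u v)
    have "j + 2 \<le> i \<or> i + 2 \<le> j" using comm(3) by blast
    show ?thesis unfolding comm(1,2) using heq_step[OF hecke_step.comm[of j i "rev v" "rev u"]] comm(3) by auto
  qed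
qed (auto intro: heq_trans heq_sym)

text \<open>Dropping the small letters turns a braid relation across the threshold into an
  idempotent one; the other relations persist or disappear.\<close>

lemma heq_large: assumes "a \<approx> b" shows "large N a \<approx> large N b"
proof (rule heq_induct[OF assms])
  fix a b assume "hecke_step a b"
  then show "large N a \<approx> large N b"
  proof cases
    case (idem u i v)
    show ?thesis unfolding idem using heq_step[OF hecke_step.idem[of "large N u" i "large N v"]] by simp
  next
    case (braid u i v)
    consider "N < i" | "i = N" | "Suc i \<le> N" by linarith
    then show ?thesis
    proof cases
      case 1 then show ?thesis unfolding braid using heq_step[OF hecke_step.braid[of "large N u" i "large N v"]] by simp
    next
      case 2 then show ?thesis unfolding braid using heq_sym[OF heq_step[OF hecke_step.idem[of "large N u" "Suc i" "large N v"]]] by simp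
    next
      case 3 then show ?thesis unfolding braid by simp
    qed
  next
    case (comm i j u v)
    show ?thesis unfolding comm(1,2) using heq_step[OF hecke_step.comm[OF comm(3), of "large N u" "large N v"]] by auto
  qed
qed (auto intro: heq_trans heq_sym)

lemma hecke_word_cong: "a \<approx> b \<Longrightarrow> hecke_word a w \<longleftrightarrow> hecke_word b w"
  unfolding hecke_word_def using heq_set[of a b] heq_trans heq_sym by metis

lemma sref_invol: "sref i \<circ> sref i = id" by (auto simp: sref_def fun_eq_iff)

lemma bij_sref: "bij (sref i)" using sref_invol o_bij by blast

lemma perm_of_word_Cons: "perm_of_word (x # a) = sref x \<circ> perm_of_word a" by (simp add: perm_of_word_def)

lemma perm_of_word_append: "perm_of_word (a @ b) = perm_of_word a \<circ> perm_of_word b"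
  by (induction a) (auto simp: perm_of_word_def)

lemma perm_of_word_single: "perm_of_word [x] = sref x" by (simp add: perm_of_word_def)

lemma perm_of_word_Nil: "perm_of_word [] = id" unfolding perm_of_word_def by simp

lemma bij_perm_of_word: "bij (perm_of_word a)"
proof (induction a)
  case (Cons x a) then show ?case unfolding perm_of_word_Cons using bij_comp bij_sref by blast
qed (simp add: perm_of_word_def bij_def inj_def surj_def)

lemma perm_of_word_rev: "perm_of_word (rev a) = inv (perm_of_word a)"
proof -
  have "perm_of_word (rev a) \<circ> perm_of_word a = id"
  proof (induction a)
    case (Cons x a)
    have "perm_of_word (rev (x # a)) \<circ> perm_of_word (x # a) = perm_of_word (rev a) \<circ> (sref x \<circ> sref x) \<circ> perm_of_word a"
      by (simp add: perm_of_word_append perm_of_word_Cons perm_of_word_Nil o_assoc)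
    then show ?case using Cons sref_invol by simp
  qed (simp add: perm_of_word_def)
  then show ?thesis using bij_perm_of_word[of a] by (metis bij_is_surj comp_assoc comp_id id_comp surj_iff)
qed

lemma is_word_of_rev: assumes "bij w" shows "is_word_of (rev a) (inv w) \<longleftrightarrow> is_word_of a w"
  unfolding is_word_of_def perm_of_word_rev using inv_inv_eq[OF assms] inv_inv_eq[OF bij_perm_of_word[of a]] by auto

lemma perm_length_inv: assumes "bij w" shows "perm_length (inv w) = perm_length w"
proof -
  have "(\<exists>a. length a = l \<and> is_word_of a (inv w)) \<longleftrightarrow> (\<exists>a. length a = l \<and> is_word_of a w)" for l
    using is_word_of_rev[OF assms] by (metis length_rev rev_rev_ident)
  then show ?thesis by (simp add: perm_length_def)
qed

lemma hecke_word_inv: assumes "bij w" shows "hecke_word a (inv w) \<longleftrightarrow> hecke_word (rev a) w"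
proof -
  have r: "reduced_word b (inv w) \<longleftrightarrow> reduced_word (rev b) w" for b
    unfolding reduced_word_def perm_length_inv[OF assms] using is_word_of_rev[OF assms, of "rev b"] by simp
  show ?thesis unfolding hecke_word_def r set_rev using heq_rev by (metis rev_rev_ident)
qed

text \<open>One factor of the Demazure product: multiply by a simple transposition on the right only
  if this creates a descent. The product over a word is constant on 0-Hecke classes and equals
  \<open>w\<close> on reduced words of \<open>w\<close>.\<close>

definition dst :: "(nat \<Rightarrow> nat) \<Rightarrow> nat \<Rightarrow> nat \<Rightarrow> nat" where
  "dst u i = (if u i < u (Suc i) then u \<circ> sref i else u)"

abbreviation dem :: "nat list \<Rightarrow> nat \<Rightarrow> nat" where "dem \<equiv> foldl dst (\<lambda>x. x)"

lemma dem_snoc: "dem (a @ [i]) = (if dem a i < dem a (Suc i) then dem a \<circ> sref i else dem a)"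
  by (simp add: dst_def[of "foldl dst (\<lambda>x. x) a" i])

lemma dst_idem: "dst (dst u i) i = dst u i" by (auto simp: dst_def sref_def)

lemma dst_braid: "dst (dst (dst u i) (Suc i)) i = dst (dst (dst u (Suc i)) i) (Suc i)"
  by (rule ext) (simp add: dst_def sref_def)

lemma dst_comm: "i + 2 \<le> j \<or> j + 2 \<le> i \<Longrightarrow> dst (dst u i) j = dst (dst u j) i"
  by (rule ext) (auto simp: dst_def sref_def)

lemma dem_cong: assumes "a \<approx> b" shows "dem a = dem b"
proof (rule heq_induct[OF assms])
  fix a b assume "hecke_step a b"
  then show "dem a = dem b"
  proof cases
    case (idem u i v) show ?thesis unfolding idem by (simp add: dst_idem)
  next
    case (braid u i v) show ?thesis unfolding braid by (simp add: dst_braid)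
  next
    case (comm i j u v) show ?thesis unfolding comm(1,2) by (simp add: dst_comm[OF comm(3)])
  qed
qed auto

text \<open>The exchange condition of Coxeter groups, in the form that multiplication by a descent
  deletes one letter.\<close>

lemma exchange:
  assumes "perm_of_word p (Suc i) < perm_of_word p i"
  shows "\<exists>p'. Suc (length p') = length p \<and> set p' \<subseteq> set p \<and> perm_of_word p' = perm_of_word p \<circ> sref i"
  using assms
proof (induction p)
  case Nil then show ?case by (simp add: perm_of_word_def)
next
  case (Cons x p)
  let ?v = "perm_of_word p"
  have inj: "inj ?v" using bij_perm_of_word bij_is_inj by blast
  show ?case
  proof (cases "?v (Suc i) < ?v i")
    case True
    then obtain p' where p': "Suc (length p') = length p" "set p' \<subseteq> set p" "perm_of_word p' = ?v \<circ> sref i" using Cons.IH by blast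
    then have "perm_of_word (x # p') = perm_of_word (x # p) \<circ> sref i" by (simp add: perm_of_word_Cons o_assoc)
    then show ?thesis using p' by (intro exI[of _ "x # p'"]) auto
  next
    case False
    have lt: "sref x (?v (Suc i)) < sref x (?v i)" using Cons.prems by (simp add: perm_of_word_Cons)
    have ne: "?v i \<noteq> ?v (Suc i)" using inj by (metis injD n_not_Suc_n)
    have v: "?v i = x" "?v (Suc i) = Suc x" using lt ne False by (auto simp: sref_def split: if_splits)
    have "sref x (?v y) = ?v (sref i y)" for y
      using v inj_eq[OF inj, of y i] inj_eq[OF inj, of y "Suc i"] by (simp add: sref_def)
    then have "perm_of_word (x # p) = ?v \<circ> sref i" by (simp add: perm_of_word_Cons fun_eq_iff)
    then have "perm_of_word (x # p) \<circ> sref i = ?v" using sref_invol by (simp add: o_assoc[symmetric])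
    then show ?thesis by (intro exI[of _ p]) auto
  qed
qed

lemma perm_length_le: "is_word_of a w \<Longrightarrow> perm_length w \<le> length a"
  unfolding perm_length_def by (rule Least_le) blast

text \<open>A descent met along a prefix of a reduced word could be removed by
  \<open>exchange\<close>, giving a shorter word. So every Demazure factor really
  multiplies.\<close>

lemma dem_reduced_aux:
  assumes "is_word_of (p @ q) w" "length (p @ q) = perm_length w"
  shows "dem p = perm_of_word p"
  using assms
proof (induction p arbitrary: q rule: rev_induct)
  case Nil then show ?case by (simp add: perm_of_word_def)
next
  case (snoc i p)
  have IH: "dem p = perm_of_word p" using snoc.IH[of "i # q"] snoc.prems by simp
  have "\<not> perm_of_word p (Suc i) < perm_of_word p i"
  proof
    assume "perm_of_word p (Suc i) < perm_of_word p i"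
    then obtain p' where p': "Suc (length p') = length p" "set p' \<subseteq> set p" "perm_of_word p' = perm_of_word p \<circ> sref i"
      using exchange by blast
    have "is_word_of (p' @ q) w" using snoc.prems(1) p'(2,3)
      by (auto simp: is_word_of_def perm_of_word_append perm_of_word_Cons o_assoc)
    from perm_length_le[OF this] show False using snoc.prems(2) p'(1) by simp
  qed
  moreover have "perm_of_word p i \<noteq> perm_of_word p (Suc i)"
    using bij_is_inj[OF bij_perm_of_word[of p]] by (metis injD n_not_Suc_n)
  ultimately have "perm_of_word p i < perm_of_word p (Suc i)" by simp
  then show ?case unfolding dem_snoc IH perm_of_word_append perm_of_word_single by simp
qed

lemma dem_hecke: assumes "hecke_word a w" shows "dem a = w"
proof -
  obtain b where b: "a \<approx> b" "reduced_word b w" using assms by (auto simp: hecke_word_def)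
  then have "dem b = perm_of_word b" using dem_reduced_aux[of b "[]" w] by (simp add: reduced_word_def)
  then show ?thesis using b dem_cong[OF b(1)] by (simp add: reduced_word_def is_word_of_def)
qed

lemma dem_subword: "\<exists>b. length b \<le> length a \<and> set b \<subseteq> set a \<and> perm_of_word b = dem a"
proof (induction a rule: rev_induct)
  case Nil show ?case by (simp add: perm_of_word_Nil id_def)
next
  case (snoc i a)
  then obtain b where b: "length b \<le> length a" "set b \<subseteq> set a" "perm_of_word b = dem a" by blast
  show ?case
  proof (cases "dem a i < dem a (Suc i)")
    case True
    then show ?thesis using b by (intro exI[of _ "b @ [i]"]) (unfold dem_snoc perm_of_word_append perm_of_word_single, auto)
  next
    case False
    then show ?thesis using b by (intro exI[of _ b]) (unfold dem_snoc, auto)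
  qed
qed

lemma hecke_length: assumes "hecke_word a w" shows "perm_length w \<le> length a"
proof -
  obtain b where b: "length b \<le> length a" "set b \<subseteq> set a" "perm_of_word b = dem a" using dem_subword by blast
  then have "is_word_of b w" using assms dem_hecke[OF assms] by (auto simp: is_word_of_def hecke_word_def)
  then show ?thesis using perm_length_le b(1) le_trans by blast
qed

text \<open>If nothing up to position \<open>x\<close> exceeds \<open>x\<close>, these values are
  permuted among themselves and the factor \<open>x\<close> must move a larger value in. Later
  factors preserve the property, as they only move larger values to the left. This confines the
  letters of a Hecke word to the support of the permutation.\<close>

lemma dem_moves: "x \<in> set a \<Longrightarrow> \<exists>y\<le>x. x < dem a y"
proof (induction a rule: rev_induct)
  case (snoc i a)
  let ?u = "dem a"
  have inj: "inj ?u" using dem_subword[of a] bij_perm_of_word bij_is_inj by metis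
  show ?case
  proof (cases "\<exists>y\<le>x. x < ?u y")
    case True
    then obtain y where y: "y \<le> x" "x < ?u y" by blast
    show ?thesis
    proof (cases "?u i < ?u (Suc i)")
      case lt: True
      have e: "dem (a @ [i]) = ?u \<circ> sref i" unfolding dem_snoc using lt by (rule if_P)
      consider "i = x" "y = x" | "i = x" "y < x" | "i \<noteq> x" using y(1) by fastforce
      then show ?thesis
      proof cases
        case 1 then show ?thesis unfolding e using lt y by (intro exI[of _ x]) (auto simp: sref_def)
      next
        case 2 then show ?thesis unfolding e using lt y by (intro exI[of _ y]) (auto simp: sref_def)
      next
        case 3
        have "sref i y \<le> x" using 3 y(1) by (auto simp: sref_def)
        moreover have "sref i (sref i y) = y" using sref_invol by (metis comp_apply id_apply)
        ultimately show ?thesis unfolding e using y by (intro exI[of _ "sref i y"]) auto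
      qed
    next
      case False
      then have "dem (a @ [i]) = ?u" unfolding dem_snoc by (rule if_not_P)
      then show ?thesis using y by auto
    qed
  next
    case False
    then have ix: "i = x" using snoc by auto
    have sub: "?u ` {..x} \<subseteq> {..x}" using False by (auto simp: not_less)
    have "?u ` {..x} = {..x}"
      by (rule card_subset_eq[OF _ sub]) (auto simp: card_image inj_on_subset[OF inj])
    moreover have "?u (Suc x) \<notin> ?u ` {..x}"
    proof
      assume "?u (Suc x) \<in> ?u ` {..x}"
      then obtain y where "?u (Suc x) = ?u y" "y \<le> x" by blast
      then show False using injD[OF inj, of "Suc x" y] by simp
    qed
    ultimately have g: "x < ?u (Suc x)" by auto
    moreover have "?u x \<le> x" using False by (auto simp: not_less)
    ultimately have "?u i < ?u (Suc i)" using ix by simp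
    then have e: "dem (a @ [i]) = ?u \<circ> sref i" unfolding dem_snoc by (rule if_P)
    show ?thesis unfolding e using ix g by (intro exI[of _ x]) (simp add: sref_def)
  qed
qed simp

lemma hecke_letters:
  assumes "hecke_word a w" "\<forall>i\<le>N. w i = i" "\<forall>i>m. w i = i" "inj w"
  shows "set a \<subseteq> {Suc N..m}"
proof
  fix x assume "x \<in> set a"
  then obtain y where y: "y \<le> x" "x < w y" using dem_moves dem_hecke[OF assms(1)] by blast
  have "N < x"
  proof (rule ccontr)
    assume "\<not> N < x"
    then have "w y = y" using y assms(2) by simp
    then show False using y by simp
  qed
  moreover have "x \<le> m"
  proof (rule ccontr)
    assume "\<not> x \<le> m"
    then have "w (w y) = w y" using y assms(3) by simp
    then have "w y = y" using assms(4) by (simp add: inj_eq)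
    then show False using y by simp
  qed
  ultimately show "x \<in> {Suc N..m}" by simp
qed

text \<open>Words are inserted from the right while the reading word grows at its right end, hence
  the reversal. It is balanced later by the inverse permutation in the definition of
  \<open>groth\<close>.\<close>

lemma fw_tab: assumes "set a \<subseteq> {1..M}" "M < K" shows "fw K (cl (tab a)) \<approx> rev a"
  using assms(1)
proof (induction a)
  case Nil
  have "fw k (cl emptyF) = []" for k by (simp add: fw_def cl_def emptyF_def cw_def)
  then show ?case by simp
next
  case (Cons x a)
  have "fw K (cl (tab a)) @ [x] \<approx> fw K (cl (tab (x # a)))"
    using hecke_ins[OF fam_tab[of a M], of x K] Cons.prems assms(2) by simp
  moreover have "fw K (cl (tab a)) @ [x] \<approx> rev a @ [x]" using Cons by (intro heq_R) simp
  ultimately show ?case using heq_trans heq_sym by (metis rev.simps(2))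
qed

lemma hecke_tab:
  assumes "set a \<subseteq> {1..M}" "M < K"
  shows "hecke_word (large N (fw K (cl (tab a)))) w \<longleftrightarrow> hecke_word (rev (large N a)) w"
  using hecke_word_cong[OF heq_large[OF fw_tab[OF assms]]] by (simp add: rev_filter)

lemma hecke_dup: "hecke_word (rev (u @ x # x # v)) w \<longleftrightarrow> hecke_word (rev (u @ x # v)) w"
  by (rule hecke_word_cong, rule heq_rev, rule heq_step)
    (use hecke_step.idem[of u x v] in simp)

section \<open>Set-valued tableaux as strict token words\<close>

text \<open>A token puts its label into the lowest cell of its column at that moment:
  \<open>New\<close> opens this cell and \<open>Mark\<close> enlarges its set.\<close>

fun eT :: "(nat \<Rightarrow> nat) \<Rightarrow> nat list \<Rightarrow> code list \<Rightarrow> nat \<Rightarrow> nat \<Rightarrow> nat set" where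
  "eT g (i # is) (Tok t # cs) = (\<lambda>r c. if r = g (tcol t) \<and> c = Suc (tcol t)
      then insert i (eT (down g t) is cs r c) else eT (down g t) is cs r c)"
| "eT g is cs = (\<lambda>_ _. {})"

text \<open>The value outside the diagram is the empty set, so a set-valued tableau is a plain
  function and its support is its shape.\<close>

definition VT :: "(nat \<Rightarrow> nat) \<Rightarrow> (nat \<Rightarrow> nat \<Rightarrow> nat set) \<Rightarrow> bool" where
  "VT g e \<longleftrightarrow> (\<forall>r c. finite (e r c) \<and> (e r c \<noteq> {} \<longleftrightarrow> (r, c) \<in> dg g))
     \<and> (\<forall>r c. \<forall>x\<in>e r c. \<forall>y\<in>e r (Suc c). y \<le> x) \<and> (\<forall>r c. \<forall>x\<in>e r c. \<forall>y\<in>e (Suc r) c. y < x)"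

definition cnt :: "(nat \<Rightarrow> nat \<Rightarrow> nat set) \<Rightarrow> nat \<Rightarrow> nat" where
  "cnt e v = card {(r, c). v \<in> e r c}"

definition Bc :: "nat \<Rightarrow> (nat \<Rightarrow> nat) \<Rightarrow> nat list \<Rightarrow> code list set" where
  "Bc M g is = {cs. length cs = length is \<and> vcode M M g cs \<and> adj cls is cs}"

definition Ec :: "(nat \<Rightarrow> nat) \<Rightarrow> nat list \<Rightarrow> (nat \<Rightarrow> nat \<Rightarrow> nat set) set" where
  "Ec g is = {e. VT g e \<and> (\<forall>v. cnt e v = count_list is v)}"

lemma eT_zip: "v \<in> eT g is cs r c \<Longrightarrow> \<exists>t. (v, Tok t) \<in> set (zip is cs) \<and> c = Suc (tcol t)"
  by (induction g "is" cs rule: eT.induct) (auto split: if_splits)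

lemma part_down_corner:
  assumes "part g" "corner g t" shows "part (down g t)"
proof (cases t)
  case (New j)
  have a: "g (Suc j) < g j" using assms(2) New by (simp add: corner_def)
  have m: "\<And>x y. x \<le> y \<Longrightarrow> g y \<le> g x" and z: "\<exists>c. g c = 0" using assms(1) by (auto simp: part_def antimono_def)
  have "antimono (g(j := g j - 1))"
  proof (rule antimonoI)
    fix x y :: nat assume xy: "x \<le> y"
    show "(g(j := g j - 1)) y \<le> (g(j := g j - 1)) x"
    proof (cases "x = j \<and> y \<noteq> j")
      case True
      then have "g y \<le> g (Suc j)" using xy m[of "Suc j" y] by simp
      then show ?thesis using True a by simp
    next
      case False then show ?thesis using m[OF xy] by auto
    qed
  qed
  moreover have "\<exists>c. (g(j := g j - 1)) c = 0" using z a by (metis fun_upd_apply not_less_zero)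
  ultimately show ?thesis using New by (simp add: part_def)
qed (use assms in \<open>auto simp: corner_def\<close>)

lemma dg_down:
  assumes "part g" "corner g t"
  shows "(r, c) \<in> dg (down g t) \<longleftrightarrow> (r, c) \<in> dg g \<and> (t = New (tcol t) \<longrightarrow> \<not> (r = g (tcol t) \<and> c = Suc (tcol t)))"
  using assms(2) by (cases t) (auto simp: dg_def corner_def)

lemma dg_bottom:
  assumes "part g" "corner g t"
  shows "(g (tcol t), Suc (tcol t)) \<in> dg g" "(Suc (g (tcol t)), Suc (tcol t)) \<notin> dg g" "(g (tcol t), Suc (Suc (tcol t))) \<notin> dg g"
  using assms(2) by (auto simp: dg_def corner_def)

lemma VT_finite: assumes "VT g e" "part g" shows "finite {(r, c). v \<in> e r c}"
proof -
  obtain z where z: "g z = 0" using assms(2) by (auto simp: part_def)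
  have "{(r, c). v \<in> e r c} \<subseteq> {..g 0} \<times> {..z}"
  proof
    fix p assume "p \<in> {(r, c). v \<in> e r c}"
    then obtain r c where p: "p = (r, c)" "v \<in> e r c" by auto
    then have "(r, c) \<in> dg g" using assms(1) unfolding VT_def by blast
    then have "1 \<le> r" "1 \<le> c" "r \<le> g (c - 1)" by (auto simp: dg_def)
    moreover have "g (c - 1) \<le> g 0" using partD[OF assms(2)] by simp
    moreover have "c \<le> z" using partD[OF assms(2), of z "c - 1"] z calculation by (cases "z \<le> c - 1") auto
    ultimately show "p \<in> {..g 0} \<times> {..z}" using p by auto
  qed
  then show ?thesis by (rule finite_subset) simp
qed

lemma VT_col_less:
  assumes "VT g e" "part g" "x \<in> e r c" "y \<in> e r' c" "r < r'" shows "y < x"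
  using assms(4,5)
proof (induction r' arbitrary: y)
  case (Suc r')
  have rc: "(Suc r', c) \<in> dg g" using Suc.prems assms(1) unfolding VT_def by blast
  have r1: "(r, c) \<in> dg g" using assms(1,3) unfolding VT_def by blast
  have "(r', c) \<in> dg g" using rc r1 Suc.prems(2) by (auto simp: dg_def)
  then obtain z where z: "z \<in> e r' c" using assms(1) unfolding VT_def by blast
  have yz: "y < z" using z Suc.prems(1) assms(1) unfolding VT_def by blast
  show ?case
  proof (cases "r = r'")
    case True then show ?thesis using Suc.prems(1) assms(1,3) unfolding VT_def by blast
  next
    case False then show ?thesis using Suc.IH[OF z] Suc.prems(2) yz by simp
  qed
qed simp

lemma eT_head:
  assumes "adj cls (i # is) (Tok t # cs)" "sorted (i # is)" "length is = length cs" "v \<in> eT g' is cs r c"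
  shows "i \<le> v" "v = i \<Longrightarrow> c \<le> tcol t"
proof -
  obtain t' where t': "(v, Tok t') \<in> set (zip is cs)" "c = Suc (tcol t')" using eT_zip[OF assms(4)] by blast
  then have "v \<in> set is" by (meson set_zip_leftD)
  then show "i \<le> v" using assms(2) by simp
  show "c \<le> tcol t" if "v = i"
  proof -
    have "cls (Tok t') (Tok t)" by (rule adj_cls_all[OF assms(1,2)]) (use t' that in simp)
    then show ?thesis using t'(2) by simp
  qed
qed

text \<open>The arriving label is at most all earlier ones, and its equals lie in columns strictly
  to the left. So it may enter any corner cell without violating the column condition, and it is
  small enough for the row condition.\<close>

lemma eT_Ec:
  assumes "part g" "sorted is" "cs \<in> Bc M g is" shows "eT g is cs \<in> Ec g is"
  using assms
proof (induction cs arbitrary: g "is")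
  case Nil
  then have "is = []" "\<forall>c. g c = 0" by (auto simp: Bc_def)
  then show ?case by (auto simp: Ec_def VT_def dg_def cnt_def)
next
  case (Cons d cs)
  obtain i is' where isq: "is = i # is'" using Cons.prems by (cases "is") (auto simp: Bc_def)
  obtain t where d: "d = Tok t" using Cons.prems(3) by (cases d) (auto simp: Bc_def)
  have co: "corner g t" and v: "vcode M M (down g t) cs" and l: "length is' = length cs"
    and a: "adj cls (i # is') (Tok t # cs)" using Cons.prems(3) isq d by (auto simp: Bc_def)
  let ?e' = "eT (down g t) is' cs" and ?e = "eT g is (d # cs)" and ?p = "(g (tcol t), Suc (tcol t))"
  have pd: "part (down g t)" by (rule part_down_corner[OF Cons.prems(1) co])
  have "cs \<in> Bc M (down g t) is'" using v l adj_tl[OF a] by (auto simp: Bc_def)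
  then have IH: "?e' \<in> Ec (down g t) is'" using Cons.IH[OF pd] Cons.prems(2) isq by simp
  then have V: "VT (down g t) ?e'" and cn: "\<And>v. cnt ?e' v = count_list is' v" by (auto simp: Ec_def)
  have e: "?e r c = (if (r, c) = ?p then insert i (?e' r c) else ?e' r c)" for r c using isq d by auto
  have hd: "\<And>v r c. v \<in> ?e' r c \<Longrightarrow> i \<le> v \<and> (v = i \<longrightarrow> c \<le> tcol t)"
    using eT_head[OF a _ l] Cons.prems(2) isq by blast
  have b: "?p \<in> dg g" "(Suc (g (tcol t)), Suc (tcol t)) \<notin> dg g" "(g (tcol t), Suc (Suc (tcol t))) \<notin> dg g"
    using dg_bottom[OF Cons.prems(1) co] by auto
  have sup: "?e' r c \<noteq> {} \<longleftrightarrow> (r, c) \<in> dg (down g t)" and fe: "finite (?e' r c)" for r c using V unfolding VT_def by auto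
  have out: "(r, c) \<notin> dg g \<Longrightarrow> ?e' r c = {}" for r c using sup[of r c] dg_down[OF Cons.prems(1) co, of r c] by blast
  have row: "\<And>r c x y. x \<in> ?e' r c \<Longrightarrow> y \<in> ?e' r (Suc c) \<Longrightarrow> y \<le> x"
    and colm: "\<And>r c x y. x \<in> ?e' r c \<Longrightarrow> y \<in> ?e' (Suc r) c \<Longrightarrow> y < x" using V unfolding VT_def by blast+
  have "VT g ?e"
    unfolding VT_def
  proof (intro conjI allI ballI)
    fix r c
    show "finite (?e r c)" unfolding e using fe by simp
    show "?e r c \<noteq> {} \<longleftrightarrow> (r, c) \<in> dg g"
    proof (cases "(r, c) = ?p")
      case True then show ?thesis unfolding e using b(1) by simp
    next
      case False
      then have "(r, c) \<in> dg (down g t) \<longleftrightarrow> (r, c) \<in> dg g" using dg_down[OF Cons.prems(1) co, of r c] by auto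
      then show ?thesis unfolding e using sup[of r c] False by auto
    qed
  next
    fix r c x y assume x: "x \<in> ?e r c" and y: "y \<in> ?e r (Suc c)"
    have yi: "y = i \<or> y \<in> ?e' r (Suc c)" using y unfolding e by (auto split: if_splits)
    have xi: "i \<le> x" using x hd unfolding e by (auto split: if_splits)
    show "y \<le> x"
    proof (cases "y = i")
      case False
      then have y': "y \<in> ?e' r (Suc c)" using yi by simp
      then have "(r, Suc c) \<in> dg g" using out by blast
      then have "(r, c) \<noteq> ?p" using b(3) by auto
      then show ?thesis using x y' row unfolding e by auto
    qed (use xi in simp)
  next
    fix r c x y assume x: "x \<in> ?e r c" and y: "y \<in> ?e (Suc r) c"
    show "y < x"
    proof (cases "(Suc r, c) = ?p")
      case True
      then have np: "(r, c) \<noteq> ?p" by auto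
      then have x': "x \<in> ?e' r c" using x np unfolding e by (auto split: if_splits)
      have "x \<noteq> i" using hd[OF x'] True by auto
      then have "i < x" using hd[OF x'] by simp
      then show ?thesis using y colm[OF x'] unfolding e by (auto split: if_splits)
    next
      case False
      then have y': "y \<in> ?e' (Suc r) c" using y False unfolding e by (auto split: if_splits)
      then have "(Suc r, c) \<in> dg g" using out by blast
      then have "(r, c) \<noteq> ?p" using b(2) by auto
      then show ?thesis using x colm y' unfolding e by auto
    qed
  qed
  moreover have "cnt ?e v = count_list is v" for v
  proof (cases "v = i")
    case True
    have "{(r, c). i \<in> ?e r c} = insert ?p {(r, c). i \<in> ?e' r c}" unfolding e by (auto split: if_splits)
    moreover have "?p \<notin> {(r, c). i \<in> ?e' r c}" using hd[of i "g (tcol t)" "Suc (tcol t)"] by auto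
    ultimately have "cnt ?e i = Suc (cnt ?e' i)" unfolding cnt_def using VT_finite[OF V pd, of i] by simp
    then show ?thesis using cn True isq by simp
  next
    case False
    then have "cnt ?e v = cnt ?e' v" unfolding cnt_def e by (intro arg_cong[of _ _ card]) (auto split: if_splits)
    then show ?thesis using cn False isq by simp
  qed
  ultimately show ?case by (simp add: Ec_def)
qed

text \<open>The last insertion is visible in the filling: it concerns the smallest label at its
  rightmost occurrence, and it was \<open>New\<close> exactly if the label is alone in its
  cell.\<close>

lemma eT_inj:
  assumes "part g" "sorted is" "cs \<in> Bc M g is" "ds \<in> Bc M g is" "eT g is cs = eT g is ds" shows "cs = ds"
  using assms
proof (induction cs arbitrary: g "is" ds)
  case Nil then show ?case by (auto simp: Bc_def)
next
  case (Cons d cs)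
  obtain i is' where isq: "is = i # is'" using Cons.prems by (cases "is") (auto simp: Bc_def)
  obtain d' ds' where ds: "ds = d' # ds'" using Cons.prems(4) isq by (cases ds) (auto simp: Bc_def)
  obtain t where d: "d = Tok t" using Cons.prems(3) by (cases d) (auto simp: Bc_def)
  obtain t' where d': "d' = Tok t'" using Cons.prems(4) ds by (cases d') (auto simp: Bc_def)
  have fact: "corner g t \<and> cs \<in> Bc M (down g t) is' \<and> Suc (tcol t) = Max {c. \<exists>r. i \<in> e r c}
      \<and> (t = New (tcol t) \<longleftrightarrow> e (g (tcol t)) (Suc (tcol t)) = {i})
      \<and> eT (down g t) is' cs = (\<lambda>r c. if (r, c) = (g (tcol t), Suc (tcol t)) then e r c - {i} else e r c)"
    if B: "Tok t # cs \<in> Bc M g (i # is')" and ee: "e = eT g (i # is') (Tok t # cs)" for t cs e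
  proof -
    have co: "corner g t" and v: "vcode M M (down g t) cs" and l: "length is' = length cs"
      and a: "adj cls (i # is') (Tok t # cs)" using B by (auto simp: Bc_def)
    let ?e' = "eT (down g t) is' cs" and ?p = "(g (tcol t), Suc (tcol t))"
    have pd: "part (down g t)" by (rule part_down_corner[OF Cons.prems(1) co])
    have Bc': "cs \<in> Bc M (down g t) is'" using v l adj_tl[OF a] by (auto simp: Bc_def)
    then have IH: "?e' \<in> Ec (down g t) is'" using eT_Ec[OF pd] Cons.prems(2) isq by simp
    then have V: "VT (down g t) ?e'" by (auto simp: Ec_def)
    have e: "e r c = (if (r, c) = ?p then insert i (?e' r c) else ?e' r c)" for r c using ee by auto
    have hd: "\<And>v r c. v \<in> ?e' r c \<Longrightarrow> i \<le> v \<and> (v = i \<longrightarrow> c \<le> tcol t)"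
      using eT_head[OF a _ l] Cons.prems(2) isq by blast
    have ni: "i \<notin> ?e' (g (tcol t)) (Suc (tcol t))" using hd[of i "g (tcol t)" "Suc (tcol t)"] by auto
    have le: "c \<le> Suc (tcol t)" if "i \<in> e r c" for r c using that hd[of i r c] unfolding e by (auto split: if_splits)
    have mx: "Max {c. \<exists>r. i \<in> e r c} = Suc (tcol t)"
    proof (rule Max_eqI)
      show "finite {c. \<exists>r. i \<in> e r c}" by (rule finite_subset[of _ "{..Suc (tcol t)}"]) (use le in auto)
      show "Suc (tcol t) \<in> {c. \<exists>r. i \<in> e r c}" using e[of "g (tcol t)" "Suc (tcol t)"] by auto
    qed (use le in auto)
    have sup: "?e' (g (tcol t)) (Suc (tcol t)) = {} \<longleftrightarrow> ?p \<notin> dg (down g t)" using V unfolding VT_def by blast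
    have "?p \<notin> dg (down g t) \<longleftrightarrow> t = New (tcol t)"
      using dg_down[OF Cons.prems(1) co, of "g (tcol t)" "Suc (tcol t)"] dg_bottom(1)[OF Cons.prems(1) co] by blast
    moreover have "e (g (tcol t)) (Suc (tcol t)) = {i} \<longleftrightarrow> ?e' (g (tcol t)) (Suc (tcol t)) = {}" using e ni by auto
    ultimately have nw: "t = New (tcol t) \<longleftrightarrow> e (g (tcol t)) (Suc (tcol t)) = {i}" using sup by blast
    have "?e' r c = (if (r, c) = ?p then e r c - {i} else e r c)" for r c
    proof (cases "(r, c) = ?p")
      case True
      have "e r c = insert i (?e' r c)" using e[of r c] unfolding if_P[OF True] .
      moreover have "i \<notin> ?e' r c" using ni True by simp
      ultimately show ?thesis unfolding if_P[OF True] by simp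
    next
      case False show ?thesis using e[of r c] unfolding if_not_P[OF False] by (rule sym)
    qed
    then have "?e' = (\<lambda>r c. if (r, c) = ?p then e r c - {i} else e r c)" by (intro ext)
    then show ?thesis using co Bc' mx nw by simp
  qed
  let ?e = "eT g is (d # cs)"
  have B: "Tok t # cs \<in> Bc M g (i # is')" "Tok t' # ds' \<in> Bc M g (i # is')" using Cons.prems(3,4) isq d d' ds by auto
  have e1: "?e = eT g (i # is') (Tok t # cs)" using isq d by simp
  have e2: "?e = eT g (i # is') (Tok t' # ds')" using Cons.prems(5) isq d d' ds by simp
  note f1 = fact[OF B(1) e1] and f2 = fact[OF B(2) e2]
  have tc: "tcol t = tcol t'" using f1 f2 by simp
  have "t = New (tcol t) \<longleftrightarrow> t' = New (tcol t')" using f1 f2 tc by simp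
  then have tt: "t = t'" using f1 f2 tc by (cases t; cases t') (auto simp: corner_def)
  have "eT (down g t) is' cs = eT (down g t) is' ds'" using f1 f2 tt by simp
  then have "cs = ds'" using Cons.IH[of "down g t" is' ds'] f1 f2 tt part_down_corner[OF Cons.prems(1)] Cons.prems(2) isq by simp
  then show ?case using ds d d' tt by simp
qed

text \<open>The rightmost occurrence of the smallest label lies in a corner: a cell below would need
  a smaller label, and a cell to the right would contain the same label again. Removing it undoes
  one token.\<close>

lemma eT_surj:
  assumes "part g" "sorted is" "e \<in> Ec g is" shows "\<exists>cs \<in> Bc M g is. eT g is cs = e"
  using assms
proof (induction "is" arbitrary: g e)
  case Nil
  have V: "VT g e" and c0: "\<And>v. cnt e v = 0" using Nil by (auto simp: Ec_def)
  have em: "e r c = {}" for r c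
  proof (rule ccontr)
    assume "e r c \<noteq> {}"
    then obtain v where "v \<in> e r c" by blast
    then have "{(r, c). v \<in> e r c} \<noteq> {}" by auto
    then show False using c0[of v] VT_finite[OF V Nil(1), of v] by (simp add: cnt_def)
  qed
  have "g c = 0" for c
  proof (rule ccontr)
    assume "g c \<noteq> 0"
    then have "(1, Suc c) \<in> dg g" by (simp add: dg_def)
    then show False using V em unfolding VT_def by blast
  qed
  then have "[] \<in> Bc M g []" by (simp add: Bc_def)
  moreover have "eT g [] [] = e" using em by (simp add: fun_eq_iff)
  ultimately show ?case by blast
next
  case (Cons i "is")
  have V: "VT g e" and cn: "\<And>v. cnt e v = count_list (i # is) v" using Cons.prems by (auto simp: Ec_def)
  have fin: "\<And>v. finite {(r, c). v \<in> e r c}" using VT_finite[OF V Cons.prems(1)] .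
  have min: "i \<le> v" if "v \<in> e r c" for v r c
  proof -
    have "{(r, c). v \<in> e r c} \<noteq> {}" using that by auto
    then have "cnt e v \<noteq> 0" using fin[of v] by (simp add: cnt_def)
    then have "count_list (i # is) v \<noteq> 0" using cn[of v] by simp
    then have "v \<in> set (i # is)" by (metis count_notin)
    then show ?thesis using Cons.prems(2) by auto
  qed
  let ?C = "{c. \<exists>r. i \<in> e r c}"
  have "?C = snd ` {(r, c). i \<in> e r c}" by force
  then have fC: "finite ?C" using fin[of i] by simp
  have "cnt e i \<noteq> 0" using cn[of i] by simp
  then have "{(r, c). i \<in> e r c} \<noteq> {}" unfolding cnt_def by (metis card.empty)
  then have "?C \<noteq> {}" by auto
  from Max_in[OF fC this] obtain r0 where r0: "i \<in> e r0 (Max ?C)" by blast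
  have sup: "\<And>r c. e r c \<noteq> {} \<longleftrightarrow> (r, c) \<in> dg g" and fe: "\<And>r c. finite (e r c)" using V unfolding VT_def by auto
  have d0: "(r0, Max ?C) \<in> dg g" using r0 sup by blast
  then obtain j where j: "Max ?C = Suc j" by (cases "Max ?C") (auto simp: dg_def)
  have r1: "1 \<le> r0" "r0 \<le> g j" using d0 j by (auto simp: dg_def)
  have rg: "r0 = g j"
  proof (rule ccontr)
    assume "r0 \<noteq> g j"
    then have "(Suc r0, Suc j) \<in> dg g" using r1 by (simp add: dg_def)
    then obtain y where y: "y \<in> e (Suc r0) (Suc j)" using sup by blast
    then have "y < i" using V r0 j unfolding VT_def by metis
    then show False using min[OF y] by simp
  qed
  have gc: "g (Suc j) < g j"
  proof (rule ccontr)
    assume "\<not> ?thesis"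
    then have "(r0, Suc (Suc j)) \<in> dg g" using r1 by (simp add: dg_def)
    then obtain y where y: "y \<in> e r0 (Suc (Suc j))" using sup by blast
    then have "y \<le> i" using V r0 j unfolding VT_def by metis
    then have "y = i" using min[OF y] by simp
    then have "Suc (Suc j) \<in> ?C" using y by blast
    then have "Suc (Suc j) \<le> Suc j" using Max_ge[OF fC] j by metis
    then show False by simp
  qed
  define t where "t = (if e (g j) (Suc j) = {i} then New j else Mark j)"
  have tj: "tcol t = j" and co: "corner g t" using gc by (auto simp: t_def corner_def)
  have pd: "part (down g t)" by (rule part_down_corner[OF Cons.prems(1) co])
  define e' where "e' r c = (if (r, c) = (g j, Suc j) then e r c - {i} else e r c)" for r c
  have ip: "i \<in> e (g j) (Suc j)" using r0 rg j by simp
  have e'e: "x \<in> e' r c \<Longrightarrow> x \<in> e r c" for x r c by (auto simp: e'_def split: if_splits)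
  have row: "\<And>r c x y. x \<in> e r c \<Longrightarrow> y \<in> e r (Suc c) \<Longrightarrow> y \<le> x"
    and colm: "\<And>r c x y. x \<in> e r c \<Longrightarrow> y \<in> e (Suc r) c \<Longrightarrow> y < x" using V unfolding VT_def by blast+
  have "VT (down g t) e'"
    unfolding VT_def
  proof (intro conjI allI ballI)
    fix r c
    show "finite (e' r c)" using fe by (simp add: e'_def)
    have dd: "(r, c) \<in> dg (down g t) \<longleftrightarrow> (r, c) \<in> dg g \<and> (t = New j \<longrightarrow> (r, c) \<noteq> (g j, Suc j))"
      using dg_down[OF Cons.prems(1) co, of r c] tj by auto
    show "e' r c \<noteq> {} \<longleftrightarrow> (r, c) \<in> dg (down g t)"
    proof (cases "(r, c) = (g j, Suc j)")
      case True
      then have "e' r c = {} \<longleftrightarrow> e (g j) (Suc j) = {i}" using ip by (auto simp: e'_def)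
      moreover have "(r, c) \<in> dg g" using sup ip True by blast
      ultimately show ?thesis using dd True by (auto simp: t_def)
    next
      case False then show ?thesis using dd sup[of r c] by (auto simp: e'_def)
    qed
    show "y \<le> x" if "x \<in> e' r c" "y \<in> e' r (Suc c)" for x y by (rule row[OF e'e[OF that(1)] e'e[OF that(2)]])
    show "y < x" if "x \<in> e' r c" "y \<in> e' (Suc r) c" for x y by (rule colm[OF e'e[OF that(1)] e'e[OF that(2)]])
  qed
  moreover have "cnt e' v = count_list is v" for v
  proof (cases "v = i")
    case True
    have "{(r, c). i \<in> e r c} = insert (g j, Suc j) {(r, c). i \<in> e' r c}" using ip by (auto simp: e'_def split: if_splits)
    moreover have "(g j, Suc j) \<notin> {(r, c). i \<in> e' r c}" by (simp add: e'_def)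
    moreover have "finite {(r, c). i \<in> e' r c}" by (rule finite_subset[OF _ fin[of i]]) (auto dest: e'e)
    ultimately have "cnt e i = Suc (cnt e' i)" by (simp add: cnt_def)
    then show ?thesis using cn[of i] True by simp
  next
    case False
    then have "cnt e v = cnt e' v" unfolding cnt_def e'_def by (intro arg_cong[of _ _ card]) (auto split: if_splits)
    then show ?thesis using cn[of v] False by simp
  qed
  ultimately have E': "e' \<in> Ec (down g t) is" by (simp add: Ec_def)
  obtain cs where cs: "cs \<in> Bc M (down g t) is" "eT (down g t) is cs = e'"
    using Cons.IH[OF pd _ E'] Cons.prems(2) by auto
  have "eT g (i # is) (Tok t # cs) = e"
    using cs(2) tj ip by (auto simp: e'_def fun_eq_iff)
  moreover have "adj cls (i # is) (Tok t # cs)"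
  proof (cases "\<exists>i' is' c' cs'. is = i' # is' \<and> cs = c' # cs' \<and> i = i'")
    case True
    then obtain is' c' cs' where s: "is = i # is'" "cs = c' # cs'" by blast
    obtain t' where c': "c' = Tok t'" using cs(1) s by (cases c') (auto simp: Bc_def)
    have "i \<in> e' (down g t (tcol t')) (Suc (tcol t'))" using cs(2) s c' by auto
    then have i': "i \<in> e (down g t (tcol t')) (Suc (tcol t'))" "\<not> (down g t (tcol t') = g j \<and> tcol t' = j)"
      by (auto simp: e'_def split: if_splits)
    have "Suc (tcol t') \<in> ?C" using i'(1) by blast
    then have "Suc (tcol t') \<le> Suc j" using Max_ge[OF fC] j by metis
    moreover have "tcol t' \<noteq> j"
    proof
      assume tt: "tcol t' = j"
      then have ne: "down g t j \<noteq> g j" using i'(2) by auto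
      have "down g t j < g j \<or> g j < down g t j" using ne by linarith
      then show False
        using VT_col_less[OF V Cons.prems(1) ip, of i "down g t j"] VT_col_less[OF V Cons.prems(1), of i "down g t j" "Suc j" i "g j"] i'(1) ip tt
        by auto
    qed
    ultimately have "tcol t' < tcol t" using tj by simp
    then show ?thesis using s c' cs(1) by (simp add: Bc_def)
  next
    case False
    then show ?thesis using cs(1) by (cases "is"; cases cs) (auto simp: Bc_def)
  qed
  ultimately have "Tok t # cs \<in> Bc M g (i # is) \<and> eT g (i # is) (Tok t # cs) = e" using cs(1) co by (auto simp: Bc_def)
  then show ?case by blast
qed

lemma eT_bij: assumes "part g" "sorted is" shows "bij_betw (eT g is) (Bc M g is) (Ec g is)"
proof (rule bij_betw_imageI)
  show "inj_on (eT g is) (Bc M g is)" by (rule inj_onI) (rule eT_inj[OF assms])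
  show "eT g is ` Bc M g is = Ec g is"
  proof
    show "eT g is ` Bc M g is \<subseteq> Ec g is" by (rule image_subsetI) (rule eT_Ec[OF assms])
    show "Ec g is \<subseteq> eT g is ` Bc M g is"
    proof
      fix e assume "e \<in> Ec g is"
      from eT_surj[OF assms this, of M] show "e \<in> eT g is ` Bc M g is" by auto
    qed
  qed
qed

text \<open>Labels entering an existing cell never exceed the one that opened it, so the maxima are
  already fixed by the \<open>New\<close> tokens.\<close>

lemma eT_Max:
  assumes "part g" "sorted is" "cs \<in> Bc M g is"
  shows "qC is cs c = (\<lambda>r. Max (eT g is cs r (Suc c))) ` {1..g c}"
  using assms
proof (induction cs arbitrary: g "is")
  case Nil then show ?case by (auto simp: Bc_def)
next
  case (Cons d cs)
  obtain i is' where isq: "is = i # is'" using Cons.prems by (cases "is") (auto simp: Bc_def)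
  obtain t where d: "d = Tok t" using Cons.prems(3) by (cases d) (auto simp: Bc_def)
  have co: "corner g t" and v: "vcode M M (down g t) cs" and l: "length is' = length cs"
    and a: "adj cls (i # is') (Tok t # cs)" using Cons.prems(3) isq d by (auto simp: Bc_def)
  let ?e' = "eT (down g t) is' cs" and ?e = "eT g is (d # cs)" and ?p = "(g (tcol t), Suc (tcol t))"
  have pd: "part (down g t)" by (rule part_down_corner[OF Cons.prems(1) co])
  have B': "cs \<in> Bc M (down g t) is'" using v l adj_tl[OF a] by (auto simp: Bc_def)
  have s': "sorted is'" using Cons.prems(2) isq by simp
  have IH: "qC is' cs c = (\<lambda>r. Max (?e' r (Suc c))) ` {1..down g t c}" by (rule Cons.IH[OF pd s' B'])
  have V: "VT (down g t) ?e'" using eT_Ec[OF pd s' B'] by (simp add: Ec_def)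
  have sup: "?e' r c \<noteq> {} \<longleftrightarrow> (r, c) \<in> dg (down g t)" and fe: "finite (?e' r c)" for r c using V unfolding VT_def by auto
  have e: "?e r c = (if (r, c) = ?p then insert i (?e' r c) else ?e' r c)" for r c using isq d by auto
  have hd: "\<And>v r c. v \<in> ?e' r c \<Longrightarrow> i \<le> v" using eT_head[OF a _ l] Cons.prems(2) isq by blast
  have gp: "1 \<le> g (tcol t)" using co by (simp add: corner_def)
  show ?case
  proof (cases t)
    case Idle then show ?thesis using co by (simp add: corner_def)
  next
    case (New j)
    show ?thesis
    proof (cases "c = j")
      case False
      then have "?e r (Suc c) = ?e' r (Suc c)" for r unfolding e using New by simp
      moreover have "qC is (d # cs) c = qC is' cs c" using isq d New False by simp
      ultimately show ?thesis using IH New False by simp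
    next
      case True
      have r: "{1..g j} = insert (g j) {1..down g t j}" using gp New by auto
      have em: "?e' (g j) (Suc j) = {}" using sup[of "g j" "Suc j"] New gp by (auto simp: dg_def)
      have "Max (?e (g j) (Suc j)) = i" unfolding e using em New by simp
      moreover have "Max (?e r (Suc j)) = Max (?e' r (Suc j))" if "r \<in> {1..down g t j}" for r
        using that unfolding e using New gp by auto
      moreover have "qC is (d # cs) j = insert i (qC is' cs j)" using isq d New by simp
      ultimately show ?thesis using IH True unfolding True r by (auto simp: image_def)
    qed
  next
    case (Mark j)
    have "Max (?e r (Suc c)) = Max (?e' r (Suc c))" for r
    proof (cases "(r, Suc c) = ?p")
      case p: True
      have "(r, Suc c) \<in> dg (down g t)" using p Mark dg_bottom(1)[OF Cons.prems(1) co] by simp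
      then have ne: "?e' r (Suc c) \<noteq> {}" using sup by simp
      have "Max (insert i (?e' r (Suc c))) = max i (Max (?e' r (Suc c)))" by (rule Max_insert[OF fe ne])
      moreover have "i \<le> Max (?e' r (Suc c))" using hd[OF Max_in[OF fe ne]] .
      ultimately show ?thesis unfolding e if_P[OF p] by simp
    qed (auto simp: e)
    then show ?thesis using IH isq d Mark by simp
  qed
qed

section \<open>Splitting words into tokens and letters\<close>

lemma bij_betw_inverseI:
  assumes "f ` A \<subseteq> B" "g ` B \<subseteq> A" "\<And>x. x \<in> A \<Longrightarrow> g (f x) = x" "\<And>y. y \<in> B \<Longrightarrow> f (g y) = y"
  shows "bij_betw f A B"
  by (rule bij_betw_byWitness[where f' = g]) (use assms in auto)


text \<open>Sorted labels and strictness under equal labels in a single relation on pairs. As a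
  \<open>sorted_wrt\<close> condition it passes to sublists, which is what separating tokens from
  letters requires.\<close>

definition pre :: "nat \<times> code \<Rightarrow> nat \<times> code \<Rightarrow> bool" where
  "pre p q \<longleftrightarrow> fst p < fst q \<or> fst p = fst q \<and> cls (snd q) (snd p)"

fun isTok :: "code \<Rightarrow> bool" where "isTok (Tok t) = True" | "isTok (Let x) = False"

abbreviation tks :: "(nat \<times> code) list \<Rightarrow> (nat \<times> code) list" where "tks \<equiv> filter (\<lambda>p. isTok (snd p))"
abbreviation lts :: "(nat \<times> code) list \<Rightarrow> (nat \<times> code) list" where "lts \<equiv> filter (\<lambda>p. \<not> isTok (snd p))"

lemma pre_zip:
  assumes "length is = length cs"
  shows "sorted_wrt pre (zip is cs) \<longleftrightarrow> sorted is \<and> adj cls is cs"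
  using assms
proof (induction "is" cs rule: list_induct2)
  case (Cons i "is" c cs)
  show ?case
  proof
    assume a: "sorted_wrt pre (zip (i # is) (c # cs))"
    then have al: "\<And>q. q \<in> set (zip is cs) \<Longrightarrow> pre (i, c) q" and t: "sorted is" "adj cls is cs" using Cons.IH by auto
    have "i \<le> x" if x: "x \<in> set is" for x
    proof -
      obtain k where k: "k < length is" "is ! k = x" using x unfolding in_set_conv_nth by blast
      then have "(x, cs ! k) \<in> set (zip is cs)" using Cons.hyps by (auto simp: in_set_zip)
      from al[OF this] show ?thesis by (auto simp: pre_def)
    qed
    moreover have "cls c' c" if "is = i # is'" "cs = c' # cs'" for c' is' cs' using al[of "(i, c')"] that by (simp add: pre_def)
    then have "adj cls (i # is) (c # cs)" using t(2) by (cases "is"; cases cs) auto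
    ultimately show "sorted (i # is) \<and> adj cls (i # is) (c # cs)" using t by simp
  next
    assume a: "sorted (i # is) \<and> adj cls (i # is) (c # cs)"
    have "pre (i, c) q" if "q \<in> set (zip is cs)" for q
    proof -
      obtain x y where q: "q = (x, y)" by (cases q)
      have "x \<in> set is" using that q by (meson set_zip_leftD)
      then have "i \<le> x" using a by simp
      moreover have "cls y c" if "x = i" using adj_cls_all[of i "is" c cs y] a \<open>q \<in> set (zip is cs)\<close> q that by blast
      ultimately show ?thesis using q by (auto simp: pre_def)
    qed
    then show "sorted_wrt pre (zip (i # is) (c # cs))" using a adj_tl[of cls i "is" c cs] Cons.IH by auto
  qed
qed simp

text \<open>Tokens are in the first list, verbatim letters in the second. Under equal labels the
  letters go first, since \<open>cls\<close> ranks them above tokens; hence the strict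
  inequality.\<close>

fun mrg :: "(nat \<times> code) list \<Rightarrow> (nat \<times> code) list \<Rightarrow> (nat \<times> code) list" where
  "mrg (x # xs) (y # ys) = (if fst x < fst y then x # mrg xs (y # ys) else y # mrg (x # xs) ys)"
| "mrg [] ys = ys"
| "mrg xs [] = xs"

lemma mrg_Nil [simp]: "mrg xs [] = xs" by (cases xs) auto

lemma mrg_set: "set (mrg xs ys) = set xs \<union> set ys" by (induction xs ys rule: mrg.induct) auto

lemma mrg_filter:
  "\<forall>x\<in>set xs. isTok (snd x) \<Longrightarrow> \<forall>y\<in>set ys. \<not> isTok (snd y) \<Longrightarrow> tks (mrg xs ys) = xs \<and> lts (mrg xs ys) = ys"
proof (induction xs ys rule: mrg.induct)
  case (2 ys) then show ?case by (simp add: filter_id_conv filter_empty_conv)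
next
  case (3 x xs) then show ?case by (auto simp: filter_id_conv filter_empty_conv)
qed auto

lemma cls_TL: "isTok a \<Longrightarrow> \<not> isTok b \<Longrightarrow> cls a b \<and> \<not> cls b a" by (cases a; cases b) auto

lemma mrg_sorted:
  "\<forall>x\<in>set xs. isTok (snd x) \<Longrightarrow> \<forall>y\<in>set ys. \<not> isTok (snd y) \<Longrightarrow> sorted_wrt pre xs \<Longrightarrow> sorted_wrt pre ys
    \<Longrightarrow> sorted_wrt pre (mrg xs ys)"
proof (induction xs ys rule: mrg.induct)
  case (1 x xs y ys)
  show ?case
  proof (cases "fst x < fst y")
    case True
    have "pre x q" if "q \<in> set (y # ys)" for q
    proof -
      have "fst y \<le> fst q" using that 1(6) by (auto simp: pre_def)
      then show ?thesis using True by (simp add: pre_def)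
    qed
    then show ?thesis using 1(1) 1(3-6) True by (auto simp: mrg_set)
  next
    case False
    have "pre y q" if "q \<in> set (x # xs)" for q
    proof -
      have "fst x \<le> fst q" using that 1(5) by (auto simp: pre_def)
      moreover have "cls (snd q) (snd y)" using that 1(3,4) cls_TL by auto
      ultimately show ?thesis using False by (auto simp: pre_def)
    qed
    then show ?thesis using 1(2) 1(3-6) False by (auto simp: mrg_set)
  qed
qed auto

lemma mrg_split: "sorted_wrt pre z \<Longrightarrow> mrg (tks z) (lts z) = z"
proof (induction z)
  case (Cons p z)
  then have IH: "mrg (tks z) (lts z) = z" and al: "\<And>q. q \<in> set z \<Longrightarrow> pre p q" by auto
  show ?case
  proof (cases "isTok (snd p)")
    case True
    show ?thesis
    proof (cases "lts z")
      case Nil then show ?thesis using IH True by simp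
    next
      case (Cons y ys)
      then have "y \<in> set (lts z)" by simp
      then have y: "y \<in> set z" "\<not> isTok (snd y)" by auto
      have "fst p < fst y" using al[OF y(1)] cls_TL[OF True y(2)] by (auto simp: pre_def)
      then show ?thesis using IH True Cons by simp
    qed
  next
    case False
    show ?thesis
    proof (cases "tks z")
      case Nil then show ?thesis using IH False by simp
    next
      case (Cons y ys)
      then have "y \<in> set (tks z)" by simp
      then have y: "y \<in> set z" by auto
      have "\<not> fst y < fst p" using al[OF y] by (auto simp: pre_def)
      then show ?thesis using IH False Cons by simp
    qed
  qed
qed simp

lemma vcode_split: "vcode N M g cs \<longleftrightarrow> vcode M M g (filter isTok cs) \<and> (\<forall>x\<in>set (lets cs). N < x \<and> x \<le> M)"
proof (induction cs arbitrary: g)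
  case (Cons c cs) then show ?case by (cases c) auto
qed simp

lemma vcode_isTok: "vcode M M g cs \<Longrightarrow> \<forall>c\<in>set cs. isTok c"
proof (induction cs arbitrary: g)
  case (Cons c cs) then show ?case by (cases c) auto
qed simp

lemma lets_lts: "lets (map snd (lts z)) = lets (map snd z)"
proof (induction z)
  case (Cons p z) then show ?case by (cases "snd p") auto
qed simp

lemma lets_Nil: "\<forall>c\<in>set cs. isTok c \<Longrightarrow> lets cs = []"
proof (induction cs)
  case (Cons c cs) then show ?case by (cases c) auto
qed simp

lemma aq_tks: "aq (map fst (tks z)) (map snd (tks z)) = aq (map fst z) (map snd z)"
proof (induction z)
  case (Cons p z)
  show ?case
  proof (cases "snd p")
    case (Tok t) then show ?thesis using Cons by (cases t) (auto simp: aq_Tok)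
  next
    case (Let x) then show ?thesis using Cons by simp
  qed
qed simp

lemma map_snd_tks: "map snd (tks z) = filter isTok (map snd z)" by (simp add: filter_map o_def)

section \<open>Label words and their weights\<close>

lemma length_wtw [simp]: "length (wtw n l) = n" by (simp add: wtw_def)

lemma length_filter_eq: "length (filter (\<lambda>x. x = v) l) = count_list l v" by (induction l) auto

lemma wtw_nth: "k < n \<Longrightarrow> wtw n l ! k = count_list l (Suc k)"
  by (simp add: wtw_def length_filter_eq del: upt_Suc)

lemma sorted_count_unique:
  "sorted l \<Longrightarrow> sorted l' \<Longrightarrow> (\<And>v. count_list l v = count_list l' v) \<Longrightarrow> l = (l' :: nat list)"
proof (induction l arbitrary: l')
  case Nil
  show ?case
  proof (cases l')
    case (Cons x xs) then show ?thesis using Nil(3)[of x] by simp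
  qed simp
next
  case (Cons i l)
  show ?case
  proof (cases l')
    case Nil then show ?thesis using Cons.prems(3)[of i] by simp
  next
    case l': (Cons x xs)
    have "i \<in> set l'" using Cons.prems(3)[of i] by (metis count_list.simps(2) count_notin add_is_0 zero_neq_one)
    then have "x \<le> i" using Cons.prems(2) l' by auto
    moreover have "x \<in> set (i # l)" using Cons.prems(3)[of x] l' by (metis count_list.simps(2) count_notin add_is_0 zero_neq_one)
    then have "i \<le> x" using Cons.prems(1) by auto
    ultimately have ix: "i = x" by simp
    have "count_list l v = count_list xs v" for v using Cons.prems(3)[of v] l' ix by (auto split: if_splits)
    then show ?thesis using Cons.IH[of xs] Cons.prems l' ix by simp
  qed
qed

lemma wtw_unique:
  assumes "sorted l" "sorted l'" "set l \<subseteq> {1..n}" "set l' \<subseteq> {1..n}" "wtw n l = wtw n l'" shows "l = l'"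
proof (rule sorted_count_unique[OF assms(1,2)])
  fix v
  show "count_list l v = count_list l' v"
  proof (cases "v \<in> {1..n}")
    case True
    then have "wtw n l ! (v - 1) = wtw n l' ! (v - 1)" "v - 1 < n" "Suc (v - 1) = v" using assms(5) by auto
    then show ?thesis using wtw_nth[of "v - 1" n] by metis
  next
    case False
    then have "v \<notin> set l" "v \<notin> set l'" using assms(3,4) by blast+
    then show ?thesis by simp
  qed
qed

lemma isof: "\<exists>l. sorted l \<and> set l \<subseteq> {1..length \<gamma>} \<and> wtw (length \<gamma>) l = \<gamma> \<and> length l = sum_list \<gamma>"
proof (induction \<gamma> rule: rev_induct)
  case Nil show ?case by (rule exI[of _ "[]"]) (simp add: wtw_def)
next
  case (snoc m \<gamma>)
  then obtain l where l: "sorted l" "set l \<subseteq> {1..length \<gamma>}" "wtw (length \<gamma>) l = \<gamma>" "length l = sum_list \<gamma>" by blast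
  let ?l = "l @ replicate m (Suc (length \<gamma>))"
  have "sorted ?l" using l(1,2) by (auto simp: sorted_append)
  moreover have "set ?l \<subseteq> {1..length (\<gamma> @ [m])}" using l(2) by auto
  moreover have "wtw (length (\<gamma> @ [m])) ?l = \<gamma> @ [m]"
  proof (rule nth_equalityI)
    fix k assume "k < length (wtw (length (\<gamma> @ [m])) ?l)"
    then have k: "k < Suc (length \<gamma>)" by simp
    have c: "count_list (replicate m x) v = (if x = v then m else 0)" for x v :: nat by (induction m) auto
    have z: "count_list l (Suc (length \<gamma>)) = 0" using l(2) by (intro count_notin) auto
    show "wtw (length (\<gamma> @ [m])) ?l ! k = (\<gamma> @ [m]) ! k"
    proof (cases "k < length \<gamma>")
      case True
      have "count_list l (Suc k) = \<gamma> ! k" using wtw_nth[OF True, of l] l(3) by simp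
      then show ?thesis using True k c by (simp add: wtw_nth nth_append)
    next
      case False
      then have "k = length \<gamma>" using k by simp
      then show ?thesis using z c by (simp add: wtw_nth)
    qed
  qed simp
  moreover have "length ?l = sum_list (\<gamma> @ [m])" using l(4) by simp
  ultimately show ?case by blast
qed

lemma length_wtw_sum: "sorted l \<Longrightarrow> set l \<subseteq> {1..n} \<Longrightarrow> length l = sum_list (wtw n l)"
  using isof[of "wtw n l"] wtw_unique[of l _ n] by (metis length_wtw)

definition ZZ :: "nat \<Rightarrow> nat \<Rightarrow> (nat \<Rightarrow> nat) \<Rightarrow> (nat \<Rightarrow> nat) \<Rightarrow> (nat list \<Rightarrow> bool) \<Rightarrow> nat \<Rightarrow> nat list \<Rightarrow> (nat \<times> code) list set" where
  "ZZ N M g A R n \<gamma> = {z. sorted_wrt pre z \<and> fst ` set z \<subseteq> {1..n} \<and> wtw n (map fst z) = \<gamma> \<and> vcode N M g (map snd z)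
     \<and> kle (aq (map fst z) (map snd z)) A \<and> R (lets (map snd z))}"

definition ZL :: "nat \<Rightarrow> nat \<Rightarrow> (nat list \<Rightarrow> bool) \<Rightarrow> nat \<Rightarrow> nat list \<Rightarrow> (nat \<times> code) list set" where
  "ZL N M R n \<gamma> = {z. sorted_wrt pre z \<and> fst ` set z \<subseteq> {1..n} \<and> wtw n (map fst z) = \<gamma> \<and> (\<forall>p\<in>set z. \<not> isTok (snd p))
     \<and> (\<forall>x\<in>set (lets (map snd z)). N < x \<and> x \<le> M) \<and> R (lets (map snd z))}"

lemma sorted_pre: assumes "sorted_wrt pre z" shows "sorted (map fst z)" "adj cls (map fst z) (map snd z)"
proof -
  have "zip (map fst z) (map snd z) = z" by (rule zip_map_fst_snd)
  then show "sorted (map fst z)" "adj cls (map fst z) (map snd z)" using pre_zip[of "map fst z" "map snd z"] assms by auto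
qed

text \<open>A sorted label word with entries in \<open>{1..n}\<close> is determined by its weight,
  so fixing the weight of the pairs is the same as fixing the label word.\<close>

lemma bij_ZZ:
  assumes "sorted is" "set is \<subseteq> {1..n}" "wtw n is = \<gamma>"
  shows "bij_betw (zip is) {cs. length cs = length is \<and> vcode N M g cs \<and> adj cls is cs \<and> kle (aq is cs) A \<and> R (lets cs)}
     (ZZ N M g A R n \<gamma>)"
proof (rule bij_betw_inverseI[where g = "map snd"])
  show "zip is ` {cs. length cs = length is \<and> vcode N M g cs \<and> adj cls is cs \<and> kle (aq is cs) A \<and> R (lets cs)} \<subseteq> ZZ N M g A R n \<gamma>"
  proof (rule image_subsetI)
    fix cs assume cs: "cs \<in> {cs. length cs = length is \<and> vcode N M g cs \<and> adj cls is cs \<and> kle (aq is cs) A \<and> R (lets cs)}"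
    have m: "map fst (zip is cs) = is" "map snd (zip is cs) = cs" using cs by auto
    have "fst ` set (zip is cs) = set is" using m(1) by (metis set_map)
    then show "zip is cs \<in> ZZ N M g A R n \<gamma>" unfolding ZZ_def using m cs assms pre_zip[of "is" cs] by simp
  qed
  have f: "map fst z = is" if "z \<in> ZZ N M g A R n \<gamma>" for z
    by (rule wtw_unique[of _ _ n]) (use that assms sorted_pre in \<open>auto simp: ZZ_def\<close>)
  show "map snd ` ZZ N M g A R n \<gamma> \<subseteq> {cs. length cs = length is \<and> vcode N M g cs \<and> adj cls is cs \<and> kle (aq is cs) A \<and> R (lets cs)}"
  proof (rule image_subsetI)
    fix z assume z: "z \<in> ZZ N M g A R n \<gamma>"
    have "adj cls is (map snd z)" using sorted_pre(2)[of z] f[OF z] z by (simp add: ZZ_def)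
    moreover have "length (map snd z) = length is" using f[OF z] by (metis length_map)
    ultimately show "map snd z \<in> {cs. length cs = length is \<and> vcode N M g cs \<and> adj cls is cs \<and> kle (aq is cs) A \<and> R (lets cs)}"
      using z f[OF z] by (simp add: ZZ_def)
  qed
  show "map snd (zip is cs) = cs" if "cs \<in> {cs. length cs = length is \<and> vcode N M g cs \<and> adj cls is cs \<and> kle (aq is cs) A \<and> R (lets cs)}" for cs
    using that by simp
  show "zip is (map snd z) = z" if "z \<in> ZZ N M g A R n \<gamma>" for z using f[OF that] by (metis zip_map_fst_snd)
qed

lemma finite_list_le: "finite {c. list_all2 (\<le>) c (\<gamma> :: nat list)}"
proof (rule finite_subset)
  show "{c. list_all2 (\<le>) c \<gamma>} \<subseteq> {c. set c \<subseteq> {..sum_list \<gamma>} \<and> length c = length \<gamma>}"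
  proof (intro subsetI CollectI conjI)
    fix c x assume c: "c \<in> {c. list_all2 (\<le>) c \<gamma>}"
    then show l: "length c = length \<gamma>" by (auto simp: list_all2_lengthD)
    assume "x \<in> set c"
    then obtain k where k: "k < length c" "x = c ! k" by (auto simp: in_set_conv_nth)
    have "c ! k \<le> \<gamma> ! k" using c k list_all2_nthD by blast
    also have "\<dots> \<le> sum_list \<gamma>" using k l by (intro member_le_sum_list) auto
    finally show "x \<in> {..sum_list \<gamma>}" using k by simp
  qed
qed (rule finite_lists_length_eq, simp)

lemma finite_ZL: "finite (ZL N M R n \<gamma>)"
proof (cases "length \<gamma> = n")
  case True
  then obtain "is" where is': "sorted is" "set is \<subseteq> {1..n}" "wtw n is = \<gamma>" using isof[of \<gamma>] by blast
  have "ZL N M R n \<gamma> \<subseteq> zip is ` map Let ` {a. set a \<subseteq> {..M} \<and> length a = length is}"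
  proof
    fix z assume z: "z \<in> ZL N M R n \<gamma>"
    have f: "map fst z = is" by (rule wtw_unique[of _ _ n]) (use z is' sorted_pre in \<open>auto simp: ZL_def\<close>)
    have l: "map snd z = map Let (lets (map snd z))" if "\<forall>p\<in>set z. \<not> isTok (snd p)" for z
      using that
    proof (induction z)
      case (Cons p z) then show ?case by (cases "snd p") auto
    qed simp
    have m: "map snd z = map Let (lets (map snd z))" by (rule l) (use z in \<open>simp add: ZL_def\<close>)
    have "length (map Let (lets (map snd z))) = length is" using m f by (metis length_map)
    then have "lets (map snd z) \<in> {a. set a \<subseteq> {..M} \<and> length a = length is}" using z by (auto simp: ZL_def)
    moreover have "z = zip is (map Let (lets (map snd z)))" using m f by (metis zip_map_fst_snd)
    ultimately show "z \<in> zip is ` map Let ` {a. set a \<subseteq> {..M} \<and> length a = length is}" by blast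
  qed
  then show ?thesis by (rule finite_subset) (intro finite_imageI finite_lists_length_eq, simp)
next
  case False
  then have "ZL N M R n \<gamma> = {}" by (auto simp: ZL_def)
  then show ?thesis by simp
qed

lemma count_split: "count_list (map fst z) v = count_list (map fst (tks z)) v + count_list (map fst (lts z)) v"
  by (induction z) auto

text \<open>A sorted code is the unique merge of its tokens and its letters, and the conditions
  separate: shape and key concern the tokens, \<open>R\<close> concerns the letters. Distributing by
  the weight \<open>c\<close> of the tokens produces the convolution of a product of
  polynomials.\<close>

lemma card_ZZ:
  assumes "\<And>c. finite (ZZ M M g A (\<lambda>_. True) n c)"
  shows "card (ZZ N M g A R n \<gamma>) = (\<Sum>c\<in>{c. list_all2 (\<le>) c \<gamma>}. card (ZZ M M g A (\<lambda>_. True) n c) * card (ZL N M R n (map2 (-) \<gamma> c)))"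
proof -
  let ?S = "SIGMA c:{c. list_all2 (\<le>) c \<gamma>}. ZZ M M g A (\<lambda>_. True) n c \<times> ZL N M R n (map2 (-) \<gamma> c)"
  let ?f = "\<lambda>z. (wtw n (map fst (tks z)), tks z, lts z)"
  have "bij_betw ?f (ZZ N M g A R n \<gamma>) ?S"
  proof (rule bij_betw_inverseI[where g = "\<lambda>(c, x, y). mrg x y"])
    show "?f ` ZZ N M g A R n \<gamma> \<subseteq> ?S"
    proof (rule image_subsetI)
      fix z assume z: "z \<in> ZZ N M g A R n \<gamma>"
      then have s: "sorted_wrt pre z" and w: "wtw n (map fst z) = \<gamma>" and fs: "fst ` set z \<subseteq> {1..n}"
        and v: "vcode N M g (map snd z)" and k: "kle (aq (map fst z) (map snd z)) A" and R: "R (lets (map snd z))" by (auto simp: ZZ_def)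
      have lg: "length \<gamma> = n" using w by auto
      have nth: "wtw n (map fst (tks z)) ! i + wtw n (map fst (lts z)) ! i = \<gamma> ! i" if "i < n" for i
        using that count_split[of z "Suc i"] w wtw_nth[OF that, of "map fst z"] by (simp add: wtw_nth)
      have 1: "list_all2 (\<le>) (wtw n (map fst (tks z))) \<gamma>"
        unfolding list_all2_conv_all_nth using lg nth by (metis le_add1 length_wtw)
      have w2: "wtw n (map fst (lts z)) = map2 (-) \<gamma> (wtw n (map fst (tks z)))"
      proof (rule nth_equalityI)
        fix i assume "i < length (wtw n (map fst (lts z)))"
        then have i: "i < n" by simp
        then show "wtw n (map fst (lts z)) ! i = map2 (-) \<gamma> (wtw n (map fst (tks z))) ! i"
          using nth[OF i] lg by simp
      qed (use lg in simp)
      have 2: "tks z \<in> ZZ M M g A (\<lambda>_. True) n (wtw n (map fst (tks z)))"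
        unfolding ZZ_def mem_Collect_eq
      proof (intro conjI TrueI refl)
        show "sorted_wrt pre (tks z)" by (rule sorted_wrt_filter[OF s])
        show "fst ` set (tks z) \<subseteq> {1..n}" using fs by auto
        show "vcode M M g (map snd (tks z))" unfolding map_snd_tks using v vcode_split[of N M g "map snd z"] by blast
        show "kle (aq (map fst (tks z)) (map snd (tks z))) A" unfolding aq_tks by (rule k)
      qed
      have 3: "lts z \<in> ZL N M R n (map2 (-) \<gamma> (wtw n (map fst (tks z))))"
        unfolding ZL_def mem_Collect_eq lets_lts
      proof (intro conjI w2 R)
        show "sorted_wrt pre (lts z)" by (rule sorted_wrt_filter[OF s])
        show "fst ` set (lts z) \<subseteq> {1..n}" using fs by auto
        show "\<forall>p\<in>set (lts z). \<not> isTok (snd p)" by simp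
        show "\<forall>x\<in>set (lets (map snd z)). N < x \<and> x \<le> M" using v vcode_split[of N M g "map snd z"] by blast
      qed
      show "?f z \<in> ?S" using 1 2 3 by blast
    qed
    show "(\<lambda>(c, x, y). mrg x y) ` ?S \<subseteq> ZZ N M g A R n \<gamma>"
    proof (rule image_subsetI)
      fix p assume "p \<in> ?S"
      then obtain c x y where p: "p = (c, x, y)" and c: "list_all2 (\<le>) c \<gamma>" and x: "x \<in> ZZ M M g A (\<lambda>_. True) n c"
        and y: "y \<in> ZL N M R n (map2 (-) \<gamma> c)" by auto
      have xt: "\<forall>q\<in>set x. isTok (snd q)" using x vcode_isTok[of M g "map snd x"] by (auto simp: ZZ_def)
      have yt: "\<forall>q\<in>set y. \<not> isTok (snd q)" using y by (auto simp: ZL_def)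
      let ?z = "mrg x y"
      have f: "tks ?z = x" "lts ?z = y" using mrg_filter[OF xt yt] by auto
      have s: "sorted_wrt pre ?z" using mrg_sorted[OF xt yt] x y by (auto simp: ZZ_def ZL_def)
      have lg: "length c = length \<gamma>" "length c = n" using list_all2_lengthD[OF c] x by (auto simp: ZZ_def)
      have "wtw n (map fst ?z) = \<gamma>"
      proof (rule nth_equalityI)
        fix i assume "i < length (wtw n (map fst ?z))"
        then have i: "i < n" by simp
        have "wtw n (map fst ?z) ! i = wtw n (map fst x) ! i + wtw n (map fst y) ! i"
          using count_split[of ?z "Suc i"] f i by (simp add: wtw_nth)
        also have "\<dots> = c ! i + (\<gamma> ! i - c ! i)" using x y i lg by (simp add: ZZ_def ZL_def)
        also have "\<dots> = \<gamma> ! i" using list_all2_nthD[OF c, of i] i lg by simp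
        finally show "wtw n (map fst ?z) ! i = \<gamma> ! i" .
      qed (use lg in simp)
      moreover have "fst ` set ?z \<subseteq> {1..n}" using x y by (auto simp: mrg_set ZZ_def ZL_def)
      moreover have "vcode N M g (map snd ?z)"
        unfolding vcode_split[of N M g "map snd ?z"] map_snd_tks[symmetric] lets_lts[of ?z, symmetric] f
        using x y by (auto simp: ZZ_def ZL_def)
      moreover have "kle (aq (map fst ?z) (map snd ?z)) A" using x aq_tks[of ?z] f by (simp add: ZZ_def)
      moreover have "R (lets (map snd ?z))" using y lets_lts[of ?z] f by (simp add: ZL_def)
      ultimately show "(\<lambda>(c, x, y). mrg x y) p \<in> ZZ N M g A R n \<gamma>" using s p by (simp add: ZZ_def)
    qed
    show "(\<lambda>(c, x, y). mrg x y) (?f z) = z" if "z \<in> ZZ N M g A R n \<gamma>" for z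
      using mrg_split[of z] that by (simp add: ZZ_def)
    show "?f ((\<lambda>(c, x, y). mrg x y) p) = p" if "p \<in> ?S" for p
    proof -
      obtain c x y where p: "p = (c, x, y)" and x: "x \<in> ZZ M M g A (\<lambda>_. True) n c"
        and y: "y \<in> ZL N M R n (map2 (-) \<gamma> c)" using \<open>p \<in> ?S\<close> by auto
      have xt: "\<forall>q\<in>set x. isTok (snd q)" using x vcode_isTok[of M g "map snd x"] by (auto simp: ZZ_def)
      have yt: "\<forall>q\<in>set y. \<not> isTok (snd q)" using y by (auto simp: ZL_def)
      show ?thesis using mrg_filter[OF xt yt] p x by (simp add: ZZ_def)
    qed
  qed
  then have "card (ZZ N M g A R n \<gamma>) = card ?S" by (rule bij_betw_same_card)
  also have "\<dots> = (\<Sum>c\<in>{c. list_all2 (\<le>) c \<gamma>}. card (ZZ M M g A (\<lambda>_. True) n c \<times> ZL N M R n (map2 (-) \<gamma> c)))"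
    by (rule card_SigmaI[OF finite_list_le]) (use assms finite_ZL in auto)
  finally show ?thesis by (simp add: card_cartesian_product)
qed

lemma adj_nth:
  "length is = length cs \<Longrightarrow> adj R is cs \<longleftrightarrow> (\<forall>j. Suc j < length is \<longrightarrow> is ! j = is ! Suc j \<longrightarrow> R (cs ! Suc j) (cs ! j))"
proof (induction "is" cs rule: list_induct2)
  case (Cons i "is" c cs)
  have all: "(\<forall>j. P j) \<longleftrightarrow> P 0 \<and> (\<forall>j. P (Suc j))" for P :: "nat \<Rightarrow> bool" by (metis not0_implies_Suc)
  show ?case
  proof (cases "is")
    case Nil then show ?thesis using Cons by simp
  next
    case is': (Cons i' is')
    then obtain c' cs' where cs: "cs = c' # cs'" using Cons.hyps by (cases cs) auto
    show ?thesis using Cons.IH unfolding is' cs by (subst all) simp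
  qed
qed simp

lemma compatible_adj:
  "compatible a l \<longleftrightarrow> length a = length l \<and> sorted l \<and> adj cls l (map Let a)"
  unfolding compatible_def using adj_nth[of l "map Let a" cls] by auto

lemma groth_ZL:
  assumes "\<And>a. hecke_word a (inv w) \<longleftrightarrow> R a" "\<And>a. R a \<Longrightarrow> set a \<subseteq> {Suc N..M}" "sum_list \<gamma> = perm_length w + k"
  shows "groth n w \<gamma> k = int (card (ZL N M R n \<gamma>))"
proof -
  let ?D = "{(a, i). compatible a i \<and> set i \<subseteq> {1..n} \<and> hecke_word a (inv w) \<and> wtw n i = \<gamma> \<and> length a = perm_length w + k}"
  have lM: "lets (map Let a) = a" for a by (induction a) auto
  have Ml: "map Let (lets (map snd z)) = map snd z" if "\<forall>p\<in>set z. \<not> isTok (snd p)" for z :: "(nat \<times> code) list"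
    using that
  proof (induction z)
    case (Cons p z) then show ?case by (cases "snd p") auto
  qed simp
  have "bij_betw (\<lambda>(a, i). zip i (map Let a)) ?D (ZL N M R n \<gamma>)"
  proof (rule bij_betw_inverseI[where g = "\<lambda>z. (lets (map snd z), map fst z)"])
    show "(\<lambda>(a, i). zip i (map Let a)) ` ?D \<subseteq> ZL N M R n \<gamma>"
    proof (rule image_subsetI)
      fix p assume "p \<in> ?D"
      then obtain a i where p: "p = (a, i)" and c: "compatible a i" "set i \<subseteq> {1..n}" "R a" "wtw n i = \<gamma>" using assms(1) by auto
      let ?z = "zip i (map Let a)"
      have l: "length i = length (map Let a)" using c(1) by (simp add: compatible_def)
      have m: "map fst ?z = i" "map snd ?z = map Let a" using l by auto
      have "fst ` set ?z = set i" using m(1) by (metis set_map)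
      moreover have "\<forall>q\<in>set ?z. \<not> isTok (snd q)"
      proof
        fix q assume "q \<in> set ?z"
        then have "snd q \<in> set (map snd ?z)" by simp
        then show "\<not> isTok (snd q)" unfolding m(2) by auto
      qed
      moreover have "sorted_wrt pre ?z" using pre_zip[OF l] c(1) compatible_adj by simp
      ultimately have "?z \<in> ZL N M R n \<gamma>" unfolding ZL_def using m c assms(2)[OF c(3)] lM by auto
      then show "(\<lambda>(a, i). zip i (map Let a)) p \<in> ZL N M R n \<gamma>" using p by simp
    qed
    show "(\<lambda>z. (lets (map snd z), map fst z)) ` ZL N M R n \<gamma> \<subseteq> ?D"
    proof (rule image_subsetI)
      fix z assume z: "z \<in> ZL N M R n \<gamma>"
      then have zt: "\<forall>p\<in>set z. \<not> isTok (snd p)" and s: "sorted_wrt pre z" by (auto simp: ZL_def)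
      note m = Ml[OF zt]
      have l: "length (lets (map snd z)) = length (map fst z)" using m by (metis length_map)
      have "compatible (lets (map snd z)) (map fst z)" unfolding compatible_adj m using l sorted_pre[OF s] by simp
      moreover have "length (map fst z) = sum_list \<gamma>" using length_wtw_sum[OF sorted_pre(1)[OF s], of n] z by (simp add: ZL_def)
      ultimately show "(lets (map snd z), map fst z) \<in> ?D" using z l assms(1,3) by (auto simp: ZL_def)
    qed
    show "(\<lambda>z. (lets (map snd z), map fst z)) ((\<lambda>(a, i). zip i (map Let a)) p) = p" if "p \<in> ?D" for p
      using that lM by (auto simp: compatible_def)
    show "(\<lambda>(a, i). zip i (map Let a)) (lets (map snd z), map fst z) = z" if "z \<in> ZL N M R n \<gamma>" for z
      using that Ml[of z] by (simp add: ZL_def zip_map_fst_snd)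
  qed
  then show ?thesis unfolding groth_def using bij_betw_same_card by fastforce
qed

section \<open>Restriction, reading word and capped keys\<close>

lemma filter_take:
  assumes "k \<le> length xs" "\<And>c. c < length xs \<Longrightarrow> Q (xs ! c) \<longleftrightarrow> c < k" shows "filter Q xs = take k xs"
proof -
  have "filter Q (take k xs) = take k xs" unfolding filter_id_conv
  proof
    fix x assume "x \<in> set (take k xs)"
    then obtain c where c: "c < length (take k xs)" "x = take k xs ! c" unfolding in_set_conv_nth by blast
    then show "Q x" using assms(2)[of c] by simp
  qed
  moreover have "filter Q (drop k xs) = []" unfolding filter_empty_conv
  proof
    fix x assume "x \<in> set (drop k xs)"
    then obtain c where c: "c < length (drop k xs)" "x = drop k xs ! c" unfolding in_set_conv_nth by blast
    then show "\<not> Q x" using assms(2)[of "k + c"] assms(1) by simp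
  qed
  ultimately show ?thesis by (metis append_take_drop_id filter_append append_Nil2)
qed

lemma ht_fam_of:
  assumes "increasing P" shows "ht (fam_of P) a c = card {b \<in> col P (Suc c). b \<le> a}"
  unfolding ht_card cl_fam_of by (rule arg_cong[of _ _ card]) (use inc_pos[OF assms] in auto)

lemma ht_le_hts: assumes "increasing P" shows "ht (fam_of P) a c \<le> hts P c"
  unfolding ht_fam_of[OF assms] inc_col_list(4)[OF assms, of c, symmetric]
  by (rule card_mono[OF inc_col_list(5)[OF assms]]) auto

text \<open>Rows and columns increase, so the entries up to \<open>N\<close> occupy an initial part
  of each row and the emptied rows are at the bottom; filtering therefore moves no entry to another
  cell.\<close>

lemma restrict_mkT:
  assumes inc: "increasing P" and f: "fam M (fam_of P)"
  shows "restrict_le N P = mkT (ht (fam_of P) N) (entry P)"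
proof -
  let ?h = "ht (fam_of P) N"
  let ?row = "\<lambda>r. map (\<lambda>c. entry P (Suc r) (Suc c)) [0..<first_col ?h r]"
  have y: "young P" using inc by (simp add: increasing_def)
  have p: "part ?h" by (rule fam_part[OF f])
  have row: "filter (\<lambda>x. x \<le> N) (P ! r) = ?row r" if r: "r < length P" for r
  proof -
    have "hts P (length (P ! r)) \<le> r" using first_col(1)[OF young_cells(2)[OF y], of r] young_cells(3)[OF y r] by simp
    then have fl: "first_col ?h r \<le> length (P ! r)"
      using first_col_less[OF p, of "length (P ! r)" r] ht_le_hts[OF inc, of N "length (P ! r)"] by linarith
    have "filter (\<lambda>x. x \<le> N) (P ! r) = take (first_col ?h r) (P ! r)"
    proof (rule filter_take[OF fl])
      fix c assume c: "c < length (P ! r)"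
      have ce: "(Suc r, Suc c) \<in> cells P" using r c by (simp add: cells_def)
      show "P ! r ! c \<le> N \<longleftrightarrow> c < first_col ?h r"
        using inc_le_iff[OF inc ce, of N] ht_fam_of[OF inc, of N c] first_col_less[OF p, of c r] by (simp add: entry_def Suc_le_eq)
    qed
    also have "\<dots> = ?row r" by (rule nth_equalityI) (use fl in \<open>auto simp: entry_def\<close>)
    finally show ?thesis .
  qed
  have "map (filter (\<lambda>x. x \<le> N)) P = map (\<lambda>r. filter (\<lambda>x. x \<le> N) (P ! r)) [0..<length P]" by (rule nth_equalityI) auto
  also have "\<dots> = map ?row [0..<length P]" by (rule map_cong) (use row in auto)
  finally have "restrict_le N P = filter (\<lambda>row. row \<noteq> []) (map ?row [0..<length P])" by (simp add: restrict_le_def)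
  also have "\<dots> = map ?row (filter (\<lambda>r. ?row r \<noteq> []) [0..<length P])" by (simp only: filter_map o_def)
  also have "filter (\<lambda>r. ?row r \<noteq> []) [0..<length P] = filter (\<lambda>r. r < ?h 0) [0..<length P]"
  proof (rule filter_cong[OF refl])
    fix r show "?row r \<noteq> [] \<longleftrightarrow> r < ?h 0" using first_col_less[OF p, of 0 r] by auto
  qed
  also have "\<dots> = take (?h 0) [0..<length P]"
    by (rule filter_take) (use ht_le_hts[OF inc, of N 0] young_cells(4)[OF y] in auto)
  also have "\<dots> = [0..<?h 0]" using ht_le_hts[OF inc, of N 0] young_cells(4)[OF y] by (simp add: take_upt)
  finally show ?thesis by (simp add: mkT_def)
qed

lemma restrict_inc:
  assumes inc: "increasing P" and f: "fam M (fam_of P)"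
  shows "increasing (restrict_le N P)" "fam_of (restrict_le N P) = res N (fam_of P)"
proof -
  let ?h = "ht (fam_of P) N"
  have y: "young P" using inc by (simp add: increasing_def)
  have p: "part ?h" by (rule fam_part[OF f])
  note R = restrict_mkT[OF inc f, of N]
  have ce: "cells (restrict_le N P) = dg ?h" unfolding R by (rule cells_mkT[OF p])
  have en: "entry (restrict_le N P) r c = entry P r c" if "(r, c) \<in> dg ?h" for r c unfolding R by (rule entry_mkT[OF p that])
  have sub: "(r, c) \<in> cells P" if "(r, c) \<in> dg ?h" for r c
    using that ht_le_hts[OF inc, of N "c - 1"] unfolding young_cells(1)[OF y] by (auto simp: dg_def)
  have i1: "\<And>r c. (r, c) \<in> cells P \<Longrightarrow> 0 < entry P r c"
    and i2: "\<And>r c. (r, c) \<in> cells P \<Longrightarrow> (r, Suc c) \<in> cells P \<Longrightarrow> entry P r c < entry P r (Suc c)"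
    and i3: "\<And>r c. (r, c) \<in> cells P \<Longrightarrow> (Suc r, c) \<in> cells P \<Longrightarrow> entry P r c < entry P (Suc r) c"
    using inc unfolding increasing_def by auto
  show "increasing (restrict_le N P)"
    unfolding increasing_def ce
  proof (intro conjI allI impI ballI)
    show "young (restrict_le N P)" unfolding R by (rule young_mkT[OF p])
    show "case x of (r, c) \<Rightarrow> 0 < entry (restrict_le N P) r c" if "x \<in> dg ?h" for x
    proof -
      obtain r c where x: "x = (r, c)" by (cases x)
      have "(r, c) \<in> dg ?h" using that x by simp
      then show ?thesis using x en i1[OF sub] by simp
    qed
    show "entry (restrict_le N P) r c < entry (restrict_le N P) r (Suc c)" if "(r, c) \<in> dg ?h \<and> (r, Suc c) \<in> dg ?h" for r c
      using that en i2[OF sub sub] by simp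
    show "entry (restrict_le N P) r c < entry (restrict_le N P) (Suc r) c" if "(r, c) \<in> dg ?h \<and> (Suc r, c) \<in> dg ?h" for r c
      using that en i3[OF sub sub] by simp
  qed
  have c: "col (restrict_le N P) (Suc c) = {b \<in> col P (Suc c). b \<le> N}" for c
  proof -
    have d: "(r, Suc c) \<in> dg ?h \<longleftrightarrow> (r, Suc c) \<in> cells P \<and> entry P r (Suc c) \<le> N" for r
    proof (cases "(r, Suc c) \<in> cells P")
      case True
      then have "1 \<le> r" by (simp add: cells_def)
      then show ?thesis using True inc_le_iff[OF inc True, of N] ht_fam_of[OF inc, of N c] by (simp add: dg_def)
    qed (use sub in blast)
    have "col (restrict_le N P) (Suc c) = {entry P r (Suc c) | r. (r, Suc c) \<in> dg ?h}"
      unfolding col_def ce using en[of _ "Suc c"] by (metis (no_types, lifting))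
    then show ?thesis unfolding d col_def by auto
  qed
  show "fam_of (restrict_le N P) = res N (fam_of P)"
    unfolding fam_of_def c res_def by (auto simp: fun_eq_iff)
qed

lemma restrict_iff:
  assumes "increasing P" "fam M (fam_of P)" "increasing P1"
  shows "restrict_le N P = P1 \<longleftrightarrow> res N (fam_of P) = fam_of P1"
  using restrict_inc[OF assms(1,2), of N] fam_of_inj[OF _ assms(3), of "restrict_le N P"] by auto

lemma fw_more: "K' \<le> K \<Longrightarrow> (\<And>c. K' \<le> c \<Longrightarrow> C c = {}) \<Longrightarrow> fw K C = fw K' C"
proof (induction K)
  case (Suc K)
  then show ?case by (cases "K' = Suc K") (auto simp: fw_Suc cw_def)
qed simp

lemma col_list_sorted:
  assumes inc: "increasing P" shows "col_list P (Suc c) = sorted_list_of_set (col P (Suc c))"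
proof -
  have y: "young P" using inc by (simp add: increasing_def)
  have ce: "(r, Suc c) \<in> cells P \<longleftrightarrow> 1 \<le> r \<and> r \<le> hts P c" for r unfolding young_cells(1)[OF y] dg_def by auto
  have hl: "hts P c \<le> length P" using partD[OF young_cells(2)[OF y], of 0 c] young_cells(4)[OF y] by simp
  have "filter (\<lambda>r. (r, Suc c) \<in> cells P) [1..<length P + 1] = take (hts P c) [1..<length P + 1]"
  proof (rule filter_take)
    show "hts P c \<le> length [1..<length P + 1]" using hl by (simp del: upt_Suc)
    fix k assume "k < length [1..<length P + 1]"
    then have "[1..<length P + 1] ! k = Suc k" using nth_upt[of 1 k "length P + 1"] by (simp del: upt_Suc)
    then show "([1..<length P + 1] ! k, Suc c) \<in> cells P \<longleftrightarrow> k < hts P c" using ce[of "Suc k"] by (simp add: Suc_le_eq del: upt_Suc)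
  qed
  also have "\<dots> = [1..<Suc (hts P c)]" using hl by (simp add: take_upt del: upt_Suc)
  finally show ?thesis unfolding col_list_def inc_col_list(1)[OF inc] by simp
qed

text \<open>Columns to the right of the tableau are empty and add nothing to the word, so one number
  \<open>K\<close> of columns can be used for all tableaux.\<close>

lemma word_fw:
  assumes inc: "increasing P" and f: "fam M (fam_of P)" and "M < K"
  shows "word P = fw K (cl (fam_of P))"
proof -
  have y: "young P" using inc by (simp add: increasing_def)
  have em: "col P (Suc c) = {}" if "ncols P \<le> c" for c
  proof (rule ccontr)
    assume "col P (Suc c) \<noteq> {}"
    then obtain r where r: "1 \<le> r" "r \<le> length P" "Suc c \<le> length (P ! (r - 1))" unfolding col_def cells_def by auto
    have "length (P ! (r - 1)) \<le> length (P ! 0)" by (rule young_len[OF y]) (use r in auto)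
    moreover have "P \<noteq> []" using r by auto
    then have "length (P ! 0) = ncols P" by (simp add: ncols_def hd_conv_nth)
    ultimately show False using r(3) that by simp
  qed
  have nK: "ncols P \<le> K"
  proof (cases "ncols P")
    case (Suc c)
    then have "P \<noteq> []" by (auto simp: ncols_def)
    then have "(1, Suc c) \<in> cells P" using Suc by (cases P) (auto simp: cells_def ncols_def)
    then have "entry P 1 (Suc c) \<in> col P (Suc c)" by (auto simp: col_def)
    then have "c \<in> fam_of P (entry P 1 (Suc c))" by (simp add: fam_of_def)
    then have "c < M" by (rule fam_cols[OF f])
    then show ?thesis using Suc assms(3) by simp
  qed simp
  have "word P = concat (map (\<lambda>j. rev (col_list P j)) (map Suc [0..<ncols P]))"
    unfolding word_def map_Suc_upt by simp
  also have "\<dots> = fw (ncols P) (cl (fam_of P))"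
    unfolding fw_def map_map o_def col_list_sorted[OF inc] cl_fam_of cw_def ..
  also have "\<dots> = fw K (cl (fam_of P))" by (rule fw_more[symmetric, OF nK]) (simp add: em cl_fam_of)
  finally show ?thesis .
qed

lemma tri_fold:
  assumes "finite X" "\<And>i. finite (D i)"
  shows "foldr (\<lambda>i X. tri (D i) X) l X = foldr (\<lambda>i X. gl.G (D i) X) l X \<and> finite (foldr (\<lambda>i X. gl.G (D i) X) l X)"
proof (induction l)
  case (Cons i l)
  let ?X = "foldr (\<lambda>i X. gl.G (D i) X) l X"
  have "tri (D i) ?X = gl.G (D i) ?X" using Cons assms(2) by (intro tri_G) auto
  moreover have "finite (gl.G (D i) ?X)" by (rule finite_subset[OF gl.G_sub[OF assms(2)] assms(2)])
  ultimately show ?case using Cons by simp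
qed (use assms in simp)

lemma leftkey_al:
  assumes inc: "increasing P" and f: "fam M (fam_of P)"
  shows "leftkey_col P (Suc c) = {i. c < al (fam_of P) M i}"
proof -
  have fi: "\<And>c. finite (col P (Suc c))" by (rule inc_col_list(5)[OF inc])
  have D: "Da (fam_of P) M c = col P (Suc c)" for c
    unfolding Da_def cl_fam_of using f inc_pos[OF inc] unfolding fam_def fam_of_def by (auto simp: not_less[symmetric])
  have "leftkey_col P (Suc c) = foldr (\<lambda>i X. tri (col P i) X) (map Suc [0..<c]) (col P (Suc c))"
    unfolding leftkey_col_def map_Suc_upt by simp
  also have "\<dots> = foldr (\<lambda>i X. tri (col P (Suc i)) X) [0..<c] (col P (Suc c))" by (simp add: foldr_map o_def)
  also have "\<dots> = gl.lk (Da (fam_of P) M) c"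
    unfolding gl.lk_def gl.Ph_def D 
    by (rule conjunct1[OF tri_fold[of "col P (Suc c)" "\<lambda>i. col P (Suc i)" "[0..<c]", OF fi fi]])
  also have "\<dots> = {i. c < al (fam_of P) M i}" using lk_al[of M "fam_of P"] f unfolding fam_def by blast
  finally show ?thesis .
qed

lemma kv_fam: "fam M F \<Longrightarrow> kv M (ht F M) (al F M)" by (rule kv_al) (simp add: fam_def)

lemma count_mkT:
  assumes p: "part h"
  shows "sum_list (map (\<lambda>row. length (filter Q row)) (mkT h e)) = card {(r, c). r < h c \<and> Q (e (Suc r) (Suc c))}"
proof -
  have "sum_list (map (\<lambda>row. length (filter Q row)) (mkT h e))
      = (\<Sum>r\<in>{0..<h 0}. length (filter Q (map (\<lambda>c. e (Suc r) (Suc c)) [0..<first_col h r])))"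
    by (simp add: mkT_def o_def interv_sum_list_conv_sum_set_nat)
  also have "\<dots> = (\<Sum>r\<in>{0..<h 0}. card {c. c < first_col h r \<and> Q (e (Suc r) (Suc c))})"
    by (rule sum.cong) (auto simp: length_filter_conv_card intro!: arg_cong[of _ _ card])
  also have "\<dots> = card (SIGMA r:{0..<h 0}. {c. c < first_col h r \<and> Q (e (Suc r) (Suc c))})"
    by (rule card_SigmaI[symmetric]) auto
  also have "(SIGMA r:{0..<h 0}. {c. c < first_col h r \<and> Q (e (Suc r) (Suc c))}) = {(r, c). r < h c \<and> Q (e (Suc r) (Suc c))}"
  proof -
    have "r < h 0" if "r < h c" for r c using partD[OF p, of 0 c] that by simp
    then show ?thesis using first_col_less[OF p] by auto
  qed
  finally show ?thesis .
qed

lemma card_by_col: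
  fixes X :: "nat \<Rightarrow> 'a set"
  assumes "\<And>c. finite (X c)" "\<And>c. z \<le> c \<Longrightarrow> X c = {}"
  shows "card {(i, c). i \<in> X c} = (\<Sum>c<z. card (X c))"
proof -
  have "{(i, c). i \<in> X c} = prod.swap ` (SIGMA c:{..<z}. X c)" 
  proof (rule set_eqI)
    fix p :: "'a \<times> nat"
    obtain i c where p: "p = (i, c)" by (cases p)
    have "c < z" if "i \<in> X c" using assms(2)[of c] that by (cases "z \<le> c") auto
    then show "p \<in> {(i, c). i \<in> X c} \<longleftrightarrow> p \<in> prod.swap ` (SIGMA c:{..<z}. X c)" unfolding p pair_in_swap_image by auto
  qed
  moreover have "inj_on prod.swap (SIGMA c:{..<z}. X c)" by (auto simp: inj_on_def)
  ultimately have "card {(i, c). i \<in> X c} = card (SIGMA c:{..<z}. X c)" by (simp add: card_image)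
  then show ?thesis using assms(1) by simp
qed

lemma col_tab:
  assumes p: "part h" and C: "\<And>c. finite (C (Suc c))" "\<And>c. card (C (Suc c)) = h c"
    and T: "T = mkT h (\<lambda>r c. sorted_list_of_set (C c) ! (r - 1))"
  shows "col T (Suc c) = C (Suc c)" "wt n T = map (\<lambda>i. card {c. i \<in> C (Suc c)}) [1..<n + 1]"
proof -
  have im: "(\<lambda>r. sorted_list_of_set (C (Suc c)) ! r) ` {..<h c} = C (Suc c)" for c
  proof -
    have l: "length (sorted_list_of_set (C (Suc c))) = h c" using C by simp
    have "(\<lambda>r. sorted_list_of_set (C (Suc c)) ! r) ` {..<h c} = set (sorted_list_of_set (C (Suc c)))"
      unfolding set_conv_nth l by auto
    then show ?thesis using C(1) by simp
  qed
  show "col T (Suc c) = C (Suc c)"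
  proof -
    have "col T (Suc c) = {entry T r (Suc c) | r. (r, Suc c) \<in> dg h}" unfolding col_def T cells_mkT[OF p] ..
    also have "\<dots> = (\<lambda>r. entry T r (Suc c)) ` {r. (r, Suc c) \<in> dg h}" by auto
    also have "{r. (r, Suc c) \<in> dg h} = Suc ` {..<h c}"
    proof -
      have "(r, Suc c) \<in> dg h \<longleftrightarrow> r \<in> Suc ` {..<h c}" for r by (cases r) (auto simp: dg_def)
      then show ?thesis by auto
    qed
    also have "(\<lambda>r. entry T r (Suc c)) ` Suc ` {..<h c} = (\<lambda>r. sorted_list_of_set (C (Suc c)) ! r) ` {..<h c}"
      unfolding image_image
    proof (rule image_cong[OF refl])
      fix r assume "r \<in> {..<h c}"
      then have d: "(Suc r, Suc c) \<in> dg h" by (simp add: dg_def)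
      from entry_mkT[OF p d, of "\<lambda>r c. sorted_list_of_set (C c) ! (r - 1)"] show "entry T (Suc r) (Suc c) = sorted_list_of_set (C (Suc c)) ! r" unfolding T by simp
    qed
    finally show ?thesis using im by simp
  qed
  have "card {(r, c). r < h c \<and> sorted_list_of_set (C (Suc c)) ! r = i} = card {c. i \<in> C (Suc c)}" for i
  proof -
    let ?S = "{(r, c). r < h c \<and> sorted_list_of_set (C (Suc c)) ! r = i}"
    have "snd ` ?S = {c. i \<in> C (Suc c)}"
    proof
      show "snd ` ?S \<subseteq> {c. i \<in> C (Suc c)}"
      proof
        fix c assume "c \<in> snd ` ?S"
        then obtain r where "r < h c" "sorted_list_of_set (C (Suc c)) ! r = i" by auto
        then have "i \<in> (\<lambda>r. sorted_list_of_set (C (Suc c)) ! r) ` {..<h c}" by auto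
        then show "c \<in> {c. i \<in> C (Suc c)}" unfolding im by simp
      qed
      show "{c. i \<in> C (Suc c)} \<subseteq> snd ` ?S"
      proof
        fix c assume "c \<in> {c. i \<in> C (Suc c)}"
        then have "i \<in> (\<lambda>r. sorted_list_of_set (C (Suc c)) ! r) ` {..<h c}" unfolding im by simp
        then obtain r where "r < h c" "sorted_list_of_set (C (Suc c)) ! r = i" by auto
        then have "(r, c) \<in> ?S" by simp
        then show "c \<in> snd ` ?S" by force
      qed
    qed
    moreover have "inj_on snd ?S"
    proof (rule inj_onI)
      fix x y assume x: "x \<in> ?S" and y: "y \<in> ?S" and s: "snd x = snd y"
      obtain r c where x': "x = (r, c)" by (cases x)
      obtain r' where y': "y = (r', c)" using s x' by (cases y) auto
      have "distinct (sorted_list_of_set (C (Suc c)))" "length (sorted_list_of_set (C (Suc c))) = h c" using C by auto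
      moreover have "r < h c" "r' < h c" "sorted_list_of_set (C (Suc c)) ! r = sorted_list_of_set (C (Suc c)) ! r'" using x y x' y' by auto
      ultimately have "r = r'" using nth_eq_iff_index_eq by metis
      then show "x = y" using x' y' by simp
    qed
    ultimately show ?thesis using card_image[of snd ?S] by simp
  qed
  then show "wt n T = map (\<lambda>i. card {c. i \<in> C (Suc c)}) [1..<n + 1]"
    unfolding wt_def T count_mkT[OF p] by (simp del: upt_Suc)
qed

lemma K_minus_cols:
  assumes inc: "increasing P" and f: "fam M (fam_of P)"
  shows "col (K_minus P) (Suc c) = {i. c < al (fam_of P) M i}" "wt n (K_minus P) = map (al (fam_of P) M) [1..<n + 1]"
    "map length (K_minus P) = map length P"
proof -
  have y: "young P" using inc by (simp add: increasing_def)
  have T: "K_minus P = mkT (hts P) (\<lambda>r c. sorted_list_of_set (leftkey_col P c) ! (r - 1))"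
    unfolding K_minus_def by (rule tab_of_cols_mkT[OF y])
  have p: "part (hts P)" by (rule young_cells(2)[OF y])
  note kv = kv_fam[OF f, unfolded hts_fam_of[OF inc f]]
  have 1: "finite (leftkey_col P (Suc c))" for c unfolding leftkey_al[OF inc f] by (rule kv_fin[OF kv])
  have 2: "card (leftkey_col P (Suc c)) = hts P c" for c unfolding leftkey_al[OF inc f] using kv by (simp add: kv_def)
  show "col (K_minus P) (Suc c) = {i. c < al (fam_of P) M i}" using col_tab(1)[OF p 1 2 T, of c] leftkey_al[OF inc f] by simp
  have "card {c. c < al (fam_of P) M i} = al (fam_of P) M i" for i by simp
  then show "wt n (K_minus P) = map (al (fam_of P) M) [1..<n + 1]"
    using col_tab(2)[OF p 1 2 T, of n] unfolding leftkey_al[OF inc f] by simp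
  show "map length (K_minus P) = map length P" unfolding T map_length_mkT
    by (rule nth_equalityI) (use young_cells(3,4)[OF y] in auto)
qed

section \<open>Capped key columns\<close>

lemma top_k_card: "finite A \<Longrightarrow> k \<le> card A \<Longrightarrow> card (top_k k (A :: nat set)) = k"
proof (induction k)
  case 0 show ?case by (simp add: top_k_def)
next
  case (Suc k)
  let ?B = "A - top_k k A"
  have t: "top_k k A \<subseteq> A" by (auto simp: top_k_def)
  have c: "card (top_k k A) = k" using Suc by simp
  have "?B \<noteq> {}" using Suc.prems c t by (metis Diff_eq_empty_iff Suc_n_not_le_n subset_antisym)
  moreover have fB: "finite ?B" using Suc.prems by simp
  ultimately have m: "Max ?B \<in> ?B" by (rule Max_in[rotated])
  have gt: "{b \<in> A. Max ?B < b} = top_k k A"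
  proof
    show "{b \<in> A. Max ?B < b} \<subseteq> top_k k A"
    proof
      fix b assume b: "b \<in> {b \<in> A. Max ?B < b}"
      show "b \<in> top_k k A"
      proof (rule ccontr)
        assume "b \<notin> top_k k A"
        then have "b \<le> Max ?B" using b fB by (intro Max_ge) auto
        then show False using b by simp
      qed
    qed
    show "top_k k A \<subseteq> {b \<in> A. Max ?B < b}"
    proof
      fix b assume b: "b \<in> top_k k A"
      have "Max ?B < b"
      proof (rule ccontr)
        assume "\<not> Max ?B < b"
        then have "{x \<in> A. Max ?B < x} \<subseteq> {x \<in> A. b < x}" by auto
        then have "card {x \<in> A. Max ?B < x} \<le> card {x \<in> A. b < x}" using Suc.prems by (intro card_mono) auto
        then have "Max ?B \<in> top_k k A" using b m by (auto simp: top_k_def)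
        then show False using m by simp
      qed
      then show "b \<in> {b \<in> A. Max ?B < b}" using b t by auto
    qed
  qed
  have "top_k (Suc k) A = insert (Max ?B) (top_k k A)"
  proof
    have in_top: "x \<in> top_k l A" if "x \<in> A" "card {b \<in> A. x < b} < l" for x l using that by (simp add: top_k_def)
    have "Max ?B \<in> A" using m by blast
    moreover have "card {b \<in> A. Max ?B < b} < Suc k" unfolding gt c by simp
    ultimately have "Max ?B \<in> top_k (Suc k) A" by (rule in_top)
    moreover have "top_k k A \<subseteq> top_k (Suc k) A" by (auto simp: top_k_def)
    ultimately show "insert (Max ?B) (top_k k A) \<subseteq> top_k (Suc k) A" by simp
    show "top_k (Suc k) A \<subseteq> insert (Max ?B) (top_k k A)"
    proof
      fix b assume b: "b \<in> top_k (Suc k) A"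
      then have bA: "b \<in> A" and bc: "card {x \<in> A. b < x} < Suc k" by (auto simp: top_k_def)
      show "b \<in> insert (Max ?B) (top_k k A)"
      proof (rule ccontr)
        assume n: "\<not> ?thesis"
        then have "b \<in> ?B" "b \<noteq> Max ?B" using bA by blast+
        then have lt: "b < Max ?B" using Max_ge[OF fB] by (simp add: le_neq_implies_less)
        have sub: "insert (Max ?B) (top_k k A) \<subseteq> {x \<in> A. b < x}"
        proof
          fix x assume "x \<in> insert (Max ?B) (top_k k A)"
          then have "x = Max ?B \<or> x \<in> {b \<in> A. Max ?B < b}" using gt by blast
          then show "x \<in> {x \<in> A. b < x}"
          proof
            assume "x = Max ?B" then show ?thesis using lt m by blast
          next
            assume "x \<in> {b \<in> A. Max ?B < b}" then show ?thesis using less_trans[OF lt] by blast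
          qed
        qed
        have fA: "finite {x \<in> A. b < x}" using Suc.prems by simp
        have "card (insert (Max ?B) (top_k k A)) \<le> card {x \<in> A. b < x}" by (rule card_mono[OF fA sub])
        moreover have "Max ?B \<notin> top_k k A" using m by blast
        then have "card (insert (Max ?B) (top_k k A)) = Suc k" using c finite_subset[OF t] Suc.prems(1) card_insert_disjoint by metis
        ultimately show False using bc by linarith
      qed
    qed
  qed
  moreover have "Max ?B \<notin> top_k k A" using m by blast
  ultimately show ?case using c finite_subset[OF t] Suc.prems(1) card_insert_disjoint by metis
qed

lemma cap_col_basic:
  assumes "finite C" "card C \<le> n"
  shows "cap_col n C \<subseteq> {1..n}" "finite (cap_col n C)" "card (cap_col n C) = card C"
proof -
  show s: "cap_col n C \<subseteq> {1..n}" by (auto simp: cap_col_def top_k_def)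
  then show "finite (cap_col n C)" by (rule finite_subset) simp
  have cc: "card C = card (C \<inter> {1..n}) + card (C - {1..n})" using card_Int_Diff[OF assms(1)] .
  have "card ({1..n} - C) = n - card (C \<inter> {1..n})"
    using card_Diff_subset_Int[of "{1..n}" C] by (simp add: Int_commute)
  then have "card (C - {1..n}) \<le> card ({1..n} - C)" using cc assms(2) by simp
  then have "card (top_k (card (C - {1..n})) ({1..n} - C)) = card (C - {1..n})" by (intro top_k_card) auto
  moreover have "(C \<inter> {1..n}) \<inter> top_k (card (C - {1..n})) ({1..n} - C) = {}" by (auto simp: top_k_def)
  moreover have "finite (top_k (card (C - {1..n})) ({1..n} - C))" by (rule finite_subset[of _ "{1..n}"]) (auto simp: top_k_def)
  ultimately show "card (cap_col n C) = card C" unfolding cap_col_def using cc assms(1) by (subst card_Un_disjoint) auto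
qed

text \<open>The larger column has at least as many entries to relocate and at most as many gaps
  above \<open>x\<close>. This keeps capped columns nested, so that a weight vector describes
  them.\<close>

lemma cap_col_mono:
  assumes "finite B" "A \<subseteq> B" shows "cap_col n A \<subseteq> cap_col n B"
proof
  fix x assume x: "x \<in> cap_col n A"
  show "x \<in> cap_col n B"
  proof (cases "x \<in> B")
    case True then show ?thesis using x by (auto simp: cap_col_def top_k_def)
  next
    case False
    then have "x \<in> top_k (card (A - {1..n})) ({1..n} - A)" using x assms(2) by (auto simp: cap_col_def)
    then have x1: "x \<in> {1..n}" "card {b \<in> {1..n} - A. x < b} < card (A - {1..n})" by (auto simp: top_k_def)
    have "card {b \<in> {1..n} - B. x < b} \<le> card {b \<in> {1..n} - A. x < b}" using assms(2) by (intro card_mono) auto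
    moreover have "card (A - {1..n}) \<le> card (B - {1..n})" using assms by (intro card_mono) auto
    ultimately have "x \<in> top_k (card (B - {1..n})) ({1..n} - B)" using x1 False by (auto simp: top_k_def)
    then show ?thesis by (simp add: cap_col_def)
  qed
qed

text \<open>A column inside \<open>{1..n}\<close> is indifferent to where beyond \<open>n\<close> an
  entry lies. As soon as a relocated entry lies below \<open>t\<close>, all of \<open>{t..n}\<close>
  is occupied in the capped column, and the inequality follows by counting the entries from
  \<open>t\<close> on.\<close>

lemma cap_lo:
  assumes C: "finite C" "card A = card C" and A: "A \<subseteq> {1..n}" and z: "0 \<notin> C"
  shows "(\<forall>t. card {x \<in> C. x < t} \<le> card {x \<in> A. x < t}) \<longleftrightarrow> (\<forall>t. card {x \<in> cap_col n C. x < t} \<le> card {x \<in> A. x < t})"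
proof -
  have fA: "finite A" using A by (rule finite_subset) simp
  have "card A \<le> n" using card_mono[OF _ A] by simp
  then have cn: "card C \<le> n" using C(2) by simp
  note b = cap_col_basic[OF C(1) cn]
  show ?thesis
  proof (intro iffI allI)
    fix t assume H: "\<forall>t. card {x \<in> cap_col n C. x < t} \<le> card {x \<in> A. x < t}"
    show "card {x \<in> C. x < t} \<le> card {x \<in> A. x < t}"
    proof (cases "n < t")
      case True
      then have "{x \<in> A. x < t} = A" using A by auto
      moreover have "card {x \<in> C. x < t} \<le> card C" using C(1) by (intro card_mono) auto
      ultimately show ?thesis using C(2) by simp
    next
      case False
      have "{x \<in> C. x < t} \<subseteq> {x \<in> cap_col n C. x < t}"
      proof
        fix x assume x: "x \<in> {x \<in> C. x < t}"
        then have "0 < x" using z by (cases x) auto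
        then show "x \<in> {x \<in> cap_col n C. x < t}" using x False by (auto simp: cap_col_def)
      qed
      then have "card {x \<in> C. x < t} \<le> card {x \<in> cap_col n C. x < t}" using b(2) by (intro card_mono) auto
      then show ?thesis using H le_trans by blast
    qed
  next
    fix t assume H: "\<forall>t. card {x \<in> C. x < t} \<le> card {x \<in> A. x < t}"
    show "card {x \<in> cap_col n C. x < t} \<le> card {x \<in> A. x < t}"
    proof (cases "\<exists>y \<in> cap_col n C - C. y < t")
      case False
      then have "{x \<in> cap_col n C. x < t} \<subseteq> {x \<in> C. x < t}" by auto
      then have "card {x \<in> cap_col n C. x < t} \<le> card {x \<in> C. x < t}" using C(1) by (intro card_mono) auto
      then show ?thesis using H le_trans by blast
    next
      case True
      then obtain y where y: "y \<in> cap_col n C" "y \<notin> C" "y < t" by blast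
      then have y2: "y \<in> {1..n} - C" "card {b \<in> {1..n} - C. y < b} < card (C - {1..n})" by (auto simp: cap_col_def top_k_def)
      have up: "{t..n} \<subseteq> cap_col n C"
      proof
        fix x assume x: "x \<in> {t..n}"
        show "x \<in> cap_col n C"
        proof (cases "x \<in> C")
          case True then show ?thesis using x y2 y(3) by (auto simp: cap_col_def)
        next
          case False
          have "card {b \<in> {1..n} - C. x < b} \<le> card {b \<in> {1..n} - C. y < b}" using x y(3) by (intro card_mono) auto
          then show ?thesis using False x y2 y(3) by (auto simp: cap_col_def top_k_def)
        qed
      qed
      have spl: "card X = card {x \<in> X. x < t} + card {x \<in> X. t \<le> x}" if "finite X" for X :: "nat set"
      proof -
        have "card ({x \<in> X. x < t} \<union> {x \<in> X. t \<le> x}) = card {x \<in> X. x < t} + card {x \<in> X. t \<le> x}"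
          by (rule card_Un_disjoint) (use that in auto)
        moreover have "{x \<in> X. x < t} \<union> {x \<in> X. t \<le> x} = X" by auto
        ultimately show ?thesis by simp
      qed
      have "card {x \<in> A. t \<le> x} \<le> card {t..n}" using A by (intro card_mono) auto
      also have "\<dots> \<le> card {x \<in> cap_col n C. t \<le> x}" using up b(2) by (intro card_mono) auto
      finally show ?thesis using spl[OF fA] spl[OF b(2)] b(3) C(2) by linarith
    qed
  qed
qed

text \<open>By nestedness the capped columns containing \<open>i\<close> form an initial segment, so
  its length determines membership. Capping preserves the column sizes, which is why the number of
  cells of \<open>P\<close> appears in the exponent of beta.\<close>

lemma cap_wt:
  assumes inc: "increasing P" and f: "fam M (fam_of P)" and n: "length P \<le> n" and \<beta>: "\<beta> = wt n (cap n (K_minus P))"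
  shows "length \<beta> = n" "\<And>i. i \<in> {1..n} \<Longrightarrow> c < \<beta> ! (i - 1) \<longleftrightarrow> i \<in> cap_col n {i. c < al (fam_of P) M i}"
    "sum_list \<beta> = size_tab P"
proof -
  let ?C = "\<lambda>c. {i. c < al (fam_of P) M i}"
  have y: "young P" using inc by (simp add: increasing_def)
  have p: "part (hts P)" by (rule young_cells(2)[OF y])
  note kv = kv_fam[OF f, unfolded hts_fam_of[OF inc f]]
  have fC: "finite (?C c)" for c by (rule kv_fin[OF kv])
  have cC: "card (?C c) = hts P c" for c using kv by (simp add: kv_def)
  have hn: "hts P c \<le> n" for c using partD[OF p, of 0 c] young_cells(4)[OF y] n by simp
  have b: "cap_col n (?C c) \<subseteq> {1..n}" "finite (cap_col n (?C c))" "card (cap_col n (?C c)) = hts P c" for c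
    using cap_col_basic[OF fC[of c], of n] cC[of c] hn[of c] by simp_all
  have q: "col (K_minus P) (Suc c) = ?C c" for c by (rule K_minus_cols(1)[OF inc f])
  have 1: "finite (cap_col n (col (K_minus P) (Suc c)))" for c unfolding q by (rule b(2))
  have 2: "card (cap_col n (col (K_minus P) (Suc c))) = hts P c" for c unfolding q by (rule b(3))
  have T: "cap n (K_minus P) = mkT (hts P) (\<lambda>r c. sorted_list_of_set (cap_col n (col (K_minus P) c)) ! (r - 1))"
    unfolding cap_def K_minus_cols(3)[OF inc f] by (rule tab_of_cols_mkT[OF y])
  have w: "\<beta> = map (\<lambda>i. card {c. i \<in> cap_col n (?C c)}) [1..<n + 1]"
    unfolding \<beta> using col_tab(2)[OF p 1 2 T, of n] unfolding q .
  show l: "length \<beta> = n" unfolding w by simp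
  have nth: "\<beta> ! (i - 1) = card {c. i \<in> cap_col n (?C c)}" if "i \<in> {1..n}" for i
  proof -
    have "[1..<n + 1] ! (i - 1) = i" using that nth_upt[of 1 "i - 1" "n + 1"] by simp
    moreover have "i - 1 < n" using that unfolding atLeastAtMost_iff by linarith
    then have "i - 1 < length [1..<n + 1]" by simp
    ultimately show ?thesis unfolding w by (simp only: nth_map)
  qed
  obtain z where z: "hts P z = 0" using p by (auto simp: part_def)
  have e: "cap_col n (?C c) = {}" if "z \<le> c" for c
  proof -
    have "card (cap_col n (?C c)) = 0" using b(3)[of c] partD[OF p that] z by simp
    then show ?thesis using b(2)[of c] by simp
  qed
  have cz: "c < z" if "i \<in> cap_col n (?C c)" for i c using e[of c] that by (cases "z \<le> c") auto
  have fS: "finite {c. i \<in> cap_col n (?C c)}" for i by (rule finite_subset[of _ "{..<z}"]) (use cz[of i] in blast, simp)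
  show "c < \<beta> ! (i - 1) \<longleftrightarrow> i \<in> cap_col n (?C c)" if i: "i \<in> {1..n}" for i c
  proof -
    let ?S = "{c. i \<in> cap_col n (?C c)}"
    have dn: "c' \<in> ?S" if "c \<in> ?S" "c' \<le> c" for c c'
    proof -
      have "?C c \<subseteq> ?C c'" using that(2) by auto
      from cap_col_mono[OF fC this, of n] show ?thesis using that(1) by blast
    qed
    have "?S = {..<card ?S}"
    proof (rule card_subset_eq[symmetric])
      show "{..<card ?S} \<subseteq> ?S"
      proof
        fix c assume c: "c \<in> {..<card ?S}"
        show "c \<in> ?S"
        proof (rule ccontr)
          assume "c \<notin> ?S"
          then have "?S \<subseteq> {..<c}" using dn by (meson lessThan_iff not_le subsetI)
          then have "card ?S \<le> c" using card_mono[of "{..<c}" ?S] by simp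
          then show False using c by simp
        qed
      qed
    qed (use fS[of i] in simp_all)
    then show ?thesis unfolding nth[OF i] by (metis lessThan_iff mem_Collect_eq)
  qed
  have "sum_list \<beta> = (\<Sum>i\<in>{1..n}. card {c. i \<in> cap_col n (?C c)})"
  proof -
    have "{1..<n + 1} = {1..n}" by auto
    then show ?thesis unfolding w by (simp add: interv_sum_list_conv_sum_set_nat del: upt_Suc)
  qed
  also have "\<dots> = card (SIGMA i:{1..n}. {c. i \<in> cap_col n (?C c)})"
    by (rule card_SigmaI[symmetric]) (use fS in simp_all)
  also have "(SIGMA i:{1..n}. {c. i \<in> cap_col n (?C c)}) = {(i, c). i \<in> cap_col n (?C c)}" using b(1) by auto
  also have "card \<dots> = (\<Sum>c<z. card (cap_col n (?C c)))" by (rule card_by_col) (use b(2) e in auto)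
  also have "\<dots> = (\<Sum>c<z. hts P c)" using b(3) by simp
  also have "\<dots> = card {(r, c). r \<in> {..<hts P c}}"
    by (subst card_by_col[of "\<lambda>c. {..<hts P c}" z]) (use partD[OF p, of z] z in auto)
  also have "\<dots> = size_tab P"
    using count_mkT[OF p, of "\<lambda>_. True" "entry P"] young_mkT_eq[OF y] by (simp add: size_tab_def)
  finally show "sum_list \<beta> = size_tab P" .
qed

section \<open>Lascoux polynomials as counts of token words\<close>

lemma dom_lists:
  assumes "finite (A :: nat set)" "finite B" "card A = m" "card B = m"
  shows "(\<forall>r<m. rev (sorted_list_of_set A) ! r \<le> rev (sorted_list_of_set B) ! r) \<longleftrightarrow>
    (\<forall>t. card {x \<in> B. x < t} \<le> card {x \<in> A. x < t})"
proof -
  let ?a = "sorted_list_of_set A" and ?b = "sorted_list_of_set B"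
  have l: "length ?a = m" "length ?b = m" using assms by auto
  have "(\<forall>r<m. rev ?a ! r \<le> rev ?b ! r) \<longleftrightarrow> (\<forall>r<m. ?a ! r \<le> ?b ! r)"
  proof (intro iffI allI impI)
    fix r assume H: "\<forall>r<m. rev ?a ! r \<le> rev ?b ! r" and r: "r < m"
    have "rev ?a ! (m - Suc r) \<le> rev ?b ! (m - Suc r)" using H r by simp
    then show "?a ! r \<le> ?b ! r" using r l by (simp add: rev_nth)
  next
    fix r assume H: "\<forall>r<m. ?a ! r \<le> ?b ! r" and r: "r < m"
    have "?a ! (m - Suc r) \<le> ?b ! (m - Suc r)" using H r by simp
    then show "rev ?a ! r \<le> rev ?b ! r" using r l by (simp add: rev_nth)
  qed
  also have "\<dots> \<longleftrightarrow> (\<forall>t. card {x \<in> B. x < t} \<le> card {x \<in> A. x < t})"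
  proof (intro iffI allI impI)
    fix t assume H: "\<forall>r<m. ?a ! r \<le> ?b ! r"
    show "card {x \<in> B. x < t} \<le> card {x \<in> A. x < t}"
    proof (cases "card {x \<in> B. x < t}")
      case (Suc k)
      have "Suc k \<le> m" using card_mono[of B "{x \<in> B. x < t}"] assms Suc by auto
      then have k: "k < card B" "k < card A" "k < m" using assms by auto
      have "?b ! k < t"
      proof (rule ccontr)
        assume "\<not> ?b ! k < t"
        then have "{x \<in> B. x < t} \<subseteq> {x \<in> B. x < ?b ! k}" by auto
        then have "card {x \<in> B. x < t} \<le> card {x \<in> B. x < ?b ! k}" using assms(2) by (intro card_mono) auto
        then show False using sls_nth_count(1)[OF assms(2) k(1)] Suc by simp
      qed
      then have at: "?a ! k < t" using H k(3) le_less_trans by blast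
      have "insert (?a ! k) {x \<in> A. x < ?a ! k} \<subseteq> {x \<in> A. x < t}" using at sls_nth_count(2)[OF assms(1) k(2)] by auto
      then have "card (insert (?a ! k) {x \<in> A. x < ?a ! k}) \<le> card {x \<in> A. x < t}" using assms(1) by (intro card_mono) auto
      then show ?thesis using sls_nth_count(1)[OF assms(1) k(2)] assms(1) Suc by simp
    next
      case 0 then show ?thesis by linarith
    qed
  next
    fix r assume H: "\<forall>t. card {x \<in> B. x < t} \<le> card {x \<in> A. x < t}" and r: "r < m"
    have rA: "r < card A" and rB: "r < card B" using r assms by auto
    let ?t = "Suc (?b ! r)"
    have "insert (?b ! r) {x \<in> B. x < ?b ! r} \<subseteq> {x \<in> B. x < ?t}" using sls_nth_count(2)[OF assms(2) rB] by auto
    then have "card (insert (?b ! r) {x \<in> B. x < ?b ! r}) \<le> card {x \<in> B. x < ?t}" using assms(2) by (intro card_mono) auto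
    then have "Suc r \<le> card {x \<in> B. x < ?t}" using sls_nth_count(1)[OF assms(2) rB] assms(2) by simp
    then have c: "Suc r \<le> card {x \<in> A. x < ?t}" using H le_trans by blast
    show "?a ! r \<le> ?b ! r"
    proof (rule ccontr)
      assume "\<not> ?a ! r \<le> ?b ! r"
      then have "{x \<in> A. x < ?t} \<subseteq> {x \<in> A. x < ?a ! r}" by auto
      then have "card {x \<in> A. x < ?t} \<le> card {x \<in> A. x < ?a ! r}" using assms(1) by (intro card_mono) auto
      then show False using sls_nth_count(1)[OF assms(1) rA] c by simp
    qed
  qed
  finally show ?thesis .
qed

text \<open>Column heights of the key of \<open>\<beta>\<close>, that is, the conjugate of the
  partition obtained by sorting \<open>\<beta>\<close>.\<close>

definition hb :: "nat list \<Rightarrow> nat \<Rightarrow> nat" where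
  "hb \<beta> c = card {i \<in> {1..length \<beta>}. c < \<beta> ! (i - 1)}"

definition fb :: "nat list \<Rightarrow> nat \<Rightarrow> nat" where
  "fb \<beta> i = (if i \<in> {1..length \<beta>} then \<beta> ! (i - 1) else 0)"

lemma fb_level: "{i. c < fb \<beta> i} = {i \<in> {1..length \<beta>}. c < \<beta> ! (i - 1)}" by (auto simp: fb_def)

lemma hb_filter: "hb \<beta> c = length (filter (\<lambda>x. c < x) \<beta>)"
proof -
  have "{i \<in> {1..length \<beta>}. c < \<beta> ! (i - 1)} = Suc ` {k. k < length \<beta> \<and> c < \<beta> ! k}"
  proof -
    have "i \<in> {i \<in> {1..length \<beta>}. c < \<beta> ! (i - 1)} \<longleftrightarrow> i \<in> Suc ` {k. k < length \<beta> \<and> c < \<beta> ! k}" for i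
      by (cases i) (auto simp: Suc_le_eq)
    then show ?thesis by blast
  qed
  then show ?thesis unfolding hb_def length_filter_conv_card by (simp add: card_image)
qed

lemma part_hb: "part (hb \<beta>)"
proof -
  have "antimono (hb \<beta>)" unfolding hb_def by (rule antimonoI, rule card_mono) auto
  moreover have "hb \<beta> (sum_list \<beta>) = 0"
    unfolding hb_filter using member_le_sum_list by (auto simp: filter_empty_conv not_less)
  ultimately show ?thesis by (auto simp: part_def)
qed

lemma keyshape_hb: "keyshape \<beta> = map (first_col (hb \<beta>)) [0..<hb \<beta> 0]"
proof -
  let ?l = "keyshape \<beta>"
  have f: "hb \<beta> c = length (filter (\<lambda>x. c < x) ?l)" for c
  proof -
    have "length (filter (\<lambda>x. c < x) ?l) = length (filter (\<lambda>x. c < x) (filter (\<lambda>x. 0 < x) \<beta>))"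
      unfolding keyshape_def by (simp add: rev_filter[symmetric] filter_sort)
    also have "filter (\<lambda>x. c < x) (filter (\<lambda>x. 0 < x) \<beta>) = filter (\<lambda>x. c < x) \<beta>"
      by (simp add: conj_commute) (rule filter_cong, auto)
    finally show ?thesis by (simp add: hb_filter)
  qed
  have s: "\<And>i j. i \<le> j \<Longrightarrow> j < length ?l \<Longrightarrow> ?l ! j \<le> ?l ! i"
    unfolding keyshape_def by (auto simp: rev_nth intro!: sorted_nth_mono)
  have len: "length ?l = hb \<beta> 0" unfolding hb_filter keyshape_def by simp
  show ?thesis
  proof (rule nth_equalityI)
    show "length ?l = length (map (first_col (hb \<beta>)) [0..<hb \<beta> 0])" using len by simp
    fix r assume r: "r < length ?l"
    have c: "hb \<beta> c = card {k. k < length ?l \<and> c < ?l ! k}" for c unfolding f length_filter_conv_card ..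
    have "first_col (hb \<beta>) r = ?l ! r"
    proof (rule first_col_eq[OF part_hb])
      have "{k. k < length ?l \<and> ?l ! r < ?l ! k} \<subseteq> {..<r}" using s[of r] by (auto simp: not_less[symmetric])
      then show "hb \<beta> (?l ! r) \<le> r" unfolding c using card_mono[of "{..<r}"] by fastforce
      show "\<forall>i<?l ! r. r < hb \<beta> i"
      proof (intro allI impI)
        fix i assume i: "i < ?l ! r"
        have "{..r} \<subseteq> {k. k < length ?l \<and> i < ?l ! k}" using s[of _ r] r i by (auto intro: less_le_trans)
        then have "card {..r} \<le> card {k. k < length ?l \<and> i < ?l ! k}" by (intro card_mono) auto
        then show "r < hb \<beta> i" unfolding c by simp
      qed
    qed
    then show "?l ! r = map (first_col (hb \<beta>)) [0..<hb \<beta> 0] ! r" using r len by simp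
  qed
qed

lemma leftkey_rev_lk: "leftkey_rev_col T (Suc c) = gh.lk (\<lambda>c. col T (Suc c)) c"
proof -
  have "leftkey_rev_col T (Suc c) = foldr (\<lambda>i X. tri_ge (col T i) X) (map Suc [0..<c]) (col T (Suc c))"
    unfolding leftkey_rev_col_def map_Suc_upt by simp
  also have "\<dots> = gh.lk (\<lambda>c. col T (Suc c)) c" by (simp add: gh.lk_def gh.Ph_def foldr_map o_def tri_ge_G)
  finally show ?thesis .
qed

lemma tab_le_mkT:
  assumes "part h"
  shows "tab_le (mkT h e1) (mkT h e2) \<longleftrightarrow> (\<forall>c. \<forall>r<h c. e1 (Suc r) (Suc c) \<le> e2 (Suc r) (Suc c))"
proof -
  have "tab_le (mkT h e1) (mkT h e2) \<longleftrightarrow> (\<forall>(r, c)\<in>dg h. entry (mkT h e1) r c \<le> entry (mkT h e2) r c)"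
    unfolding tab_le_def map_length_mkT cells_mkT[OF assms] by simp
  also have "\<dots> \<longleftrightarrow> (\<forall>(r, c)\<in>dg h. e1 r c \<le> e2 r c)" by (rule ball_cong) (auto simp: entry_mkT[OF assms])
  also have "\<dots> \<longleftrightarrow> (\<forall>c. \<forall>r<h c. e1 (Suc r) (Suc c) \<le> e2 (Suc r) (Suc c))"
  proof
    assume H: "\<forall>(r, c)\<in>dg h. e1 r c \<le> e2 r c"
    show "\<forall>c. \<forall>r<h c. e1 (Suc r) (Suc c) \<le> e2 (Suc r) (Suc c)"
    proof (intro allI impI)
      fix c r assume "r < h c"
      then have "(Suc r, Suc c) \<in> dg h" by (simp add: dg_def)
      then show "e1 (Suc r) (Suc c) \<le> e2 (Suc r) (Suc c)" using H by blast
    qed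
  next
    assume H: "\<forall>c. \<forall>r<h c. e1 (Suc r) (Suc c) \<le> e2 (Suc r) (Suc c)"
    have "e1 r c \<le> e2 r c" if "(r, c) \<in> dg h" for r c
    proof -
      have "1 \<le> r" "1 \<le> c" "r - 1 < h (c - 1)" using that by (auto simp: dg_def)
      then show ?thesis using H[rule_format, of "r - 1" "c - 1"] by simp
    qed
    then show "\<forall>(r, c)\<in>dg h. e1 r c \<le> e2 r c" by blast
  qed
  finally show ?thesis .
qed

lemma tab_of_cols_shape:
  "tab_of_cols (map (first_col h) [0..<h 0]) C od = mkT h (\<lambda>r c. od (C c) ! (r - 1))"
  unfolding tab_of_cols_def mkT_def by simp

lemma kle_cols: "kle a b \<longleftrightarrow> (\<forall>c t. card {x \<in> {i. c < b i}. x < t} \<le> card {x \<in> {i. c < a i}. x < t})"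
proof -
  have "{x \<in> {i. c < a i}. x < t} = {i. i < t \<and> c < a i}" for c t and a :: "nat \<Rightarrow> nat" by auto
  then show ?thesis unfolding kle_def lo_def by auto
qed

lemma cnt_mem: "VT g e \<Longrightarrow> part g \<Longrightarrow> v \<in> e r c \<Longrightarrow> cnt e v \<noteq> 0"
  unfolding cnt_def using VT_finite[of g e v] by auto

text \<open>The maxima of the filling form the columns \<open>qC\<close>, whose left key has weight
  \<open>aq\<close>, and \<open>key_tab\<close> has weight \<open>fb\<close>; by
  \<open>dom_lists\<close> the entrywise comparison of the two is the counting relation.\<close>

lemma key_condition:
  assumes h: "h = hb \<beta>" and s: "sorted is" and cs: "cs \<in> Bc M h is"
  shows "tab_le (K_minus_rev (Lmax (mkT h (eT h is cs)))) (key_tab \<beta>) \<longleftrightarrow> kle (aq is cs) (fb \<beta>)"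
proof -
  let ?e = "eT h is cs"
  let ?T = "Lmax (mkT h ?e)"
  have p: "part h" unfolding h by (rule part_hb)
  have L: "?T = mkT h (\<lambda>r c. Max (?e r c))" by (simp add: Lmax_def mkT_def)
  have v: "vcode M M h cs" "length is = length cs" "adj cls is cs" using cs by (auto simp: Bc_def)
  have "col ?T (Suc c) = qC is cs c" for c
  proof -
    have "col ?T (Suc c) = {entry ?T r (Suc c) | r. (r, Suc c) \<in> dg h}" unfolding col_def L cells_mkT[OF p] ..
    also have "\<dots> = {Max (?e r (Suc c)) | r. (r, Suc c) \<in> dg h}" unfolding L using entry_mkT[OF p] by (metis (no_types, lifting))
    also have "\<dots> = (\<lambda>r. Max (?e r (Suc c))) ` {1..h c}" by (auto simp: dg_def)
    finally show ?thesis using eT_Max[OF p s cs, of c] by simp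
  qed
  then have lk: "leftkey_rev_col ?T (Suc c) = {i. c < aq is cs i}" for c
    unfolding leftkey_rev_lk using lk_aq[OF p v(1,2) s v(3)] by simp
  have K: "K_minus_rev ?T = mkT h (\<lambda>r c. rev (sorted_list_of_set (leftkey_rev_col ?T c)) ! (r - 1))"
    unfolding K_minus_rev_def L map_length_mkT by (rule tab_of_cols_shape)
  have ky: "key_tab \<beta> = mkT h (\<lambda>r c. rev (sorted_list_of_set {i \<in> {1..length \<beta>}. c \<le> \<beta> ! (i - 1)}) ! (r - 1))"
    unfolding key_tab_def keyshape_hb h by (rule tab_of_cols_shape)
  have kq: "kq h (aq is cs)" by (rule kq_aq[OF p v(1,2) s])
  have Sc: "{i \<in> {1..length \<beta>}. Suc c \<le> \<beta> ! (i - 1)} = {i. c < fb \<beta> i}" for c by (auto simp: fb_def)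
  have "tab_le (K_minus_rev ?T) (key_tab \<beta>) \<longleftrightarrow>
    (\<forall>c. \<forall>r<h c. rev (sorted_list_of_set {i. c < aq is cs i}) ! r \<le> rev (sorted_list_of_set {i. c < fb \<beta> i}) ! r)"
    unfolding K ky tab_le_mkT[OF p] lk Sc by simp
  also have "\<dots> \<longleftrightarrow> kle (aq is cs) (fb \<beta>)"
    unfolding kle_cols
  proof (rule all_cong1)
    fix c
    have 1: "finite {i. c < aq is cs i}" by (rule kq_fin[OF kq])
    have 2: "finite {i. c < fb \<beta> i}" unfolding fb_level by simp
    have 3: "card {i. c < aq is cs i} = h c" using kq by (simp add: kq_def)
    have 4: "card {i. c < fb \<beta> i} = h c" unfolding fb_level h hb_def ..
    show "(\<forall>r<h c. rev (sorted_list_of_set {i. c < aq is cs i}) ! r \<le> rev (sorted_list_of_set {i. c < fb \<beta> i}) ! r) \<longleftrightarrow>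
      (\<forall>t. card {x \<in> {i. c < fb \<beta> i}. x < t} \<le> card {x \<in> {i. c < aq is cs i}. x < t})" by (rule dom_lists[OF 1 2 3 4])
  qed
  finally show ?thesis .
qed

definition YT :: "nat \<Rightarrow> (nat \<Rightarrow> nat) \<Rightarrow> nat list \<Rightarrow> nat set list list set" where
  "YT n h \<gamma> = {T. rsvt n T \<and> map length T = map (first_col h) [0..<h 0] \<and> wt_rsvt n T = \<gamma>}"

lemma mkT_bij:
  assumes p: "part h" and l: "set is \<subseteq> {1..n}" "wtw n is = \<gamma>"
  shows "bij_betw (mkT h) (Ec h is) (YT n h \<gamma>)"
proof (rule bij_betw_inverseI[where g = "\<lambda>T r c. if (r, c) \<in> dg h then entry T r c else {}"])
  show "mkT h ` Ec h is \<subseteq> YT n h \<gamma>"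
  proof (rule image_subsetI)
    fix e assume "e \<in> Ec h is"
    then have V: "VT h e" and cn: "\<And>v. cnt e v = count_list is v" by (auto simp: Ec_def)
    let ?T = "mkT h e"
    have ce: "cells ?T = dg h" by (rule cells_mkT[OF p])
    have en: "(r, c) \<in> dg h \<Longrightarrow> entry ?T r c = e r c" for r c by (rule entry_mkT[OF p])
    have ne: "(r, c) \<in> dg h \<Longrightarrow> e r c \<noteq> {}" and fe: "finite (e r c)" and em: "x \<in> e r c \<Longrightarrow> (r, c) \<in> dg h" for r c x
      using V unfolding VT_def by blast+
    have row: "\<And>r c x y. x \<in> e r c \<Longrightarrow> y \<in> e r (Suc c) \<Longrightarrow> y \<le> x"
      and colm: "\<And>r c x y. x \<in> e r c \<Longrightarrow> y \<in> e (Suc r) c \<Longrightarrow> y < x" using V unfolding VT_def by blast+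
    have lab: "e r c \<subseteq> {1..n}" for r c
    proof
      fix v assume "v \<in> e r c"
      then have "count_list is v \<noteq> 0" using cnt_mem[OF V p] cn by simp
      then have "v \<in> set is" by (metis count_notin)
      then show "v \<in> {1..n}" using l(1) by blast
    qed
    have "rsvt n ?T"
      unfolding rsvt_def ce
    proof (intro conjI allI impI ballI)
      show "young ?T" by (rule young_mkT[OF p])
      show "case x of (r, c) \<Rightarrow> entry ?T r c \<noteq> {} \<and> entry ?T r c \<subseteq> {1..n}" if "x \<in> dg h" for x
      proof -
        obtain r c where x: "x = (r, c)" by (cases x)
        then have "(r, c) \<in> dg h" using that by simp
        then show ?thesis using x en ne lab by simp
      qed
      fix r c
      show "Max (entry ?T r (Suc c)) \<le> Min (entry ?T r c)" if "(r, c) \<in> dg h \<and> (r, Suc c) \<in> dg h"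
      proof -
        have "Min (e r c) \<in> e r c" "Max (e r (Suc c)) \<in> e r (Suc c)" using that ne fe by auto
        then show ?thesis using row that en by simp
      qed
      show "Max (entry ?T (Suc r) c) < Min (entry ?T r c)" if "(r, c) \<in> dg h \<and> (Suc r, c) \<in> dg h"
      proof -
        have "Min (e r c) \<in> e r c" "Max (e (Suc r) c) \<in> e (Suc r) c" using that ne fe by auto
        then show ?thesis using colm that en by simp
      qed
    qed
    moreover have "wt_rsvt n ?T = \<gamma>"
    proof (rule nth_equalityI)
      have "length \<gamma> = n" using l(2) by auto
      then show "length (wt_rsvt n ?T) = length \<gamma>" by (simp add: wt_rsvt_def del: upt_Suc)
      fix k assume "k < length (wt_rsvt n ?T)"
      then have k: "k < n" by (simp add: wt_rsvt_def del: upt_Suc)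
      have "{(r, c) \<in> cells ?T. v \<in> entry ?T r c} = {(r, c). v \<in> e r c}" for v
        unfolding ce using en em by (auto)
      then have "wt_rsvt n ?T ! k = cnt e (Suc k)" using k by (simp add: wt_rsvt_def cnt_def del: upt_Suc)
      then show "wt_rsvt n ?T ! k = \<gamma> ! k" using cn wtw_nth[OF k, of "is"] l(2) by simp
    qed
    ultimately show "?T \<in> YT n h \<gamma>" by (simp add: YT_def map_length_mkT)
  qed
  have Y: "young T \<and> hts T = h \<and> cells T = dg h" if "T \<in> YT n h \<gamma>" for T
  proof -
    have y: "young T" using that by (simp add: YT_def rsvt_def)
    have "map length T = map length (mkT h (\<lambda>_ _. ()))" using that by (simp add: YT_def map_length_mkT)
    then have "hts T = h" using hts_cong hts_mkT[OF p] by metis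
    then show ?thesis using y young_cells(1)[OF y] by simp
  qed
  show "(\<lambda>T r c. if (r, c) \<in> dg h then entry T r c else {}) ` YT n h \<gamma> \<subseteq> Ec h is"
  proof (rule image_subsetI)
    fix T assume T: "T \<in> YT n h \<gamma>"
    note y = Y[OF T]
    let ?e = "\<lambda>r c. if (r, c) \<in> dg h then entry T r c else {}"
    have r1: "\<And>r c. (r, c) \<in> dg h \<Longrightarrow> entry T r c \<noteq> {} \<and> entry T r c \<subseteq> {1..n}"
      and r2: "\<And>r c. (r, c) \<in> dg h \<Longrightarrow> (r, Suc c) \<in> dg h \<Longrightarrow> Max (entry T r (Suc c)) \<le> Min (entry T r c)"
      and r3: "\<And>r c. (r, c) \<in> dg h \<Longrightarrow> (Suc r, c) \<in> dg h \<Longrightarrow> Max (entry T (Suc r) c) < Min (entry T r c)"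
      using T y unfolding YT_def rsvt_def by auto
    have fe: "finite (entry T r c)" if "(r, c) \<in> dg h" for r c by (rule finite_subset[of _ "{1..n}"]) (use r1[OF that] in auto)
    have V: "VT h ?e"
      unfolding VT_def
    proof (intro conjI allI ballI)
      fix r c
      show "finite (?e r c)" using fe by simp
      show "?e r c \<noteq> {} \<longleftrightarrow> (r, c) \<in> dg h" using r1 by simp
    next
      fix r c x y assume x: "x \<in> ?e r c" and y: "y \<in> ?e r (Suc c)"
      have d: "(r, c) \<in> dg h" "(r, Suc c) \<in> dg h" using x y by (auto split: if_splits)
      have "y \<le> Max (entry T r (Suc c))" "Min (entry T r c) \<le> x" using x y d fe by auto
      then show "y \<le> x" using r2[OF d] by simp
    next
      fix r c x y assume x: "x \<in> ?e r c" and y: "y \<in> ?e (Suc r) c"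
      have d: "(r, c) \<in> dg h" "(Suc r, c) \<in> dg h" using x y by (auto split: if_splits)
      have "y \<le> Max (entry T (Suc r) c)" "Min (entry T r c) \<le> x" using x y d fe by auto
      then show "y < x" using r3[OF d] by simp
    qed
    moreover have "cnt ?e v = count_list is v" for v
    proof (cases "v \<in> {1..n}")
      case True
      have "{(r, c) \<in> cells T. v \<in> entry T r c} = {(r, c). v \<in> ?e r c}" using y by (auto split: if_splits)
      moreover have "v - 1 < n" "Suc (v - 1) = v" using True by auto
      ultimately have "wt_rsvt n T ! (v - 1) = cnt ?e v" by (simp add: wt_rsvt_def cnt_def del: upt_Suc)
      then show ?thesis using T wtw_nth[OF \<open>v - 1 < n\<close>, of "is"] l(2) \<open>Suc (v - 1) = v\<close> by (simp add: YT_def)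
    next
      case False
      then have "v \<notin> set is" using l(1) by blast
      moreover have nv: "v \<notin> entry T r c" if "(r, c) \<in> dg h" for r c using r1[OF that] False by blast
      have "\<not> v \<in> ?e r c" for r c using nv[of r c] by simp
      then have "{(r, c). v \<in> ?e r c} = {}" by simp
      ultimately show ?thesis by (simp add: cnt_def)
    qed
    ultimately show "?e \<in> Ec h is" by (simp add: Ec_def)
  qed
  show "(\<lambda>r c. if (r, c) \<in> dg h then entry (mkT h e) r c else {}) = e" if "e \<in> Ec h is" for e
  proof (intro ext)
    fix r c
    have "(r, c) \<notin> dg h \<Longrightarrow> e r c = {}" using that unfolding Ec_def VT_def by blast
    then show "(if (r, c) \<in> dg h then entry (mkT h e) r c else {}) = e r c" using entry_mkT[OF p, of r c e] by simp
  qed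
  show "mkT h (\<lambda>r c. if (r, c) \<in> dg h then entry T r c else {}) = T" if "T \<in> YT n h \<gamma>" for T
  proof -
    note y = Y[OF that]
    have "T = mkT h (entry T)" using young_mkT_eq[of T] y by simp
    moreover have "mkT h (\<lambda>r c. if (r, c) \<in> dg h then entry T r c else {}) = mkT h (entry T)" by (rule mkT_cong[OF p]) simp
    ultimately show ?thesis by simp
  qed
qed

lemma lascoux_card:
  assumes s: "sorted is" "set is \<subseteq> {1..n}" "wtw n is = \<gamma>" and k: "sum_list \<gamma> = sum_list \<beta> + k"
  shows "lascoux n \<beta> \<gamma> k = int (card {cs. length cs = length is \<and> vcode M M (hb \<beta>) cs \<and> adj cls is cs \<and> kle (aq is cs) (fb \<beta>) \<and> True})"
proof -
  let ?h = "hb \<beta>"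
  let ?f = "\<lambda>cs. mkT ?h (eT ?h is cs)"
  let ?A = "{cs \<in> Bc M ?h is. kle (aq is cs) (fb \<beta>)}"
  let ?X = "{T. rsvt n T \<and> map length T = keyshape \<beta> \<and> tab_le (K_minus_rev (Lmax T)) (key_tab \<beta>) \<and> wt_rsvt n T = \<gamma> \<and> sum_list \<gamma> = sum_list \<beta> + k}"
  have b: "bij_betw ?f (Bc M ?h is) (YT n ?h \<gamma>)"
    using bij_betw_trans[OF eT_bij[OF part_hb s(1)] mkT_bij[OF part_hb s(2,3)]] by (simp add: o_def)
  have kc: "\<And>cs. cs \<in> Bc M ?h is \<Longrightarrow> tab_le (K_minus_rev (Lmax (?f cs))) (key_tab \<beta>) \<longleftrightarrow> kle (aq is cs) (fb \<beta>)"
    by (rule key_condition[OF refl s(1)])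
  have "?X = ?f ` ?A"
  proof
    show "?X \<subseteq> ?f ` ?A"
    proof
      fix T assume T: "T \<in> ?X"
      then have "T \<in> YT n ?h \<gamma>" by (simp add: YT_def keyshape_hb)
      then obtain cs where cs: "cs \<in> Bc M ?h is" "T = ?f cs" using b unfolding bij_betw_def by blast
      then have "cs \<in> ?A" using T kc[OF cs(1)] by simp
      then show "T \<in> ?f ` ?A" using cs(2) by blast
    qed
    show "?f ` ?A \<subseteq> ?X"
    proof (rule image_subsetI)
      fix cs assume cs: "cs \<in> ?A"
      then have "?f cs \<in> YT n ?h \<gamma>" using b unfolding bij_betw_def by blast
      then show "?f cs \<in> ?X" using cs kc[of cs] k by (simp add: YT_def keyshape_hb)
    qed
  qed
  moreover have "inj_on ?f ?A" using b unfolding bij_betw_def by (auto intro: inj_on_subset)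
  ultimately have "card ?X = card ?A" by (simp add: card_image)
  moreover have "?A = {cs. length cs = length is \<and> vcode M M ?h cs \<and> adj cls is cs \<and> kle (aq is cs) (fb \<beta>) \<and> True}"
    unfolding Bc_def by auto
  ultimately show ?thesis unfolding lascoux_def by simp
qed

lemma lascoux_zero: "sum_list \<gamma> \<noteq> sum_list \<beta> + k \<or> length \<gamma> \<noteq> n \<Longrightarrow> lascoux n \<beta> \<gamma> k = 0"
proof -
  assume a: "sum_list \<gamma> \<noteq> sum_list \<beta> + k \<or> length \<gamma> \<noteq> n"
  have "length (wt_rsvt n T) = n" for T by (simp add: wt_rsvt_def)
  then have "{T. rsvt n T \<and> map length T = keyshape \<beta> \<and> tab_le (K_minus_rev (Lmax T)) (key_tab \<beta>) \<and> wt_rsvt n T = \<gamma> \<and> sum_list \<gamma> = sum_list \<beta> + k} = {}"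
    using a by auto
  then show ?thesis unfolding lascoux_def by (simp only: card.empty of_nat_0)
qed

lemma groth_zero: "sum_list \<gamma> \<noteq> perm_length w + k \<or> length \<gamma> \<noteq> n \<Longrightarrow> groth n w \<gamma> k = 0"
proof -
  assume a: "sum_list \<gamma> \<noteq> perm_length w + k \<or> length \<gamma> \<noteq> n"
  have "(a, i) \<notin> {(a, i). compatible a i \<and> set i \<subseteq> {1..n} \<and> hecke_word a (inv w) \<and> wtw n i = \<gamma> \<and> length a = perm_length w + k}" for a i
    using a length_wtw_sum[of i n] by (auto simp: compatible_def)
  then have "{(a, i). compatible a i \<and> set i \<subseteq> {1..n} \<and> hecke_word a (inv w) \<and> wtw n i = \<gamma> \<and> length a = perm_length w + k} = {}" by auto
  then show ?thesis unfolding groth_def by (simp only: card.empty of_nat_0)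
qed

text \<open>Every cell is opened by a token of its own, so too few labels admit no code. This
  disposes of negative powers of beta.\<close>

lemma vcode_length: "part g \<Longrightarrow> vcode N M g cs \<Longrightarrow> (\<Sum>c<z. g c) \<le> length cs"
proof (induction cs arbitrary: g)
  case (Cons d cs)
  show ?case
  proof (cases d)
    case (Let x) then show ?thesis using Cons.IH[of g] Cons.prems by simp
  next
    case (Tok t)
    have co: "corner g t" and v: "vcode N M (down g t) cs" using Cons.prems Tok by auto
    have IH: "(\<Sum>c<z. down g t c) \<le> length cs" by (rule Cons.IH[OF part_down_corner[OF Cons.prems(1) co] v])
    have "(\<Sum>c<z. g c) \<le> (\<Sum>c<z. down g t c + (if c = tcol t then 1 else 0))"
      by (rule sum_mono) (cases t; auto)
    also have "\<dots> = (\<Sum>c<z. down g t c) + (\<Sum>c<z. if c = tcol t then 1 else 0)" by (rule sum.distrib)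
    also have "(\<Sum>c<z. if c = tcol t then 1 else 0 :: nat) \<le> 1" by (simp add: sum.delta)
    finally show ?thesis using IH by simp
  qed
qed simp

section \<open>The product formula\<close>

lemma entry_in_word: assumes y: "young P" and c: "(r, c) \<in> cells P" shows "entry P r c \<in> set (word P)"
proof -
  have rc: "1 \<le> r" "r \<le> length P" "1 \<le> c" "c \<le> length (P ! (r - 1))" using c by (auto simp: cells_def)
  have "length (P ! (r - 1)) \<le> length (P ! 0)" by (rule young_len[OF y]) (use rc in auto)
  moreover have "P \<noteq> []" using rc by auto
  ultimately have "c \<le> ncols P" using rc(4) by (simp add: ncols_def hd_conv_nth)
  then have "c \<in> set [1..<ncols P + 1]" using rc(3) by (simp del: upt_Suc)
  moreover have "r \<in> set (filter (\<lambda>r. (r, c) \<in> cells P) [1..<length P + 1])" using rc c by (simp del: upt_Suc)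
  then have "entry P r c \<in> set (rev (col_list P c))" unfolding col_list_def set_rev set_map by (rule imageI)
  ultimately show ?thesis unfolding word_def set_concat set_map by blast
qed

lemma sum_hb: "\<forall>x\<in>set \<beta>. x \<le> z \<Longrightarrow> (\<Sum>c<z. hb \<beta> c) = sum_list \<beta>"
  unfolding hb_filter
proof (induction \<beta>)
  case (Cons x \<beta>)
  have "(\<Sum>c<z. length (filter (\<lambda>y. c < y) (x # \<beta>))) = (\<Sum>c<z. (if c < x then 1 else 0) + length (filter (\<lambda>y. c < y) \<beta>))"
    by (rule sum.cong) auto
  also have "\<dots> = (\<Sum>c<z. if c < x then 1 else 0) + (\<Sum>c<z. length (filter (\<lambda>y. c < y) \<beta>))" by (rule sum.distrib)
  also have "(\<Sum>c<z. if c < x then 1 else 0 :: nat) = card ({..<z} \<inter> {c. c < x})" by (simp add: sum.If_cases)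
  also have "{..<z} \<inter> {c. c < x} = {..<x}" using Cons.prems by auto
  finally show ?case using Cons by simp
qed simp

lemma vcode_hb_length: "vcode N M (hb \<beta>) cs \<Longrightarrow> sum_list \<beta> \<le> length cs"
  using vcode_length[OF part_hb, of N M \<beta> cs "sum_list \<beta>"] sum_hb[of \<beta> "sum_list \<beta>"] member_le_sum_list[of _ \<beta>] by auto

lemma sum_map2: "list_all2 (\<le>) c (\<gamma> :: nat list) \<Longrightarrow> sum_list c + sum_list (map2 (-) \<gamma> c) = sum_list \<gamma>"
  by (induction rule: list_all2_induct) auto

text \<open>Column 0 of the recording key is the set of labels that opened the cells of the first
  column. So the key uses only labels that occur, and there are at most as many rows as distinct
  labels; the bound by \<open>n\<close> on the number of rows originates here.\<close>

lemma aq_labels: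
  assumes "part g" "vcode N M g cs" "length is = length cs" "sorted is" "adj cls is cs"
  shows "{i. c < aq is cs i} \<subseteq> set is" "g 0 \<le> card (set is)"
proof -
  note lk = lk_aq[OF assms]
  have "gh.lk (qC is cs) 0 = qC is cs 0" by (simp add: gh.lk_def)
  then have e: "{i. 0 < aq is cs i} = qC is cs 0" using lk by metis
  have q: "qC is cs 0 \<subseteq> set is"
  proof
    fix i assume "i \<in> qC is cs 0"
    from qC_zip[OF this] show "i \<in> set is" by (rule set_zip_leftD)
  qed
  have "{i. c < aq is cs i} \<subseteq> {i. 0 < aq is cs i}" by auto
  then show "{i. c < aq is cs i} \<subseteq> set is" using e q by blast
  have "card (qC is cs 0) = g 0" using lk by blast
  then show "g 0 \<le> card (set is)" using card_mono[OF _ q] by simp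
qed

lemma cap_kle:
  assumes inc: "increasing P" and f: "fam M (fam_of P)" and n: "length P \<le> n" and \<beta>: "\<beta> = wt n (cap n (K_minus P))"
  shows "hb \<beta> = ht (fam_of P) M"
    "vcode M M (hb \<beta>) cs \<Longrightarrow> length is = length cs \<Longrightarrow> sorted is \<Longrightarrow> adj cls is cs \<Longrightarrow> set is \<subseteq> {1..n} \<Longrightarrow>
      kle (aq is cs) (al (fam_of P) M) \<longleftrightarrow> kle (aq is cs) (fb \<beta>)"
proof -
  let ?C = "\<lambda>c. {i. c < al (fam_of P) M i}"
  note cw = cap_wt[OF inc f n \<beta>]
  have y: "young P" using inc by (simp add: increasing_def)
  note kv = kv_fam[OF f]
  have fC: "finite (?C c)" for c by (rule kv_fin[OF kv])
  have cC: "card (?C c) = ht (fam_of P) M c" for c using kv by (simp add: kv_def)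
  have hn: "card (?C c) \<le> n" for c
    unfolding cC hts_fam_of[OF inc f] using partD[OF young_cells(2)[OF y], of 0 c] young_cells(4)[OF y] n by simp
  have z: "0 \<notin> ?C c" for c by (simp add: al_zero)
  have lev: "{i. c < fb \<beta> i} = cap_col n (?C c)" for c
  proof -
    have "{i. c < fb \<beta> i} = {i \<in> {1..n}. c < \<beta> ! (i - 1)}" unfolding fb_level cw(1) ..
    also have "\<dots> = {i \<in> {1..n}. i \<in> cap_col n (?C c)}" using cw(2)[of _ c] by blast
    also have "\<dots> = cap_col n (?C c)" using cap_col_basic(1)[OF fC hn, of c] by blast
    finally show ?thesis .
  qed
  have "hb \<beta> c = card {i. c < fb \<beta> i}" for c unfolding fb_level hb_def ..
  then have "hb \<beta> c = ht (fam_of P) M c" for c unfolding lev using cap_col_basic(3)[OF fC hn, of c] cC by simp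
  then show h: "hb \<beta> = ht (fam_of P) M" by (rule ext)
  assume v: "vcode M M (hb \<beta>) cs" "length is = length cs" "sorted is" "adj cls is cs" "set is \<subseteq> {1..n}"
  have kq: "kq (hb \<beta>) (aq is cs)" by (rule kq_aq[OF part_hb v(1-3)])
  show "kle (aq is cs) (al (fam_of P) M) \<longleftrightarrow> kle (aq is cs) (fb \<beta>)"
    unfolding kle_cols lev
  proof (rule all_cong1)
    fix c
    have 1: "card {i. c < aq is cs i} = card (?C c)" using kq h cC by (simp add: kq_def)
    have 2: "{i. c < aq is cs i} \<subseteq> {1..n}" using aq_labels(1)[OF part_hb v(1-4), of c] v(5) by blast
    show "(\<forall>t. card {x \<in> ?C c. x < t} \<le> card {x \<in> {i. c < aq is cs i}. x < t}) \<longleftrightarrow>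
      (\<forall>t. card {x \<in> cap_col n (?C c). x < t} \<le> card {x \<in> {i. c < aq is cs i}. x < t})"
      by (rule cap_lo[OF fC 1 2 z])
  qed
qed

lemma shift_lascoux:
  assumes inc: "increasing P" and f: "fam M (fam_of P)" and n: "length P \<le> n"
    and s: "sorted is" "set is \<subseteq> {1..n}" "wtw n is = \<gamma>" and g: "sum_list \<gamma> = a + l + k"
  shows "shift_beta (int (size_tab P) - int l - int a) (lascoux n (wt n (cap n (K_minus P)))) \<gamma> k
    = int (card (St M M (fam_of P) (\<lambda>_. True) is))"
proof -
  define \<beta> where "\<beta> = wt n (cap n (K_minus P))"
  note cw = cap_wt[OF inc f n \<beta>_def] and ck = cap_kle[OF inc f n \<beta>_def]
  let ?e = "int (size_tab P) - int l - int a"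
  let ?A = "{cs. length cs = length is \<and> vcode M M (hb \<beta>) cs \<and> adj cls is cs \<and> kle (aq is cs) (fb \<beta>) \<and> True}"
  have li: "length is = sum_list \<gamma>" using length_wtw_sum[OF s(1,2)] s(3) by simp
  have St: "St M M (fam_of P) (\<lambda>_. True) is = ?A"
    unfolding St_def ck(1)[symmetric]
  proof (rule Collect_cong)
    fix cs
    show "(length cs = length is \<and> vcode M M (hb \<beta>) cs \<and> adj cls is cs \<and> kle (aq is cs) (al (fam_of P) M) \<and> True) \<longleftrightarrow>
      (length cs = length is \<and> vcode M M (hb \<beta>) cs \<and> adj cls is cs \<and> kle (aq is cs) (fb \<beta>) \<and> True)"
      using ck(2)[of cs "is"] s by auto
  qed
  show ?thesis
  proof (cases "?e \<le> int k")
    case True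
    then have "sum_list \<gamma> = sum_list \<beta> + nat (int k - ?e)" using g cw(3) by linarith
    from lascoux_card[OF s this, of M] show ?thesis unfolding shift_beta_def St \<beta>_def[symmetric] using True by simp
  next
    case False
    then have lt: "sum_list \<gamma> < sum_list \<beta>" using g cw(3) by linarith
    have "cs \<notin> ?A" for cs using vcode_hb_length[of M M \<beta> cs] lt li by auto
    then have "?A = {}" by blast
    then show ?thesis unfolding shift_beta_def St using False by (simp only: if_False card.empty of_nat_0)
  qed
qed

text \<open>Entries above \<open>N\<close> form a Hecke word of \<open>w\<close> and so are at most
  \<open>M\<close>, like all the others. This makes the index set finite and turns it into a set of
  families; the bound on the number of rows is left aside until the summands are known.\<close>

lemma index_bij:
  assumes inc1: "increasing P1" and NM: "N \<le> M"
    and let': "\<forall>a. hecke_word a w \<longrightarrow> set a \<subseteq> {Suc N..M}"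
  defines "J \<equiv> {P. increasing P \<and> restrict_le N P = P1 \<and> hecke_word (filter (\<lambda>x. N < x) (word P)) w}"
  shows "\<And>P. P \<in> J \<Longrightarrow> fam M (fam_of P)"
    "bij_betw fam_of J {F. fam M F \<and> res N F = fam_of P1 \<and> hecke_word (filter (\<lambda>x. N < x) (fw (Suc M) (cl F))) w}"
proof -
  show fm: "fam M (fam_of P)" if "P \<in> J" for P
  proof (rule fam_fam_of)
    show inc: "increasing P" using that by (simp add: J_def)
    have y: "young P" using inc by (simp add: increasing_def)
    have "entry P r c \<le> M" if "(r, c) \<in> cells P" for r c
    proof (cases "N < entry P r c")
      case True
      then have "entry P r c \<in> set (filter (\<lambda>x. N < x) (word P))" using entry_in_word[OF y that] by simp
      then show ?thesis using let' \<open>P \<in> J\<close> unfolding J_def by fastforce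
    qed (use NM in simp)
    then show "\<forall>(r, c)\<in>cells P. entry P r c \<le> M" by blast
  qed
  let ?I = "{F. fam M F \<and> res N F = fam_of P1 \<and> hecke_word (filter (\<lambda>x. N < x) (fw (Suc M) (cl F))) w}"
  show "bij_betw fam_of J ?I"
  proof (rule bij_betw_imageI)
    show "inj_on fam_of J" by (rule inj_onI) (auto simp: J_def intro: fam_of_inj)
    show "fam_of ` J = ?I"
    proof
      show "fam_of ` J \<subseteq> ?I"
      proof (rule image_subsetI)
        fix P assume P: "P \<in> J"
        then have inc: "increasing P" and r: "restrict_le N P = P1" and h: "hecke_word (filter (\<lambda>x. N < x) (word P)) w" by (auto simp: J_def)
        have "res N (fam_of P) = fam_of P1" using restrict_iff[OF inc fm[OF P] inc1, of N] r by simp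
        moreover have "word P = fw (Suc M) (cl (fam_of P))" by (rule word_fw[OF inc fm[OF P]]) simp
        ultimately show "fam_of P \<in> ?I" using fm[OF P] h by simp
      qed
      show "?I \<subseteq> fam_of ` J"
      proof
        fix F assume F: "F \<in> ?I"
        then obtain P where P: "increasing P" "fam_of P = F" using fam_of_surj[of M F] by blast
        have f: "fam M (fam_of P)" using F P by simp
        have "restrict_le N P = P1" using restrict_iff[OF P(1) f inc1, of N] F P(2) by simp
        moreover have "word P = fw (Suc M) (cl F)" using word_fw[OF P(1) f, of "Suc M"] P(2) by simp
        ultimately have "P \<in> J" using F P by (simp add: J_def)
        then show "F \<in> fam_of ` J" using P(2) by blast
      qed
    qed
  qed
qed

lemma product_card:
  assumes f: "fam N F1" and NM: "N \<le> M" and h: "hb \<alpha> = ht F1 N" and a: "fb \<alpha> = al F1 N"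
    and R: "\<And>a. hecke_word a (inv w) \<longleftrightarrow> R a" "\<And>a. R a \<Longrightarrow> set a \<subseteq> {Suc N..M}" "\<And>a. R a \<Longrightarrow> perm_length w \<le> length a"
    and s: "sorted is" "set is \<subseteq> {1..n}" "wtw n is = \<gamma>" and g: "sum_list \<gamma> = sum_list \<alpha> + perm_length w + k"
  shows "poly_mult (lascoux n \<alpha>) (groth n w) \<gamma> k = int (card (St N M F1 R is))"
proof -
  let ?Z = "\<lambda>c. ZZ M M (hb \<alpha>) (fb \<alpha>) (\<lambda>_. True) n c" and ?L = "ZL N M R n"
  have card_Z: "card (?Z c) = card {cs. length cs = length js \<and> vcode M M (hb \<alpha>) cs \<and> adj cls js cs \<and> kle (aq js cs) (fb \<alpha>) \<and> True}"
    if "sorted js" "set js \<subseteq> {1..n}" "wtw n js = c" for js c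
    using bij_betw_same_card[OF bij_ZZ[OF that, of M M "hb \<alpha>" "fb \<alpha>" "\<lambda>_. True"]] by simp
  have Zn: "?Z c = {}" if "length c \<noteq> n" for c using that by (auto simp: ZZ_def)
  have fin: "finite (?Z c)" for c
  proof (cases "length c = n")
    case True
    then obtain js where j: "sorted js" "set js \<subseteq> {1..n}" "wtw n js = c" using isof[of c] by blast
    have sub: "{cs. length cs = length js \<and> vcode M M (hb \<alpha>) cs \<and> adj cls js cs \<and> kle (aq js cs) (fb \<alpha>) \<and> True} \<subseteq> St N M F1 (\<lambda>_. True) js"
    proof
      fix cs assume cs: "cs \<in> {cs. length cs = length js \<and> vcode M M (hb \<alpha>) cs \<and> adj cls js cs \<and> kle (aq js cs) (fb \<alpha>) \<and> True}"
      then have v: "vcode M M (hb \<alpha>) cs" by simp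
      have "vcode N M (hb \<alpha>) cs"
        using vcode_split[of N M "hb \<alpha>" cs] vcode_split[of M M "hb \<alpha>" cs] v lets_Nil[OF vcode_isTok[OF v]] by simp
      then show "cs \<in> St N M F1 (\<lambda>_. True) js" using cs h a by (simp add: St_def)
    qed
    have "finite {cs. length cs = length js \<and> vcode M M (hb \<alpha>) cs \<and> adj cls js cs \<and> kle (aq js cs) (fb \<alpha>) \<and> True}"
      by (rule finite_subset[OF sub finite_Wk(2)[OF f NM j(1)]])
    then show ?thesis using bij_betw_finite[OF bij_ZZ[OF j, of M M "hb \<alpha>" "fb \<alpha>" "\<lambda>_. True"]] by simp
  qed (use Zn in simp)
  \<comment> \<open>For given weights each factor has a single power of beta, fixed by the degree,
    so at most one \<open>k1\<close> contributes.\<close>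
  have inner: "(\<Sum>k1\<in>{0..k}. lascoux n \<alpha> c k1 * groth n w (map2 (-) \<gamma> c) (k - k1)) = int (card (?Z c) * card (?L (map2 (-) \<gamma> c)))"
    if c: "list_all2 (\<le>) c \<gamma>" for c
  proof -
    let ?d = "map2 (-) \<gamma> c"
    have lc: "length c = n" using list_all2_lengthD[OF c] s(3) by auto
    obtain js where j: "sorted js" "set js \<subseteq> {1..n}" "wtw n js = c" using isof[of c] lc by blast
    have sm: "sum_list c + sum_list ?d = sum_list \<gamma>" by (rule sum_map2[OF c])
    have L1: "lascoux n \<alpha> c k1 = (if sum_list c = sum_list \<alpha> + k1 then int (card (?Z c)) else 0)" for k1
      using lascoux_card[OF j, of \<alpha> k1 M] lascoux_zero[of c \<alpha> k1 n] card_Z[OF j] by simp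
    have G1: "groth n w ?d k2 = (if sum_list ?d = perm_length w + k2 then int (card (?L ?d)) else 0)" for k2
      using groth_ZL[OF R(1) R(2), of ?d k2 n] groth_zero[of ?d w k2 n] by simp
    have e1: "?Z c = {}" if "sum_list c < sum_list \<alpha>"
    proof (rule ccontr)
      assume "?Z c \<noteq> {}"
      then obtain z where z: "z \<in> ?Z c" by blast
      then have v: "vcode M M (hb \<alpha>) (map snd z)" and so: "sorted_wrt pre z" by (auto simp: ZZ_def)
      have "length (map fst z) = sum_list c" using length_wtw_sum[OF sorted_pre(1)[OF so], of n] z by (simp add: ZZ_def)
      then show False using vcode_hb_length[OF v] that by simp
    qed
    have e2: "?L ?d = {}" if "sum_list ?d < perm_length w"
    proof (rule ccontr)
      assume "?L ?d \<noteq> {}"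
      then obtain z where z: "z \<in> ?L ?d" by blast
      then have so: "sorted_wrt pre z" and Rz: "R (lets (map snd z))" by (auto simp: ZL_def)
      have "length (lets cs) \<le> length cs" for cs
      proof (induction cs)
        case (Cons x cs) then show ?case by (cases x) auto
      qed simp
      from this[of "map snd z"] have "length (lets (map snd z)) \<le> length z" by simp
      moreover have "length (map fst z) = sum_list ?d" using length_wtw_sum[OF sorted_pre(1)[OF so], of n] z by (simp add: ZL_def)
      ultimately show False using R(3)[OF Rz] that by simp
    qed
    consider "sum_list c < sum_list \<alpha>" | "sum_list ?d < perm_length w" | "sum_list \<alpha> \<le> sum_list c" "perm_length w \<le> sum_list ?d" by linarith
    then show ?thesis
    proof cases
      case 1
      have "lascoux n \<alpha> c k1 = 0" for k1 unfolding L1 using 1 by simp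
      then show ?thesis using e1[OF 1] by simp
    next
      case 2
      have "groth n w ?d k2 = 0" for k2 unfolding G1 using 2 by simp
      then show ?thesis using e2[OF 2] by simp
    next
      case 3
      let ?k = "sum_list c - sum_list \<alpha>"
      have kk: "?k \<in> {0..k}" using 3 sm g by simp
      have "lascoux n \<alpha> c k1 * groth n w ?d (k - k1) = (if k1 = ?k then int (card (?Z c) * card (?L ?d)) else 0)" if "k1 \<in> {0..k}" for k1
      proof (cases "k1 = ?k")
        case True
        have "sum_list c = sum_list \<alpha> + k1" "sum_list ?d = perm_length w + (k - k1)" using True 3 sm g by linarith+
        then show ?thesis unfolding L1 G1 using True by simp
      next
        case False
        then have "sum_list c \<noteq> sum_list \<alpha> + k1" using 3 by linarith
        then show ?thesis unfolding L1 using False by simp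
      qed
      then have "(\<Sum>k1\<in>{0..k}. lascoux n \<alpha> c k1 * groth n w ?d (k - k1)) = (\<Sum>k1\<in>{0..k}. if k1 = ?k then int (card (?Z c) * card (?L ?d)) else 0)"
        by (rule sum.cong[OF refl])
      also have "\<dots> = int (card (?Z c) * card (?L ?d))" using kk by (simp add: sum.delta)
      finally show ?thesis .
    qed
  qed
  have "poly_mult (lascoux n \<alpha>) (groth n w) \<gamma> k = (\<Sum>c\<in>{c. list_all2 (\<le>) c \<gamma>}. int (card (?Z c) * card (?L (map2 (-) \<gamma> c))))"
    unfolding poly_mult_def by (rule sum.cong[OF refl]) (use inner in blast)
  also have "\<dots> = int (\<Sum>c\<in>{c. list_all2 (\<le>) c \<gamma>}. card (?Z c) * card (?L (map2 (-) \<gamma> c)))" by simp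
  also have "\<dots> = int (card (ZZ N M (hb \<alpha>) (fb \<alpha>) R n \<gamma>))" by (rule arg_cong[of _ _ int], rule card_ZZ[OF fin, symmetric])
  also have "\<dots> = int (card (St N M F1 R is))"
    unfolding St_def h[symmetric] a[symmetric] using bij_betw_same_card[OF bij_ZZ[OF s, of N M "hb \<alpha>" "fb \<alpha>" R]] by simp
  finally show ?thesis .
qed

theorem theorem1p3:
  fixes n N :: nat and \<alpha> :: "nat list" and P1 :: "nat list list" and w :: "nat \<Rightarrow> nat"
  assumes "0 < n"
    and "length \<alpha> = n"
    and "increasing P1"
    and "\<forall>(r, c)\<in>cells (K_minus P1). entry (K_minus P1) r c \<in> {1..n}"
    and "wt n (K_minus P1) = \<alpha>"
    and "n < N"
    and "\<forall>(r, c)\<in>cells P1. entry P1 r c < N"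
    and "in_S_plus w"
    and "\<forall>i\<in>{1..N}. w i = i"
  shows "poly_mult (lascoux n \<alpha>) (groth n w) =
    (\<lambda>\<gamma> k. \<Sum>P\<in>thm_index_set n P1 N w.
        shift_beta (int (size_tab P) - int (perm_length w) - int (sum_list \<alpha>))
                   (lascoux n (wt n (cap n (K_minus P)))) \<gamma> k)"
proof (intro ext)
  fix \<gamma> k
  let ?F = "fam_of P1" and ?l = "perm_length w" and ?I = "thm_index_set n P1 N w"
  \<comment> \<open>\<open>groth\<close> sums over Hecke words of the inverse permutation; reversing
    them gives Hecke words of \<open>w\<close>, which is the form delivered by reading words of
    tableaux.\<close>
  define R where "R a \<longleftrightarrow> hecke_word (rev a) w" for a
  have f1: "fam N ?F" by (rule fam_fam_of[OF assms(3)]) (use assms(7) in auto)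
  have bw: "bij w" "w 0 = 0" "finite {i. w i \<noteq> i}" using assms(8) by (auto simp: in_S_plus_def)
  obtain m where m: "\<forall>i\<in>{i. w i \<noteq> i}. i \<le> m" using bw(3) finite_nat_set_iff_bounded_le by blast
  \<comment> \<open>\<open>w\<close> fixes everything up to \<open>N\<close> and everything beyond
    \<open>M\<close>, so its Hecke words have letters in \<open>{Suc N..M}\<close>.\<close>
  define M where "M = max N m"
  have NM: "N \<le> M" by (simp add: M_def)
  have w1: "\<forall>i\<le>N. w i = i"
  proof (intro allI impI)
    fix i assume "i \<le> N" then show "w i = i" using bw(2) assms(9) by (cases "i = 0") auto
  qed
  have w2: "\<forall>i>M. w i = i"
  proof (intro allI impI)
    fix i assume "M < i"
    then have "\<not> i \<le> m" by (simp add: M_def)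
    then show "w i = i" using m by blast
  qed
  have lts: "hecke_word a w \<Longrightarrow> set a \<subseteq> {Suc N..M}" for a by (rule hecke_letters[OF _ w1 w2 bij_is_inj[OF bw(1)]])
  have R1: "hecke_word a (inv w) \<longleftrightarrow> R a" for a unfolding R_def by (rule hecke_word_inv[OF bw(1)])
  have R2: "R a \<Longrightarrow> set a \<subseteq> {Suc N..M}" for a using lts[of "rev a"] by (simp add: R_def)
  have R3: "R a \<Longrightarrow> ?l \<le> length a" for a using hecke_length[of "rev a" w] by (simp add: R_def)
  have R4: "R (u @ x # x # v) = R (u @ x # v)" for u x v unfolding R_def by (rule hecke_dup)
  let ?RR = "\<lambda>F. hecke_word (large N (fw (Suc M) (cl F))) w"
  have RR: "?RR (tab a) \<longleftrightarrow> R (large N a)" if "set a \<subseteq> {1..M}" for a unfolding R_def by (rule hecke_tab[OF that]) simp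
  have al: "\<alpha> = map (al ?F N) [1..<n + 1]" using assms(5) K_minus_cols(2)[OF assms(3) f1, of n] by simp
  \<comment> \<open>The left key of \<open>P1\<close> has entries in \<open>[n]\<close> only, so
    \<open>\<alpha>\<close> records it completely; otherwise its weight would cut off a part of the
    key.\<close>
  have sup: "i \<in> {1..n}" if "0 < al ?F N i" for i
  proof -
    have "i \<in> col (K_minus P1) (Suc 0)" using K_minus_cols(1)[OF assms(3) f1, of 0] that by simp
    then obtain r where "(r, Suc 0) \<in> cells (K_minus P1)" "i = entry (K_minus P1) r (Suc 0)" by (auto simp: col_def)
    then show ?thesis using assms(4) by blast
  qed
  have fa: "fb \<alpha> = al ?F N"
  proof
    fix i
    show "fb \<alpha> i = al ?F N i"
    proof (cases "i \<in> {1..n}")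
      case True
      have "[1..<n + 1] ! (i - 1) = i" using True nth_upt[of 1 "i - 1" "n + 1"] by simp
      moreover have "i - 1 < n" using True unfolding atLeastAtMost_iff by linarith
      then have "i - 1 < length [1..<n + 1]" by simp
      ultimately have "\<alpha> ! (i - 1) = al ?F N i" unfolding al by (simp only: nth_map)
      then show ?thesis using True assms(2) by (simp add: fb_def)
    next
      case False
      then have "al ?F N i = 0" using sup[of i] by (cases "al ?F N i") auto
      then show ?thesis using False assms(2) by (auto simp: fb_def)
    qed
  qed
  have ha: "hb \<alpha> = ht ?F N"
  proof
    fix c
    have "hb \<alpha> c = card {i. c < fb \<alpha> i}" unfolding fb_level hb_def ..
    then show "hb \<alpha> c = ht ?F N c" unfolding fa using kv_fam[OF f1] by (simp add: kv_def)
  qed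
  define J where "J = {P. increasing P \<and> restrict_le N P = P1 \<and> hecke_word (filter (\<lambda>x. N < x) (word P)) w}"
  have lts': "\<forall>a. hecke_word a w \<longrightarrow> set a \<subseteq> {Suc N..M}" using lts by blast
  note ix = index_bij[OF assms(3) NM lts', folded J_def]
  have IJ: "?I = {P \<in> J. length P \<le> n}" by (auto simp: thm_index_set_def J_def)
  have fJ: "finite J" using bij_betw_finite[OF ix(2)] fam_finite[of M] by simp
  show "poly_mult (lascoux n \<alpha>) (groth n w) \<gamma> k = (\<Sum>P\<in>?I. shift_beta (int (size_tab P) - int ?l - int (sum_list \<alpha>))
      (lascoux n (wt n (cap n (K_minus P)))) \<gamma> k)"
  \<comment> \<open>If beta is given degree -1, both sides are homogeneous: a nonzero coefficient
    forces the degree of the monomial to be the sum in this condition. Outside of it all terms on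
    both sides vanish.\<close>
  proof (cases "length \<gamma> = n \<and> sum_list \<gamma> = sum_list \<alpha> + ?l + k")
    case True
    then obtain js where j: "sorted js" "set js \<subseteq> {1..n}" "wtw n js = \<gamma>" using isof[of \<gamma>] by blast
    have jN: "set js \<subseteq> {..N}" using j(2) assms(6) by auto
    \<comment> \<open>Tableaux with more than \<open>n\<close> rows contribute nothing, since the
      first column of the recording tableau has distinct labels from \<open>[n]\<close>. So the sum
      over \<open>J\<close> restricts to the index set.\<close>
    have z: "St M M (fam_of P) (\<lambda>_. True) js = {}" if P: "P \<in> J" "\<not> length P \<le> n" for P
    proof (rule ccontr)
      assume "St M M (fam_of P) (\<lambda>_. True) js \<noteq> {}"
      then obtain cs where cs: "vcode M M (ht (fam_of P) M) cs" "length js = length cs" "adj cls js cs" by (auto simp: St_def)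
      have inc: "increasing P" using P by (simp add: J_def)
      have y: "young P" using inc by (simp add: increasing_def)
      have "ht (fam_of P) M 0 \<le> card (set js)" by (rule aq_labels(2)[OF fam_part[OF ix(1)[OF P(1)]] cs(1,2) j(1) cs(3)])
      also have "\<dots> \<le> n" using card_mono[OF _ j(2)] by simp
      finally show False using hts_fam_of[OF inc ix(1)[OF P(1)]] young_cells(4)[OF y] P(2) by simp
    qed
    have "poly_mult (lascoux n \<alpha>) (groth n w) \<gamma> k = int (card (St N M ?F R js))"
      by (rule product_card[OF f1 NM ha fa R1 R2 R3 j]) (use True in auto)
    also have "card (St N M ?F R js) = (\<Sum>F\<in>{F. fam M F \<and> res N F = ?F \<and> ?RR F}. card (St M M F (\<lambda>_. True) js))"
      by (rule card_St_threshold[OF f1 NM j(1) jN R4 RR])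
    also have "\<dots> = (\<Sum>P\<in>J. card (St M M (fam_of P) (\<lambda>_. True) js))"
      by (rule sum.reindex_bij_betw[OF ix(2), symmetric])
    also have "\<dots> = (\<Sum>P\<in>?I. card (St M M (fam_of P) (\<lambda>_. True) js))"
      unfolding IJ by (rule sum.mono_neutral_right[OF fJ]) (use z in auto)
    also have "int \<dots> = (\<Sum>P\<in>?I. int (card (St M M (fam_of P) (\<lambda>_. True) js)))" by simp
    also have "\<dots> = (\<Sum>P\<in>?I. shift_beta (int (size_tab P) - int ?l - int (sum_list \<alpha>)) (lascoux n (wt n (cap n (K_minus P)))) \<gamma> k)"
    proof (rule sum.cong[OF refl])
      fix P assume "P \<in> ?I"
      then have P: "P \<in> J" "length P \<le> n" "increasing P" by (auto simp: IJ J_def)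
      show "int (card (St M M (fam_of P) (\<lambda>_. True) js))
          = shift_beta (int (size_tab P) - int ?l - int (sum_list \<alpha>)) (lascoux n (wt n (cap n (K_minus P)))) \<gamma> k"
        by (rule shift_lascoux[OF P(3) ix(1)[OF P(1)] P(2) j, symmetric]) (use True in simp)
    qed
    finally show ?thesis .
  next
    case False
    have "lascoux n \<alpha> c k1 * groth n w (map2 (-) \<gamma> c) (k - k1) = 0" if c: "list_all2 (\<le>) c \<gamma>" and k1: "k1 \<in> {0..k}" for c k1
    proof (rule ccontr)
      assume "\<not> ?thesis"
      then have "lascoux n \<alpha> c k1 \<noteq> 0" "groth n w (map2 (-) \<gamma> c) (k - k1) \<noteq> 0" by auto
      then have "length c = n" "sum_list c = sum_list \<alpha> + k1" "sum_list (map2 (-) \<gamma> c) = ?l + (k - k1)"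
        using lascoux_zero[of c \<alpha> k1 n] groth_zero[of "map2 (-) \<gamma> c" w "k - k1" n] by blast+
      then show False using False sum_map2[OF c] list_all2_lengthD[OF c] k1 by auto
    qed
    then have "poly_mult (lascoux n \<alpha>) (groth n w) \<gamma> k = 0" unfolding poly_mult_def by (intro sum.neutral ballI) blast
    moreover have "shift_beta (int (size_tab P) - int ?l - int (sum_list \<alpha>)) (lascoux n (wt n (cap n (K_minus P)))) \<gamma> k = 0"
      if "P \<in> ?I" for P
    proof (rule ccontr)
      let ?e = "int (size_tab P) - int ?l - int (sum_list \<alpha>)"
      assume "\<not> ?thesis"
      then have e: "?e \<le> int k" and nz: "lascoux n (wt n (cap n (K_minus P))) \<gamma> (nat (int k - ?e)) \<noteq> 0"
        unfolding shift_beta_def by (auto split: if_splits)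
      have P: "P \<in> J" "length P \<le> n" "increasing P" using that by (auto simp: IJ J_def)
      have "sum_list (wt n (cap n (K_minus P))) = size_tab P" by (rule cap_wt(3)[OF P(3) ix(1)[OF P(1)] P(2) refl])
      moreover have "length \<gamma> = n" "sum_list \<gamma> = sum_list (wt n (cap n (K_minus P))) + nat (int k - ?e)"
        using nz lascoux_zero[of \<gamma> "wt n (cap n (K_minus P))" "nat (int k - ?e)" n] by blast+
      ultimately show False using False e by linarith
    qed
    ultimately show ?thesis by simp
  qed
qed

end
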